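(* Let $p=2s$ with $s\in\mathbb{N}\cup\{0\}$, and let $c_s=\frac{s!\,(s+1)!}{(2s+2)!}$. For each $\delta>0$ there exists $\mu:\mathbb{N}\to(0,\infty)$, depending on $p$ and $\delta$ only, such that for each mesh $X\in\mathcal{F}_\mu$ and each $2\pi$-periodic $v_0\in C^{p+2}(\mathbb{R})$, the solution $u(t)$ of the finite-volume scheme with polynomial reconstruction of order $p$ on $X$ with initial data $v_0$ satisfies, for all $t\ge0$, $$\frac1{\sqrt{2\pi}}\left(\sum_{j=1}^{N(X)}h_{j+1/2}\left|u_j(t)-\frac1{h_{j+1/2}}\int_{x_j}^{x_{j+1}}v_0(x-t)\,dx\right|^2\right)^{1/2}\le c\,|v_0|_{p+1}\,h_{\max}^{p}(h_{\max}-h_{\min})+(c_s+\delta)\,|v_0|_{p+2}\,h_{\max}^{p+1}\,t,$$ where $c$ depends only on $m(X)$ and $p$.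
   Context: A mesh is a strictly increasing sequence $X=\{x_j\in\mathbb{R},\,j\in\mathbb{Z}\}$ such that for some $N=N(X)\in\mathbb{N}$ there holds $x_{j+N}=x_j+2\pi$ for all $j$. Put $h_{av}=h_{av}(X)=2\pi/N(X)$, $h_{j+1/2}=x_{j+1}-x_j$, $h_{\max}=\max_j h_{j+1/2}$, $h_{\min}=\min_j h_{j+1/2}$. The period $m(X)$ is the minimal $m\in\mathbb{N}$ such that $h_{j+m+1/2}=h_{j+1/2}$ for all $j$. For $\mu:\mathbb{N}\to(0,\infty)$, $\mathcal{F}_\mu=\{X : h_{\max}(X)-h_{\min}(X)\le\mu(m(X))\,h_{av}(X)\}$. The finite-volume scheme with polynomial reconstruction of order $p=2s$ (for the transport equation $\partial_t v+\partial_x v=0$, $v(0,x)=v_0(x)$) is the system, for $N(X)$-periodic sequences $u(t)=\{u_j(t)\}_{j\in\mathbb{Z}}$, $$\frac{du_j}{dt}+\frac{p_j(x_{j+1})-p_{j-1}(x_j)}{h_{j+1/2}}=0,\qquad u_j(0)=\frac1{h_{j+1/2}}\int_{x_j}^{x_{j+1}}v_0(x)\,dx,\quad j\in\mathbb{Z},$$ where $p_j$ (depending on $t$) is the unique polynomial of degree at most $p$ such that $\frac1{h_{j+k+1/2}}\int_{x_{j+k}}^{x_{j+k+1}}p_j(x)\,dx=u_{j+k}$ for each $k=-p/2,\ldots,p/2$. $|v_0|_q=\sup_{x\in\mathbb{R}}\left|\frac{d^qv_0}{dx^q}(x)\right|$. *)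

theory Defs
  imports "HOL-Analysis.Analysis" "HOL-Computational_Algebra.Polynomial"
begin

section \<open>Meshes\<close>

definition is_mesh_period :: "(int \<Rightarrow> real) \<Rightarrow> nat \<Rightarrow> bool" where
  "is_mesh_period x N \<longleftrightarrow> N > 0 \<and> (\<forall>j. x (j + int N) = x j + 2 * pi)"

definition mesh :: "(int \<Rightarrow> real) \<Rightarrow> bool" where
  "mesh x \<longleftrightarrow> strict_mono x \<and> (\<exists>N. is_mesh_period x N)"

text \<open>For a mesh, the number \<open>N\<close> is determined by \<open>x\<close>; see \<open>mesh_N\<close> below.\<close>

definition mesh_N :: "(int \<Rightarrow> real) \<Rightarrow> nat" where
  "mesh_N x = (THE N. is_mesh_period x N)"

definition h_av :: "(int \<Rightarrow> real) \<Rightarrow> real" where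
  "h_av x = 2 * pi / real (mesh_N x)"

text \<open>Half-integer indices are rounded down: \<open>h x j\<close> is $h_{j+1/2}$.\<close>

definition h :: "(int \<Rightarrow> real) \<Rightarrow> int \<Rightarrow> real" where
  "h x j = x (j + 1) - x j"

text \<open>By periodicity, \<open>range (h x)\<close> is finite for a mesh; see \<open>mesh_finite_range_h\<close> below.\<close>

definition h_max :: "(int \<Rightarrow> real) \<Rightarrow> real" where
  "h_max x = Max (range (h x))"

definition h_min :: "(int \<Rightarrow> real) \<Rightarrow> real" where
  "h_min x = Min (range (h x))"

definition mesh_m :: "(int \<Rightarrow> real) \<Rightarrow> nat" where
  "mesh_m x = (LEAST m. m > 0 \<and> (\<forall>j. h x (j + int m) = h x j))"

definition mesh_class :: "(nat \<Rightarrow> real) \<Rightarrow> (int \<Rightarrow> real) set" where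
  "mesh_class \<mu> = {x. mesh x \<and> h_max x - h_min x \<le> \<mu> (mesh_m x) * h_av x}"

lemma mesh_N:
  assumes "mesh x"
  shows "is_mesh_period x (mesh_N x)"
proof -
  obtain N where N: "is_mesh_period x N" and sm: "strict_mono x"
    using assms by (auto simp: mesh_def)
  have "M = N" if "is_mesh_period x M" for M
  proof -
    have "x (int M) = x (int N)"
      using that N unfolding is_mesh_period_def by (metis add_0)
    then show ?thesis
      using sm by (simp add: strict_mono_eq)
  qed
  with N show ?thesis
    unfolding mesh_N_def by (rule theI)
qed

lemma mesh_finite_range_h:
  assumes "mesh x"
  shows "finite (range (h x))"
proof -
  define N where "N = int (mesh_N x)"
  have N: "N > 0" and per: "\<And>j. x (j + N) = x j + 2 * pi"
    using mesh_N[OF assms] by (auto simp: is_mesh_period_def N_def)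
  have per_h: "h x (j + N) = h x j" for j
    using per[of j] per[of "j + 1"] by (simp add: h_def algebra_simps)
  have shift: "h x (j + int k * N) = h x j" for j k
  proof (induction k)
    case (Suc k)
    then show ?case
      using per_h[of "j + int k * N"] by (simp add: algebra_simps)
  qed simp
  have "h x j = h x (j mod N)" for j
  proof (cases "j div N \<ge> 0")
    case True
    then show ?thesis
      using shift[of "j mod N" "nat (j div N)"] by (simp add: mod_div_mult_eq)
  next
    case False
    moreover have "j - (j div N) * N = j mod N"
      by (rule minus_div_mult_eq_mod)
    ultimately have "j + int (nat (- (j div N))) * N = j mod N"
      by simp
    then show ?thesis
      using shift[of j "nat (- (j div N))"] by (metis (no_types))
  qed
  moreover have "j mod N \<in> {0..<N}" for j
    using N by simp
  ultimately have "range (h x) \<subseteq> h x ` {0..<N}"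
    by blast
  then show ?thesis
    by (rule finite_subset) simp
qed


section \<open>The finite-volume scheme\<close>

definition cell_avg :: "(int \<Rightarrow> real) \<Rightarrow> (real \<Rightarrow> real) \<Rightarrow> int \<Rightarrow> real" where
  "cell_avg x f j = 1 / h x j * integral {x j..x (j + 1)} f"

definition is_recon :: "nat \<Rightarrow> (int \<Rightarrow> real) \<Rightarrow> (int \<Rightarrow> real) \<Rightarrow> int \<Rightarrow> real poly \<Rightarrow> bool" where
  "is_recon p x u j P \<longleftrightarrow> degree P \<le> p \<and>
     (\<forall>k\<in>{- int (p div 2)..int (p div 2)}. cell_avg x (poly P) (j + k) = u (j + k))"

definition recon :: "nat \<Rightarrow> (int \<Rightarrow> real) \<Rightarrow> (int \<Rightarrow> real) \<Rightarrow> int \<Rightarrow> real poly" where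
  "recon p x u j = (THE P. is_recon p x u j P)"

text \<open>\<open>fv_solution p x v0 u\<close>: the function \<open>u\<close>, with \<open>u t j\<close> standing for $u_j(t)$, solves the
  scheme on the time interval $[0,\infty)$; at \<open>t = 0\<close> the derivative is one-sided.\<close>

definition fv_solution ::
    "nat \<Rightarrow> (int \<Rightarrow> real) \<Rightarrow> (real \<Rightarrow> real) \<Rightarrow> (real \<Rightarrow> int \<Rightarrow> real) \<Rightarrow> bool" where
  "fv_solution p x v0 u \<longleftrightarrow>
     (\<forall>t\<ge>0. \<forall>j. u t (j + int (mesh_N x)) = u t j) \<and>
     (\<forall>t\<ge>0. \<forall>j. ((\<lambda>\<tau>. u \<tau> j) has_real_derivative
        - ((poly (recon p x (u t) j) (x (j + 1)) - poly (recon p x (u t) (j - 1)) (x j)) / h x j))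
        (at t within {0..})) \<and>
     (\<forall>j. u 0 j = cell_avg x v0 j)"

text \<open>The reconstruction is well defined when \<open>p\<close> is even.\<close>

lemma interpolating_poly_exists:
  fixes a y :: "nat \<Rightarrow> real"
  assumes "strict_mono a"
  shows "\<exists>Q. degree Q \<le> n \<and> (\<forall>i\<le>n. poly Q (a i) = y i)"
proof (induction n)
  case 0
  show ?case
    by (rule exI[of _ "[:y 0:]"]) simp
next
  case (Suc n)
  then obtain Q where Q: "degree Q \<le> n" "\<And>i. i \<le> n \<Longrightarrow> poly Q (a i) = y i"
    by blast
  define W where "W = (\<Prod>i\<le>n. [:- a i, 1:])"
  have W0: "poly W (a i) = 0" if "i \<le> n" for i
    using that by (auto simp: W_def poly_prod)
  have W1: "poly W (a (Suc n)) \<noteq> 0"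
    using assms by (auto simp: W_def poly_prod strict_mono_eq)
  have dW: "degree W \<le> Suc n"
  proof -
    have "degree W \<le> sum (degree \<circ> (\<lambda>i. [:- a i, 1:])) {..n}"
      unfolding W_def by (rule degree_prod_sum_le) simp
    also have "\<dots> = Suc n"
      by simp
    finally show ?thesis .
  qed
  let ?R = "Q + smult ((y (Suc n) - poly Q (a (Suc n))) / poly W (a (Suc n))) W"
  have "degree ?R \<le> Suc n"
    using Q(1) dW by (intro degree_add_le) (auto intro: order_trans[OF degree_smult_le])
  moreover have "\<forall>i\<le>Suc n. poly ?R (a i) = y i"
    using Q(2) W0 W1 by (auto simp: le_Suc_eq)
  ultimately show ?case
    by blast
qed

lemma integral_poly_eq_0_imp_root:
  fixes a b :: real
  assumes "a < b" "integral {a..b} (poly D) = 0"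
  shows "\<exists>z. a < z \<and> z < b \<and> poly D z = 0"
proof (rule ccontr)
  assume no: "\<not> ?thesis"
  define F where "F t = integral {a..t} (poly D)" for t
  have der: "(F has_real_derivative poly D t) (at t within {a..b})" if "t \<in> {a..b}" for t
    unfolding F_def
    by (rule integral_has_real_derivative) (use that in \<open>auto intro: continuous_intros\<close>)
  have cont: "continuous_on {a..b} F"
    using der by (meson DERIV_continuous continuous_on_eq_continuous_within)
  have der': "(F has_derivative (*) (poly D t)) (at t)" if "a < t" "t < b" for t
    using der[of t] that by (simp add: at_within_Icc_at has_field_derivative_def)
  have "F a = F b"
    using assms(2) by (simp add: F_def)
  from Rolle_deriv[OF assms(1) this cont der']
  obtain z where "a < z" "z < b" "(*) (poly D z) = (\<lambda>v. 0)"
    by blast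
  then show False
    using no by (metis mult_1_right)
qed

lemma poly_from_integrals:
  fixes a w :: "nat \<Rightarrow> real"
  assumes a: "strict_mono a"
  shows "\<exists>!P. degree P \<le> n \<and> (\<forall>i\<le>n. integral {a i..a (Suc i)} (poly P) = w i)"
proof (rule ex_ex1I)
  obtain Q where Q: "degree Q \<le> Suc n"
      "\<And>i. i \<le> Suc n \<Longrightarrow> poly Q (a i) = (\<Sum>l<i. w l)"
    using interpolating_poly_exists[OF a, of "Suc n" "\<lambda>i. \<Sum>l<i. w l"] by blast
  have "integral {a i..a (Suc i)} (poly (pderiv Q)) = w i" if "i \<le> n" for i
  proof -
    have "a i \<le> a (Suc i)"
      using a by (simp add: strict_mono_less_eq)
    then have "(poly (pderiv Q) has_integral (poly Q (a (Suc i)) - poly Q (a i))) {a i..a (Suc i)}"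
      by (rule fundamental_theorem_of_calculus)
        (metis poly_DERIV has_field_derivative_at_within has_real_derivative_iff_has_vector_derivative)
    then show ?thesis
      using Q(2)[of i] Q(2)[of "Suc i"] that by (simp add: integral_unique)
  qed
  moreover have "degree (pderiv Q) \<le> n"
    using Q(1) by (simp add: degree_pderiv)
  ultimately show "\<exists>P. degree P \<le> n \<and> (\<forall>i\<le>n. integral {a i..a (Suc i)} (poly P) = w i)"
    by blast
next
  fix P Q :: "real poly"
  assume P: "degree P \<le> n \<and> (\<forall>i\<le>n. integral {a i..a (Suc i)} (poly P) = w i)"
    and Q: "degree Q \<le> n \<and> (\<forall>i\<le>n. integral {a i..a (Suc i)} (poly Q) = w i)"
  define D where "D = P - Q"
  have int: "poly R integrable_on {c..d}" for R :: "real poly" and c d :: real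
    by (rule integrable_continuous_real) (intro continuous_intros)
  have "\<exists>z. a i < z \<and> z < a (Suc i) \<and> poly D z = 0" if "i \<le> n" for i
  proof (rule integral_poly_eq_0_imp_root)
    show "a i < a (Suc i)"
      using a by (simp add: strict_mono_less)
    have "integral {a i..a (Suc i)} (\<lambda>z. poly P z - poly Q z) = 0"
      using P Q that by (simp add: integral_diff int)
    moreover have "poly D = (\<lambda>z. poly P z - poly Q z)"
      by (simp add: D_def fun_eq_iff)
    ultimately show "integral {a i..a (Suc i)} (poly D) = 0"
      by simp
  qed
  then obtain z where z: "\<And>i. i \<le> n \<Longrightarrow> a i < z i \<and> z i < a (Suc i) \<and> poly D (z i) = 0"
    by metis
  have "inj_on z {..n}"
  proof (rule linorder_inj_onI)
    fix i l assume "i < l" "i \<in> {..n}" "l \<in> {..n}"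
    then have "z i < a (Suc i)" "a (Suc i) \<le> a l" "a l < z l"
      using z a by (auto simp: strict_mono_less_eq)
    then show "z i \<noteq> z l"
      by linarith
  qed auto
  then have "card (z ` {..n}) = Suc n"
    by (simp add: card_image)
  moreover have "degree D \<le> n"
    unfolding D_def using P Q by (intro degree_diff_le) auto
  moreover have "card (z ` {..n}) \<le> degree D" if "D \<noteq> 0"
  proof -
    have "card (z ` {..n}) \<le> card {x. poly D x = 0}"
      using z that by (intro card_mono poly_roots_finite) auto
    also have "\<dots> \<le> degree D"
      using that by (rule card_poly_roots_bound)
    finally show ?thesis .
  qed
  ultimately have "D = 0"
    by fastforce
  then show "P = Q"
    by (simp add: D_def)
qed

lemma is_recon_ex1:
  assumes "strict_mono x" "even p"
  shows "\<exists>!P. is_recon p x u j P"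
proof -
  define s where "s = p div 2"
  have p: "p = 2 * s"
    using assms(2) by (simp add: s_def)
  define a where "a i = x (j - int s + int i)" for i
  define w where "w i = h x (j - int s + int i) * u (j - int s + int i)" for i
  have a: "strict_mono a"
    using assms(1) by (auto simp: a_def strict_mono_def)
  have "is_recon p x u j P \<longleftrightarrow>
      degree P \<le> p \<and> (\<forall>i\<le>p. integral {a i..a (Suc i)} (poly P) = w i)" for P
  proof -
    have pos: "h x i > 0" for i
      using assms(1) by (simp add: h_def strict_mono_less)
    have cond: "cell_avg x (poly P) (j - int s + int i) = u (j - int s + int i) \<longleftrightarrow>
        integral {a i..a (Suc i)} (poly P) = w i" for i
      using pos[of "j - int s + int i"]
      by (auto simp: cell_avg_def a_def w_def field_simps)
    have "(\<forall>k\<in>{- int s..int s}. B (j + k)) \<longleftrightarrow> (\<forall>i\<le>p. B (j - int s + int i))" for B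
    proof
      assume *: "\<forall>k\<in>{- int s..int s}. B (j + k)"
      show "\<forall>i\<le>p. B (j - int s + int i)"
        using *[rule_format, of "int i - int s" for i] by (auto simp: p algebra_simps)
    next
      assume *: "\<forall>i\<le>p. B (j - int s + int i)"
      show "\<forall>k\<in>{- int s..int s}. B (j + k)"
      proof
        fix k assume "k \<in> {- int s..int s}"
        then have "nat (k + int s) \<le> p" "j - int s + int (nat (k + int s)) = j + k"
          by (auto simp: p)
        then show "B (j + k)"
          using * by metis
      qed
    qed
    from this[of "\<lambda>i. cell_avg x (poly P) i = u i"] show ?thesis
      by (simp add: is_recon_def s_def[symmetric] cond)
  qed
  then show ?thesis
    using poly_from_integrals[OF a, of p w] by simp
qed


section \<open>Smoothness and norms of the initial data\<close>

definition C_k :: "nat \<Rightarrow> (real \<Rightarrow> real) \<Rightarrow> bool" where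
  "C_k k f \<longleftrightarrow> (\<forall>i<k. \<forall>x. (deriv ^^ i) f differentiable (at x)) \<and>
     continuous_on UNIV ((deriv ^^ k) f)"

text \<open>The supremum is finite for the periodic data of class \<open>C_k q\<close>.\<close>

definition deriv_seminorm :: "nat \<Rightarrow> (real \<Rightarrow> real) \<Rightarrow> real" where
  "deriv_seminorm q f = (SUP x. \<bar>(deriv ^^ q) f x\<bar>)"

end

theory Submission
  imports Defs
begin

text \<open>Let \<open>p = 2 s\<close>, let \<open>e\<close> be the error of the cell averages and let \<open>W\<close> be a sequence on the nodes with
\<open>W (j + 1) - W j = h j * e j\<close>. The reconstruction is the derivative of the polynomial that interpolates
the primitive of the data in \<open>p + 2\<close> nodes, so the scheme for \<open>W\<close> is the finite-difference scheme
\<open>W' = - D W + T\<close>, where \<open>D\<close> differentiates interpolating polynomials of degree \<open>p + 1\<close> at a node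
(\<open>recon_eq_flux\<close>) and \<open>T\<close> is its truncation error on the exact solution. Lengths are measured in
units of the average cell, and \<open>m\<close> is the period of the mesh.

Consistency. By the interpolation error formula \<open>T j\<close> is \<open>\<omega> j * v^(p+1)\<close> up to higher order,
where \<open>(p + 2)! * \<omega> j\<close> is a product of node distances. On a uniform mesh \<open>\<omega>\<close> is the
constant \<open>c_s\<close> up to sign; only differences of \<open>W\<close> count, and the difference quotient of \<open>T\<close> is
at most \<open>c_s |v|_(p+2) h^(p+1)\<close> (\<open>uniform_trunc_lipschitz\<close>). On a mesh of period \<open>m\<close> the
oscillation of \<open>\<omega>\<close> is of size \<open>h_max - h_min\<close> and would spoil one order. But it lies in the
range of \<open>D\<close> up to a constant: there is an \<open>m\<close>-periodic \<open>g\<close> with \<open>D g = \<omega> + const\<close>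
(\<open>corrector\<close>). Subtracting \<open>g * v^(p+1)\<close> from \<open>W\<close> removes the oscillation. The subtracted term
stays bounded in time and gives the first summand of the estimate; what remains is the uniform
truncation error up to a relative error that is small with the deviation of the mesh from the
uniform one (\<open>residual_bound\<close>).

Stability. On the uniform mesh the scheme acts on the wave \<open>exp (i \<theta> j)\<close> by a symbol whose real part is
\<open>\<kappa> |exp (i \<theta>) - 1|^(2s+2)\<close> with \<open>\<kappa> > 0\<close> (\<open>Re_symbol\<close>). A perturbation of the coefficients is not
dominated by this dissipation at small frequencies. A perturbation of period \<open>m\<close>, however, couples
only the \<open>m\<close> frequencies \<open>\<theta> + 2 \<pi> k / m\<close>, of which all but one are damped at a rate depending on \<open>m\<close>.
For the remaining one the perturbed \<open>m\<close> by \<open>m\<close> matrix has a left eigenvector close to the unit vector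
(\<open>left_eigenvector\<close>), and the samples of the plane wave on the actual mesh are a right eigenvector up
to an error of the order of the dissipation, because \<open>D\<close> is exact on polynomials. Comparing the two, the
eigenvalue has positive real part. The amplitude defined by the left eigenvector and the
complementary part together give a quadratic form that does not increase and is close to the
Euclidean norm, uniformly in the number of cells (\<open>mode_energy_core\<close>, \<open>near_uniform_stability\<close>).
The energy estimate for this form, with constant close to one, proves the theorem
(\<open>energy_estimate\<close>, \<open>error_bound_for_period\<close>).\<close>

section \<open>The scheme as a differentiation formula for the primitive\<close>

text \<open>Offsets of the interpolation nodes other than the base node itself. There is one more node on the
upwind side, which makes the scheme dissipative.\<close>

definition stencil :: "nat \<Rightarrow> int set" where
  "stencil s = {- int s - 1..int s} - {0}"

lemma finite_stencil [simp]: "finite (stencil s)"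
  by (simp add: stencil_def)

lemma card_stencil: "card (stencil s) = 2 * s + 1"
  by (simp add: stencil_def)

lemma stencil_nonzero: "i \<in> stencil s \<Longrightarrow> i \<noteq> 0"
  by (simp add: stencil_def)

lemma stencil_abs_le: "i \<in> stencil s \<Longrightarrow> \<bar>i\<bar> \<le> int s + 1"
  by (auto simp: stencil_def)

lemma lagrange_interpolation:
  fixes y :: "'i \<Rightarrow> real"
  assumes "finite I" "inj_on y I" "degree q < card I"
  shows "(\<Sum>i\<in>I. (\<Prod>l\<in>I - {i}. (a - y l) / (y i - y l)) * poly q (y i)) = poly q a"
proof -
  define L where "L i = (\<Prod>l\<in>I - {i}. smult (1 / (y i - y l)) [:- y l, 1:])" for i
  define R where "R = (\<Sum>i\<in>I. smult (poly q (y i)) (L i)) - q"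
  have polyL: "poly (L i) b = (\<Prod>l\<in>I - {i}. (b - y l) / (y i - y l))" for i b
    unfolding L_def poly_prod by (intro prod.cong) (auto simp: divide_simps)
  have degL: "degree (L i) \<le> card I - 1" if "i \<in> I" for i
  proof -
    have "degree (L i) \<le> sum (degree \<circ> (\<lambda>l. smult (1 / (y i - y l)) [:- y l, 1:])) (I - {i})"
      unfolding L_def by (rule degree_prod_sum_le) (use assms(1) in simp)
    also have "\<dots> \<le> (\<Sum>l\<in>I - {i}. 1)"
      by (intro sum_mono) simp
    finally show ?thesis
      using assms(1) that by simp
  qed
  have degR: "degree R \<le> card I - 1"
    unfolding R_def using assms(1,3) degL
    by (intro degree_diff_le degree_sum_le) (auto intro: order_trans[OF degree_smult_le])
  have LK: "poly (L i) (y k) = (if i = k then 1 else 0)" if "i \<in> I" "k \<in> I" for i k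
  proof (cases "i = k")
    case True
    have "(y i - y l) / (y i - y l) = 1" if "l \<in> I - {i}" for l
      using assms(2) that \<open>i \<in> I\<close> by (auto dest: inj_onD)
    then show ?thesis
      using True by (simp add: polyL)
  next
    case False
    then show ?thesis
      using that assms(1) by (auto simp: polyL intro!: prod_zero)
  qed
  have root: "poly R (y k) = 0" if "k \<in> I" for k
    using that assms(1) by (simp add: R_def poly_sum LK if_distrib cong: if_cong)
  have "R = 0"
  proof (rule ccontr)
    assume "R \<noteq> 0"
    have "card I = card (y ` I)"
      using assms(2) by (simp add: card_image)
    also have "\<dots> \<le> card {x. poly R x = 0}"
      using root \<open>R \<noteq> 0\<close> by (intro card_mono poly_roots_finite) auto
    also have "\<dots> \<le> degree R"
      using \<open>R \<noteq> 0\<close> by (rule card_poly_roots_bound)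
    finally show False
      using degR assms(3) by linarith
  qed
  then have "poly R a = 0"
    by simp
  then show ?thesis
    by (simp add: R_def poly_sum polyL mult.commute)
qed

text \<open>Weights that extrapolate a polynomial of degree at most \<open>2 s\<close> from the neighbours of node \<open>j\<close> to
node \<open>j\<close>.\<close>

definition lagrange_weight :: "nat \<Rightarrow> (int \<Rightarrow> real) \<Rightarrow> int \<Rightarrow> int \<Rightarrow> real" where
  "lagrange_weight s x j i = (\<Prod>l\<in>stencil s - {i}. (x j - x (j + l)) / (x (j + i) - x (j + l)))"

text \<open>Differentiation weights, to be applied to differences of values. If \<open>q\<close> is a polynomial, then
\<open>q - q (x j)\<close> is \<open>X - x j\<close> times a polynomial whose value at \<open>x j\<close> is the derivative of \<open>q\<close>; so differentiation at
\<open>x j\<close> is extrapolation of the divided differences to \<open>x j\<close>. The base node needs no weight.\<close>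

definition coef :: "nat \<Rightarrow> (int \<Rightarrow> real) \<Rightarrow> int \<Rightarrow> int \<Rightarrow> real" where
  "coef s x j i = lagrange_weight s x j i / (x (j + i) - x j)"

lemma lagrange_weight_interpolation:
  assumes "strict_mono x" "degree q \<le> 2 * s"
  shows "(\<Sum>i\<in>stencil s. lagrange_weight s x j i * poly q (x (j + i))) = poly q (x j)"
  unfolding lagrange_weight_def
  by (rule lagrange_interpolation)
    (use assms in \<open>auto simp: card_stencil inj_on_def strict_mono_eq\<close>)

lemma coef_mult_diff:
  assumes "strict_mono x" "i \<in> stencil s"
  shows "coef s x j i * (x (j + i) - x j) = lagrange_weight s x j i"
  using assms stencil_nonzero[OF assms(2)] by (simp add: coef_def strict_mono_eq)

lemma coef_exact:
  assumes "strict_mono x" "degree q \<le> 2 * s + 1"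
  shows "(\<Sum>i\<in>stencil s. coef s x j i * (poly q (x (j + i)) - poly q (x j))) = poly (pderiv q) (x j)"
proof -
  have "poly (q - [:poly q (x j):]) (x j) = 0"
    by simp
  then obtain g where g: "q - [:poly q (x j):] = [:- x j, 1:] * g"
    unfolding poly_eq_0_iff_dvd by (auto elim: dvdE)
  have q: "q = [:- x j, 1:] * g + [:poly q (x j):]"
    using g by (simp add: algebra_simps)
  have pq: "poly q b - poly q (x j) = (b - x j) * poly g b" for b
    using arg_cong[OF g, of "\<lambda>r. poly r b"] by (simp add: algebra_simps)
  have "degree g \<le> 2 * s"
  proof (cases "g = 0")
    case False
    have "degree ([:- x j, 1:] * g) = 1 + degree g"
      using False by (subst degree_mult_eq) auto
    moreover have "degree (q - [:poly q (x j):]) \<le> 2 * s + 1"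
      using assms(2) by (intro degree_diff_le) auto
    ultimately show ?thesis
      using g by simp
  qed simp
  then have "poly g (x j) = (\<Sum>i\<in>stencil s. lagrange_weight s x j i * poly g (x (j + i)))"
    using lagrange_weight_interpolation[OF assms(1)] by simp
  also have "\<dots> = (\<Sum>i\<in>stencil s. coef s x j i * (poly q (x (j + i)) - poly q (x j)))"
    by (intro sum.cong) (auto simp: pq coef_mult_diff[OF assms(1), symmetric])
  moreover have "poly (pderiv q) (x j) = poly g (x j)"
    by (subst q, subst pderiv_add, subst pderiv_mult) (simp add: pderiv_pCons)
  ultimately show ?thesis by simp
qed

lemma coef_moment:
  assumes "strict_mono x" "1 \<le> q" "q \<le> 2 * s + 1"
  shows "(\<Sum>i\<in>stencil s. coef s x j i * (x (j + i) - x j) ^ q) = (if q = 1 then 1 else 0)"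
proof -
  define r where "r = [:- x j, 1:] ^ q"
  have "degree r \<le> 2 * s + 1"
    using assms(3) by (simp add: r_def degree_power_eq)
  from coef_exact[OF assms(1) this, of j]
  have "(\<Sum>i\<in>stencil s. coef s x j i * (x (j + i) - x j) ^ q) = poly (pderiv r) (x j)"
    using assms(2) by (simp add: r_def poly_power power_0_left)
  also have "\<dots> = (if q = 1 then 1 else 0)"
    using assms(2) by (auto simp: r_def pderiv_power poly_power power_0_left pderiv_pCons)
  finally show ?thesis .
qed

text \<open>The first power that is not differentiated exactly: \<open>(X - x j) ^ (2 s + 1)\<close> minus the node
polynomial has degree at most \<open>2 s\<close>, so the extrapolation error is the node polynomial at \<open>x j\<close>.\<close>

lemma coef_moment_top:
  assumes "strict_mono x"
  shows "(\<Sum>i\<in>stencil s. coef s x j i * (x (j + i) - x j) ^ (2 * s + 2))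
       = - (\<Prod>i\<in>stencil s. x j - x (j + i))"
proof -
  define A where "A = [:- x j, 1:] ^ (2 * s + 1)"
  define W where "W = (\<Prod>i\<in>stencil s. [:- x (j + i), 1:])"
  have W0: "poly W (x (j + i)) = 0" if "i \<in> stencil s" for i
    using that by (auto simp: W_def poly_prod intro!: prod_zero)
  have "degree (A - W) \<le> 2 * s"
  proof -
    have pow: "degree ([:- x j, 1:] ^ n) = n \<and> lead_coeff ([:- x j, 1:] ^ n) = 1" for n
      by (metis degree_power_eq degree_pCons_eq_if lead_coeff_power lead_coeff_pCons(1)
          degree_1 mult.right_neutral one_neq_zero one_pCons pCons_eq_0_iff power_one lead_coeff_1 degree_linear_power)
    from this[of "2 * s + 1"] have dA: "degree A = 2 * s + 1" "lead_coeff A = 1"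
      unfolding A_def by blast+
    have dW: "degree W = 2 * s + 1"
      unfolding W_def by (subst degree_prod_eq_sum_degree) (auto simp: card_stencil)
    have lW: "lead_coeff W = 1"
      unfolding W_def by (subst lead_coeff_prod) auto
    have "coeff (A - W) n = 0" if "n > 2 * s" for n
    proof (cases "n = 2 * s + 1")
      case True
      then show ?thesis using dA dW lW by simp
    next
      case False
      then show ?thesis using that dA dW by (simp add: coeff_eq_0)
    qed
    then show ?thesis by (intro degree_le) auto
  qed
  from lagrange_weight_interpolation[OF assms this, of j]
  have "(\<Sum>i\<in>stencil s. lagrange_weight s x j i * poly (A - W) (x (j + i))) = - poly W (x j)"
    by (simp add: A_def poly_power)
  moreover have "(\<Sum>i\<in>stencil s. lagrange_weight s x j i * poly (A - W) (x (j + i)))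
      = (\<Sum>i\<in>stencil s. coef s x j i * (x (j + i) - x j) ^ (2 * s + 2))"
    using W0 by (intro sum.cong)
      (auto simp: coef_mult_diff[OF assms, symmetric] A_def poly_power algebra_simps)
  ultimately show ?thesis
    by (simp add: W_def poly_prod)
qed

text \<open>The increment between nodes \<open>j\<close> and \<open>j + i\<close> of any primitive of \<open>z\<close>. With it the scheme can be applied
to cell quantities without choosing a primitive, and periodicity is preserved.\<close>

definition psum :: "(int \<Rightarrow> 'a::real_vector) \<Rightarrow> int \<Rightarrow> int \<Rightarrow> 'a" where
  "psum z j i = sum z {j..<j + i} - sum z {j + i..<j}"

text \<open>The derivative at node \<open>j\<close> of the interpolated primitive of \<open>z\<close>.\<close>

definition flux :: "nat \<Rightarrow> (int \<Rightarrow> real) \<Rightarrow> (int \<Rightarrow> 'a::real_vector) \<Rightarrow> int \<Rightarrow> 'a" where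
  "flux s x z j = (\<Sum>i\<in>stencil s. coef s x j i *\<^sub>R psum z j i)"

lemma sum_int_telescope:
  fixes w :: "int \<Rightarrow> 'a::ab_group_add"
  assumes "a \<le> b"
  shows "(\<Sum>l\<in>{a..<b}. w (l + 1) - w l) = w b - w a"
  using assms
proof (induction b rule: int_ge_induct)
  case (step b)
  then have "{a..<b + 1} = insert b {a..<b}" by auto
  then show ?case using step by simp
qed simp

lemma psum_telescope: "psum (\<lambda>l. w (l + 1) - w l) j i = w (j + i) - w j"
proof (cases "i \<ge> 0")
  case True
  then show ?thesis by (simp add: psum_def sum_int_telescope)
next
  case False
  then show ?thesis by (simp add: psum_def sum_int_telescope)
qed

lemma poly_antiderivative:
  fixes P :: "real poly"
  obtains Q where "pderiv Q = P" "degree Q \<le> degree P + 1"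
proof
  define Q where "Q = (\<Sum>i\<le>degree P. monom (coeff P i / real (Suc i)) (Suc i))"
  show "pderiv Q = P"
  proof -
    have "pderiv Q = (\<Sum>i\<le>degree P. monom (coeff P i) i)"
      unfolding Q_def by (subst higher_pderiv_sum[of 1, simplified]) (auto simp: pderiv_monom simp del: of_nat_Suc intro!: sum.cong)
    then show ?thesis by (simp add: poly_as_sum_of_monoms)
  qed
  show "degree Q \<le> degree P + 1"
    unfolding Q_def by (intro degree_sum_le) (auto intro: order_trans[OF degree_monom_le])
qed

text \<open>A primitive of the reconstruction on cell \<open>j - 1\<close> matches the increments of the primitive of the data
between the \<open>2 s + 2\<close> nodes around \<open>j\<close> and has degree at most \<open>2 s + 1\<close>, so it is differentiated
exactly by the weights.\<close>

lemma recon_eq_flux: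
  assumes x: "strict_mono x"
  shows "poly (recon (2 * s) x u (j - 1)) (x j) = flux s x (\<lambda>l. h x l * u l) j"
proof -
  define P where "P = recon (2 * s) x u (j - 1)"
  have "is_recon (2 * s) x u (j - 1) P"
    unfolding P_def recon_def by (rule theI') (rule is_recon_ex1[OF x], simp)
  then have dP: "degree P \<le> 2 * s"
    and avg: "\<And>k. - int s \<le> k \<Longrightarrow> k \<le> int s \<Longrightarrow> cell_avg x (poly P) (j - 1 + k) = u (j - 1 + k)"
    by (auto simp: is_recon_def)
  obtain Q where Q: "pderiv Q = P" "degree Q \<le> degree P + 1"
    by (rule poly_antiderivative)
  have step: "poly Q (x (l + 1)) - poly Q (x l) = h x l * u l" if "j - 1 - int s \<le> l" "l \<le> j - 1 + int s" for l
  proof -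
    have le: "x l \<le> x (l + 1)" and pos: "h x l > 0"
      using x by (simp_all add: strict_mono_less_eq h_def strict_mono_less)
    have "(poly P has_integral (poly Q (x (l + 1)) - poly Q (x l))) {x l..x (l + 1)}"
      using le by (rule fundamental_theorem_of_calculus)
        (metis Q(1) poly_DERIV has_field_derivative_at_within has_real_derivative_iff_has_vector_derivative)
    then have "cell_avg x (poly P) l = (poly Q (x (l + 1)) - poly Q (x l)) / h x l"
      by (simp add: cell_avg_def integral_unique)
    moreover have "cell_avg x (poly P) l = u l"
      using avg[of "l - j + 1"] that by simp
    ultimately show ?thesis using pos by (simp add: field_simps)
  qed
  have "poly P (x j) = (\<Sum>i\<in>stencil s. coef s x j i * (poly Q (x (j + i)) - poly Q (x j)))"
    using coef_exact[OF x, of Q s j] Q dP by simp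
  also have "\<dots> = (\<Sum>i\<in>stencil s. coef s x j i * psum (\<lambda>l. h x l * u l) j i)"
  proof (intro sum.cong refl)
    fix i assume i: "i \<in> stencil s"
    have "poly Q (x (j + i)) - poly Q (x j) = psum (\<lambda>l. poly Q (x (l + 1)) - poly Q (x l)) j i"
      by (simp add: psum_telescope[of "\<lambda>l. poly Q (x l)"])
    also have "\<dots> = psum (\<lambda>l. h x l * u l) j i"
      unfolding psum_def using i
      by (intro arg_cong2[where f = minus] sum.cong refl step) (auto simp: stencil_def)
    finally show "coef s x j i * (poly Q (x (j + i)) - poly Q (x j)) = coef s x j i * psum (\<lambda>l. h x l * u l) j i"
      by simp
  qed
  finally show ?thesis
    by (simp add: P_def flux_def)
qed

section \<open>The uniform mesh and its symbol\<close>

definition near_uniform :: "real \<Rightarrow> (int \<Rightarrow> real) \<Rightarrow> bool" where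
  "near_uniform \<mu> X \<longleftrightarrow> (\<forall>j. \<bar>X (j + 1) - X j - 1\<bar> \<le> \<mu>)"

lemma near_uniform_mono: "near_uniform \<mu> X \<Longrightarrow> \<mu> \<le> \<mu>' \<Longrightarrow> near_uniform \<mu>' X"
  unfolding near_uniform_def by (meson order_trans)

lemma near_uniform_dist_le:
  assumes "near_uniform \<mu> X" "a \<le> b"
  shows "\<bar>X b - X a - real_of_int (b - a)\<bar> \<le> real_of_int (b - a) * \<mu>"
  using assms(2)
proof (induction b rule: int_ge_induct)
  case (step b)
  have "\<bar>X (b + 1) - X b - 1\<bar> \<le> \<mu>"
    using assms(1) by (simp add: near_uniform_def)
  then show ?case
    using step by (simp add: algebra_simps)
qed simp

lemma near_uniform_dist:
  assumes "near_uniform \<mu> X"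
  shows "\<bar>X (j + i) - X j - real_of_int i\<bar> \<le> \<bar>real_of_int i\<bar> * \<mu>"
proof (cases "i \<ge> 0")
  case True
  then show ?thesis using near_uniform_dist_le[OF assms, of j "j + i"] by simp
next
  case False
  then show ?thesis using near_uniform_dist_le[OF assms, of "j + i" j] by (simp add: abs_if split: if_splits)
qed

lemma near_uniform_strict_mono:
  assumes "near_uniform \<mu> X" "\<mu> < 1"
  shows "strict_mono X"
proof (rule strict_monoI)
  fix a b :: int assume "a < b"
  then have "real_of_int (b - a) * \<mu> < real_of_int (b - a)"
    using assms(2) by simp
  then show "X a < X b"
    using near_uniform_dist_le[OF assms(1), of a b] \<open>a < b\<close> by linarith
qed

definition uniform_coef :: "nat \<Rightarrow> int \<Rightarrow> real" where
  "uniform_coef s i = coef s real_of_int 0 i"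

lemma coef_of_int [simp]: "coef s real_of_int j i = uniform_coef s i"
  by (simp add: uniform_coef_def coef_def lagrange_weight_def)

text \<open>The weights are rational functions of finitely many node differences, all of which tend to integers.
The limit is taken along the filter on pairs of a mesh and a node that is generated by the
deviation of the mesh, so that one threshold serves all meshes and all nodes.\<close>

lemma coef_close:
  assumes "\<eta> > 0"
  obtains \<mu> where "\<mu> > 0"
    "\<And>X j i. near_uniform \<mu> X \<Longrightarrow> i \<in> stencil s \<Longrightarrow> \<bar>coef s X j i - uniform_coef s i\<bar> \<le> \<eta>"
proof -
  define F where "F = (INF \<mu>\<in>{0::real<..}. principal {p :: (int \<Rightarrow> real) \<times> int. near_uniform \<mu> (fst p)})"
  define D where "D i p = fst p (snd p + i) - fst p (snd p)" for i and p :: "(int \<Rightarrow> real) \<times> int"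
  have D: "(D i \<longlongrightarrow> real_of_int i) F" for i
  proof (rule tendstoI)
    fix e :: real assume e: "e > 0"
    define \<mu> where "\<mu> = e / (2 * (\<bar>real_of_int i\<bar> + 1))"
    have "\<mu> > 0" using e by (simp add: \<mu>_def)
    have "\<bar>real_of_int i\<bar> * \<mu> < e"
      using e by (simp add: \<mu>_def field_simps) (smt (verit) mult_nonneg_nonneg)
    then have "dist (D i p) (real_of_int i) < e" if "near_uniform \<mu> (fst p)" for p
      using near_uniform_dist[OF that, of "snd p" i] by (simp add: D_def dist_real_def)
    then show "\<forall>\<^sub>F p in F. dist (D i p) (real_of_int i) < e"
      unfolding F_def using \<open>\<mu> > 0\<close>
      by (intro eventually_INF1[of \<mu>]) (auto simp: eventually_principal)
  qed
  have coefD: "coef s (fst p) (snd p) i = (\<Prod>l\<in>stencil s - {i}. (D 0 p - D l p) / (D i p - D l p)) / D i p" for p i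
    by (simp add: coef_def lagrange_weight_def D_def)
  have lim: "((\<lambda>p. coef s (fst p) (snd p) i) \<longlongrightarrow> uniform_coef s i) F" if "i \<in> stencil s" for i
  proof -
    have "((\<lambda>p. (\<Prod>l\<in>stencil s - {i}. (D 0 p - D l p) / (D i p - D l p)) / D i p)
      \<longlongrightarrow> (\<Prod>l\<in>stencil s - {i}. (real_of_int 0 - real_of_int l) / (real_of_int i - real_of_int l)) / real_of_int i) F"
      using stencil_nonzero[OF that] by (intro tendsto_intros D) auto
    moreover have "uniform_coef s i = (\<Prod>l\<in>stencil s - {i}. (real_of_int 0 - real_of_int l) / (real_of_int i - real_of_int l)) / real_of_int i"
      by (simp add: uniform_coef_def coef_def lagrange_weight_def)
    ultimately show ?thesis
      unfolding coefD by simp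
  qed
  have "\<forall>\<^sub>F p in F. \<forall>i\<in>stencil s. dist (coef s (fst p) (snd p) i) (uniform_coef s i) < \<eta>"
    using tendstoD[OF lim assms] by (intro eventually_ball_finite) auto
  then obtain \<mu> where "\<mu> > 0" "\<forall>p. near_uniform \<mu> (fst p) \<longrightarrow> (\<forall>i\<in>stencil s. dist (coef s (fst p) (snd p) i) (uniform_coef s i) < \<eta>)"
    unfolding F_def
  proof (subst (asm) eventually_INF_base, goal_cases)
    case (2 a b)
    then show ?case
      by (intro bexI[of _ "min a b"]) (auto intro: near_uniform_mono)
  qed (auto simp: eventually_principal)
  then show ?thesis
    using that[of \<mu>] by (auto simp: dist_real_def less_imp_le)
qed

text \<open>The eigenvalue of the scheme on the uniform mesh for the wave of frequency \<open>\<theta>\<close>; see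
\<open>fv_op_uniform_wave\<close>.\<close>

definition symbol :: "nat \<Rightarrow> real \<Rightarrow> complex" where
  "symbol s \<theta> = (\<Sum>i\<in>stencil s. uniform_coef s i *\<^sub>R (cis (\<theta> * real_of_int i) - 1))"

definition dissipation :: "nat \<Rightarrow> real" where
  "dissipation s = (- 1) ^ (s + 1) * uniform_coef s (- int s - 1) / 2"

lemma dissipation_pos: "dissipation s > 0"
proof -
  let ?A = "{1..int s}" and ?B = "{- int s..-1}"
  let ?f = "\<lambda>l. (- real_of_int l) / (- real_of_int s - 1 - real_of_int l)"
  have st: "stencil s - {- int s - 1} = ?A \<union> ?B"
    by (auto simp: stencil_def)
  have A: "prod ?f ?A > 0"
    by (intro prod_pos) (auto simp: divide_simps)
  have "?f l = (- 1) * (real_of_int (- l) / (real s + 1 + real_of_int l))" for l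
  proof -
    have "- real_of_int (int s) - 1 - real_of_int l = - (real s + 1 + real_of_int l)"
      by simp
    then show ?thesis
      by (metis minus_divide_divide minus_divide_left minus_minus mult_minus1 of_int_minus)
  qed
  then have "prod ?f ?B = (\<Prod>l\<in>?B. (- 1) * (real_of_int (- l) / (real s + 1 + real_of_int l)))"
    by simp
  also have "\<dots> = (- 1) ^ s * (\<Prod>l\<in>?B. real_of_int (- l) / (real s + 1 + real_of_int l))"
    by (subst prod.distrib) simp
  finally have "(- 1) ^ s * prod ?f ?B = (\<Prod>l\<in>?B. real_of_int (- l) / (real s + 1 + real_of_int l))"
    by (simp flip: power_add mult.assoc mult_2)
  moreover have "(\<Prod>l\<in>?B. real_of_int (- l) / (real s + 1 + real_of_int l)) > 0"
    by (intro prod_pos divide_pos_pos) auto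
  ultimately have B: "(- 1) ^ s * prod ?f ?B > 0"
    by (simp only:)
  have "uniform_coef s (- int s - 1) = (prod ?f ?A * prod ?f ?B) / (- real s - 1)"
    unfolding uniform_coef_def coef_def lagrange_weight_def st
    by (subst prod.union_disjoint[symmetric]) (auto intro!: prod.cong)
  moreover have "(- 1) ^ (s + 1) * ((a * b) / (- real s - 1)) / 2 = a * ((- 1) ^ s * b) / (2 * (real s + 1))" for a b :: real
    by (simp add: divide_simps) (simp add: algebra_simps)
  ultimately have "dissipation s = prod ?f ?A * ((- 1) ^ s * prod ?f ?B) / (2 * (real s + 1))"
    by (simp only: dissipation_def)
  then show ?thesis
    using A B by simp
qed

text \<open>Expand each power around one. The vanishing moments remove all powers of \<open>\<omega> - 1\<close> but the top one.\<close>

lemma alternating_expansion: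
  fixes E :: "nat \<Rightarrow> real" and \<omega> :: complex
  assumes "\<And>q. q < n \<Longrightarrow> (\<Sum>k\<le>n. E k * real (k choose q)) = 0"
  shows "(\<Sum>k\<le>n. of_real (E k) * \<omega> ^ k) = of_real (E n) * (\<omega> - 1) ^ n"
proof -
  have "(\<Sum>k\<le>n. of_real (E k) * \<omega> ^ k)
      = (\<Sum>k\<le>n. \<Sum>q\<le>n. of_real (E k * real (k choose q)) * (\<omega> - 1) ^ q)"
  proof (intro sum.cong refl)
    fix k assume k: "k \<in> {..n}"
    have "\<omega> ^ k = ((\<omega> - 1) + 1) ^ k" by simp
    also have "\<dots> = (\<Sum>q\<le>k. of_nat (k choose q) * (\<omega> - 1) ^ q)"
      by (subst binomial_ring) simp
    also have "\<dots> = (\<Sum>q\<le>n. of_nat (k choose q) * (\<omega> - 1) ^ q)"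
      using k by (intro sum.mono_neutral_left) auto
    finally show "of_real (E k) * \<omega> ^ k = (\<Sum>q\<le>n. of_real (E k * real (k choose q)) * (\<omega> - 1) ^ q)"
      by (simp add: sum_distrib_left mult.assoc)
  qed
  also have "\<dots> = (\<Sum>q\<le>n. of_real (\<Sum>k\<le>n. E k * real (k choose q)) * (\<omega> - 1) ^ q)"
    by (subst sum.swap) (simp add: sum_distrib_right)
  also have "\<dots> = (\<Sum>q\<in>{n}. of_real (\<Sum>k\<le>n. E k * real (k choose q)) * (\<omega> - 1) ^ q)"
    using assms by (intro sum.mono_neutral_right) auto
  also have "\<dots> = of_real (E n) * (\<omega> - 1) ^ n"
  proof -
    have "(\<Sum>k\<le>n. E k * real (k choose n)) = (\<Sum>k\<in>{n}. E k * real (k choose n))"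
      by (intro sum.mono_neutral_right) auto
    then show ?thesis by simp
  qed
  finally show ?thesis .
qed

lemma cis_minus_one_square: "(cis \<theta> - 1)\<^sup>2 = - of_real ((cmod (cis \<theta> - 1))\<^sup>2) * cis \<theta>"
proof -
  have "of_real ((cmod (cis \<theta> - 1))\<^sup>2) = (cis \<theta> - 1) * cnj (cis \<theta> - 1)"
    by (rule complex_norm_square)
  also have "\<dots> * cis \<theta> = (cis \<theta> - 1) * (1 - cis \<theta>)"
    by (simp add: cis_cnj algebra_simps cis_mult)
  finally show ?thesis by (simp add: power2_eq_square algebra_simps)
qed

lemma power_even_split:
  fixes a :: "'a::monoid_mult"
  shows "a ^ (2 * s + 2) = (a\<^sup>2) ^ (s + 1)"
proof -
  have "2 * s + 2 = 2 * (s + 1)" by simp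
  then show ?thesis by (simp only: power_mult)
qed

text \<open>The real part of the symbol is the cosine sum of the symmetrised weights. The symmetrised functional
annihilates all polynomials of degree at most \<open>2 s + 1\<close>, because the derivative of an even
polynomial vanishes at zero, and it lives on \<open>2 s + 3\<close> points; hence its generating function is a
multiple of \<open>(\<omega> - 1) ^ (2 s + 2)\<close>.\<close>

lemma Re_symbol: "Re (symbol s \<theta>) = dissipation s * cmod (cis \<theta> - 1) ^ (2 * s + 2)"
proof -
  define I where "I = {- int s - 1..int s + 1}"
  define d where "d i = (if i \<in> stencil s then uniform_coef s i else if i = 0 then - sum (uniform_coef s) (stencil s) else 0)" for i
  define e where "e i = (d i + d (- i)) / 2" for i
  have finI: "finite I" by (simp add: I_def)
  have sub: "insert 0 (stencil s) \<subseteq> I" by (auto simp: I_def stencil_def)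
  have sumd: "(\<Sum>i\<in>I. d i * f i) = (\<Sum>i\<in>stencil s. uniform_coef s i * (f i - f 0))" for f :: "int \<Rightarrow> real"
  proof -
    have "(\<Sum>i\<in>I. d i * f i) = (\<Sum>i\<in>insert 0 (stencil s). d i * f i)"
      using finI sub by (intro sum.mono_neutral_right) (auto simp: d_def)
    also have "\<dots> = d 0 * f 0 + (\<Sum>i\<in>stencil s. d i * f i)"
      using stencil_nonzero[of 0] by (subst sum.insert) auto
    also have "d 0 = - sum (uniform_coef s) (stencil s)"
      using stencil_nonzero[of 0] by (auto simp: d_def)
    also have "(\<Sum>i\<in>stencil s. d i * f i) = (\<Sum>i\<in>stencil s. uniform_coef s i * f i)"
      by (simp add: d_def)
    finally show ?thesis
      by (simp add: algebra_simps sum_subtractf sum_distrib_left)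
  qed
  have reflect: "(\<Sum>i\<in>I. f (- i)) = (\<Sum>i\<in>I. f i)" for f :: "int \<Rightarrow> real"
    by (rule sum.reindex_bij_witness[of _ uminus uminus]) (auto simp: I_def)
  have sume: "(\<Sum>i\<in>I. e i * f i) = (\<Sum>i\<in>I. d i * (f i + f (- i))) / 2" for f :: "int \<Rightarrow> real"
    using reflect[of "\<lambda>i. d (- i) * f i"]
    by (simp add: e_def sum.distrib algebra_simps flip: sum_divide_distrib add_divide_distrib)
  have mom: "(\<Sum>i\<in>I. e i * poly f (real_of_int i)) = 0" if "degree f \<le> 2 * s + 1" for f
  proof -
    define g where "g = f + pcompose f [:0, -1:]"
    have "degree g \<le> 2 * s + 1"
      unfolding g_def using that by (intro degree_add_le) (auto simp: degree_pcompose)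
    from coef_exact[OF _ this, of real_of_int 0]
    have "(\<Sum>i\<in>stencil s. uniform_coef s i * (poly g (real_of_int i) - poly g 0)) = poly (pderiv g) 0"
      by (simp add: strict_mono_def)
    also have "poly (pderiv g) 0 = 0"
      by (simp add: g_def pderiv_add pderiv_pcompose poly_pcompose pderiv_pCons)
    finally show ?thesis
      unfolding sume sumd by (simp add: g_def poly_pcompose algebra_simps)
  qed
  define E where "E k = e (int k - int s - 1)" for k
  have shift: "(\<Sum>i\<in>I. f i) = (\<Sum>k\<le>2 * s + 2. f (int k - int s - 1))" for f :: "int \<Rightarrow> 'b::comm_monoid_add"
    by (rule sum.reindex_bij_witness[of _ "\<lambda>k. int k - int s - 1" "\<lambda>i. nat (i + int s + 1)"]) (auto simp: I_def)
  have "(\<Sum>k\<le>2 * s + 2. E k * real (k choose q)) = 0" if "q < 2 * s + 2" for q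
  proof -
    define f where "f = smult (1 / fact q) (\<Prod>l = 0..<q. [:real s + 1 - real l, 1:])"
    have "degree f \<le> 2 * s + 1"
    proof -
      have "degree (\<Prod>l = 0..<q. [:real s + 1 - real l, 1:]) \<le> sum (degree \<circ> (\<lambda>l. [:real s + 1 - real l, 1:])) {0..<q}"
        by (rule degree_prod_sum_le) simp
      then show ?thesis
        unfolding f_def using that by simp
    qed
    moreover have "poly f (real_of_int (int k - int s - 1)) = real (k choose q)" for k
      by (simp add: f_def poly_prod binomial_gbinomial gbinomial_prod_rev)
    ultimately show ?thesis
      using mom[of f] by (simp add: shift E_def)
  qed
  from alternating_expansion[of "2 * s + 2" E "cis \<theta>", OF this]
  have 1: "(\<Sum>k\<le>2 * s + 2. of_real (E k) * cis \<theta> ^ k) = of_real (E (2 * s + 2)) * (cis \<theta> - 1) ^ (2 * s + 2)" .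
  have "E (2 * s + 2) = uniform_coef s (- int s - 1) / 2"
    by (simp add: E_def e_def d_def stencil_def minus_diff_commute[of 1])
  then have top: "E (2 * s + 2) * (- 1) ^ (s + 1) = dissipation s"
    by (simp add: dissipation_def)
  have "(\<Sum>i\<in>I. of_real (e i) * cis (\<theta> * real_of_int i)) 
      = cis (- (real (s + 1) * \<theta>)) * (\<Sum>k\<le>2 * s + 2. of_real (E k) * cis \<theta> ^ k)"
    unfolding shift E_def sum_distrib_left
  proof (rule sum.cong[OF refl])
    fix k
    have "cis (- (real (s + 1) * \<theta>)) * cis \<theta> ^ k = cis (\<theta> * real_of_int (int k - int s - 1))"
      apply (simp only: Complex.DeMoivre cis_mult)
      apply (rule arg_cong[of _ _ cis])
      apply (simp add: algebra_simps)
      done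
    then show "of_real (e (int k - int s - 1)) * cis (\<theta> * real_of_int (int k - int s - 1))
        = cis (- (real (s + 1) * \<theta>)) * (of_real (e (int k - int s - 1)) * cis \<theta> ^ k)"
      by (metis mult.left_commute)
  qed
  also have "\<dots> = of_real (E (2 * s + 2)) * (cis (- (real (s + 1) * \<theta>)) * ((cis \<theta> - 1)\<^sup>2) ^ (s + 1))"
    unfolding 1 power_even_split by (simp only: mult_ac)
  also have "\<dots> = of_real (E (2 * s + 2)) * ((- of_real ((cmod (cis \<theta> - 1))\<^sup>2)) ^ (s + 1) * (cis (- (real (s + 1) * \<theta>)) * cis \<theta> ^ (s + 1)))"
    unfolding cis_minus_one_square power_mult_distrib by (simp only: mult_ac)
  also have "cis (- (real (s + 1) * \<theta>)) * cis \<theta> ^ (s + 1) = 1"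
    unfolding Complex.DeMoivre cis_mult by simp
  also have "of_real (E (2 * s + 2)) * ((- of_real ((cmod (cis \<theta> - 1))\<^sup>2)) ^ (s + 1) * 1)
      = (of_real (E (2 * s + 2) * ((- 1) ^ (s + 1) * ((cmod (cis \<theta> - 1))\<^sup>2) ^ (s + 1))) :: complex)"
    unfolding power_minus[of "of_real _"] by simp
  also have "E (2 * s + 2) * ((- 1) ^ (s + 1) * ((cmod (cis \<theta> - 1))\<^sup>2) ^ (s + 1)) 
      = dissipation s * cmod (cis \<theta> - 1) ^ (2 * s + 2)"
    unfolding top[symmetric] power_even_split by (simp only: mult_ac)
  finally have 2: "(\<Sum>i\<in>I. of_real (e i) * cis (\<theta> * real_of_int i)) = of_real (dissipation s * cmod (cis \<theta> - 1) ^ (2 * s + 2))" .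
  have "Re (symbol s \<theta>) = (\<Sum>i\<in>stencil s. uniform_coef s i * (cos (\<theta> * real_of_int i) - cos (\<theta> * real_of_int 0)))"
    by (simp add: symbol_def)
  also have "\<dots> = (\<Sum>i\<in>I. d i * cos (\<theta> * real_of_int i))"
    by (rule sumd[symmetric])
  also have "\<dots> = (\<Sum>i\<in>I. e i * cos (\<theta> * real_of_int i))"
    unfolding sume by (simp add: sum_divide_distrib)
  also have "\<dots> = Re (\<Sum>i\<in>I. of_real (e i) * cis (\<theta> * real_of_int i))"
    by simp
  finally show ?thesis
    unfolding 2 by simp
qed

section \<open>An invariant functional of a perturbed diagonal matrix\<close>

text \<open>Banach's fixed point theorem in the maximum norm of finitely many coordinates, on a ball. The index
set is a set rather than a type since the number of coordinates will be the period of the mesh.\<close>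

lemma picard_fixpoint:
  fixes F :: "('i \<Rightarrow> complex) \<Rightarrow> 'i \<Rightarrow> complex"
  assumes "finite I" and q: "0 \<le> q" "q < 1" and R: "0 \<le> R"
    and ball: "\<And>y k. \<forall>k\<in>I. norm (y k) \<le> R \<Longrightarrow> k \<in> I \<Longrightarrow> norm (F y k) \<le> R"
    and contr: "\<And>y y' M k. \<forall>k\<in>I. norm (y k) \<le> R \<Longrightarrow> \<forall>k\<in>I. norm (y' k) \<le> R \<Longrightarrow>
      \<forall>k\<in>I. norm (y k - y' k) \<le> M \<Longrightarrow> k \<in> I \<Longrightarrow> norm (F y k - F y' k) \<le> q * M"
  obtains y where "\<And>k. k \<in> I \<Longrightarrow> norm (y k) \<le> R" "\<And>k. k \<in> I \<Longrightarrow> F y k = y k"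
proof -
  define Y where "Y n = (F ^^ n) (\<lambda>_. 0)" for n
  have YS: "Y (Suc n) = F (Y n)" for n
    by (simp add: Y_def)
  have Yball: "\<forall>k\<in>I. norm (Y n k) \<le> R" for n
  proof (induction n)
    case 0
    then show ?case using R by (simp add: Y_def)
  next
    case (Suc n)
    then show ?case using ball by (simp add: YS)
  qed
  have step: "\<forall>k\<in>I. norm (Y (Suc n) k - Y n k) \<le> q ^ n * R" for n
  proof (induction n)
    case 0
    then show ?case using Yball[of 1] by (simp add: Y_def)
  next
    case (Suc n)
    then show ?case
      using contr[OF Yball[of "Suc n"] Yball[of n] Suc] by (simp add: YS mult.assoc)
  qed
  define y where "y k = lim (\<lambda>n. Y n k)" for k
  have lim: "(\<lambda>n. Y n k) \<longlonglongrightarrow> y k" if "k \<in> I" for k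
  proof -
    have "summable (\<lambda>n. Y (Suc n) k - Y n k)"
    proof (rule summable_comparison_test')
      show "summable (\<lambda>n. q ^ n * R)"
        using q by (intro summable_mult2 summable_geometric) auto
      show "norm (Y (Suc n) k - Y n k) \<le> q ^ n * R" if "n \<ge> 0" for n
        using step \<open>k \<in> I\<close> by blast
    qed
    then have "convergent (\<lambda>n. \<Sum>i<n. Y (Suc i) k - Y i k)"
      by (simp add: summable_iff_convergent)
    then have "convergent (\<lambda>n. Y n k - Y 0 k)"
      by (simp only: sum_lessThan_telescope[of "\<lambda>n. Y n k"])
    then have "convergent (\<lambda>n. Y n k)"
      by (simp add: convergent_diff_const_right_iff)
    then show ?thesis
      unfolding y_def by (simp add: convergent_LIMSEQ_iff)
  qed
  have yball: "norm (y k) \<le> R" if "k \<in> I" for k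
    by (rule Lim_norm_ubound[OF _ lim[OF that]]) (use Yball that in auto)
  have fix_eq: "F y k = y k" if k: "k \<in> I" for k
  proof -
    have "norm (F y k - y k) \<le> e" if "e > 0" for e
    proof -
      have ev: "\<forall>\<^sub>F n in sequentially. \<forall>k\<in>I. dist (Y n k) (y k) < e / 2"
        using tendstoD[OF lim, of _ "e / 2"] that assms(1) by (intro eventually_ball_finite) auto
      then obtain n where n: "\<And>l. l \<ge> n \<Longrightarrow> \<forall>k\<in>I. dist (Y l k) (y k) < e / 2"
        by (auto simp: eventually_sequentially)
      have "\<forall>k\<in>I. norm (y k - Y n k) \<le> e / 2"
        using n[of n] by (auto simp: dist_norm norm_minus_commute less_imp_le)
      from contr[OF _ Yball this k] have "norm (F y k - Y (Suc n) k) \<le> q * (e / 2)"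
        using yball by (simp add: YS)
      also have "\<dots> \<le> 1 * (e / 2)"
        using q that by (intro mult_right_mono) auto
      finally have "norm (F y k - Y (Suc n) k) \<le> e / 2" by simp
      moreover have "norm (Y (Suc n) k - y k) \<le> e / 2"
        using n[of "Suc n"] k by (auto simp: dist_norm less_imp_le)
      moreover have "norm (F y k - y k) \<le> norm (F y k - Y (Suc n) k) + norm (Y (Suc n) k - y k)"
        using norm_triangle_ineq[of "F y k - Y (Suc n) k" "Y (Suc n) k - y k"] by simp
      ultimately show ?thesis by linarith
    qed
    then have "norm (F y k - y k) \<le> 0"
      by (rule field_le_epsilon) simp
    then show ?thesis by simp
  qed
  show ?thesis
    by (rule that[of y]) (use yball fix_eq in auto)
qed

lemma norm_sum_mult_le:
  fixes a b :: "'i \<Rightarrow> complex"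
  assumes "\<And>i. i \<in> I \<Longrightarrow> norm (a i) \<le> A" "\<And>i. i \<in> I \<Longrightarrow> norm (b i) \<le> B" "0 \<le> A"
    and "real (card I) \<le> m" "0 \<le> B"
  shows "norm (\<Sum>i\<in>I. a i * b i) \<le> m * (A * B)"
proof -
  have "norm (\<Sum>i\<in>I. a i * b i) \<le> real (card I) * (A * B)"
    by (rule sum_norm_bound) (use assms in \<open>auto simp: norm_mult intro!: mult_mono\<close>)
  also have "\<dots> \<le> m * (A * B)"
    using assms by (intro mult_right_mono) auto
  finally show ?thesis .
qed

text \<open>With \<open>y 0 = 1\<close> the equation for index zero gives the eigenvalue, and the other ones become a fixed
point equation after division by the gaps. Its inhomogeneity is row zero of the perturbation, hence
the factor \<open>\<tau>\<close> in the bound for \<open>y\<close>; this factor compensates the loss of one power of \<open>\<tau>\<close> in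
the residual of the approximate right eigenvector below.\<close>

lemma left_eigenvector:
  fixes L :: "nat \<Rightarrow> complex" and P :: "nat \<Rightarrow> nat \<Rightarrow> complex"
  assumes m: "0 < m" and g: "0 < g" and \<tau>: "0 \<le> \<tau>" "\<tau> \<le> 2" and \<eta>: "0 \<le> \<eta>" "4 * real m * \<eta> \<le> g"
    and P: "\<And>i k. i < m \<Longrightarrow> k < m \<Longrightarrow> norm (P i k) \<le> \<eta>"
    and P0: "\<And>k. 0 < k \<Longrightarrow> k < m \<Longrightarrow> norm (P 0 k) \<le> \<eta> * \<tau>"
    and gap: "\<And>k. 0 < k \<Longrightarrow> k < m \<Longrightarrow> g \<le> norm (L k - L 0)"
  obtains y l where "y 0 = 1" "\<And>k. 0 < k \<Longrightarrow> k < m \<Longrightarrow> norm (y k) \<le> 2 * \<eta> * \<tau> / g"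
    "\<And>k. k < m \<Longrightarrow> y k * L k + (\<Sum>i<m. y i * P i k) = l * y k"
proof -
  define I where "I = {1..<m}"
  define A where "A y = P 0 0 + (\<Sum>i\<in>I. y i * P i 0)" for y
  define F where "F y k = (y k * A y - P 0 k - (\<Sum>i\<in>I. y i * P i k)) / (L k - L 0)" for y k
  define R where "R = 2 * \<eta> * \<tau> / g"
  have R: "0 \<le> R" using \<eta> \<tau> g by (simp add: R_def)
  have m1: "1 \<le> real m" using m by simp
  have "4 * \<eta> \<le> g"
    using \<eta> m1 mult_right_mono[OF m1 \<eta>(1)] by linarith
  then have R1: "R \<le> 1"
    using \<tau> g \<eta> mult_mono[of \<eta> "g / 4" \<tau> 2] by (simp add: R_def field_simps)
  have cI: "real (card I) \<le> real m - 1" using m by (simp add: I_def of_nat_diff)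
  have Abound: "norm (A y) \<le> real m * \<eta>" if "\<forall>k\<in>I. norm (y k) \<le> R" for y
  proof -
    have "norm (\<Sum>i\<in>I. y i * P i 0) \<le> (real m - 1) * (1 * \<eta>)"
      by (rule norm_sum_mult_le) (use that R1 P cI \<eta> m in \<open>auto simp: I_def intro: order_trans\<close>)
    moreover have "norm (P 0 0) \<le> \<eta>" using P m by simp
    ultimately show ?thesis
      unfolding A_def by (intro order_trans[OF norm_triangle_ineq]) (simp add: algebra_simps)
  qed
  have Pbound: "norm (\<Sum>i\<in>I. y i * P i k) \<le> real m * (M * \<eta>)"
    if "\<forall>k\<in>I. norm (y k) \<le> M" "k < m" "0 \<le> M" for y M k
    by (rule norm_sum_mult_le) (use that P cI \<eta> in \<open>auto simp: I_def\<close>)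
  have div: "norm (z / (L k - L 0)) \<le> B" if "norm z \<le> B * g" "k \<in> I" "0 \<le> B" for z B k
  proof -
    have gk: "g \<le> norm (L k - L 0)" using gap[of k] that by (simp add: I_def)
    have "norm z \<le> B * norm (L k - L 0)"
      using that gk by (meson mult_left_mono order_trans)
    then show ?thesis using gk g that by (simp add: norm_divide divide_le_eq)
  qed
  have small: "real m * (\<eta> * R) \<le> g / 4 * R"
    using mult_right_mono[OF \<eta>(2) R] by (simp add: algebra_simps)
  have Rg: "\<eta> * \<tau> = R * g / 2" using g by (simp add: R_def)
  obtain y where y: "\<And>k. k \<in> I \<Longrightarrow> norm (y k) \<le> R" "\<And>k. k \<in> I \<Longrightarrow> F y k = y k"
  proof (rule picard_fixpoint[of I "3/4" R F])
    show "norm (F y k) \<le> R" if y: "\<forall>k\<in>I. norm (y k) \<le> R" and k: "k \<in> I" for y k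
    proof -
      have "norm (y k * A y) \<le> R * (real m * \<eta>)"
        unfolding norm_mult using y k Abound[OF y] R by (intro mult_mono) auto
      moreover have "norm (P 0 k) \<le> \<eta> * \<tau>" using P0 k by (simp add: I_def)
      moreover have "norm (\<Sum>i\<in>I. y i * P i k) \<le> real m * (R * \<eta>)"
        by (rule Pbound) (use y k R in \<open>auto simp: I_def\<close>)
      moreover have "norm (y k * A y - P 0 k - (\<Sum>i\<in>I. y i * P i k))
          \<le> norm (y k * A y) + norm (P 0 k) + norm (\<Sum>i\<in>I. y i * P i k)"
        using norm_triangle_ineq4 by (smt (verit))
      ultimately have "norm (y k * A y - P 0 k - (\<Sum>i\<in>I. y i * P i k)) \<le> R * g"
        using small Rg by (simp add: algebra_simps)
      then show ?thesis unfolding F_def using k R by (intro div) auto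
    qed
    show "norm (F y k - F y' k) \<le> 3 / 4 * M"
      if y: "\<forall>k\<in>I. norm (y k) \<le> R" and y': "\<forall>k\<in>I. norm (y' k) \<le> R"
        and M: "\<forall>k\<in>I. norm (y k - y' k) \<le> M" and k: "k \<in> I" for y y' M k
    proof -
      have M0: "0 \<le> M" using M k norm_ge_zero order_trans by blast
      define E where "E = (y k - y' k) * A y + y' k * (A y - A y') - (\<Sum>i\<in>I. (y i - y' i) * P i k)"
      have FE: "F y k - F y' k = E / (L k - L 0)"
        unfolding F_def E_def by (simp add: algebra_simps sum_subtractf flip: diff_divide_distrib)
      have "norm ((y k - y' k) * A y) \<le> real m * (M * \<eta>)"
        unfolding norm_mult mult.left_commute[of _ M] using M k Abound[OF y] M0 by (intro mult_mono) auto
      moreover have "norm (y' k * (A y - A y')) \<le> 1 * (real m * (M * \<eta>))"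
      proof -
        have "A y - A y' = (\<Sum>i\<in>I. (y i - y' i) * P i 0)"
          by (simp add: A_def algebra_simps sum_subtractf)
        then show ?thesis
          unfolding norm_mult using y' k R1 m M M0 Pbound[of "\<lambda>i. y i - y' i" M 0]
          by (intro mult_mono) (auto intro: order_trans)
      qed
      moreover have "norm (\<Sum>i\<in>I. (y i - y' i) * P i k) \<le> real m * (M * \<eta>)"
        by (rule Pbound) (use M k M0 in \<open>auto simp: I_def\<close>)
      moreover have "norm E
          \<le> norm ((y k - y' k) * A y) + norm (y' k * (A y - A y')) + norm (\<Sum>i\<in>I. (y i - y' i) * P i k)"
        unfolding E_def by (meson add_mono norm_triangle_ineq norm_triangle_ineq4 order_refl order_trans)
      moreover have "real m * (M * \<eta>) \<le> M * g / 4"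
        using mult_right_mono[OF \<eta>(2) M0] by (simp add: algebra_simps)
      ultimately have "norm E \<le> 3 / 4 * (M * g)" by linarith
      then show ?thesis
        unfolding FE using k M0 by (intro div) (auto simp: mult.assoc)
    qed
  qed (use R I_def in auto)
  define y1 where "y1 k = (if k = 0 then 1 else y k)" for k
  define l where "l = L 0 + A y"
  have split: "(\<Sum>i<m. y1 i * P i k) = P 0 k + (\<Sum>i\<in>I. y i * P i k)" for k
  proof -
    have "{..<m} = insert 0 I" using m by (auto simp: I_def)
    moreover have "(\<Sum>i\<in>I. y1 i * P i k) = (\<Sum>i\<in>I. y i * P i k)"
      by (intro sum.cong) (auto simp: y1_def I_def)
    ultimately show ?thesis
      by (simp add: y1_def) (simp add: I_def)
  qed
  show ?thesis
  proof (rule that[of y1 l])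
    show "y1 0 = 1" by (simp add: y1_def)
    show "norm (y1 k) \<le> 2 * \<eta> * \<tau> / g" if "0 < k" "k < m" for k
      using y(1)[of k] that by (simp add: y1_def R_def I_def)
    show "y1 k * L k + (\<Sum>i<m. y1 i * P i k) = l * y1 k" if "k < m" for k
    proof (cases "k = 0")
      case True
      then show ?thesis by (simp only: split l_def A_def) (simp add: y1_def)
    next
      case False
      then have k: "k \<in> I" using that by (simp add: I_def)
      have "L k - L 0 \<noteq> 0" using gap[of k] k g by (auto simp: I_def)
      then have "y k * (L k - L 0) = y k * A y - P 0 k - (\<Sum>i\<in>I. y i * P i k)"
        using y(2)[OF k] by (simp add: F_def field_simps)
      then show ?thesis
        using False by (simp only: split l_def) (simp add: y1_def algebra_simps)
    qed
  qed
qed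

lemma Re_cnj_mult_ge: "- (norm a * norm b) \<le> Re (cnj a * b)"
  using abs_Re_le_cmod[of "cnj a * b"] by (simp add: norm_mult abs_le_iff)

lemma Re_cnj_mult_scale: "Re (cnj a * (c * a)) = Re c * (norm a)\<^sup>2"
proof -
  have "cnj a * (c * a) = c * of_real ((norm a)\<^sup>2)"
    by (simp only: complex_norm_square mult_ac)
  then show ?thesis
    by (simp only: times_complex.sel Re_complex_of_real Im_complex_of_real mult_zero_right diff_zero)
qed

lemma norm_add_diff_le: "norm (a + b - c) \<le> norm a + norm b + norm c"
  for a b c :: "'a::real_normed_vector"
  using norm_triangle_ineq4[of "a + b" c] norm_triangle_ineq[of a b] by linarith

lemma norm_diff_diff_le: "norm (a - b - c) \<le> norm a + norm b + norm c"
  for a b c :: "'a::real_normed_vector"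
  using norm_triangle_ineq4[of "a - b" c] norm_triangle_ineq4[of a b] by linarith

lemma norm_square_diff_le:
  fixes a b :: complex
  assumes "norm a \<le> S" "norm (b - a) \<le> \<epsilon> * S" "0 \<le> \<epsilon>" "\<epsilon> \<le> 3"
  shows "\<bar>(norm b)\<^sup>2 - (norm a)\<^sup>2\<bar> \<le> 5 * \<epsilon> * S\<^sup>2"
proof -
  have S: "0 \<le> S" using assms(1) norm_ge_zero order_trans by blast
  have "norm b \<le> norm a + norm (b - a)"
    using norm_triangle_ineq[of a "b - a"] by simp
  then have b: "norm b \<le> S + 3 * S"
    using assms S mult_right_mono[OF assms(4) S] by linarith
  have "\<bar>norm b - norm a\<bar> \<le> \<epsilon> * S"
    using norm_triangle_ineq3[of b a] assms(2) by linarith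
  moreover have "norm b + norm a \<le> 5 * S" using b assms(1) by linarith
  ultimately have "\<bar>norm b - norm a\<bar> * (norm b + norm a) \<le> (\<epsilon> * S) * (5 * S)"
    by (intro mult_mono) (use S assms in auto)
  moreover have "\<bar>(norm b)\<^sup>2 - (norm a)\<^sup>2\<bar> = \<bar>norm b - norm a\<bar> * (norm b + norm a)"
    by (simp add: power2_eq_square square_diff_square_factored abs_mult)
  ultimately show ?thesis by (simp add: power2_eq_square algebra_simps)
qed

text \<open>The vector \<open>z\<close> is split into \<open>a z * r\<close> and a part \<open>w z\<close> annihilated by the left eigenvector \<open>y\<close>. The
amplitude obeys \<open>a (M z) = l * a z\<close> exactly. Pairing \<open>M r = \<nu> r + \<rho>\<close> with \<open>y\<close> gives
\<open>l - \<nu> = (y . \<rho>) / (y . r)\<close>, which is \<open>L 0 - \<nu>\<close> up to a small multiple of \<open>\<tau> ^ (2 s + 2)\<close>. Hence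
the real part of \<open>l\<close> is at least half of that of \<open>L 0\<close>. On \<open>w\<close> the matrix is coercive,
as \<open>w\<close> has almost no component of index zero. The two parts interact only through the
defect of \<open>r\<close>; its square is small compared with the product of the two damping rates.\<close>

lemma mode_energy_core:
  fixes L r y \<rho> z :: "nat \<Rightarrow> complex" and P :: "nat \<Rightarrow> nat \<Rightarrow> complex"
    and \<epsilon> \<tau> \<kappa> g K :: real and s m :: nat
  defines "C \<equiv> 2 * real m * (1 + 2 * K)"
    and "C' \<equiv> 2 * (1 + K + 2 * (2 * real m * (1 + 2 * K)))"
    and "D \<equiv> \<Sum>l<m. y l * r l"
    and "M \<equiv> \<lambda>z k. L k * z k + (\<Sum>l<m. P k l * z l)"
  defines "a \<equiv> \<lambda>z. (\<Sum>l<m. y l * z l) / D"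
  defines "w \<equiv> \<lambda>z k. z k - a z * r k"
  assumes m: "0 < m" and g: "0 < g" and K: "0 \<le> K" and \<tau>: "0 \<le> \<tau>" "\<tau> \<le> 2"
    and \<epsilon>: "0 \<le> \<epsilon>" "\<epsilon> \<le> 1" "2 * real m * \<epsilon> \<le> 1 / 2" "C * \<epsilon> \<le> \<kappa> / 2"
      "real m * (4 * g + 1) * \<epsilon> \<le> g / 2" "C' * \<epsilon> \<le> \<kappa>" "C' * \<epsilon> * (4 ^ s * real m) \<le> g"
    and P: "\<And>i k. i < m \<Longrightarrow> k < m \<Longrightarrow> norm (P i k) \<le> \<epsilon>"
    and y0: "y 0 = 1" and y: "\<And>k. 0 < k \<Longrightarrow> k < m \<Longrightarrow> norm (y k) \<le> \<epsilon> * \<tau>"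
    and left: "\<And>k. k < m \<Longrightarrow> y k * L k + (\<Sum>i<m. y i * P i k) = l * y k"
    and r0: "norm (r 0 - 1) \<le> \<epsilon>" and r: "\<And>k. 0 < k \<Longrightarrow> k < m \<Longrightarrow> norm (r k) \<le> \<epsilon>"
    and right: "\<And>k. k < m \<Longrightarrow> L k * r k + (\<Sum>i<m. P k i * r i) = \<nu> * r k + \<rho> k"
    and \<rho>0: "norm (\<rho> 0 - (L 0 - \<nu>)) \<le> \<epsilon> * \<tau> ^ (2 * s + 2)"
    and \<rho>: "\<And>k. 0 < k \<Longrightarrow> k < m \<Longrightarrow> norm (\<rho> k) \<le> \<epsilon> * \<tau> ^ (2 * s + 1)"
    and ReL0: "Re (L 0) = \<kappa> * \<tau> ^ (2 * s + 2)"
    and ReL: "\<And>k. 0 < k \<Longrightarrow> k < m \<Longrightarrow> g \<le> Re (L k)"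
    and L\<nu>: "norm (L 0 - \<nu>) \<le> K * \<tau> ^ (2 * s + 2)"
  shows "0 \<le> Re (cnj (a z) * a (M z)) + (\<Sum>k<m. Re (cnj (w z k) * w (M z) k))"
    and "\<bar>(\<Sum>k<m. (norm (z k))\<^sup>2) - ((norm (a z))\<^sup>2 + (\<Sum>k<m. (norm (w z k))\<^sup>2))\<bar>
      \<le> (16 * real m + 4) * (real m + 1) * \<epsilon> * ((norm (a z))\<^sup>2 + (\<Sum>k<m. (norm (w z k))\<^sup>2))"
proof -
  define \<beta> where "\<beta> = \<tau> ^ (2 * s + 2)"
  define \<sigma> where "\<sigma> = \<tau> ^ (2 * s + 1)"
  define I where "I = {1..<m}"
  note \<rho>0 = \<rho>0[folded \<beta>_def] and \<rho> = \<rho>[folded \<sigma>_def]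
    and ReL0 = ReL0[folded \<beta>_def] and L\<nu> = L\<nu>[folded \<beta>_def]
  have \<beta>0: "0 \<le> \<beta>" and \<sigma>0: "0 \<le> \<sigma>" using \<tau> by (simp_all add: \<beta>_def \<sigma>_def)
  have \<beta>\<sigma>: "\<beta> = \<tau> * \<sigma>" by (simp add: \<beta>_def \<sigma>_def)
  have \<beta>2: "\<beta> \<le> 2 * \<sigma>" using mult_right_mono[OF \<tau>(2) \<sigma>0] by (simp add: \<beta>\<sigma>)
  have m1: "1 \<le> real m" using m by simp
  have cI: "real (card I) \<le> real m - 1" using m by (simp add: I_def of_nat_diff)
  have split: "(\<Sum>k<m. f k) = f 0 + (\<Sum>k\<in>I. f k)" for f :: "nat \<Rightarrow> 'b::comm_monoid_add"
  proof -
    have "{..<m} = insert 0 I" using m by (auto simp: I_def)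
    then show ?thesis by (simp add: I_def)
  qed
  have C0: "0 \<le> C" using K by (simp add: C_def)
  have D1: "norm (D - 1) \<le> 2 * real m * \<epsilon>"
  proof -
    have "norm (\<Sum>k\<in>I. y k * r k) \<le> (real m - 1) * (2 * \<epsilon>)"
    proof (rule order_trans[OF norm_sum_mult_le[where A = 2 and B = \<epsilon> and m = "real m - 1"]])
      show "norm (y k) \<le> 2" if "k \<in> I" for k
        using y[of k] that mult_mono[OF \<epsilon>(2) \<tau>(2)] \<tau> by (auto simp: I_def)
    qed (use r \<epsilon> cI in \<open>auto simp: I_def\<close>)
    moreover have "D - 1 = (r 0 - 1) + (\<Sum>k\<in>I. y k * r k)"
      unfolding D_def by (simp add: split y0)
    then have "norm (D - 1) \<le> norm (r 0 - 1) + norm (\<Sum>k\<in>I. y k * r k)"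
      by (metis norm_triangle_ineq)
    ultimately have "norm (D - 1) \<le> \<epsilon> + (real m - 1) * (2 * \<epsilon>)"
      using r0 by linarith
    also have "\<dots> \<le> 2 * real m * \<epsilon>" using \<epsilon>(1) by (simp add: algebra_simps)
    finally show ?thesis .
  qed
  have Dhalf: "norm D \<ge> 1 / 2"
    using D1 \<epsilon>(3) norm_triangle_ineq2[of 1 "1 - D"] by (simp add: norm_minus_commute)
  then have D0: "D \<noteq> 0" by auto
  have yM: "(\<Sum>k<m. y k * M v k) = l * (\<Sum>k<m. y k * v k)" for v
  proof -
    have "(\<Sum>k<m. y k * M v k) = (\<Sum>k<m. y k * L k * v k) + (\<Sum>k<m. \<Sum>i<m. y k * P k i * v i)"
      by (simp add: M_def algebra_simps sum.distrib sum_distrib_left)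
    also have "(\<Sum>k<m. \<Sum>i<m. y k * P k i * v i) = (\<Sum>i<m. (\<Sum>k<m. y k * P k i) * v i)"
      by (subst sum.swap) (simp add: sum_distrib_right)
    also have "(\<Sum>k<m. y k * L k * v k) + (\<Sum>i<m. (\<Sum>k<m. y k * P k i) * v i)
        = (\<Sum>k<m. (y k * L k + (\<Sum>i<m. y i * P i k)) * v k)"
      by (simp add: algebra_simps sum.distrib)
    also have "\<dots> = (\<Sum>k<m. l * y k * v k)"
      by (intro sum.cong refl) (simp add: left)
    finally show ?thesis by (simp add: sum_distrib_left mult.assoc)
  qed
  have aM: "a (M v) = l * a v" for v
    by (simp add: a_def yM)
  have Mr: "M r k = \<nu> * r k + \<rho> k" if "k < m" for k
    using right[OF that] by (simp add: M_def)
  have l\<nu>: "(l - \<nu>) * D = (\<Sum>k<m. y k * \<rho> k)"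
  proof -
    have "l * D = (\<Sum>k<m. y k * M r k)"
      by (simp add: yM D_def)
    also have "\<dots> = (\<Sum>k<m. y k * (\<nu> * r k + \<rho> k))"
      by (intro sum.cong) (auto simp: Mr)
    also have "\<dots> = \<nu> * D + (\<Sum>k<m. y k * \<rho> k)"
      by (simp add: D_def algebra_simps sum.distrib sum_distrib_left)
    finally show ?thesis by (simp add: algebra_simps)
  qed
  have lL: "norm (l - L 0) \<le> C * \<epsilon> * \<beta>"
  proof -
    have "norm (\<Sum>k\<in>I. y k * \<rho> k) \<le> (real m - 1) * ((\<epsilon> * \<tau>) * (\<epsilon> * \<sigma>))"
      by (rule norm_sum_mult_le) (use y \<rho> \<epsilon> \<tau> \<sigma>0 cI in \<open>auto simp: I_def\<close>)
    also have "(\<epsilon> * \<tau>) * (\<epsilon> * \<sigma>) = \<epsilon> * (\<epsilon> * \<beta>)"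
      by (simp add: \<beta>\<sigma>)
    also have "(real m - 1) * (\<epsilon> * (\<epsilon> * \<beta>)) \<le> (real m - 1) * (1 * (\<epsilon> * \<beta>))"
      using m1 \<epsilon> \<beta>0 by (intro mult_left_mono mult_right_mono) auto
    finally have 1: "norm (\<Sum>k\<in>I. y k * \<rho> k) \<le> (real m - 1) * (\<epsilon> * \<beta>)" by simp
    have "(l - L 0) * D = (\<rho> 0 - (L 0 - \<nu>)) + (\<Sum>k\<in>I. y k * \<rho> k) - (L 0 - \<nu>) * (D - 1)"
      using l\<nu> by (simp add: split y0 algebra_simps)
    then have "norm ((l - L 0) * D) \<le> norm (\<rho> 0 - (L 0 - \<nu>)) + norm (\<Sum>k\<in>I. y k * \<rho> k) + norm ((L 0 - \<nu>) * (D - 1))"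
      by (metis norm_add_diff_le)
    also have "norm ((L 0 - \<nu>) * (D - 1)) \<le> (K * \<beta>) * (2 * real m * \<epsilon>)"
      unfolding norm_mult using L\<nu> D1 K \<beta>0 by (intro mult_mono) auto
    finally have "norm ((l - L 0) * D) \<le> real m * (\<epsilon> * \<beta>) + (K * \<beta>) * (2 * real m * \<epsilon>)"
      using 1 \<rho>0 by (simp add: algebra_simps)
    moreover have "norm (l - L 0) * (1 / 2) \<le> norm ((l - L 0) * D)"
      unfolding norm_mult using Dhalf by (intro mult_left_mono) auto
    ultimately show ?thesis
      by (simp add: C_def algebra_simps)
  qed
  have Rel: "\<kappa> / 2 * \<beta> \<le> Re l"
  proof -
    have "C * \<epsilon> * \<beta> \<le> \<kappa> / 2 * \<beta>"
      using \<epsilon>(4) \<beta>0 by (intro mult_right_mono) auto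
    then have "norm (l - L 0) \<le> \<kappa> / 2 * \<beta>" using lL by linarith
    then show ?thesis
      using abs_Re_le_cmod[of "l - L 0"] ReL0 by simp
  qed
  define \<xi> where "\<xi> k = \<rho> k - (l - \<nu>) * r k" for k
  have l\<nu>': "norm (l - \<nu>) \<le> (K + C) * \<beta>"
  proof -
    have "norm (l - \<nu>) \<le> norm (l - L 0) + norm (L 0 - \<nu>)"
      using norm_triangle_ineq[of "l - L 0" "L 0 - \<nu>"] by simp
    moreover have "C * \<epsilon> * \<beta> \<le> C * 1 * \<beta>"
      using \<epsilon> \<beta>0 C0 by (intro mult_right_mono mult_left_mono) auto
    ultimately show ?thesis using lL L\<nu> by (simp add: algebra_simps)
  qed
  have \<xi>: "norm (\<xi> k) \<le> C' * \<epsilon> * \<sigma>" if k: "k < m" for k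
  proof (cases "k = 0")
    case True
    have "\<xi> 0 = (\<rho> 0 - (L 0 - \<nu>)) - (l - L 0) - (l - \<nu>) * (r 0 - 1)"
      by (simp add: \<xi>_def algebra_simps)
    then have "norm (\<xi> 0) \<le> norm (\<rho> 0 - (L 0 - \<nu>)) + norm (l - L 0) + norm ((l - \<nu>) * (r 0 - 1))"
      by (metis norm_diff_diff_le)
    moreover have "norm ((l - \<nu>) * (r 0 - 1)) \<le> ((K + C) * \<beta>) * \<epsilon>"
      unfolding norm_mult using l\<nu>' r0 C0 K \<beta>0 by (intro mult_mono) auto
    ultimately have "norm (\<xi> 0) \<le> (1 + K + 2 * C) * \<epsilon> * \<beta>"
      using lL \<rho>0 by (simp add: algebra_simps)
    also have "\<dots> \<le> (1 + K + 2 * C) * \<epsilon> * (2 * \<sigma>)"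
      using \<beta>2 K C0 \<epsilon> by (intro mult_left_mono) auto
    finally show ?thesis using True by (simp add: C'_def C_def algebra_simps)
  next
    case False
    have "norm ((l - \<nu>) * r k) \<le> ((K + C) * \<beta>) * \<epsilon>"
      unfolding norm_mult using l\<nu>' r[of k] k False C0 K \<beta>0 by (intro mult_mono) auto
    also have "\<dots> \<le> ((K + C) * (2 * \<sigma>)) * \<epsilon>"
      using \<beta>2 K C0 \<epsilon> by (intro mult_right_mono mult_left_mono) auto
    finally have "norm (\<xi> k) \<le> \<epsilon> * \<sigma> + ((K + C) * (2 * \<sigma>)) * \<epsilon>"
      using \<rho>[of k] k False norm_triangle_ineq4[of "\<rho> k" "(l - \<nu>) * r k"] by (simp add: \<xi>_def)
    also have "\<dots> = (1 + 2 * K + 2 * C) * (\<epsilon> * \<sigma>)" by (simp add: algebra_simps)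
    also have "\<dots> \<le> C' * (\<epsilon> * \<sigma>)"
      using C0 K \<epsilon> \<sigma>0 by (intro mult_right_mono) (auto simp: C'_def C_def)
    finally show ?thesis by (simp add: mult.assoc)
  qed
  have wM: "w (M z) k = M (w z) k + a z * \<xi> k" if "k < m" for k
  proof -
    have "M (w z) k = M z k - a z * M r k"
      by (simp add: M_def w_def algebra_simps sum_subtractf sum_distrib_left)
    then show ?thesis
      by (simp add: w_def aM Mr[OF that] \<xi>_def algebra_simps)
  qed
  have yw: "(\<Sum>k<m. y k * w z k) = 0"
  proof -
    have "(\<Sum>k<m. y k * w z k) = (\<Sum>k<m. y k * z k) - a z * D"
      by (simp add: w_def D_def algebra_simps sum_subtractf sum_distrib_left)
    then show ?thesis using D0 by (simp add: a_def)
  qed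
  define N where "N = (\<Sum>k<m. (norm (w z k))\<^sup>2)"
  define S where "S = (\<Sum>k<m. norm (w z k))"
  have N0: "0 \<le> N" by (simp add: N_def sum_nonneg)
  have S0: "0 \<le> S" by (simp add: S_def sum_nonneg)
  have SN: "S\<^sup>2 \<le> real m * N"
    using sum_squared_le_sum_of_squares[of "\<lambda>k. norm (w z k)" "{..<m}"] by (simp add: S_def N_def mult.commute)
  have w0: "norm (w z 0) \<le> 2 * \<epsilon> * S"
  proof -
    have "w z 0 = - (\<Sum>k\<in>I. y k * w z k)"
      using yw by (simp add: split y0 add_eq_0_iff)
    then have "norm (w z 0) = norm (\<Sum>k\<in>I. y k * w z k)"
      by (simp only: norm_minus_cancel)
    also have "\<dots> \<le> (\<Sum>k\<in>I. norm (y k) * norm (w z k))"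
      by (rule sum_norm_le) (simp add: norm_mult)
    also have "\<dots> \<le> (\<Sum>k\<in>I. (2 * \<epsilon>) * norm (w z k))"
    proof (intro sum_mono mult_right_mono)
      fix k assume "k \<in> I"
      then show "norm (y k) \<le> 2 * \<epsilon>"
        using y[of k] mult_left_mono[OF \<tau>(2) \<epsilon>(1)] by (simp add: I_def mult.commute)
    qed auto
    also have "\<dots> \<le> 2 * \<epsilon> * S"
      unfolding S_def split sum_distrib_left[symmetric] using \<epsilon>(1) by (intro mult_left_mono) auto
    finally show ?thesis .
  qed
  have w0sq: "(norm (w z 0))\<^sup>2 \<le> 4 * \<epsilon> * (real m * N)"
  proof -
    have "(norm (w z 0))\<^sup>2 \<le> (2 * \<epsilon> * S)\<^sup>2" using w0 by (intro power_mono) auto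
    also have "\<dots> = 4 * \<epsilon> * (\<epsilon> * S\<^sup>2)" by (simp add: power2_eq_square)
    also have "\<dots> \<le> 4 * \<epsilon> * (1 * (real m * N))"
      using \<epsilon> SN by (intro mult_left_mono mult_mono) auto
    finally show ?thesis by simp
  qed
  have coer: "g / 2 * N \<le> (\<Sum>k<m. Re (cnj (w z k) * M (w z) k))"
  proof -
    have diag: "g * (norm (w z k))\<^sup>2 \<le> Re (cnj (w z k) * (L k * w z k))" if "k \<in> I" for k
      using ReL[of k] that unfolding Re_cnj_mult_scale by (simp add: I_def mult_right_mono)
    have diag0: "0 \<le> Re (cnj (w z 0) * (L 0 * w z 0))"
    proof -
      have "0 \<le> \<kappa>" using \<epsilon>(4) C0 \<epsilon>(1) by (smt (verit) mult_nonneg_nonneg field_sum_of_halves)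
      then show ?thesis using ReL0 \<beta>0 unfolding Re_cnj_mult_scale by simp
    qed
    have off: "- (norm (w z k) * (\<epsilon> * S)) \<le> Re (cnj (w z k) * (\<Sum>i<m. P k i * w z i))" if "k < m" for k
    proof -
      have "norm (\<Sum>i<m. P k i * w z i) \<le> (\<Sum>i<m. \<epsilon> * norm (w z i))"
        using P that by (intro sum_norm_le) (auto simp: norm_mult intro!: mult_right_mono)
      then have "norm (w z k) * norm (\<Sum>i<m. P k i * w z i) \<le> norm (w z k) * (\<epsilon> * S)"
        by (intro mult_left_mono) (auto simp: S_def sum_distrib_left)
      then show ?thesis using Re_cnj_mult_ge[of "w z k" "\<Sum>i<m. P k i * w z i"] by linarith
    qed
    have "g * (\<Sum>k\<in>I. (norm (w z k))\<^sup>2) \<le> (\<Sum>k<m. Re (cnj (w z k) * (L k * w z k)))"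
      unfolding split using diag0 sum_mono[OF diag] by (fastforce simp: sum_distrib_left)
    moreover have "(\<Sum>k\<in>I. (norm (w z k))\<^sup>2) = N - (norm (w z 0))\<^sup>2"
      by (simp add: N_def split)
    moreover have "- (\<epsilon> * S\<^sup>2) \<le> (\<Sum>k<m. Re (cnj (w z k) * (\<Sum>i<m. P k i * w z i)))"
    proof -
      have "- (\<epsilon> * S\<^sup>2) = (\<Sum>k<m. - (norm (w z k) * (\<epsilon> * S)))"
        unfolding sum_negf sum_distrib_right[symmetric] S_def[symmetric] by (simp add: power2_eq_square)
      also have "\<dots> \<le> (\<Sum>k<m. Re (cnj (w z k) * (\<Sum>i<m. P k i * w z i)))"
        by (intro sum_mono off) auto
      finally show ?thesis .
    qed
    moreover have "(\<Sum>k<m. Re (cnj (w z k) * M (w z) k))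
        = (\<Sum>k<m. Re (cnj (w z k) * (L k * w z k))) + (\<Sum>k<m. Re (cnj (w z k) * (\<Sum>i<m. P k i * w z i)))"
      unfolding M_def by (simp only: distrib_left plus_complex.sel sum.distrib)
    moreover have "\<epsilon> * S\<^sup>2 \<le> \<epsilon> * (real m * N)"
      using SN \<epsilon> by (intro mult_left_mono) auto
    moreover have "g * (norm (w z 0))\<^sup>2 \<le> g * (4 * \<epsilon> * (real m * N))"
      using w0sq g by (intro mult_left_mono) auto
    moreover have "(real m * (4 * g + 1) * \<epsilon>) * N \<le> (g / 2) * N"
      using \<epsilon>(5) N0 by (intro mult_right_mono) auto
    ultimately show ?thesis
      by (simp add: algebra_simps)
  qed
  have cross: "- (norm (a z) * (C' * \<epsilon> * \<sigma>) * S) \<le> (\<Sum>k<m. Re (cnj (w z k) * (a z * \<xi> k)))"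
  proof -
    have "- (norm (a z) * (C' * \<epsilon> * \<sigma>) * S) = (\<Sum>k<m. - (norm (w z k) * (norm (a z) * (C' * \<epsilon> * \<sigma>))))"
      unfolding sum_negf sum_distrib_right[symmetric] S_def[symmetric] by simp
    also have "\<dots> \<le> (\<Sum>k<m. Re (cnj (w z k) * (a z * \<xi> k)))"
    proof (intro sum_mono)
      fix k assume "k \<in> {..<m}"
      then have "norm (w z k) * norm (a z * \<xi> k) \<le> norm (w z k) * (norm (a z) * (C' * \<epsilon> * \<sigma>))"
        unfolding norm_mult using \<xi> by (intro mult_left_mono) auto
      then show "- (norm (w z k) * (norm (a z) * (C' * \<epsilon> * \<sigma>))) \<le> Re (cnj (w z k) * (a z * \<xi> k))"
        using Re_cnj_mult_ge[of "w z k" "a z * \<xi> k"] by linarith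
    qed
    finally show ?thesis .
  qed
  \<comment> \<open>The odd power of \<open>\<tau>\<close> splits evenly between the two damping rates.\<close>
  have amgm: "norm (a z) * \<sigma> * S \<le> (\<beta> * (norm (a z))\<^sup>2 + 4 ^ s * (real m * N)) / 2"
  proof -
    define p where "p = \<tau> ^ s"
    have p: "0 \<le> p" "p\<^sup>2 \<le> 4 ^ s"
    proof -
      show "0 \<le> p" using \<tau> by (simp add: p_def)
      have "p \<le> 2 ^ s" unfolding p_def using \<tau> by (intro power_mono)
      then have "p\<^sup>2 \<le> (2 ^ s)\<^sup>2" using \<open>0 \<le> p\<close> by (intro power_mono)
      then show "p\<^sup>2 \<le> 4 ^ s" by (simp add: power2_eq_square flip: power_mult_distrib)
    qed
    have \<sigma>p: "\<sigma> = p\<^sup>2 * \<tau>" and \<beta>p: "\<beta> = p\<^sup>2 * \<tau>\<^sup>2"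
      by (simp_all add: \<sigma>_def \<beta>_def p_def power_add power_mult power2_eq_square power_mult_distrib)
    have "2 * ((norm (a z) * p * \<tau>) * (p * S)) \<le> (norm (a z) * p * \<tau>)\<^sup>2 + (p * S)\<^sup>2"
      using sum_squares_bound[of "norm (a z) * p * \<tau>" "p * S"] by simp
    moreover have "(p * S)\<^sup>2 \<le> 4 ^ s * (real m * N)"
      unfolding power_mult_distrib using p SN by (intro mult_mono) auto
    ultimately show ?thesis
      by (simp add: \<sigma>p \<beta>p power_mult_distrib power2_eq_square mult_ac)
  qed
  show "0 \<le> Re (cnj (a z) * a (M z)) + (\<Sum>k<m. Re (cnj (w z k) * w (M z) k))"
  proof -
    have 1: "\<kappa> / 2 * \<beta> * (norm (a z))\<^sup>2 \<le> Re (cnj (a z) * a (M z))"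
      using Rel unfolding aM Re_cnj_mult_scale by (intro mult_right_mono) auto
    have 2: "(\<Sum>k<m. Re (cnj (w z k) * w (M z) k))
        = (\<Sum>k<m. Re (cnj (w z k) * M (w z) k)) + (\<Sum>k<m. Re (cnj (w z k) * (a z * \<xi> k)))"
      unfolding sum.distrib[symmetric]
      by (intro sum.cong refl) (simp only: wM lessThan_iff distrib_left plus_complex.sel)
    have C'0: "0 \<le> C' * \<epsilon>" using K \<epsilon> by (simp add: C'_def)
    have "norm (a z) * (C' * \<epsilon> * \<sigma>) * S = (C' * \<epsilon>) * (norm (a z) * \<sigma> * S)" by simp
    also have "\<dots> \<le> (C' * \<epsilon>) * ((\<beta> * (norm (a z))\<^sup>2 + 4 ^ s * (real m * N)) / 2)"
      using amgm C'0 by (rule mult_left_mono)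
    also have "\<dots> = (C' * \<epsilon>) * (\<beta> * (norm (a z))\<^sup>2) / 2 + (C' * \<epsilon> * (4 ^ s * real m)) * N / 2"
      by (simp add: algebra_simps)
    also have "\<dots> \<le> \<kappa> * (\<beta> * (norm (a z))\<^sup>2) / 2 + g * N / 2"
      using \<epsilon>(6,7) \<beta>0 N0 by (intro add_mono divide_right_mono mult_right_mono) auto
    finally show ?thesis
      using 1 2 coer cross by (simp add: algebra_simps)
  qed
  show "\<bar>(\<Sum>k<m. (norm (z k))\<^sup>2) - ((norm (a z))\<^sup>2 + (\<Sum>k<m. (norm (w z k))\<^sup>2))\<bar>
      \<le> (16 * real m + 4) * (real m + 1) * \<epsilon> * ((norm (a z))\<^sup>2 + (\<Sum>k<m. (norm (w z k))\<^sup>2))"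
  proof -
    define T where "T = norm (a z) + S"
    have T0: "0 \<le> T" using S0 by (simp add: T_def)
    have wS: "norm (w z k) \<le> S" if "k < m" for k
      unfolding S_def using that by (intro member_le_sum) auto
    have T2: "T\<^sup>2 \<le> (real m + 1) * ((norm (a z))\<^sup>2 + N)"
    proof -
      have "T\<^sup>2 = (\<Sum>k<Suc m. if k = m then norm (a z) else norm (w z k))\<^sup>2"
        by (simp add: T_def S_def add.commute)
      also have "\<dots> \<le> (\<Sum>k<Suc m. (if k = m then norm (a z) else norm (w z k))\<^sup>2) * real (card {..<Suc m})"
        by (rule sum_squared_le_sum_of_squares)
      also have "(\<Sum>k<Suc m. (if k = m then norm (a z) else norm (w z k))\<^sup>2) = (norm (a z))\<^sup>2 + N"
        by (simp add: N_def)
      finally show ?thesis by (simp add: algebra_simps)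
    qed
    have 0: "\<bar>(norm (z 0))\<^sup>2 - (norm (a z))\<^sup>2\<bar> \<le> 5 * (3 * \<epsilon>) * T\<^sup>2"
    proof (rule norm_square_diff_le)
      have "z 0 - a z = a z * (r 0 - 1) + w z 0" by (simp add: w_def algebra_simps)
      then have "norm (z 0 - a z) \<le> norm (a z) * norm (r 0 - 1) + norm (w z 0)"
        by (metis norm_mult norm_triangle_ineq)
      moreover have "norm (a z) * norm (r 0 - 1) \<le> norm (a z) * \<epsilon>"
        using r0 by (intro mult_left_mono) auto
      moreover have "norm (a z) * \<epsilon> + 2 * \<epsilon> * S \<le> 3 * \<epsilon> * T"
        using \<epsilon>(1) S0 by (simp add: T_def algebra_simps)
      ultimately show "norm (z 0 - a z) \<le> 3 * \<epsilon> * T" using w0 by linarith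
    qed (use \<epsilon> S0 in \<open>auto simp: T_def\<close>)
    have k: "\<bar>(norm (z k))\<^sup>2 - (norm (w z k))\<^sup>2\<bar> \<le> 5 * (3 * \<epsilon>) * T\<^sup>2" if "k \<in> I" for k
    proof (rule norm_square_diff_le)
      have "norm (z k - w z k) = norm (a z) * norm (r k)" by (simp add: w_def norm_mult)
      also have "\<dots> \<le> T * \<epsilon>"
        using r[of k] that S0 T0 by (intro mult_mono) (auto simp: I_def T_def)
      also have "\<dots> \<le> 3 * \<epsilon> * T" using T0 \<epsilon>(1) by simp
      finally show "norm (z k - w z k) \<le> 3 * \<epsilon> * T" .
      show "norm (w z k) \<le> T" using wS[of k] that by (simp add: T_def I_def add_increasing)
    qed (use \<epsilon> in auto)
    have "\<bar>\<Sum>k\<in>I. (norm (z k))\<^sup>2 - (norm (w z k))\<^sup>2\<bar> \<le> (\<Sum>k\<in>I. 5 * (3 * \<epsilon>) * T\<^sup>2)"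
      by (rule order_trans[OF sum_abs sum_mono[OF k]])
    also have "\<dots> = real (card I) * (5 * (3 * \<epsilon>) * T\<^sup>2)" by simp
    also have "\<dots> \<le> (real m - 1) * (5 * (3 * \<epsilon>) * T\<^sup>2)"
      using cI \<epsilon>(1) by (intro mult_right_mono) auto
    finally have 1: "\<bar>\<Sum>k\<in>I. (norm (z k))\<^sup>2 - (norm (w z k))\<^sup>2\<bar> \<le> (real m - 1) * (5 * (3 * \<epsilon>) * T\<^sup>2)" .
    have 2: "(norm (w z 0))\<^sup>2 \<le> 4 * \<epsilon> * T\<^sup>2"
    proof -
      have "(norm (w z 0))\<^sup>2 \<le> (2 * \<epsilon> * S)\<^sup>2" using w0 by (intro power_mono) auto
      also have "\<dots> = 4 * \<epsilon> * (\<epsilon> * S\<^sup>2)" by (simp add: power2_eq_square)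
      also have "\<dots> \<le> 4 * \<epsilon> * (1 * T\<^sup>2)"
        using \<epsilon> S0 by (intro mult_left_mono mult_mono power_mono) (auto simp: T_def)
      finally show ?thesis by simp
    qed
    have "(\<Sum>k<m. (norm (z k))\<^sup>2) - ((norm (a z))\<^sup>2 + (\<Sum>k<m. (norm (w z k))\<^sup>2))
        = ((norm (z 0))\<^sup>2 - (norm (a z))\<^sup>2) + (\<Sum>k\<in>I. (norm (z k))\<^sup>2 - (norm (w z k))\<^sup>2) - (norm (w z 0))\<^sup>2"
      unfolding split by (simp add: sum_subtractf)
    then have "\<bar>(\<Sum>k<m. (norm (z k))\<^sup>2) - ((norm (a z))\<^sup>2 + (\<Sum>k<m. (norm (w z k))\<^sup>2))\<bar>
        \<le> 5 * (3 * \<epsilon>) * T\<^sup>2 + (real m - 1) * (5 * (3 * \<epsilon>) * T\<^sup>2) + 4 * \<epsilon> * T\<^sup>2"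
      using 0 1 2 zero_le_power2[of "norm (w z 0)"] unfolding abs_le_iff by linarith
    also have "\<dots> = (15 * real m + 4) * \<epsilon> * T\<^sup>2" by (simp add: algebra_simps)
    also have "\<dots> \<le> (16 * real m + 4) * \<epsilon> * ((real m + 1) * ((norm (a z))\<^sup>2 + N))"
      using T2 \<epsilon>(1) by (intro mult_mono) auto
    finally show ?thesis by (simp add: N_def mult_ac)
  qed
qed

text \<open>The quadratic form with matrix \<open>T\<close> (of \<open>m + 1\<close> rows: one for the amplitude and \<open>m\<close> for the complementary part)
is close to the Euclidean norm at \<open>z\<close> and does not increase along \<open>z' = - B z\<close>.\<close>

definition mode_form ::
  "nat \<Rightarrow> real \<Rightarrow> (nat \<Rightarrow> nat \<Rightarrow> complex) \<Rightarrow> (nat \<Rightarrow> nat \<Rightarrow> complex) \<Rightarrow> (nat \<Rightarrow> complex) \<Rightarrow> bool" where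
  "mode_form m \<delta> B T z \<longleftrightarrow>
    \<bar>(\<Sum>k<m. (norm (z k))\<^sup>2) - (\<Sum>k\<le>m. (norm (\<Sum>l<m. T k l * z l))\<^sup>2)\<bar>
      \<le> \<delta> * (\<Sum>k\<le>m. (norm (\<Sum>l<m. T k l * z l))\<^sup>2) \<and>
    0 \<le> (\<Sum>k\<le>m. Re (cnj (\<Sum>l<m. T k l * z l) * (\<Sum>l<m. T k l * (\<Sum>i<m. B l i * z i))))"

lemma sum_delta_mult:
  fixes z :: "nat \<Rightarrow> complex"
  assumes "k < m"
  shows "(\<Sum>l<m. (if k = l then c else 0) * z l) = c * z k"
  using assms by (simp add: if_distrib[of "\<lambda>a. a * _"] cong: if_cong)

text \<open>Collects the smallness conditions of \<open>mode_energy_core\<close> into a single threshold.\<close>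

lemma near_mode_energy:
  fixes \<kappa> g K \<delta> :: real and s m :: nat
  assumes m: "0 < m" and \<kappa>: "0 < \<kappa>" and g: "0 < g" and K: "0 \<le> K" and \<delta>: "0 < \<delta>"
  obtains \<epsilon> where "0 < \<epsilon>"
    "\<And>L r \<rho> P \<tau> \<nu>. \<lbrakk>0 \<le> \<tau>; \<tau> \<le> 2;
      \<And>i k. i < m \<Longrightarrow> k < m \<Longrightarrow> norm (P i k) \<le> \<epsilon>;
      \<And>k. 0 < k \<Longrightarrow> k < m \<Longrightarrow> norm (P 0 k) \<le> \<epsilon> * \<tau>;
      norm (r 0 - 1) \<le> \<epsilon>; \<And>k. 0 < k \<Longrightarrow> k < m \<Longrightarrow> norm (r k) \<le> \<epsilon>;
      \<And>k. k < m \<Longrightarrow> L k * r k + (\<Sum>i<m. P k i * r i) = \<nu> * r k + \<rho> k;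
      norm (\<rho> 0 - (L 0 - \<nu>)) \<le> \<epsilon> * \<tau> ^ (2 * s + 2);
      \<And>k. 0 < k \<Longrightarrow> k < m \<Longrightarrow> norm (\<rho> k) \<le> \<epsilon> * \<tau> ^ (2 * s + 1);
      Re (L 0) = \<kappa> * \<tau> ^ (2 * s + 2);
      \<And>k. 0 < k \<Longrightarrow> k < m \<Longrightarrow> g + Re (L 0) \<le> Re (L k);
      norm (L 0 - \<nu>) \<le> K * \<tau> ^ (2 * s + 2)\<rbrakk>
      \<Longrightarrow> \<exists>T. \<forall>z. mode_form m \<delta> (\<lambda>k l. (if k = l then L k else 0) + P k l) T z"
proof -
  define C where "C = 2 * real m * (1 + 2 * K)"
  define C' where "C' = 2 * (1 + K + 2 * C)"
  define C5 where "C5 = (16 * real m + 4) * (real m + 1)"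
  have pos: "0 < C" "0 < C'" "0 < C5" using m K by (simp_all add: C_def C'_def C5_def add_pos_nonneg)
  define S where "S = {1, 1 / (4 * real m), \<kappa> / (2 * C), g / (2 * (real m * (4 * g + 1))), \<kappa> / C', g / (C' * (4 ^ s * real m)), \<delta> / C5, g / (4 * real m)}"
  define e where "e = Min S"
  have eS: "e \<le> x" if "x \<in> S" for x using that unfolding e_def by (intro Min_le) (auto simp: S_def)
  have e0: "0 < e"
    unfolding e_def using m g \<kappa> \<delta> pos by (subst Min_gr_iff) (auto simp: S_def intro!: divide_pos_pos mult_pos_pos add_pos_pos)
  have e: "e \<le> 1" "2 * real m * e \<le> 1 / 2" "C * e \<le> \<kappa> / 2" "real m * (4 * g + 1) * e \<le> g / 2"
    "C' * e \<le> \<kappa>" "C' * e * (4 ^ s * real m) \<le> g" "C5 * e \<le> \<delta>" "4 * real m * e \<le> g"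
  proof -
    have gm: "0 < real m * (4 * g + 1)" using m g by (simp add: add_pos_pos)
    show "e \<le> 1" by (rule eS) (simp add: S_def)
    have "e \<le> 1 / (4 * real m)" by (rule eS) (simp add: S_def)
    then show "2 * real m * e \<le> 1 / 2" using m by (simp add: field_simps)
    have "e \<le> \<kappa> / (2 * C)" by (rule eS) (simp add: S_def)
    then show "C * e \<le> \<kappa> / 2" using pos by (simp add: field_simps)
    have "e \<le> g / (2 * (real m * (4 * g + 1)))" by (rule eS) (simp add: S_def)
    moreover have "0 < 2 * (real m * (4 * g + 1))" using gm by simp
    ultimately have "e * (2 * (real m * (4 * g + 1))) \<le> g" by (rule pos_le_divide_eq[THEN iffD1, rotated])
    then show "real m * (4 * g + 1) * e \<le> g / 2" by (simp add: algebra_simps)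
    have "e \<le> \<kappa> / C'" by (rule eS) (simp add: S_def)
    then show "C' * e \<le> \<kappa>" using pos by (simp add: field_simps)
    have "e \<le> g / (C' * (4 ^ s * real m))" by (rule eS) (simp add: S_def)
    moreover have "0 < C' * (4 ^ s * real m)" using pos m by simp
    ultimately have "e * (C' * (4 ^ s * real m)) \<le> g" by (rule pos_le_divide_eq[THEN iffD1, rotated])
    then show "C' * e * (4 ^ s * real m) \<le> g" by (simp add: algebra_simps)
    have "e \<le> \<delta> / C5" by (rule eS) (simp add: S_def)
    then show "C5 * e \<le> \<delta>" using pos by (simp add: field_simps)
    have "e \<le> g / (4 * real m)" by (rule eS) (simp add: S_def)
    then show "4 * real m * e \<le> g" using m by (simp add: field_simps)
  qed
  define \<epsilon> where "\<epsilon> = e * min 1 (g / 2)"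
  have \<epsilon>0: "0 < \<epsilon>" using e0 g by (simp add: \<epsilon>_def)
  have \<epsilon>e: "\<epsilon> \<le> e" and \<epsilon>g: "2 * \<epsilon> / g \<le> e"
  proof -
    show "\<epsilon> \<le> e" using e0 mult_left_mono[of "min 1 (g / 2)" 1 e] by (simp add: \<epsilon>_def)
    have "\<epsilon> \<le> e * (g / 2)" unfolding \<epsilon>_def using e0 by (intro mult_left_mono) auto
    then show "2 * \<epsilon> / g \<le> e" using g by (simp add: field_simps)
  qed
  show ?thesis
  proof (rule that[OF \<epsilon>0])
    fix L r \<rho> :: "nat \<Rightarrow> complex" and P :: "nat \<Rightarrow> nat \<Rightarrow> complex" and \<tau> :: real and \<nu> :: complex
    assume \<tau>: "0 \<le> \<tau>" "\<tau> \<le> 2"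
      and P: "\<And>i k. i < m \<Longrightarrow> k < m \<Longrightarrow> norm (P i k) \<le> \<epsilon>"
      and P0: "\<And>k. 0 < k \<Longrightarrow> k < m \<Longrightarrow> norm (P 0 k) \<le> \<epsilon> * \<tau>"
      and r0: "norm (r 0 - 1) \<le> \<epsilon>" and r: "\<And>k. 0 < k \<Longrightarrow> k < m \<Longrightarrow> norm (r k) \<le> \<epsilon>"
      and right: "\<And>k. k < m \<Longrightarrow> L k * r k + (\<Sum>i<m. P k i * r i) = \<nu> * r k + \<rho> k"
      and \<rho>0: "norm (\<rho> 0 - (L 0 - \<nu>)) \<le> \<epsilon> * \<tau> ^ (2 * s + 2)"
      and \<rho>: "\<And>k. 0 < k \<Longrightarrow> k < m \<Longrightarrow> norm (\<rho> k) \<le> \<epsilon> * \<tau> ^ (2 * s + 1)"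
      and ReL0: "Re (L 0) = \<kappa> * \<tau> ^ (2 * s + 2)"
      and ReL: "\<And>k. 0 < k \<Longrightarrow> k < m \<Longrightarrow> g + Re (L 0) \<le> Re (L k)"
      and L\<nu>: "norm (L 0 - \<nu>) \<le> K * \<tau> ^ (2 * s + 2)"
    have up: "\<epsilon> * c \<le> e * c" if "0 \<le> c" for c using \<epsilon>e that by (rule mult_right_mono)
    have ReL0': "0 \<le> Re (L 0)" using ReL0 \<kappa> \<tau> by simp
    have m\<epsilon>: "4 * real m * \<epsilon> \<le> g"
      using mult_left_mono[OF \<epsilon>e, of "4 * real m"] e(8) by simp
    have gap: "g \<le> norm (L k - L 0)" if "0 < k" "k < m" for k
      using ReL[OF that] complex_Re_le_cmod[of "L k - L 0"] by simp
    obtain y l where y: "y 0 = 1" "\<And>k. 0 < k \<Longrightarrow> k < m \<Longrightarrow> norm (y k) \<le> 2 * \<epsilon> * \<tau> / g"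
      "\<And>k. k < m \<Longrightarrow> y k * L k + (\<Sum>i<m. y i * P i k) = l * y k"
      by (rule left_eigenvector[of m g \<tau> \<epsilon> P L]) (use m g \<tau> \<epsilon>0 m\<epsilon> P P0 gap in auto)
    have ye: "norm (y k) \<le> e * \<tau>" if "0 < k" "k < m" for k
      using y(2)[OF that] mult_right_mono[OF \<epsilon>g \<tau>(1)] by simp
    define D where "D = (\<Sum>l<m. y l * r l)"
    define M where "M z k = L k * z k + (\<Sum>l<m. P k l * z l)" for z k
    define a where "a z = (\<Sum>l<m. y l * z l) / D" for z
    define w where "w z k = z k - a z * r k" for z k
    define T where "T k l = (if k = m then y l / D else (if k = l then 1 else 0) - r k * y l / D)" for k l
    note core = mode_energy_core[of m g K \<tau> e \<kappa> s P y L l r \<nu> \<rho>,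
        folded C_def, folded C'_def, folded D_def, folded M_def, folded a_def, folded w_def, folded C5_def]
    have small: "4 * real m * e \<le> g" "2 * real m * e \<le> 1/2" using e by auto
    have hyps: "norm (r 0 - 1) \<le> e" "\<And>k. 0 < k \<Longrightarrow> k < m \<Longrightarrow> norm (r k) \<le> e"
      "\<And>i k. i < m \<Longrightarrow> k < m \<Longrightarrow> norm (P i k) \<le> e"
      "norm (\<rho> 0 - (L 0 - \<nu>)) \<le> e * \<tau> ^ (2 * s + 2)"
      "\<And>k. 0 < k \<Longrightarrow> k < m \<Longrightarrow> norm (\<rho> k) \<le> e * \<tau> ^ (2 * s + 1)"
      "\<And>k. 0 < k \<Longrightarrow> k < m \<Longrightarrow> g \<le> Re (L k)"
    proof -
      show "norm (r 0 - 1) \<le> e" using r0 \<epsilon>e by linarith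
      show "norm (r k) \<le> e" if "0 < k" "k < m" for k using r[OF that] \<epsilon>e by linarith
      show "norm (P i k) \<le> e" if "i < m" "k < m" for i k using P[OF that] \<epsilon>e by linarith
      show "norm (\<rho> 0 - (L 0 - \<nu>)) \<le> e * \<tau> ^ (2 * s + 2)"
        using \<rho>0 up[OF zero_le_power[OF \<tau>(1)]] by (rule order_trans)
      show "norm (\<rho> k) \<le> e * \<tau> ^ (2 * s + 1)" if "0 < k" "k < m" for k
        using \<rho>[OF that] up[OF zero_le_power[OF \<tau>(1)]] by (rule order_trans)
      show "g \<le> Re (L k)" if "0 < k" "k < m" for k using ReL[OF that] ReL0' by linarith
    qed
    have Tm: "(\<Sum>l<m. T m l * z l) = a z" for z
      by (simp add: T_def a_def sum_divide_distrib)
    have Tk: "(\<Sum>l<m. T k l * z l) = w z k" if "k < m" for k z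
    proof -
      have "(\<Sum>l<m. T k l * z l) = (\<Sum>l<m. (if k = l then 1 else 0) * z l) - (\<Sum>l<m. r k * y l / D * z l)"
        using that unfolding sum_subtractf[symmetric] by (intro sum.cong) (auto simp: T_def algebra_simps)
      moreover have "(\<Sum>l<m. r k * y l / D * z l) = a z * r k"
        by (simp add: a_def sum_divide_distrib sum_distrib_right sum_distrib_left mult_ac)
      ultimately show ?thesis
        unfolding sum_delta_mult[OF that] by (simp add: w_def)
    qed
    have B: "(\<Sum>i<m. ((if l = i then L l else 0) + P l i) * z i) = M z l" if "l < m" for l z
      unfolding distrib_right sum.distrib sum_delta_mult[OF that] by (simp add: M_def)
    show "\<exists>T. \<forall>z. mode_form m \<delta> (\<lambda>k l. (if k = l then L k else 0) + P k l) T z"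
    proof (rule exI[of _ T], rule allI)
      fix z :: "nat \<Rightarrow> complex"
      define E where "E = (norm (a z))\<^sup>2 + (\<Sum>k<m. (norm (w z k))\<^sup>2)"
      have 1: "(\<Sum>k\<le>m. (norm (\<Sum>l<m. T k l * z l))\<^sup>2) = E"
        unfolding E_def by (simp add: Tm Tk lessThan_Suc_atMost[symmetric])
      have 2: "(\<Sum>k\<le>m. Re (cnj (\<Sum>l<m. T k l * z l) * (\<Sum>l<m. T k l * (\<Sum>i<m. ((if l = i then L l else 0) + P l i) * z i))))
          = Re (cnj (a z) * a (M z)) + (\<Sum>k<m. Re (cnj (w z k) * w (M z) k))"
      proof -
        have "(\<Sum>l<m. T k l * (\<Sum>i<m. ((if l = i then L l else 0) + P l i) * z i)) = (\<Sum>l<m. T k l * M z l)" for k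
          by (intro sum.cong refl) (simp only: B lessThan_iff)
        then show ?thesis
          by (simp only: lessThan_Suc_atMost[symmetric] sum.lessThan_Suc Tm) (simp add: Tk)
      qed
      have E0: "0 \<le> E" unfolding E_def by (intro add_nonneg_nonneg sum_nonneg) auto
      have 3: "\<bar>(\<Sum>k<m. (norm (z k))\<^sup>2) - E\<bar> \<le> C5 * e * E"
        unfolding E_def
        by (rule core(2)[OF m g K \<tau> less_imp_le[OF e0] e(1-6) hyps(3) y(1) ye y(3) hyps(1,2) right[folded M_def] hyps(4,5) ReL0 hyps(6) L\<nu>])
      have 4: "0 \<le> Re (cnj (a z) * a (M z)) + (\<Sum>k<m. Re (cnj (w z k) * w (M z) k))"
        by (rule core(1)[OF m g K \<tau> less_imp_le[OF e0] e(1-6) hyps(3) y(1) ye y(3) hyps(1,2) right[folded M_def] hyps(4,5) ReL0 hyps(6) L\<nu>])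
      show "mode_form m \<delta> (\<lambda>k l. (if k = l then L k else 0) + P k l) T z"
        unfolding mode_form_def 1 2
        using 3 4 mult_right_mono[OF e(7) E0] by auto
    qed
  qed
qed

text \<open>If all components that are present are damped, then the Euclidean norm itself decreases.\<close>

lemma far_mode_energy:
  fixes L z :: "nat \<Rightarrow> complex"
  assumes g: "0 < g" and \<delta>: "0 \<le> \<delta>"
    and P: "\<And>i k. i < m \<Longrightarrow> k < m \<Longrightarrow> norm (P i k) \<le> \<epsilon>" and \<epsilon>: "real m * \<epsilon> \<le> g"
    and L: "\<And>k. k < m \<Longrightarrow> z k = 0 \<or> g \<le> Re (L k)"
  shows "mode_form m \<delta> (\<lambda>k l. (if k = l then L k else 0) + P k l) (\<lambda>k l. if k = l then 1 else 0) z"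
proof -
  define S where "S = (\<Sum>k<m. norm (z k))"
  define N where "N = (\<Sum>k<m. (norm (z k))\<^sup>2)"
  have N0: "0 \<le> N" by (simp add: N_def sum_nonneg)
  have T: "(\<Sum>l<m. (if k = l then 1 else 0) * v l) = v k" if "k < m" for k and v :: "nat \<Rightarrow> complex"
    using sum_delta_mult[OF that, of 1 v] by simp
  have Tm: "(\<Sum>l<m. (if m = l then 1 else 0) * v l) = 0" for v :: "nat \<Rightarrow> complex"
    by (intro sum.neutral) auto
  have B: "(\<Sum>i<m. ((if l = i then L l else 0) + P l i) * z i) = L l * z l + (\<Sum>i<m. P l i * z i)" if "l < m" for l
    unfolding distrib_right sum.distrib sum_delta_mult[OF that] by simp
  have diag: "g * (norm (z k))\<^sup>2 \<le> Re (cnj (z k) * (L k * z k))" if "k < m" for k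
    using L[OF that] unfolding Re_cnj_mult_scale by (auto intro: mult_right_mono)
  have off: "- (norm (z k) * (\<epsilon> * S)) \<le> Re (cnj (z k) * (\<Sum>i<m. P k i * z i))" if "k < m" for k
  proof -
    have "norm (\<Sum>i<m. P k i * z i) \<le> (\<Sum>i<m. \<epsilon> * norm (z i))"
      using P that by (intro sum_norm_le) (auto simp: norm_mult intro!: mult_right_mono)
    then have "norm (z k) * norm (\<Sum>i<m. P k i * z i) \<le> norm (z k) * (\<epsilon> * S)"
      by (intro mult_left_mono) (auto simp: S_def sum_distrib_left)
    then show ?thesis using Re_cnj_mult_ge[of "z k" "\<Sum>i<m. P k i * z i"] by linarith
  qed
  have "0 \<le> (\<Sum>k<m. Re (cnj (z k) * (L k * z k + (\<Sum>i<m. P k i * z i))))"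
  proof (cases "m = 0")
    case False
    then have \<epsilon>0: "0 \<le> \<epsilon>" using P[of 0 0] norm_ge_zero order_trans by blast
    have "\<epsilon> * S\<^sup>2 \<le> \<epsilon> * (real m * N)"
      using sum_squared_le_sum_of_squares[of "\<lambda>k. norm (z k)" "{..<m}"] \<epsilon>0
      by (intro mult_left_mono) (auto simp: S_def N_def mult.commute)
    also have "\<dots> \<le> g * N" using mult_right_mono[OF \<epsilon> N0] by (simp add: mult_ac)
    finally have "0 \<le> g * N + - (\<epsilon> * S\<^sup>2)" by simp
    also have "- (\<epsilon> * S\<^sup>2) = (\<Sum>k<m. - (norm (z k) * (\<epsilon> * S)))"
      unfolding sum_negf sum_distrib_right[symmetric] S_def[symmetric] by (simp add: power2_eq_square)
    also have "g * N + (\<Sum>k<m. - (norm (z k) * (\<epsilon> * S)))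
        = (\<Sum>k<m. g * (norm (z k))\<^sup>2 + - (norm (z k) * (\<epsilon> * S)))"
      by (simp only: N_def sum.distrib sum_distrib_left)
    also have "\<dots> \<le> (\<Sum>k<m. Re (cnj (z k) * (L k * z k + (\<Sum>i<m. P k i * z i))))"
      unfolding distrib_left plus_complex.sel by (intro sum_mono add_mono diag off) auto
    finally show ?thesis .
  qed simp
  moreover have "(\<Sum>k\<le>m. Re (cnj (\<Sum>l<m. (if k = l then 1 else 0) * z l) *
      (\<Sum>l<m. (if k = l then 1 else 0) * (\<Sum>i<m. ((if l = i then L l else 0) + P l i) * z i))))
    = (\<Sum>k<m. Re (cnj (z k) * (L k * z k + (\<Sum>i<m. P k i * z i))))"
    unfolding lessThan_Suc_atMost[symmetric] sum.lessThan_Suc Tm by (simp add: T B)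
  moreover have "(\<Sum>k\<le>m. (norm (\<Sum>l<m. (if k = l then 1 else 0) * z l))\<^sup>2) = N"
    unfolding lessThan_Suc_atMost[symmetric] sum.lessThan_Suc Tm by (simp add: T N_def)
  ultimately show ?thesis
    using \<delta> N0 by (simp only: mode_form_def N_def[symmetric]) simp
qed

section \<open>Bloch waves and the discrete Fourier transform\<close>

text \<open>Bloch waves: sequences that are multiplied by a constant under a shift by the period \<open>m\<close> are
combinations of \<open>m\<close> such waves.\<close>

definition wave :: "real \<Rightarrow> int \<Rightarrow> complex" where
  "wave \<theta> j = cis (\<theta> * real_of_int j)"

text \<open>The scheme is \<open>z' = - fv_op z\<close> for the cell integrals \<open>z\<close>.\<close>

definition fv_op :: "nat \<Rightarrow> (int \<Rightarrow> real) \<Rightarrow> (int \<Rightarrow> 'a::real_vector) \<Rightarrow> int \<Rightarrow> 'a" where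
  "fv_op s x z j = flux s x z (j + 1) - flux s x z j"

lemma norm_wave [simp]: "norm (wave \<theta> j) = 1"
  by (simp add: wave_def)

lemma wave_add: "wave \<theta> (i + j) = wave \<theta> i * wave \<theta> j"
  by (simp add: wave_def cis_mult distrib_left)

lemma wave_1: "wave \<theta> 1 = cis \<theta>"
  by (simp add: wave_def)

lemma cnj_wave_mult: "cnj (wave \<theta> j) * wave \<phi> j = cis ((\<phi> - \<theta>) * real_of_int j)"
  by (simp add: wave_def cis_cnj cis_mult algebra_simps)

lemma cis_cancel: "cnj (cis a) * v * (cis a * u) = v * u" "cis a * (v * cnj (cis a) * u) = v * u"
proof -
  have "cnj (cis a) * cis a = 1" by (simp add: cis_cnj cis_mult)
  moreover have "cnj (cis a) * v * (cis a * u) = (cnj (cis a) * cis a) * (v * u)"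
    and "cis a * (v * cnj (cis a) * u) = (cnj (cis a) * cis a) * (v * u)"
    by (simp_all only: mult_ac)
  ultimately show "cnj (cis a) * v * (cis a * u) = v * u" "cis a * (v * cnj (cis a) * u) = v * u"
    by simp_all
qed

lemma cis_2pi_int [simp]: "cis (2 * pi * real_of_int k) = 1"
  using cis_multiple_2pi[of "real_of_int k"] by simp

lemma cis_eq_1_imp:
  assumes "cis x = 1" obtains k :: int where "x = 2 * pi * real_of_int k"
proof -
  have "cos x = 1" using assms by (metis cis.simps(1) one_complex.simps(1))
  then show ?thesis using that by (auto simp: cos_one_2pi_int mult_ac)
qed

lemma root_of_unity_sum:
  assumes "N > 0"
  shows "(\<Sum>q\<in>{b..<b + int N}. cis (2 * pi * real_of_int (q * d) / real N))
    = (if int N dvd d then of_nat N else 0)"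
proof (cases "int N dvd d")
  case True
  then obtain e where e: "d = int N * e" by (auto elim: dvdE)
  have "cis (2 * pi * real_of_int (q * d) / real N) = 1" for q
  proof -
    have "2 * pi * real_of_int (q * d) / real N = 2 * pi * real_of_int (q * e)"
      using assms by (simp add: e)
    then show ?thesis by (simp only: cis_2pi_int)
  qed
  then show ?thesis using True by simp
next
  case False
  define \<omega> where "\<omega> = cis (2 * pi * real_of_int d / real N)"
  define f where "f q = cis (2 * pi * real_of_int (q * d) / real N)" for q :: int
  have \<omega>: "\<omega> \<noteq> 1"
  proof
    assume "\<omega> = 1"
    then obtain k :: int where "2 * pi * real_of_int d / real N = 2 * pi * real_of_int k"
      unfolding \<omega>_def by (rule cis_eq_1_imp)
    then have "real_of_int d = real_of_int (k * int N)"
      using assms by (simp add: field_simps)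
    then have "d = k * int N" by linarith
    then show False using False by simp
  qed
  have step: "f (q + 1) = \<omega> * f q" for q
    unfolding f_def \<omega>_def cis_mult by (rule arg_cong[of _ _ cis]) (simp add: algebra_simps add_divide_distrib)
  have "f (b + int N) = f b * cis (2 * pi * real_of_int d)"
    unfolding f_def cis_mult using assms by (intro arg_cong[of _ _ cis]) (simp add: field_simps)
  then have per: "f (b + int N) = f b" by simp
  have "(\<omega> - 1) * (\<Sum>q\<in>{b..<b + int N}. f q) = (\<Sum>q\<in>{b..<b + int N}. f (q + 1) - f q)"
    by (simp add: step sum_distrib_left algebra_simps)
  also have "\<dots> = 0"
    by (subst sum_int_telescope) (simp_all add: per)
  finally show ?thesis using \<omega> False by (simp add: f_def)
qed

lemma block_sum:
  fixes c :: "int \<Rightarrow> 'a::comm_monoid_add"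
  shows "(\<Sum>j\<in>{0..<int (m * n)}. c j) = (\<Sum>b\<in>{0..<int n}. \<Sum>j\<in>{0..<int m}. c (j + int m * b))"
proof (induction n)
  case (Suc n)
  have "{0..<K + int m} = {0..<K} \<union> {K..<K + int m}" if "0 \<le> K" for K
    using that by auto
  from this[of "int (m * n)"]
  have "{0..<int (m * Suc n)} = {0..<int (m * n)} \<union> {int (m * n)..<int (m * n) + int m}"
    by (simp add: algebra_simps)
  then have "(\<Sum>j\<in>{0..<int (m * Suc n)}. c j) = (\<Sum>j\<in>{0..<int (m * n)}. c j) + (\<Sum>j\<in>{int (m * n)..<int (m * n) + int m}. c j)"
    by (simp only:) (subst sum.union_disjoint; auto)
  also have "(\<Sum>j\<in>{int (m * n)..<int (m * n) + int m}. c j) = (\<Sum>j\<in>{0..<int m}. c (j + int m * int n))"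
    by (rule sum.reindex_bij_witness[of _ "\<lambda>j. j + int m * int n" "\<lambda>j. j - int m * int n"]) auto
  moreover have "{0..<int (Suc n)} = insert (int n) {0..<int n}" by auto
  ultimately show ?case
    using Suc by (simp add: add.commute)
qed simp

lemma sum_period_shift:
  fixes p :: "int \<Rightarrow> 'a::ab_group_add"
  assumes "\<And>j. p (j + int m) = p j"
  shows "(\<Sum>j\<in>{0..<int m}. p (j + 1)) = (\<Sum>j\<in>{0..<int m}. p j)"
  using sum_int_telescope[of 0 "int m" p] assms[of 0] by (simp add: sum_subtractf)

text \<open>Both sequences are determined by their values on one period.\<close>

lemma quasi_periodic_eq:
  fixes u v :: "int \<Rightarrow> complex"
  assumes m: "m > 0" and u: "\<And>j. u (j + int m) = \<zeta> * u j" and v: "\<And>j. v (j + int m) = \<zeta> * v j"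
    and \<zeta>: "\<zeta> \<noteq> 0" and eq: "\<And>j. j \<in> {0..<int m} \<Longrightarrow> u j = v j"
  shows "u j = v j"
proof -
  have up: "u (i + int m) = v (i + int m) \<longleftrightarrow> u i = v i" for i
    using u v \<zeta> by simp
  have "u (i + int m * b) = v (i + int m * b) \<longleftrightarrow> u i = v i" for i b
  proof (induction b rule: int_induct[where k = 0])
    case (step1 b)
    then show ?case using up[of "i + int m * b"] by (simp add: algebra_simps)
  next
    case (step2 b)
    then show ?case using up[of "i + int m * (b - 1)"] by (simp add: algebra_simps)
  qed simp
  from this[of "j mod int m" "j div int m"] eq[of "j mod int m"] m
  show ?thesis by simp
qed

lemma psum_sum:
  fixes f :: "'q \<Rightarrow> int \<Rightarrow> complex"
  shows "psum (\<lambda>l. \<Sum>q\<in>A. c q * f q l) j i = (\<Sum>q\<in>A. c q * psum (f q) j i)"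
proof -
  have "(\<Sum>l\<in>I. \<Sum>q\<in>A. c q * f q l) = (\<Sum>q\<in>A. c q * (\<Sum>l\<in>I. f q l))" for I
    by (subst sum.swap) (simp add: sum_distrib_left)
  then show ?thesis
    by (simp add: psum_def right_diff_distrib sum_subtractf)
qed

lemma flux_sum:
  fixes f :: "'q \<Rightarrow> int \<Rightarrow> complex"
  shows "flux s x (\<lambda>l. \<Sum>q\<in>A. c q * f q l) j = (\<Sum>q\<in>A. c q * flux s x (f q) j)"
  unfolding flux_def psum_sum
  by (simp add: scaleR_sum_right sum_distrib_left) (subst sum.swap, simp)

lemma fv_op_sum:
  fixes f :: "'q \<Rightarrow> int \<Rightarrow> complex"
  shows "fv_op s x (\<lambda>l. \<Sum>q\<in>A. c q * f q l) j = (\<Sum>q\<in>A. c q * fv_op s x (f q) j)"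
  unfolding fv_op_def flux_sum by (simp add: right_diff_distrib sum_subtractf)

lemma psum_of_real: "psum (\<lambda>l. complex_of_real (z l)) j i = complex_of_real (psum z j i)"
  by (simp add: psum_def)

lemma fv_op_of_real: "fv_op s x (\<lambda>l. complex_of_real (z l)) j = complex_of_real (fv_op s x z j)"
  by (simp add: fv_op_def flux_def psum_of_real scaleR_conv_of_real)

lemma psum_shift: "psum z (j + d) i = psum (\<lambda>l. z (l + d)) j i"
proof -
  have "sum z {a + d..<b + d} = (\<Sum>l\<in>{a..<b}. z (l + d))" for a b
    by (rule sum.reindex_bij_witness[of _ "\<lambda>l. l + d" "\<lambda>l. l - d"]) auto
  from this[of j "j + i"] this[of "j + i" j] show ?thesis
    by (simp add: psum_def add.commute add.left_commute)
qed

lemma coef_period: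
  assumes "\<And>j. x (j + d) = x j + c"
  shows "coef s x (j + d) i = coef s x j i"
proof -
  have "x (j + d + l) = x (j + l) + c" for l
    using assms[of "j + l"] by (simp add: add_ac)
  then show ?thesis
    by (simp add: coef_def lagrange_weight_def assms)
qed

lemma flux_quasi_periodic:
  fixes z :: "int \<Rightarrow> complex"
  assumes "\<And>j. x (j + d) = x j + c" "\<And>j. z (j + d) = \<zeta> * z j"
  shows "flux s x z (j + d) = \<zeta> * flux s x z j"
proof -
  have "psum z (j + d) i = \<zeta> * psum z j i" for i
    unfolding psum_shift assms(2) by (simp add: psum_def sum_distrib_left right_diff_distrib)
  then show ?thesis
    by (simp add: flux_def coef_period[of x d c, OF assms(1)] sum_distrib_left)
qed

lemma fv_op_quasi_periodic:
  fixes z :: "int \<Rightarrow> complex"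
  assumes "\<And>j. x (j + d) = x j + c" "\<And>j. z (j + d) = \<zeta> * z j"
  shows "fv_op s x z (j + d) = \<zeta> * fv_op s x z j"
  using flux_quasi_periodic[of x d c z \<zeta> s j, OF assms] flux_quasi_periodic[of x d c z \<zeta> s "j + 1", OF assms]
  by (simp add: fv_op_def algebra_simps)

text \<open>Multiplying by \<open>cis \<theta> - 1\<close> turns the partial sums of the wave into its increments; no division is
needed, so the frequency zero is included.\<close>

lemma fv_op_uniform_wave: "fv_op s real_of_int (wave \<theta>) j = symbol s \<theta> * wave \<theta> j"
proof -
  have 1: "flux s real_of_int (wave \<theta>) (j + 1) = cis \<theta> * flux s real_of_int (wave \<theta>) j"
    by (rule flux_quasi_periodic[where c = 1]) (simp_all add: wave_add wave_1 mult.commute)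
  have 2: "(cis \<theta> - 1) * psum (wave \<theta>) j i = (cis (\<theta> * real_of_int i) - 1) * wave \<theta> j" for i
  proof -
    have "(cis \<theta> - 1) * psum (wave \<theta>) j i = psum (\<lambda>l. wave \<theta> (l + 1) - wave \<theta> l) j i"
      by (simp add: psum_def sum_distrib_left wave_add wave_1 algebra_simps)
    also have "\<dots> = wave \<theta> (j + i) - wave \<theta> j"
      by (rule psum_telescope)
    finally show ?thesis by (simp add: wave_add algebra_simps) (simp add: wave_def mult.commute)
  qed
  have "fv_op s real_of_int (wave \<theta>) j = (cis \<theta> - 1) * flux s real_of_int (wave \<theta>) j"
    unfolding fv_op_def 1 by (simp add: left_diff_distrib)
  also have "\<dots> = (\<Sum>i\<in>stencil s. uniform_coef s i *\<^sub>R ((cis \<theta> - 1) * psum (wave \<theta>) j i))"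
    by (simp add: flux_def sum_distrib_left)
  also have "\<dots> = symbol s \<theta> * wave \<theta> j"
    unfolding 2 by (simp add: symbol_def sum_distrib_right)
  finally show ?thesis .
qed

definition bloch_coeff :: "nat \<Rightarrow> real \<Rightarrow> (int \<Rightarrow> complex) \<Rightarrow> complex" where
  "bloch_coeff m \<theta> z = (\<Sum>j\<in>{0..<int m}. cnj (wave \<theta> j) * z j) / of_nat m"

definition bfreq :: "nat \<Rightarrow> real \<Rightarrow> nat \<Rightarrow> real" where
  "bfreq m \<theta> k = \<theta> + 2 * pi * real k / real m"

lemma bloch_coeff_sum: "bloch_coeff m \<theta> (\<lambda>j. \<Sum>q\<in>A. c q * f q j) = (\<Sum>q\<in>A. c q * bloch_coeff m \<theta> (f q))"
proof -
  have "(\<Sum>j\<in>I. cnj (wave \<theta> j) * (\<Sum>q\<in>A. c q * f q j)) = (\<Sum>q\<in>A. c q * (\<Sum>j\<in>I. cnj (wave \<theta> j) * f q j))" for I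
    by (simp add: sum_distrib_left mult.left_commute) (subst sum.swap, simp)
  then show ?thesis
    by (simp only: bloch_coeff_def sum_divide_distrib[of _ A] times_divide_eq_right)
qed

lemma bloch_coeff_add: "bloch_coeff m \<theta> (\<lambda>j. f j + g j) = bloch_coeff m \<theta> f + bloch_coeff m \<theta> g"
  by (simp add: bloch_coeff_def distrib_left sum.distrib add_divide_distrib)

lemma bloch_coeff_diff: "bloch_coeff m \<theta> (\<lambda>j. f j - g j) = bloch_coeff m \<theta> f - bloch_coeff m \<theta> g"
  by (simp add: bloch_coeff_def right_diff_distrib sum_subtractf diff_divide_distrib)

lemma bloch_coeff_mult: "bloch_coeff m \<theta> (\<lambda>j. c * f j) = c * bloch_coeff m \<theta> f"
  by (simp add: bloch_coeff_def sum_distrib_left mult.left_commute)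

lemma bloch_coeff_times:
  "bloch_coeff m \<theta> z * c = (\<Sum>i\<in>{0..<int m}. z i * (cnj (wave \<theta> i) * c)) / of_nat m"
  unfolding bloch_coeff_def times_divide_eq_left sum_distrib_right by (simp add: mult_ac)

lemma norm_bloch_coeff_le:
  assumes "m > 0" "\<And>j. norm (z j) \<le> B"
  shows "norm (bloch_coeff m \<theta> z) \<le> B"
proof -
  have "norm (\<Sum>j\<in>{0..<int m}. cnj (wave \<theta> j) * z j) \<le> real (card {0..<int m}) * B"
    by (rule sum_norm_bound) (simp add: norm_mult assms)
  then show ?thesis
    using assms(1) by (simp add: bloch_coeff_def norm_divide divide_le_eq mult.commute)
qed

lemma wave_bfreq_period:
  assumes "m > 0"
  shows "wave (bfreq m \<theta> k) (j + int m) = cis (\<theta> * real m) * wave (bfreq m \<theta> k) j"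
proof -
  have "bfreq m \<theta> k * real m = \<theta> * real m + 2 * pi * real_of_int (int k)"
    using assms by (simp add: bfreq_def field_simps)
  then have "wave (bfreq m \<theta> k) (int m) = cis (\<theta> * real m) * cis (2 * pi * real_of_int (int k))"
    unfolding wave_def cis_mult by simp
  then show ?thesis by (simp only: wave_add cis_2pi_int) simp
qed

text \<open>Summation by parts. The factor \<open>cis \<phi> - 1\<close> expresses the conservation form of the scheme and is the
source of every gain of a power of \<open>\<tau>\<close> in the component of lowest frequency.\<close>

lemma bloch_coeff_difference:
  assumes m: "m > 0" and w: "\<And>j. w (j + int m) = cis (\<theta> * real m) * w j"
  shows "bloch_coeff m (bfreq m \<theta> k) (\<lambda>j. w (j + 1) - w j) = (cis (bfreq m \<theta> k) - 1) * bloch_coeff m (bfreq m \<theta> k) w"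
proof -
  let ?\<phi> = "bfreq m \<theta> k"
  define p where "p j = cnj (wave ?\<phi> j) * w j" for j
  have "p (j + int m) = p j" for j
    unfolding p_def wave_bfreq_period[OF m] w complex_cnj_mult by (rule cis_cancel)
  then have "(\<Sum>j\<in>{0..<int m}. p (j + 1)) = (\<Sum>j\<in>{0..<int m}. p j)"
    by (rule sum_period_shift)
  moreover have "cnj (wave ?\<phi> j) * w (j + 1) = cis ?\<phi> * p (j + 1)" for j
    unfolding p_def wave_add wave_1 complex_cnj_mult by (rule cis_cancel(2)[symmetric])
  ultimately have "(\<Sum>j\<in>{0..<int m}. cnj (wave ?\<phi> j) * (w (j + 1) - w j)) = (cis ?\<phi> - 1) * (\<Sum>j\<in>{0..<int m}. p j)"
    by (simp add: right_diff_distrib sum_subtractf left_diff_distrib flip: sum_distrib_left p_def)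
  then show ?thesis
    by (simp add: bloch_coeff_def p_def)
qed

lemma bloch_orthonormal:
  assumes "m > 0" "k < m" "l < m"
  shows "bloch_coeff m (bfreq m \<theta> k) (wave (bfreq m \<theta> l)) = (if k = l then 1 else 0)"
proof -
  have "cnj (wave (bfreq m \<theta> k) j) * wave (bfreq m \<theta> l) j = cis (2 * pi * real_of_int (j * (int l - int k)) / real m)" for j
    unfolding cnj_wave_mult bfreq_def by (rule arg_cong[of _ _ cis]) (simp add: algebra_simps add_divide_distrib diff_divide_distrib)
  then have "(\<Sum>j\<in>{0..<int m}. cnj (wave (bfreq m \<theta> k) j) * wave (bfreq m \<theta> l) j)
      = (if int m dvd int l - int k then of_nat m else 0)"
    using root_of_unity_sum[OF assms(1), where b = 0 and d = "int l - int k"] by (simp only: add_0)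
  moreover have "int m dvd int l - int k \<longleftrightarrow> k = l"
  proof
    assume "int m dvd int l - int k"
    moreover have "\<bar>int l - int k\<bar> < int m" using assms by linarith
    ultimately have "int l - int k = 0" using dvd_imp_le_int[of "int l - int k" "int m"] by force
    then show "k = l" by simp
  qed simp
  ultimately show ?thesis
    using assms(1) by (simp add: bloch_coeff_def)
qed

lemma bloch_inversion:
  assumes m: "m > 0" and z: "\<And>j. z (j + int m) = cis (\<theta> * real m) * z j"
  shows "z j = (\<Sum>k<m. bloch_coeff m (bfreq m \<theta> k) z * wave (bfreq m \<theta> k) j)"
proof (rule quasi_periodic_eq[OF m, where \<zeta> = "cis (\<theta> * real m)"])
  show "(\<Sum>k<m. bloch_coeff m (bfreq m \<theta> k) z * wave (bfreq m \<theta> k) (j + int m))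
      = cis (\<theta> * real m) * (\<Sum>k<m. bloch_coeff m (bfreq m \<theta> k) z * wave (bfreq m \<theta> k) j)" for j
    unfolding wave_bfreq_period[OF m] by (simp add: sum_distrib_left mult.left_commute)
  fix j assume j: "j \<in> {0..<int m}"
  have ker: "(\<Sum>k<m. cnj (wave (bfreq m \<theta> k) i) * wave (bfreq m \<theta> k) j) = (if i = j then of_nat m else 0)"
    if i: "i \<in> {0..<int m}" for i
  proof -
    have "cnj (wave (bfreq m \<theta> k) i) * wave (bfreq m \<theta> k) j
        = cis (\<theta> * real_of_int (j - i)) * cis (2 * pi * real_of_int (int k * (j - i)) / real m)" for k
      unfolding wave_def cis_cnj cis_mult bfreq_def by (rule arg_cong[of _ _ cis]) (simp add: algebra_simps add_divide_distrib diff_divide_distrib)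
    then have "(\<Sum>k<m. cnj (wave (bfreq m \<theta> k) i) * wave (bfreq m \<theta> k) j)
        = cis (\<theta> * real_of_int (j - i)) * (\<Sum>k<m. cis (2 * pi * real_of_int (int k * (j - i)) / real m))"
      by (simp add: sum_distrib_left)
    also have "(\<Sum>k<m. cis (2 * pi * real_of_int (int k * (j - i)) / real m))
        = (\<Sum>q\<in>{0..<0 + int m}. cis (2 * pi * real_of_int (q * (j - i)) / real m))"
      by (rule sum.reindex_bij_witness[of _ nat int]) auto
    also have "\<dots> = (if int m dvd j - i then of_nat m else 0)"
      by (rule root_of_unity_sum[OF m])
    also have "int m dvd j - i \<longleftrightarrow> i = j"
    proof
      assume "int m dvd j - i"
      moreover have "\<bar>j - i\<bar> < int m" using i j by auto
      ultimately have "j - i = 0" using dvd_imp_le_int[of "j - i" "int m"] by force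
      then show "i = j" by simp
    qed simp
    finally show ?thesis by simp
  qed
  have "(\<Sum>k<m. bloch_coeff m (bfreq m \<theta> k) z * wave (bfreq m \<theta> k) j)
      = (\<Sum>k<m. \<Sum>i\<in>{0..<int m}. z i * (cnj (wave (bfreq m \<theta> k) i) * wave (bfreq m \<theta> k) j)) / of_nat m"
    by (simp only: bloch_coeff_times sum_divide_distrib[symmetric])
  also have "\<dots> = (\<Sum>i\<in>{0..<int m}. z i * (\<Sum>k<m. cnj (wave (bfreq m \<theta> k) i) * wave (bfreq m \<theta> k) j)) / of_nat m"
    by (subst sum.swap) (simp add: sum_distrib_left)
  also have "\<dots> = (\<Sum>i\<in>{0..<int m}. z i * (if i = j then of_nat m else 0)) / of_nat m"
    by (simp add: ker)
  also have "\<dots> = z j"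
    using j m by (simp add: if_distrib[of "(*) _"] cong: if_cong)
  finally show "z j = (\<Sum>k<m. bloch_coeff m (bfreq m \<theta> k) z * wave (bfreq m \<theta> k) j)" by simp
qed (use z in auto)

text \<open>A centred set of representatives modulo \<open>n\<close>, so that the base frequency of each block is the smallest
one in absolute value, at most \<open>\<pi> / m\<close>.\<close>

definition dft_base :: "nat \<Rightarrow> int set" where
  "dft_base n = {- int (n div 2)..<- int (n div 2) + int n}"

definition dft_freq :: "nat \<Rightarrow> nat \<Rightarrow> int \<Rightarrow> real" where
  "dft_freq m n a = 2 * pi * real_of_int a / real (m * n)"

lemma finite_dft_base [simp]: "finite (dft_base n)"
  by (simp add: dft_base_def)

lemma dft_freq_le:
  assumes "m > 0" "n > 0" "a \<in> dft_base n"
  shows "\<bar>dft_freq m n a\<bar> \<le> pi / real m"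
proof -
  have "2 * \<bar>a\<bar> \<le> int n" using assms(3) by (auto simp: dft_base_def)
  then have "2 * \<bar>real_of_int a\<bar> \<le> real n" by linarith
  then have "pi * (2 * \<bar>real_of_int a\<bar>) / real (m * n) \<le> pi * real n / real (m * n)"
    by (intro divide_right_mono mult_left_mono) auto
  then show ?thesis
    using assms by (simp add: dft_freq_def abs_mult mult_ac)
qed

lemma dft_base_dvd:
  assumes "a \<in> dft_base n" "b \<in> dft_base n"
  shows "int n dvd a - b \<longleftrightarrow> a = b"
proof
  assume "int n dvd a - b"
  moreover have "\<bar>a - b\<bar> < int n" using assms by (auto simp: dft_base_def)
  ultimately have "a - b = 0" using dvd_imp_le_int[of "a - b" "int n"] by force
  then show "a = b" by simp
qed simp

definition dft :: "nat \<Rightarrow> nat \<Rightarrow> (int \<Rightarrow> complex) \<Rightarrow> int \<Rightarrow> nat \<Rightarrow> complex" where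
  "dft m n z a k = bloch_coeff (m * n) (bfreq m (dft_freq m n a) k) z"

lemma dft_kernel:
  assumes m: "m > 0" and n: "n > 0" and "i \<in> {0..<int (m * n)}" "j \<in> {0..<int (m * n)}"
  shows "(\<Sum>a\<in>dft_base n. \<Sum>k<m. cnj (wave (bfreq m (dft_freq m n a) k) i) * wave (bfreq m (dft_freq m n a) k) j)
    = (if i = j then of_nat (m * n) else 0)"
proof -
  define d where "d = j - i"
  have "cnj (wave (bfreq m (dft_freq m n a) k) i) * wave (bfreq m (dft_freq m n a) k) j
      = cis (2 * pi * real_of_int (a * d) / real (m * n)) * cis (2 * pi * real_of_int (int k * d) / real m)" for a k
    unfolding wave_def cis_cnj cis_mult bfreq_def dft_freq_def d_def
    by (rule arg_cong[of _ _ cis]) (simp add: algebra_simps add_divide_distrib diff_divide_distrib)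
  then have "(\<Sum>a\<in>dft_base n. \<Sum>k<m. cnj (wave (bfreq m (dft_freq m n a) k) i) * wave (bfreq m (dft_freq m n a) k) j)
      = (\<Sum>a\<in>dft_base n. cis (2 * pi * real_of_int (a * d) / real (m * n))) * (\<Sum>k<m. cis (2 * pi * real_of_int (int k * d) / real m))"
    by (simp add: sum_product)
  also have "(\<Sum>k<m. cis (2 * pi * real_of_int (int k * d) / real m))
      = (\<Sum>q\<in>{0..<0 + int m}. cis (2 * pi * real_of_int (q * d) / real m))"
    by (rule sum.reindex_bij_witness[of _ nat int]) auto
  also have "\<dots> = (if int m dvd d then of_nat m else 0)"
    by (rule root_of_unity_sum[OF m])
  also have "(\<Sum>a\<in>dft_base n. cis (2 * pi * real_of_int (a * d) / real (m * n))) * (if int m dvd d then of_nat m else 0)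
      = (if i = j then of_nat (m * n) else (0::complex))"
  proof (cases "int m dvd d")
    case True
    then obtain e where e: "d = int m * e" by (auto elim: dvdE)
    have "(\<Sum>a\<in>dft_base n. cis (2 * pi * real_of_int (a * d) / real (m * n)))
        = (\<Sum>a\<in>dft_base n. cis (2 * pi * real_of_int (a * e) / real n))"
      using m by (intro sum.cong refl arg_cong[of _ _ cis]) (simp add: e)
    also have "\<dots> = (if int n dvd e then of_nat n else 0)"
      unfolding dft_base_def by (rule root_of_unity_sum[OF n])
    also have "int n dvd e \<longleftrightarrow> i = j"
    proof
      assume "int n dvd e"
      then have "int (m * n) dvd d" by (simp add: e)
      moreover have "\<bar>d\<bar> < int (m * n)" using assms by (auto simp: d_def)
      ultimately have "d = 0" using dvd_imp_le_int[of d "int (m * n)"] by force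
      then show "i = j" by (simp add: d_def)
    next
      assume "i = j"
      then show "int n dvd e" using e m by (simp add: d_def)
    qed
    finally show ?thesis using True by simp
  next
    case False
    then have "i \<noteq> j" by (auto simp: d_def)
    then show ?thesis using False by simp
  qed
  finally show ?thesis .
qed

lemma dft_inversion:
  assumes m: "m > 0" and n: "n > 0" and z: "\<And>j. z (j + int (m * n)) = z j"
  shows "z j = (\<Sum>a\<in>dft_base n. \<Sum>k<m. dft m n z a k * wave (bfreq m (dft_freq m n a) k) j)"
proof (rule quasi_periodic_eq[where m = "m * n" and \<zeta> = 1])
  show "m * n > 0" using m n by simp
  have "wave (bfreq m (dft_freq m n a) k) (j + int (m * n)) = wave (bfreq m (dft_freq m n a) k) j" for a k j
  proof -
    have "bfreq m (dft_freq m n a) k * real (m * n) = 2 * pi * real_of_int (a + int k * int n)"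
      using m n by (simp add: bfreq_def dft_freq_def field_simps)
    then have "wave (bfreq m (dft_freq m n a) k) (int (m * n)) = 1"
      unfolding wave_def by (metis cis_2pi_int of_int_of_nat_eq)
    then show ?thesis by (simp add: wave_add)
  qed
  then show "(\<Sum>a\<in>dft_base n. \<Sum>k<m. dft m n z a k * wave (bfreq m (dft_freq m n a) k) (j + int (m * n)))
      = 1 * (\<Sum>a\<in>dft_base n. \<Sum>k<m. dft m n z a k * wave (bfreq m (dft_freq m n a) k) j)" for j
    by simp
  fix j assume j: "j \<in> {0..<int (m * n)}"
  let ?w = "\<lambda>a k. wave (bfreq m (dft_freq m n a) k)"
  have "(\<Sum>a\<in>dft_base n. \<Sum>k<m. dft m n z a k * ?w a k j)
      = (\<Sum>a\<in>dft_base n. \<Sum>k<m. \<Sum>i\<in>{0..<int (m * n)}. z i * (cnj (?w a k i) * ?w a k j)) / of_nat (m * n)"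
    by (simp only: dft_def bloch_coeff_times sum_divide_distrib[symmetric])
  also have "(\<Sum>a\<in>dft_base n. \<Sum>k<m. \<Sum>i\<in>{0..<int (m * n)}. z i * (cnj (?w a k i) * ?w a k j))
      = (\<Sum>a\<in>dft_base n. \<Sum>i\<in>{0..<int (m * n)}. \<Sum>k<m. z i * (cnj (?w a k i) * ?w a k j))"
    by (intro sum.cong refl sum.swap)
  also have "\<dots> = (\<Sum>i\<in>{0..<int (m * n)}. \<Sum>a\<in>dft_base n. \<Sum>k<m. z i * (cnj (?w a k i) * ?w a k j))"
    by (rule sum.swap)
  also have "\<dots> = (\<Sum>i\<in>{0..<int (m * n)}. z i * (\<Sum>a\<in>dft_base n. \<Sum>k<m. cnj (?w a k i) * ?w a k j))"
    by (simp add: sum_distrib_left)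
  also have "\<dots> = (\<Sum>i\<in>{0..<int (m * n)}. z i * (if i = j then of_nat (m * n) else 0))"
    by (intro sum.cong refl) (simp only: dft_kernel[OF m n _ j])
  also have "\<dots> / of_nat (m * n) = z j"
    using j m n by (simp add: if_distrib[of "(*) _"] cong: if_cong)
  finally show "z j = (\<Sum>a\<in>dft_base n. \<Sum>k<m. dft m n z a k * ?w a k j)" by simp
qed (use z in auto)

lemma dft_parseval:
  assumes m: "m > 0" and n: "n > 0" and z: "\<And>j. z (j + int (m * n)) = z j"
  shows "(\<Sum>j\<in>{0..<int (m * n)}. (norm (z j))\<^sup>2) = real (m * n) * (\<Sum>a\<in>dft_base n. \<Sum>k<m. (norm (dft m n z a k))\<^sup>2)"
proof -
  let ?w = "\<lambda>a k. wave (bfreq m (dft_freq m n a) k)"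
  have hat: "(\<Sum>j\<in>{0..<int (m * n)}. cnj (z j) * ?w a k j) = of_nat (m * n) * cnj (dft m n z a k)" for a k
    using m n by (simp add: dft_def bloch_coeff_def mult.commute)
  have "complex_of_real (\<Sum>j\<in>{0..<int (m * n)}. (norm (z j))\<^sup>2) = (\<Sum>j\<in>{0..<int (m * n)}. cnj (z j) * z j)"
    by (simp only: of_real_sum complex_norm_square mult.commute)
  also have "\<dots> = (\<Sum>j\<in>{0..<int (m * n)}. cnj (z j) * (\<Sum>a\<in>dft_base n. \<Sum>k<m. dft m n z a k * ?w a k j))"
    by (subst (2) dft_inversion[of m n z, OF m n z]) simp_all
  also have "\<dots> = (\<Sum>a\<in>dft_base n. \<Sum>k<m. dft m n z a k * (\<Sum>j\<in>{0..<int (m * n)}. cnj (z j) * ?w a k j))"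
  proof -
    have "(\<Sum>j\<in>{0..<int (m * n)}. cnj (z j) * (\<Sum>a\<in>dft_base n. \<Sum>k<m. dft m n z a k * ?w a k j))
        = (\<Sum>j\<in>{0..<int (m * n)}. \<Sum>a\<in>dft_base n. \<Sum>k<m. dft m n z a k * (cnj (z j) * ?w a k j))"
      by (simp add: sum_distrib_left mult.left_commute)
    also have "\<dots> = (\<Sum>a\<in>dft_base n. \<Sum>j\<in>{0..<int (m * n)}. \<Sum>k<m. dft m n z a k * (cnj (z j) * ?w a k j))"
      by (rule sum.swap)
    also have "\<dots> = (\<Sum>a\<in>dft_base n. \<Sum>k<m. \<Sum>j\<in>{0..<int (m * n)}. dft m n z a k * (cnj (z j) * ?w a k j))"
      by (intro sum.cong refl sum.swap)
    finally show ?thesis by (simp add: sum_distrib_left)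
  qed
  also have "\<dots> = complex_of_real (real (m * n) * (\<Sum>a\<in>dft_base n. \<Sum>k<m. (norm (dft m n z a k))\<^sup>2))"
    unfolding hat of_real_mult of_real_sum complex_norm_square sum_distrib_left
    by (intro sum.cong refl) simp
  finally show ?thesis
    by (simp only: of_real_eq_iff)
qed

definition bloch_matrix :: "nat \<Rightarrow> (int \<Rightarrow> real) \<Rightarrow> nat \<Rightarrow> real \<Rightarrow> nat \<Rightarrow> nat \<Rightarrow> complex" where
  "bloch_matrix s x m \<theta> k l = bloch_coeff m (bfreq m \<theta> k) (fv_op s x (wave (bfreq m \<theta> l)))"

text \<open>Since the coefficients have period \<open>m\<close>, the scheme maps a wave to a sequence with the same multiplier
under the shift by \<open>m\<close>; so it couples only frequencies that differ by multiples of \<open>2 \<pi> / m\<close>.\<close>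

lemma dft_fv_op:
  assumes m: "m > 0" and n: "n > 0" and z: "\<And>j. z (j + int (m * n)) = z j"
    and x: "\<And>j. x (j + int m) = x j + c" and a: "a \<in> dft_base n"
  shows "dft m n (fv_op s x z) a k = (\<Sum>l<m. bloch_matrix s x m (dft_freq m n a) k l * dft m n z a l)"
proof -
  let ?w = "\<lambda>a k. wave (bfreq m (dft_freq m n a) k)"
  have block: "bloch_coeff (m * n) (bfreq m (dft_freq m n a) k) (fv_op s x (?w b l))
      = (if b = a then bloch_matrix s x m (dft_freq m n a) k l else 0)" if b: "b \<in> dft_base n" for b l
  proof -
    define p where "p j = cnj (?w a k j) * fv_op s x (?w b l) j" for j
    define \<zeta> where "\<zeta> = cis (2 * pi * real_of_int (1 * (b - a)) / real n)"
    have pm: "p (j + int m) = \<zeta> * p j" for j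
    proof -
      have "fv_op s x (?w b l) (j + int m) = cis (dft_freq m n b * real m) * fv_op s x (?w b l) j"
        by (rule fv_op_quasi_periodic[of x "int m" c, OF x]) (rule wave_bfreq_period[OF m])
      moreover have "cnj (cis (dft_freq m n a * real m)) * cis (dft_freq m n b * real m) = \<zeta>"
        unfolding cis_cnj cis_mult \<zeta>_def dft_freq_def using m n
        by (intro arg_cong[of _ _ cis]) (simp add: field_simps)
      moreover have "u * v * (c * w) = (u * c) * (v * w)" for u v c w :: complex
        by (simp only: mult_ac)
      ultimately show ?thesis
        unfolding p_def wave_bfreq_period[OF m] complex_cnj_mult by simp
    qed
    have shift: "p (j + int m * i) = cis (2 * pi * real_of_int (i * (b - a)) / real n) * p j" if "0 \<le> i" for i j
      using that
    proof (induction i rule: int_ge_induct)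
      case (step i)
      have "p (j + int m * (i + 1)) = \<zeta> * p (j + int m * i)"
        using pm[of "j + int m * i"] by (simp add: algebra_simps)
      also have "\<dots> = (\<zeta> * cis (2 * pi * real_of_int (i * (b - a)) / real n)) * p j"
        by (simp add: step)
      also have "\<zeta> * cis (2 * pi * real_of_int (i * (b - a)) / real n) = cis (2 * pi * real_of_int ((i + 1) * (b - a)) / real n)"
        unfolding \<zeta>_def cis_mult
        by (intro arg_cong[of _ _ cis]) (simp add: algebra_simps add_divide_distrib diff_divide_distrib)
      finally show ?case .
    qed simp
    have "(\<Sum>j\<in>{0..<int (m * n)}. p j) = (\<Sum>i\<in>{0..<int n}. \<Sum>j\<in>{0..<int m}. cis (2 * pi * real_of_int (i * (b - a)) / real n) * p j)"
      unfolding block_sum by (intro sum.cong refl shift) simp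
    also have "\<dots> = (\<Sum>i\<in>{0..<0 + int n}. cis (2 * pi * real_of_int (i * (b - a)) / real n)) * (\<Sum>j\<in>{0..<int m}. p j)"
      by (simp only: sum_product add_0)
    also have "\<dots> = (if b = a then of_nat n * (\<Sum>j\<in>{0..<int m}. p j) else 0)"
      unfolding root_of_unity_sum[OF n] dft_base_dvd[OF b a] by simp
    finally show ?thesis
      using n by (simp add: bloch_coeff_def bloch_matrix_def p_def)
  qed
  define A where "A = dft_base n \<times> {..<m}"
  have zA: "z = (\<lambda>j. \<Sum>q\<in>A. dft m n z (fst q) (snd q) * ?w (fst q) (snd q) j)"
    using dft_inversion[of m n z, OF m n z] by (simp add: A_def sum.cartesian_product case_prod_beta fun_eq_iff)
  have "fv_op s x z j = (\<Sum>q\<in>A. dft m n z (fst q) (snd q) * fv_op s x (?w (fst q) (snd q)) j)" for j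
    by (subst zA) (rule fv_op_sum)
  then have "fv_op s x z = (\<lambda>j. \<Sum>q\<in>A. dft m n z (fst q) (snd q) * fv_op s x (?w (fst q) (snd q)) j)"
    by (rule ext)
  then have "dft m n (fv_op s x z) a k
      = (\<Sum>q\<in>A. dft m n z (fst q) (snd q) * bloch_coeff (m * n) (bfreq m (dft_freq m n a) k) (fv_op s x (?w (fst q) (snd q))))"
    unfolding dft_def[of m n "fv_op s x z"] by (simp only: bloch_coeff_sum)
  also have "\<dots> = (\<Sum>b\<in>dft_base n. \<Sum>l<m. dft m n z b l * (if b = a then bloch_matrix s x m (dft_freq m n a) k l else 0))"
    unfolding A_def sum.cartesian_product by (intro sum.cong refl) (auto simp: block)
  also have "\<dots> = (\<Sum>b\<in>dft_base n. if b = a then (\<Sum>l<m. dft m n z b l * bloch_matrix s x m (dft_freq m n a) k l) else 0)"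
    by (intro sum.cong refl) auto
  also have "\<dots> = (\<Sum>l<m. dft m n z a l * bloch_matrix s x m (dft_freq m n a) k l)"
    using a by simp
  finally show ?thesis by (simp add: mult.commute)
qed

section \<open>The scheme on Bloch waves of a nearly uniform mesh\<close>

lemma norm_psum_le:
  assumes "\<And>j. norm (z j) \<le> B"
  shows "norm (psum z j i) \<le> \<bar>real_of_int i\<bar> * B"
proof (cases "i \<ge> 0")
  case True
  have "norm (sum z {j..<j + i}) \<le> real (card {j..<j + i}) * B"
    by (rule sum_norm_bound) (rule assms)
  then show ?thesis using True by (simp add: psum_def)
next
  case False
  have "norm (sum z {j + i..<j}) \<le> real (card {j + i..<j}) * B"
    by (rule sum_norm_bound) (rule assms)
  then show ?thesis using False by (simp add: psum_def)
qed

lemma stencil_abs_le_real: "i \<in> stencil s \<Longrightarrow> \<bar>real_of_int i\<bar> \<le> real (s + 1)"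
  using stencil_abs_le[of i s] by linarith

lemma flux_diff_bound:
  assumes c: "\<And>i. i \<in> stencil s \<Longrightarrow> \<bar>coef s x j i - uniform_coef s i\<bar> \<le> \<eta>"
    and z: "\<And>j. norm (z j) \<le> B"
  shows "norm (flux s x z j - flux s real_of_int z j) \<le> \<eta> * (real (2 * s + 1) * real (s + 1)) * B"
proof -
  have B0: "0 \<le> B" using z norm_ge_zero order_trans by blast
  have "flux s x z j - flux s real_of_int z j = (\<Sum>i\<in>stencil s. (coef s x j i - uniform_coef s i) *\<^sub>R psum z j i)"
    by (simp add: flux_def scaleR_left_diff_distrib sum_subtractf)
  also have "norm \<dots> \<le> real (card (stencil s)) * (\<eta> * (real (s + 1) * B))"
  proof (rule sum_norm_bound)
    fix i assume i: "i \<in> stencil s"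
    have "\<bar>real_of_int i\<bar> \<le> real (s + 1)" by (rule stencil_abs_le_real[OF i])
    then have "\<bar>real_of_int i\<bar> * B \<le> real (s + 1) * B" using B0 by (rule mult_right_mono)
    then have "norm (psum z j i) \<le> real (s + 1) * B"
      using norm_psum_le[of z B j i, OF z] by linarith
    then show "norm ((coef s x j i - uniform_coef s i) *\<^sub>R psum z j i) \<le> \<eta> * (real (s + 1) * B)"
      unfolding norm_scaleR using c[OF i] by (intro mult_mono) auto
  qed
  finally show ?thesis by (simp add: card_stencil mult_ac)
qed

text \<open>The scheme is in conservation form, so its perturbation is the increment of a perturbation of the
fluxes, and summation by parts applies.\<close>

lemma bloch_matrix_split:
  assumes m: "m > 0" and x: "\<And>j. x (j + int m) = x j + real m" and k: "k < m" and l: "l < m"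
  shows "bloch_matrix s x m \<theta> k l = (if k = l then symbol s (bfreq m \<theta> k) else 0)
    + (cis (bfreq m \<theta> k) - 1) * bloch_coeff m (bfreq m \<theta> k)
        (\<lambda>j. flux s x (wave (bfreq m \<theta> l)) j - flux s real_of_int (wave (bfreq m \<theta> l)) j)"
proof -
  let ?w = "wave (bfreq m \<theta> l)"
  define q where "q j = flux s x ?w j - flux s real_of_int ?w j" for j
  have q: "q (j + int m) = cis (\<theta> * real m) * q j" for j
    using flux_quasi_periodic[of x "int m" "real m" ?w "cis (\<theta> * real m)" s j, OF x wave_bfreq_period[OF m]]
      flux_quasi_periodic[of real_of_int "int m" "real m" ?w "cis (\<theta> * real m)" s j, OF _ wave_bfreq_period[OF m]]
    by (simp add: q_def right_diff_distrib)
  have "fv_op s x ?w = (\<lambda>j. symbol s (bfreq m \<theta> l) * ?w j + (q (j + 1) - q j))"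
    unfolding fv_op_uniform_wave[symmetric] by (simp add: fun_eq_iff fv_op_def q_def)
  then have "bloch_matrix s x m \<theta> k l = symbol s (bfreq m \<theta> l) * bloch_coeff m (bfreq m \<theta> k) ?w
      + (cis (bfreq m \<theta> k) - 1) * bloch_coeff m (bfreq m \<theta> k) q"
    unfolding bloch_matrix_def by (simp only: bloch_coeff_add bloch_coeff_mult bloch_coeff_difference[of m q \<theta> k, OF m q])
  then show ?thesis
    unfolding bloch_orthonormal[OF m k l] by (simp add: q_def[abs_def])
qed

lemma norm_cis_minus_one_le: "norm (cis \<phi> - 1) \<le> 2"
  using norm_triangle_ineq4[of "cis \<phi>" 1] by simp

lemma bloch_matrix_perturbation_bound:
  assumes m: "m > 0" and x: "\<And>j. x (j + int m) = x j + real m" and k: "k < m" and l: "l < m"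
    and c: "\<And>j i. i \<in> stencil s \<Longrightarrow> \<bar>coef s x j i - uniform_coef s i\<bar> \<le> \<eta>"
  shows "norm (bloch_matrix s x m \<theta> k l - (if k = l then symbol s (bfreq m \<theta> k) else 0))
    \<le> norm (cis (bfreq m \<theta> k) - 1) * (\<eta> * (real (2 * s + 1) * real (s + 1)))"
proof -
  have "norm (bloch_coeff m (bfreq m \<theta> k)
        (\<lambda>j. flux s x (wave (bfreq m \<theta> l)) j - flux s real_of_int (wave (bfreq m \<theta> l)) j))
      \<le> \<eta> * (real (2 * s + 1) * real (s + 1)) * 1"
    by (intro norm_bloch_coeff_le m flux_diff_bound c) auto
  then show ?thesis
    unfolding bloch_matrix_split[where m = m and x = x, OF assms(1-4)] by (simp add: norm_mult mult_left_mono)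
qed

text \<open>The Taylor remainder of \<open>exp (i z)\<close>, regarded as a function on the complex plane so that the
complex differentiation rules apply; it is used on the real axis only.\<close>

definition exp_rem :: "nat \<Rightarrow> complex \<Rightarrow> complex" where
  "exp_rem n z = exp (\<i> * z) - (\<Sum>q\<le>n. (\<i> * z) ^ q / fact q)"

lemma exp_rem_deriv: "(exp_rem (Suc n) has_field_derivative \<i> * exp_rem n z) (at z within S)"
proof (induction n)
  case 0
  have "exp_rem (Suc 0) = (\<lambda>z. exp (\<i> * z) - (1 + \<i> * z))"
    by (simp add: exp_rem_def fun_eq_iff)
  then show ?case
    by (auto intro!: derivative_eq_intros simp: exp_rem_def algebra_simps)
next
  case (Suc n)
  have 1: "exp_rem (Suc (Suc n)) = (\<lambda>z. exp_rem (Suc n) z - (\<i> * z) ^ (Suc (Suc n)) / fact (Suc (Suc n)))"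
    by (simp add: exp_rem_def fun_eq_iff)
  have 2: "((\<lambda>z. (\<i> * z) ^ (Suc (Suc n)) / fact (Suc (Suc n))) has_field_derivative \<i> * ((\<i> * z) ^ Suc n / fact (Suc n))) (at z within S)"
  proof -
    have d: "((\<lambda>z. \<i> * z) has_field_derivative \<i>) (at z within S)"
      by (auto intro!: derivative_eq_intros)
    have e: "of_nat (Suc (Suc n)) * (\<i> * a) / fact (Suc (Suc n)) = \<i> * (a / fact (Suc n))" for a :: complex
    proof -
      have "of_nat (Suc (Suc n)) \<noteq> (0::complex)" by (simp only: of_nat_eq_0_iff)
      then show ?thesis by (simp add: fact_Suc[of "Suc n"] field_simps del: fact_Suc of_nat_Suc)
    qed
    from DERIV_cdivide[OF DERIV_power[OF d, of "Suc (Suc n)"], of "fact (Suc (Suc n))"]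
    show ?thesis
      unfolding e diff_Suc_Suc diff_zero .
  qed
  have 3: "\<i> * exp_rem n z - \<i> * ((\<i> * z) ^ Suc n / fact (Suc n)) = \<i> * exp_rem (Suc n) z"
    by (simp add: exp_rem_def algebra_simps)
  show ?case
    unfolding 1 using DERIV_diff[OF Suc 2] unfolding 3 .
qed

lemma exp_rem_0: "exp_rem n 0 = 0"
proof -
  have "(\<Sum>q\<le>n. (0::complex) ^ q / fact q) = (\<Sum>q\<in>{0}. 0 ^ q / fact q)"
    by (rule sum.mono_neutral_right) auto
  then show ?thesis by (simp add: exp_rem_def)
qed

lemma exp_rem_lipschitz:
  fixes a b M :: real
  assumes "\<bar>a\<bar> \<le> M" "\<bar>b\<bar> \<le> M"
  shows "norm (exp_rem n (of_real a) - exp_rem n (of_real b)) \<le> M ^ n * \<bar>a - b\<bar>"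
  using assms
proof (induction n arbitrary: a b)
  case 0
  have "norm (exp (\<i> * complex_of_real a) - exp (\<i> * complex_of_real b)) \<le> 1 * norm (complex_of_real a - complex_of_real b)"
  proof (rule field_differentiable_bound[where S = "complex_of_real ` UNIV" and f' = "\<lambda>z. \<i> * exp (\<i> * z)"])
    show "convex (range complex_of_real)"
      by (intro convex_linear_image) (auto simp: bounded_linear.linear[OF bounded_linear_of_real])
    show "((\<lambda>z. exp (\<i> * z)) has_field_derivative \<i> * exp (\<i> * z)) (at z within range complex_of_real)" for z
      by (auto intro!: derivative_eq_intros)
  qed (auto simp: norm_mult)
  then show ?case by (simp add: exp_rem_def flip: of_real_diff)
next
  case (Suc n)
  have M0: "0 \<le> M" using Suc.prems by linarith
  have "norm (exp_rem (Suc n) (of_real a) - exp_rem (Suc n) (of_real b)) \<le> M ^ Suc n * norm (complex_of_real a - complex_of_real b)"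
  proof (rule field_differentiable_bound[where S = "complex_of_real ` {-M..M}" and f' = "\<lambda>z. \<i> * exp_rem n z"])
    show "convex (complex_of_real ` {-M..M})"
      by (intro convex_linear_image) (auto simp: bounded_linear.linear[OF bounded_linear_of_real])
    show "(exp_rem (Suc n) has_field_derivative \<i> * exp_rem n z) (at z within complex_of_real ` {-M..M})" for z
      by (rule exp_rem_deriv)
    fix z assume "z \<in> complex_of_real ` {-M..M}"
    then obtain t where t: "z = complex_of_real t" "\<bar>t\<bar> \<le> M" by auto
    have "exp_rem n 0 = 0" by (rule exp_rem_0)
    then have "norm (exp_rem n z) \<le> M ^ n * \<bar>t\<bar>"
      using Suc.IH[of t 0] t M0 by simp
    also have "\<dots> \<le> M ^ n * M" using t M0 by (intro mult_left_mono) auto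
    finally show "norm (\<i> * exp_rem n z) \<le> M ^ Suc n" by (simp add: norm_mult mult.commute)
  qed (use Suc.prems in \<open>auto intro!: imageI\<close>)
  then show ?case by (simp flip: of_real_diff)
qed

lemma exp_rem_bound:
  assumes "\<bar>a\<bar> \<le> M"
  shows "norm (exp_rem n (of_real a)) \<le> M ^ Suc n"
proof -
  have "norm (exp_rem n (of_real a)) \<le> M ^ n * \<bar>a\<bar>"
    using exp_rem_lipschitz[of a M 0 n] assms by (simp add: exp_rem_0)
  also have "\<dots> \<le> M ^ n * M"
    using assms by (intro mult_left_mono) auto
  finally show ?thesis by (simp add: mult.commute)
qed

text \<open>Exactness on polynomials removes the Taylor polynomial of the wave about \<open>x j\<close>.\<close>

lemma cis_defect:
  assumes x: "strict_mono x"
  shows "(\<Sum>i\<in>stencil s. coef s x j i *\<^sub>R (cis (\<theta> * x (j + i)) - cis (\<theta> * x j))) - \<i> * of_real \<theta> * cis (\<theta> * x j)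
    = cis (\<theta> * x j) * (\<Sum>i\<in>stencil s. coef s x j i *\<^sub>R exp_rem (2 * s + 1) (of_real (\<theta> * (x (j + i) - x j))))"
proof -
  define Y where "Y i = x (j + i) - x j" for i
  have e: "cis (\<theta> * x (j + i)) - cis (\<theta> * x j) = cis (\<theta> * x j) * (exp_rem (2 * s + 1) (of_real (\<theta> * Y i))
      + (\<Sum>q\<in>{1..2 * s + 1}. (\<i> * of_real (\<theta> * Y i)) ^ q / fact q))" for i
  proof -
    have "cis (\<theta> * x (j + i)) = cis (\<theta> * x j) * exp (\<i> * of_real (\<theta> * Y i))"
      unfolding cis_conv_exp[symmetric] cis_mult Y_def by (rule arg_cong[of _ _ cis]) (simp add: algebra_simps)
    moreover have "{..2 * s + 1} = insert 0 {1..2 * s + 1}" by auto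
    ultimately show ?thesis
      by (simp add: exp_rem_def algebra_simps)
  qed
  have "(\<Sum>i\<in>stencil s. coef s x j i *\<^sub>R (\<Sum>q\<in>{1..2 * s + 1}. (\<i> * of_real (\<theta> * Y i)) ^ q / fact q))
      = (\<Sum>q\<in>{1..2 * s + 1}. (\<i> * of_real \<theta>) ^ q / fact q * of_real (\<Sum>i\<in>stencil s. coef s x j i * Y i ^ q))"
    unfolding of_real_sum sum_distrib_left scaleR_sum_right
    by (subst sum.swap) (simp add: scaleR_conv_of_real power_mult_distrib mult_ac)
  also have "\<dots> = (\<Sum>q\<in>{1..2 * s + 1}. if q = 1 then \<i> * of_real \<theta> else 0)"
    by (intro sum.cong refl) (auto simp: coef_moment[OF x] Y_def)
  also have "\<dots> = \<i> * of_real \<theta>" by simp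
  finally have mom: "(\<Sum>i\<in>stencil s. coef s x j i *\<^sub>R (\<Sum>q\<in>{1..2 * s + 1}. (\<i> * of_real (\<theta> * Y i)) ^ q / fact q)) = \<i> * of_real \<theta>" .
  have "(\<Sum>i\<in>stencil s. coef s x j i *\<^sub>R (cis (\<theta> * x (j + i)) - cis (\<theta> * x j)))
      = cis (\<theta> * x j) * ((\<Sum>i\<in>stencil s. coef s x j i *\<^sub>R exp_rem (2 * s + 1) (of_real (\<theta> * Y i)))
        + (\<Sum>i\<in>stencil s. coef s x j i *\<^sub>R (\<Sum>q\<in>{1..2 * s + 1}. (\<i> * of_real (\<theta> * Y i)) ^ q / fact q)))"
    unfolding e sum.distrib[symmetric] sum_distrib_left
    by (intro sum.cong refl) (simp add: scaleR_add_right distrib_left)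
  then show ?thesis
    unfolding mom by (simp add: Y_def algebra_simps)
qed

lemma symbol_defect:
  "symbol s \<theta> - \<i> * of_real \<theta> = (\<Sum>i\<in>stencil s. uniform_coef s i *\<^sub>R exp_rem (2 * s + 1) (of_real (\<theta> * real_of_int i)))"
  using cis_defect[of real_of_int s 0 \<theta>] by (simp add: strict_mono_def symbol_def)

definition uniform_coef_norm :: "nat \<Rightarrow> real" where
  "uniform_coef_norm s = (\<Sum>i\<in>stencil s. \<bar>uniform_coef s i\<bar>)"

lemma uniform_coef_norm_nonneg: "0 \<le> uniform_coef_norm s"
  by (simp add: uniform_coef_norm_def sum_nonneg)

lemma power_scale: "(2 * real (s + 1) * \<bar>\<theta>\<bar>) ^ n = (2 * real (s + 1)) ^ n * \<bar>\<theta>\<bar> ^ n"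
  by (rule power_mult_distrib)

lemma symbol_defect_bound:
  "norm (symbol s \<theta> - \<i> * of_real \<theta>) \<le> uniform_coef_norm s * (2 * real (s + 1)) ^ (2 * s + 2) * \<bar>\<theta>\<bar> ^ (2 * s + 2)"
proof -
  have "norm (symbol s \<theta> - \<i> * of_real \<theta>) \<le> (\<Sum>i\<in>stencil s. \<bar>uniform_coef s i\<bar> * (2 * real (s + 1) * \<bar>\<theta>\<bar>) ^ (2 * s + 2))"
    unfolding symbol_defect
  proof (rule sum_norm_le)
    fix i assume i: "i \<in> stencil s"
    have "\<bar>real_of_int i\<bar> \<le> 2 * real (s + 1)" using stencil_abs_le_real[OF i] by simp
    then have "\<bar>\<theta> * real_of_int i\<bar> \<le> 2 * real (s + 1) * \<bar>\<theta>\<bar>"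
      by (simp add: abs_mult mult.commute mult_left_mono)
    from exp_rem_bound[OF this, of "2 * s + 1"]
    show "norm (uniform_coef s i *\<^sub>R exp_rem (2 * s + 1) (of_real (\<theta> * real_of_int i))) \<le> \<bar>uniform_coef s i\<bar> * (2 * real (s + 1) * \<bar>\<theta>\<bar>) ^ (2 * s + 2)"
      by (simp add: mult_left_mono)
  qed
  then show ?thesis
    unfolding power_scale by (simp add: uniform_coef_norm_def mult.assoc flip: sum_distrib_right)
qed

lemma norm_cis_diff_le: "norm (cis a - cis b) \<le> \<bar>a - b\<bar>"
  using exp_rem_lipschitz[of a "max \<bar>a\<bar> \<bar>b\<bar>" b 0] by (simp add: exp_rem_def cis_conv_exp)

lemma mesh_offset:
  assumes m: "m > 0" and n: "near_uniform \<mu> x" and x0: "x 0 = 0" and per: "\<And>j. x (j + int m) = x j + real m"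
  shows "\<bar>x j - real_of_int j\<bar> \<le> real m * \<mu>"
proof -
  have "\<bar>x 1 - x 0 - 1\<bar> \<le> \<mu>" using n unfolding near_uniform_def by (metis add_0)
  then have \<mu>0: "0 \<le> \<mu>" by linarith
  have shift: "x (i + int m * b) = x i + real m * real_of_int b" for i b
  proof (induction b rule: int_induct[where k = 0])
    case (step1 b)
    then show ?case using per[of "i + int m * b"] by (simp add: algebra_simps)
  next
    case (step2 b)
    then show ?case using per[of "i + int m * (b - 1)"] by (simp add: algebra_simps)
  qed simp
  define r where "r = j mod int m"
  have r: "0 \<le> r" "r < int m" using m by (auto simp: r_def)
  have j: "j = r + int m * (j div int m)" by (simp add: r_def)
  have "real_of_int j = real_of_int r + real m * real_of_int (j div int m)"
    by (subst j) simp
  moreover have "x j = x r + real m * real_of_int (j div int m)"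
    by (subst j) (rule shift)
  ultimately have "x j - real_of_int j = x r - real_of_int r" by simp
  moreover have "\<bar>x r - real_of_int r\<bar> \<le> real_of_int r * \<mu>"
    using near_uniform_dist_le[OF n r(1)] x0 by simp
  moreover have "real_of_int r * \<mu> \<le> real m * \<mu>"
    using r \<mu>0 by (intro mult_right_mono) linarith+
  ultimately show ?thesis by linarith
qed

text \<open>The defect of a sampled plane wave is compared with the one on the uniform mesh. Both are of order
\<open>\<theta> ^ (2 s + 2)\<close>; the difference is moreover small with the deviation of the mesh.\<close>

lemma defect_close:
  assumes m: "m > 0" and n: "near_uniform \<mu> x" and \<mu>: "\<mu> < 1" and x0: "x 0 = 0" and per: "\<And>j. x (j + int m) = x j + real m"
    and \<theta>: "\<bar>\<theta>\<bar> \<le> pi / real m"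
    and c: "\<And>j i. i \<in> stencil s \<Longrightarrow> \<bar>coef s x j i - uniform_coef s i\<bar> \<le> \<eta>"
  shows "norm ((\<Sum>i\<in>stencil s. coef s x j i *\<^sub>R (cis (\<theta> * x (j + i)) - cis (\<theta> * x j))) - \<i> * of_real \<theta> * cis (\<theta> * x j)
      - (symbol s \<theta> - \<i> * of_real \<theta>) * wave \<theta> j)
    \<le> (real (2 * s + 1) * \<eta> + 5 * uniform_coef_norm s * \<mu>) * (2 * real (s + 1)) ^ (2 * s + 2) * \<bar>\<theta>\<bar> ^ (2 * s + 2)"
proof -
  define M where "M = 2 * real (s + 1) * \<bar>\<theta>\<bar>"
  define \<beta> where "\<beta> = M ^ (2 * s + 2)"
  have M0: "0 \<le> M" and \<beta>0: "0 \<le> \<beta>" by (simp_all add: M_def \<beta>_def)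
  have "\<bar>x 1 - x 0 - 1\<bar> \<le> \<mu>" using n unfolding near_uniform_def by (metis add_0)
  then have \<mu>0: "0 \<le> \<mu>" by linarith
  define Y where "Y i = x (j + i) - x j" for i
  define E where "E = cis (\<theta> * x j)"
  define f where "f = wave \<theta> j"
  define p where "p t = exp_rem (2 * s + 1) (of_real (\<theta> * t))" for t
  have Ef: "norm (E - f) \<le> 4 * \<mu>"
  proof -
    have "norm (E - f) \<le> \<bar>\<theta> * x j - \<theta> * real_of_int j\<bar>"
      unfolding E_def f_def wave_def by (rule norm_cis_diff_le)
    also have "\<dots> = \<bar>\<theta>\<bar> * \<bar>x j - real_of_int j\<bar>"
      by (simp add: abs_mult flip: right_diff_distrib)
    also have "\<dots> \<le> pi / real m * (real m * \<mu>)"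
      using \<theta> mesh_offset[where m = m and x = x, OF m n x0 per, of j] by (intro mult_mono) auto
    also have "\<dots> = pi * \<mu>" using m by simp
    also have "\<dots> \<le> 4 * \<mu>" using pi_less_4 \<mu>0 by (intro mult_right_mono) auto
    finally show ?thesis .
  qed
  have summand: "norm (coef s x j i *\<^sub>R (E * p (Y i)) - uniform_coef s i *\<^sub>R (f * p (real_of_int i))) \<le> \<eta> * \<beta> + \<bar>uniform_coef s i\<bar> * (5 * \<mu> * \<beta>)"
    if i: "i \<in> stencil s" for i
  proof -
    have i1: "\<bar>real_of_int i\<bar> \<le> real (s + 1)" by (rule stencil_abs_le_real[OF i])
    have Yi: "\<bar>Y i - real_of_int i\<bar> \<le> real (s + 1) * \<mu>"
      using near_uniform_dist[OF n, of j i] mult_right_mono[OF i1 \<mu>0] by (simp add: Y_def)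
    also have "\<dots> \<le> real (s + 1) * 1" using \<mu> by (intro mult_left_mono) auto
    finally have d: "\<bar>Y i - real_of_int i\<bar> \<le> real (s + 1)" by simp
    have "\<bar>Y i\<bar> \<le> \<bar>Y i - real_of_int i\<bar> + \<bar>real_of_int i\<bar>" by linarith
    then have Y2: "\<bar>Y i\<bar> \<le> 2 * real (s + 1)" using add_mono[OF d i1] by simp
    have i2: "\<bar>real_of_int i\<bar> \<le> 2 * real (s + 1)" using i1 by simp
    have YM: "\<bar>\<theta> * Y i\<bar> \<le> M" "\<bar>\<theta> * real_of_int i\<bar> \<le> M"
      using Y2 i2 by (simp_all add: M_def abs_mult mult.commute mult_left_mono)
    have pY: "norm (p (Y i)) \<le> \<beta>"
      using exp_rem_bound[OF YM(1), of "2 * s + 1"] by (simp add: p_def \<beta>_def)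
    have pd: "norm (p (Y i) - p (real_of_int i)) \<le> \<mu> * \<beta>"
    proof -
      have "norm (p (Y i) - p (real_of_int i)) \<le> M ^ (2 * s + 1) * \<bar>\<theta> * Y i - \<theta> * real_of_int i\<bar>"
        unfolding p_def by (rule exp_rem_lipschitz[OF YM])
      also have "\<bar>\<theta> * Y i - \<theta> * real_of_int i\<bar> = \<bar>\<theta>\<bar> * \<bar>Y i - real_of_int i\<bar>"
        by (simp add: abs_mult flip: right_diff_distrib)
      also have "M ^ (2 * s + 1) * (\<bar>\<theta>\<bar> * \<bar>Y i - real_of_int i\<bar>) \<le> M ^ (2 * s + 1) * (\<bar>\<theta>\<bar> * (2 * (real (s + 1) * \<mu>)))"
        using Yi M0 \<mu>0 by (intro mult_left_mono) auto
      also have "\<dots> = \<mu> * \<beta>" by (simp add: \<beta>_def M_def)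
      finally show ?thesis .
    qed
    have "coef s x j i *\<^sub>R (E * p (Y i)) - uniform_coef s i *\<^sub>R (f * p (real_of_int i))
        = (coef s x j i - uniform_coef s i) *\<^sub>R (E * p (Y i)) + uniform_coef s i *\<^sub>R ((E - f) * p (Y i) + f * (p (Y i) - p (real_of_int i)))"
      by (simp add: algebra_simps)
    also have "norm \<dots> \<le> norm ((coef s x j i - uniform_coef s i) *\<^sub>R (E * p (Y i))) + norm (uniform_coef s i *\<^sub>R ((E - f) * p (Y i) + f * (p (Y i) - p (real_of_int i))))"
      by (rule norm_triangle_ineq)
    also have "norm ((coef s x j i - uniform_coef s i) *\<^sub>R (E * p (Y i))) \<le> \<eta> * \<beta>"
      using c[OF i, of j] pY by (auto simp: norm_mult E_def intro!: mult_mono)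
    also have "norm (uniform_coef s i *\<^sub>R ((E - f) * p (Y i) + f * (p (Y i) - p (real_of_int i)))) \<le> \<bar>uniform_coef s i\<bar> * (5 * \<mu> * \<beta>)"
    proof -
      have "norm ((E - f) * p (Y i)) \<le> 4 * \<mu> * \<beta>"
        unfolding norm_mult using Ef pY \<mu>0 by (intro mult_mono) auto
      moreover have "norm (f * (p (Y i) - p (real_of_int i))) \<le> \<mu> * \<beta>"
        using pd by (simp add: norm_mult f_def)
      ultimately have "norm ((E - f) * p (Y i) + f * (p (Y i) - p (real_of_int i))) \<le> 5 * \<mu> * \<beta>"
        using norm_triangle_ineq[of "(E - f) * p (Y i)" "f * (p (Y i) - p (real_of_int i))"] by linarith
      then show ?thesis by (simp add: mult_left_mono)
    qed
    finally show ?thesis by simp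
  qed
  have "(\<Sum>i\<in>stencil s. coef s x j i *\<^sub>R (cis (\<theta> * x (j + i)) - cis (\<theta> * x j))) - \<i> * of_real \<theta> * cis (\<theta> * x j)
      - (symbol s \<theta> - \<i> * of_real \<theta>) * wave \<theta> j
      = (\<Sum>i\<in>stencil s. coef s x j i *\<^sub>R (E * p (Y i)) - uniform_coef s i *\<^sub>R (f * p (real_of_int i)))"
    unfolding cis_defect[OF near_uniform_strict_mono[OF n \<mu>]] symbol_defect
    by (simp add: sum_subtractf sum_distrib_left sum_distrib_right E_def p_def Y_def f_def mult.commute)
  also have "norm \<dots> \<le> (\<Sum>i\<in>stencil s. \<eta> * \<beta> + \<bar>uniform_coef s i\<bar> * (5 * \<mu> * \<beta>))"
    by (rule sum_norm_le) (rule summand)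
  also have "\<dots> = (real (2 * s + 1) * \<eta> + 5 * uniform_coef_norm s * \<mu>) * \<beta>"
    by (simp add: sum.distrib card_stencil uniform_coef_norm_def algebra_simps flip: sum_distrib_right sum_distrib_left)
  moreover have "\<beta> = (2 * real (s + 1)) ^ (2 * s + 2) * \<bar>\<theta>\<bar> ^ (2 * s + 2)"
    by (simp only: \<beta>_def M_def power_scale)
  ultimately show ?thesis
    by (simp only: mult.assoc)
qed

lemma norm_cis_minus_one_square: "(norm (cis \<phi> - 1))\<^sup>2 = 2 - 2 * cos \<phi>"
proof -
  have "(norm (cis \<phi> - 1))\<^sup>2 = ((cos \<phi>)\<^sup>2 + (sin \<phi>)\<^sup>2) + (1 - 2 * cos \<phi>)"
    by (simp add: cmod_power2 power2_diff)
  then show ?thesis by simp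
qed

text \<open>For small \<open>\<theta>\<close> by Taylor's formula, and otherwise since the chord length increases with the angle.\<close>

lemma abs_le_norm_cis_minus_one:
  obtains C :: real where "C > 0" "\<And>\<theta>. \<bar>\<theta>\<bar> \<le> pi \<Longrightarrow> \<bar>\<theta>\<bar> \<le> C * norm (cis \<theta> - 1)"
proof -
  define b where "b = sqrt (2 - 2 * cos (1 / 2))"
  have "cos (1 / 2) < cos (0::real)"
    by (rule cos_monotone_0_pi) (use pi_gt3 in auto)
  then have b: "b > 0" by (simp add: b_def)
  define C where "C = max 2 (pi / b)"
  have "\<bar>\<theta>\<bar> \<le> C * norm (cis \<theta> - 1)" if \<theta>: "\<bar>\<theta>\<bar> \<le> pi" for \<theta>
  proof (cases "\<bar>\<theta>\<bar> \<le> 1 / 2")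
    case True
    have "norm (cis \<theta> - 1 - \<i> * of_real \<theta>) \<le> \<bar>\<theta>\<bar> ^ 2"
      using exp_rem_bound[of \<theta> "\<bar>\<theta>\<bar>" 1] by (simp add: exp_rem_def cis_conv_exp numeral_2_eq_2 algebra_simps)
    also have "\<dots> \<le> 1 / 2 * \<bar>\<theta>\<bar>" unfolding power2_eq_square using True by (intro mult_right_mono) auto
    finally have "norm (\<i> * of_real \<theta>) - norm (cis \<theta> - 1) \<le> 1 / 2 * \<bar>\<theta>\<bar>"
      using norm_triangle_ineq2[of "\<i> * of_real \<theta>" "cis \<theta> - 1"] by (simp add: norm_minus_commute)
    then have "\<bar>\<theta>\<bar> \<le> 2 * norm (cis \<theta> - 1)" by (simp add: norm_mult)
    also have "\<dots> \<le> C * norm (cis \<theta> - 1)" by (intro mult_right_mono) (auto simp: C_def)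
    finally show ?thesis .
  next
    case False
    have "cos \<bar>\<theta>\<bar> \<le> cos (1 / 2)"
      by (rule cos_monotone_0_pi_le) (use False \<theta> in auto)
    then have "b\<^sup>2 \<le> (norm (cis \<theta> - 1))\<^sup>2"
      unfolding norm_cis_minus_one_square by (simp add: b_def)
    then have "b \<le> norm (cis \<theta> - 1)" by (rule power2_le_imp_le) simp
    have "\<bar>\<theta>\<bar> \<le> pi / b * b" using \<theta> b by simp
    also have "\<dots> \<le> C * norm (cis \<theta> - 1)"
      using \<open>b \<le> norm (cis \<theta> - 1)\<close> b by (intro mult_mono) (auto simp: C_def)
    finally show ?thesis .
  qed
  moreover have "C > 0" by (simp add: C_def)
  ultimately show ?thesis using that by blast
qed

text \<open>All frequencies of a block but the base frequency stay away from the multiples of \<open>2 \<pi>\<close>.\<close>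

lemma Re_symbol_gap:
  assumes m: "m > 0" and \<theta>: "\<bar>\<theta>\<bar> \<le> pi / real m" and k: "0 < k" "k < m"
  shows "dissipation s * (2 - 2 * cos (pi / real m)) ^ (s + 1) \<le> Re (symbol s (bfreq m \<theta> k))"
proof -
  define b where "b = pi / real m"
  define \<phi> where "\<phi> = bfreq m \<theta> k"
  have b: "0 < b" "b \<le> pi" using m by (simp_all add: b_def divide_le_eq)
  have \<phi>e: "\<phi> = \<theta> + 2 * real k * b" by (simp add: \<phi>_def bfreq_def b_def)
  have bm: "real m * b = pi" using m by (simp add: b_def)
  have "1 * b \<le> real k * b" using k b by (intro mult_right_mono) auto
  moreover have "real k * b \<le> (real m - 1) * b" using k b by (intro mult_right_mono) auto
  ultimately have \<phi>: "b \<le> \<phi>" "\<phi> \<le> 2 * pi - b"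
    using \<theta> bm by (auto simp: \<phi>e b_def[symmetric] algebra_simps abs_le_iff)
  have "cos \<phi> \<le> cos b"
  proof (cases "\<phi> \<le> pi")
    case True
    then show ?thesis using \<phi> b by (intro cos_monotone_0_pi_le) auto
  next
    case False
    have "cos \<phi> = cos (2 * pi - \<phi>)" by (simp add: cos_diff)
    also have "\<dots> \<le> cos b" using \<phi> b False by (intro cos_monotone_0_pi_le) auto
    finally show ?thesis .
  qed
  then have "(2 - 2 * cos b) ^ (s + 1) \<le> ((norm (cis \<phi> - 1))\<^sup>2) ^ (s + 1)"
    unfolding norm_cis_minus_one_square by (intro power_mono) auto
  then show ?thesis
    unfolding Re_symbol power_even_split using dissipation_pos[of s]
    by (simp add: \<phi>_def b_def mult_left_mono del: power_Suc)
qed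

section \<open>Stability\<close>

lemma cis_mesh_period:
  assumes "\<And>j. x (j + int m) = x j + real m"
  shows "cis (\<theta> * x (j + int m)) = cis (\<theta> * real m) * cis (\<theta> * x j)"
  unfolding assms cis_mult by (rule arg_cong[of _ _ cis]) (simp add: algebra_simps)

lemma wave_bfreq_0 [simp]: "wave (bfreq m \<theta> 0) = wave \<theta>"
  by (simp add: bfreq_def)

lemma bfreq_0 [simp]: "bfreq m \<theta> 0 = \<theta>"
  by (simp add: bfreq_def)

text \<open>The bound is relative to \<open>\<theta>\<close>, since the increments will be divided by \<open>cis \<theta> - 1\<close>.\<close>

lemma sampled_wave_close:
  assumes m: "m > 0" and n: "near_uniform \<mu> x" and x0: "x 0 = 0" and per: "\<And>j. x (j + int m) = x j + real m"
    and \<theta>: "\<bar>\<theta>\<bar> \<le> pi / real m"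
  shows "norm ((cis (\<theta> * x (j + 1)) - cis (\<theta> * x j)) - (cis \<theta> - 1) * wave \<theta> j) \<le> 10 * real m * \<mu> * \<bar>\<theta>\<bar>"
proof -
  have st: "\<bar>x (j + 1) - x j - 1\<bar> \<le> \<mu>" using n by (simp add: near_uniform_def)
  then have \<mu>0: "0 \<le> \<mu>" by linarith
  have m1: "1 \<le> real m" using m by simp
  have off: "\<bar>x j - real_of_int j\<bar> \<le> real m * \<mu>"
    by (rule mesh_offset[where m = m and x = x, OF m n x0 per])
  define h where "h = x (j + 1) - x j"
  have \<theta>4: "\<bar>\<theta>\<bar> \<le> 4"
  proof -
    have "pi / real m \<le> pi" using m by (simp add: divide_le_eq)
    then show ?thesis using \<theta> pi_less_4 by linarith
  qed
  have e: "cis (\<theta> * x (j + 1)) = cis (\<theta> * x j) * cis (\<theta> * h)"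
    unfolding cis_mult h_def by (rule arg_cong[of _ _ cis]) (simp add: algebra_simps)
  have "(cis (\<theta> * x (j + 1)) - cis (\<theta> * x j)) - (cis \<theta> - 1) * wave \<theta> j
      = (cis (\<theta> * x j) - wave \<theta> j) * (cis \<theta> - 1) + cis (\<theta> * x j) * (cis (\<theta> * h) - cis \<theta>)"
    unfolding e by (simp add: algebra_simps)
  then have "norm ((cis (\<theta> * x (j + 1)) - cis (\<theta> * x j)) - (cis \<theta> - 1) * wave \<theta> j)
      \<le> norm (cis (\<theta> * x j) - wave \<theta> j) * norm (cis \<theta> - 1) + norm (cis (\<theta> * h) - cis \<theta>)"
    by (metis mult_1 norm_cis norm_mult norm_triangle_ineq)
  also have "norm (cis (\<theta> * h) - cis \<theta>) \<le> \<bar>\<theta>\<bar> * \<mu>"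
  proof -
    have "norm (cis (\<theta> * h) - cis \<theta>) \<le> \<bar>\<theta> * h - \<theta>\<bar>" by (rule norm_cis_diff_le)
    also have "\<dots> = \<bar>\<theta>\<bar> * \<bar>h - 1\<bar>" by (simp add: abs_mult[symmetric] algebra_simps)
    also have "\<dots> \<le> \<bar>\<theta>\<bar> * \<mu>" using st by (intro mult_left_mono) (auto simp: h_def)
    finally show ?thesis .
  qed
  also have "norm (cis (\<theta> * x j) - wave \<theta> j) * norm (cis \<theta> - 1) \<le> (\<bar>\<theta>\<bar> * (real m * \<mu>)) * 2"
  proof (intro mult_mono)
    have "norm (cis (\<theta> * x j) - wave \<theta> j) \<le> \<bar>\<theta> * x j - \<theta> * real_of_int j\<bar>"
      unfolding wave_def by (rule norm_cis_diff_le)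
    also have "\<dots> = \<bar>\<theta>\<bar> * \<bar>x j - real_of_int j\<bar>" by (simp add: abs_mult[symmetric] algebra_simps)
    also have "\<dots> \<le> \<bar>\<theta>\<bar> * (real m * \<mu>)" using off by (intro mult_left_mono) auto
    finally show "norm (cis (\<theta> * x j) - wave \<theta> j) \<le> \<bar>\<theta>\<bar> * (real m * \<mu>)" .
  qed (use norm_cis_minus_one_le \<mu>0 in auto)
  also have "\<bar>\<theta>\<bar> * (real m * \<mu>) * 2 + \<bar>\<theta>\<bar> * \<mu> \<le> \<bar>\<theta>\<bar> * (real m * \<mu>) * 2 + \<bar>\<theta>\<bar> * (real m * \<mu>)"
    using mult_right_mono[OF m1 \<mu>0] by (intro add_left_mono mult_left_mono) auto
  also have "\<dots> \<le> 10 * real m * \<mu> * \<bar>\<theta>\<bar>" using \<mu>0 by simp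
  finally show ?thesis by simp
qed

text \<open>If the base frequency is well damped, or if it is zero and the mean vanishes, the Euclidean norm serves. Otherwise
\<open>near_mode_energy\<close> applies with \<open>r\<close> the coefficients of the increments of the plane wave on the mesh, normalised to be
close to the pure wave, and \<open>\<nu> = \<i> * \<theta>\<close>, the exact eigenvalue of the derivative.\<close>

lemma mode_form_exists:
  assumes m: "m > 0" and \<delta>: "\<delta> > 0"
  obtains \<mu> where "\<mu> > 0" "\<mu> < 1"
    "\<And>x \<theta>. near_uniform \<mu> x \<Longrightarrow> x 0 = 0 \<Longrightarrow> (\<And>j. x (j + int m) = x j + real m) \<Longrightarrow> \<bar>\<theta>\<bar> \<le> pi / real m
      \<Longrightarrow> \<exists>T. \<forall>z. (\<theta> = 0 \<longrightarrow> z 0 = 0) \<longrightarrow> mode_form m \<delta> (bloch_matrix s x m \<theta>) T z"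
proof -
  define \<kappa> where "\<kappa> = dissipation s"
  have \<kappa>: "\<kappa> > 0" by (simp add: \<kappa>_def dissipation_pos)
  define G where "G = \<kappa> * (2 - 2 * cos (pi / real m)) ^ (s + 1)"
  have "cos (pi / real m) < cos 0"
    by (rule cos_monotone_0_pi) (use m in \<open>auto simp: divide_le_eq\<close>)
  then have G: "G > 0" using \<kappa> by (simp add: G_def del: power_Suc)
  define g where "g = G / 2"
  have g: "g > 0" using G by (simp add: g_def)
  obtain C where C: "C > 0" "\<And>\<theta>. \<bar>\<theta>\<bar> \<le> pi \<Longrightarrow> \<bar>\<theta>\<bar> \<le> C * norm (cis \<theta> - 1)"
    by (rule abs_le_norm_cis_minus_one) blast
  define c where "c = (2 * real (s + 1)) ^ (2 * s + 2)"
  have c0: "c > 0" by (simp add: c_def)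
  define K where "K = uniform_coef_norm s * c * C ^ (2 * s + 2)"
  have K: "K \<ge> 0" using C c0 uniform_coef_norm_nonneg by (simp add: K_def)
  obtain \<epsilon> where \<epsilon>: "\<epsilon> > 0" and near_mode:
    "\<And>L r \<rho> P \<tau> \<nu>. \<lbrakk>0 \<le> \<tau>; \<tau> \<le> 2;
      \<And>i k. i < m \<Longrightarrow> k < m \<Longrightarrow> norm (P i k) \<le> \<epsilon>;
      \<And>k. 0 < k \<Longrightarrow> k < m \<Longrightarrow> norm (P 0 k) \<le> \<epsilon> * \<tau>;
      norm (r 0 - 1) \<le> \<epsilon>; \<And>k. 0 < k \<Longrightarrow> k < m \<Longrightarrow> norm (r k) \<le> \<epsilon>;
      \<And>k. k < m \<Longrightarrow> L k * r k + (\<Sum>i<m. P k i * r i) = \<nu> * r k + \<rho> k;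
      norm (\<rho> 0 - (L 0 - \<nu>)) \<le> \<epsilon> * \<tau> ^ (2 * s + 2);
      \<And>k. 0 < k \<Longrightarrow> k < m \<Longrightarrow> norm (\<rho> k) \<le> \<epsilon> * \<tau> ^ (2 * s + 1);
      Re (L 0) = \<kappa> * \<tau> ^ (2 * s + 2);
      \<And>k. 0 < k \<Longrightarrow> k < m \<Longrightarrow> g + Re (L 0) \<le> Re (L k);
      norm (L 0 - \<nu>) \<le> K * \<tau> ^ (2 * s + 2)\<rbrakk>
      \<Longrightarrow> \<exists>T. \<forall>z. mode_form m \<delta> (\<lambda>k l. (if k = l then L k else 0) + P k l) T z"
    by (rule near_mode_energy[OF m \<kappa> g K \<delta>, of s]) blast
  define Ks where "Ks = real (2 * s + 1) * real (s + 1)"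
  have Ks: "Ks > 0" by (simp add: Ks_def add_pos_nonneg)
  define e where "e = min (\<epsilon> / 2) (g / (2 * real m))"
  have e: "e > 0" "2 * e \<le> \<epsilon>" "real m * (2 * e) \<le> g"
  proof -
    show "e > 0" using \<epsilon> g m by (simp add: e_def)
    show "2 * e \<le> \<epsilon>" by (simp add: e_def)
    have "e \<le> g / (2 * real m)" by (simp add: e_def)
    then show "real m * (2 * e) \<le> g" using m by (simp add: field_simps)
  qed
  define D where "D = c * C ^ (2 * s + 2)"
  have D: "D > 0" using c0 C by (simp add: D_def)
  define \<eta> where "\<eta> = min (e / Ks) (\<epsilon> / (4 * D * real (2 * s + 1)))"
  have \<eta>: "\<eta> > 0" "\<eta> * Ks \<le> e" "real (2 * s + 1) * \<eta> * D \<le> \<epsilon> / 4"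
  proof -
    have d: "4 * D * real (2 * s + 1) > 0" using D by simp
    show "\<eta> > 0" unfolding \<eta>_def using e(1) Ks \<epsilon> d by (simp only: min_less_iff_conj) (intro conjI divide_pos_pos)
    have "\<eta> \<le> e / Ks" by (simp add: \<eta>_def)
    then show "\<eta> * Ks \<le> e" using Ks by (simp add: pos_le_divide_eq)
    have "\<eta> \<le> \<epsilon> / (4 * D * real (2 * s + 1))" unfolding \<eta>_def by (rule min.cobounded2)
    then have "\<eta> * (4 * D * real (2 * s + 1)) \<le> \<epsilon>" using pos_le_divide_eq[OF d] by blast
    then show "real (2 * s + 1) * \<eta> * D \<le> \<epsilon> / 4" by (simp add: algebra_simps)
  qed
  obtain \<mu>1 where \<mu>1: "\<mu>1 > 0" "\<And>X j i. near_uniform \<mu>1 X \<Longrightarrow> i \<in> stencil s \<Longrightarrow> \<bar>coef s X j i - uniform_coef s i\<bar> \<le> \<eta>"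
    by (rule coef_close[OF \<eta>(1), of s]) blast
  define U where "U = 5 * uniform_coef_norm s + 1"
  have U: "U > 0" using uniform_coef_norm_nonneg[of s] by (simp add: U_def)
  define \<mu> where "\<mu> = min (min \<mu>1 (1/2)) (min (\<epsilon> / (4 * D * U)) (\<epsilon> / (10 * real m * C)))"
  have \<mu>: "\<mu> > 0" "\<mu> < 1" "\<mu> \<le> \<mu>1" "5 * uniform_coef_norm s * \<mu> * D \<le> \<epsilon> / 4" "10 * real m * \<mu> * C \<le> \<epsilon>"
  proof -
    show "\<mu> > 0" using \<mu>1 \<epsilon> D U m C by (simp add: \<mu>_def)
    then have "5 * uniform_coef_norm s * (\<mu> * D) \<le> U * (\<mu> * D)"
      using D by (intro mult_right_mono) (auto simp: U_def)
    have "\<mu> \<le> 1 / 2" unfolding \<mu>_def by (rule order_trans[OF min.cobounded1 min.cobounded2])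
    then show "\<mu> < 1" by simp
    show "\<mu> \<le> \<mu>1" by (simp add: \<mu>_def)
    have "\<mu> \<le> \<epsilon> / (4 * D * U)" by (simp add: \<mu>_def)
    moreover have "4 * D * U > 0" using D U by simp
    ultimately have "\<mu> * (4 * D * U) \<le> \<epsilon>" using pos_le_divide_eq by blast
    moreover note \<open>5 * uniform_coef_norm s * (\<mu> * D) \<le> U * (\<mu> * D)\<close>
    ultimately show "5 * uniform_coef_norm s * \<mu> * D \<le> \<epsilon> / 4" by (simp add: algebra_simps)
    have "\<mu> \<le> \<epsilon> / (10 * real m * C)" by (simp add: \<mu>_def)
    moreover have "10 * real m * C > 0" using m C by simp
    ultimately have "\<mu> * (10 * real m * C) \<le> \<epsilon>" using pos_le_divide_eq by blast
    then show "10 * real m * \<mu> * C \<le> \<epsilon>" by (simp add: algebra_simps)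
  qed
  show ?thesis
  proof (rule that[OF \<mu>(1,2)])
    fix x :: "int \<Rightarrow> real" and \<theta> :: real
    assume n: "near_uniform \<mu> x" and x0: "x 0 = 0" and per: "\<And>j. x (j + int m) = x j + real m" and \<theta>: "\<bar>\<theta>\<bar> \<le> pi / real m"
    have co: "\<bar>coef s x j i - uniform_coef s i\<bar> \<le> \<eta>" if "i \<in> stencil s" for i j
      using \<mu>1(2)[OF near_uniform_mono[OF n \<mu>(3)] that] .
    define L where "L k = symbol s (bfreq m \<theta> k)" for k
    define P where "P k l = bloch_matrix s x m \<theta> k l - (if k = l then L k else 0)" for k l
    have BP: "bloch_matrix s x m \<theta> = (\<lambda>k l. (if k = l then L k else 0) + P k l)"
      by (simp add: P_def fun_eq_iff)
    define \<tau> where "\<tau> = norm (cis \<theta> - 1)"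
    have \<tau>: "0 \<le> \<tau>" "\<tau> \<le> 2" by (simp_all add: \<tau>_def norm_cis_minus_one_le)
    have \<theta>pi: "\<bar>\<theta>\<bar> \<le> pi"
    proof -
      have "pi / real m \<le> pi" using m by (simp add: divide_le_eq)
      then show ?thesis using \<theta> by linarith
    qed
    have \<theta>\<tau>: "\<bar>\<theta>\<bar> \<le> C * \<tau>" using C(2)[OF \<theta>pi] by (simp add: \<tau>_def)
    have \<theta>\<beta>: "c * \<bar>\<theta>\<bar> ^ (2 * s + 2) \<le> D * \<tau> ^ (2 * s + 2)"
    proof -
      have "\<bar>\<theta>\<bar> ^ (2 * s + 2) \<le> (C * \<tau>) ^ (2 * s + 2)" using \<theta>\<tau> by (intro power_mono) auto
      then have "c * \<bar>\<theta>\<bar> ^ (2 * s + 2) \<le> c * (C ^ (2 * s + 2) * \<tau> ^ (2 * s + 2))"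
        using c0 unfolding power_mult_distrib by (intro mult_left_mono) auto
      then show ?thesis by (simp only: D_def mult.assoc)
    qed
    have Pb: "norm (P k l) \<le> norm (cis (bfreq m \<theta> k) - 1) * e" if "k < m" "l < m" for k l
    proof -
      have "norm (P k l) \<le> norm (cis (bfreq m \<theta> k) - 1) * (\<eta> * Ks)"
        unfolding P_def L_def Ks_def
        by (rule bloch_matrix_perturbation_bound[where m = m and x = x, OF m per that co])
      also have "\<dots> \<le> norm (cis (bfreq m \<theta> k) - 1) * e"
        using \<eta>(2) by (intro mult_left_mono) auto
      finally show ?thesis .
    qed
    have P2: "norm (P k l) \<le> 2 * e" if "k < m" "l < m" for k l
      using Pb[OF that] mult_right_mono[OF norm_cis_minus_one_le[of "bfreq m \<theta> k"], of e] e(1) by linarith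
    have ReL0: "Re (L 0) = \<kappa> * \<tau> ^ (2 * s + 2)"
      by (simp add: L_def Re_symbol \<kappa>_def \<tau>_def)
    have ReL: "2 * g \<le> Re (L k)" if "0 < k" "k < m" for k
      using Re_symbol_gap[OF m \<theta> that, of s] by (simp add: g_def G_def \<kappa>_def L_def del: power_Suc)
    show "\<exists>T. \<forall>z. (\<theta> = 0 \<longrightarrow> z 0 = 0) \<longrightarrow> mode_form m \<delta> (bloch_matrix s x m \<theta>) T z"
    \<comment> \<open>The second case may assume a gap between \<open>L 0\<close> and the other eigenvalues, which could collide if \<open>L 0\<close> were well damped.\<close>
    proof (cases "\<theta> = 0 \<or> g \<le> Re (L 0)")
      case True
      have "mode_form m \<delta> (bloch_matrix s x m \<theta>) (\<lambda>k l. if k = l then 1 else 0) z" if z: "\<theta> = 0 \<longrightarrow> z 0 = 0" for z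
        unfolding BP
      proof (rule far_mode_energy[OF g less_imp_le[OF \<delta>] P2 e(3)])
        show "z k = 0 \<or> g \<le> Re (L k)" if "k < m" for k
          using True z ReL[of k] that g by (cases "k = 0") auto
      qed
      then show ?thesis by blast
    next
      case False
      then have \<theta>0: "\<theta> \<noteq> 0" and near0: "Re (L 0) \<le> g" by auto
      have \<tau>0: "\<tau> > 0" using \<theta>\<tau> \<theta>0 C by (smt (verit) mult_nonneg_nonneg zero_less_abs_iff zero_less_mult_pos)
      define q where "q = cis \<theta> - 1"
      have q0: "q \<noteq> 0" using \<tau>0 by (auto simp: q_def \<tau>_def)
      define E where "E j = cis (\<theta> * x j)" for j
      have Eper: "E (j + int m) = cis (\<theta> * real m) * E j" for j
        unfolding E_def by (rule cis_mesh_period) (rule per)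
      define v where "v j = (E (j + 1) - E j) / q" for j
      have Eper1: "E (j + int m + 1) = cis (\<theta> * real m) * E (j + 1)" for j
        using Eper[of "j + 1"] by (simp add: ac_simps)
      have vper: "v (j + int m) = cis (\<theta> * real m) * v j" for j
        unfolding v_def Eper1 Eper by (simp add: right_diff_distrib)
      define r where "r k = bloch_coeff m (bfreq m \<theta> k) v" for k
      have vr: "v = (\<lambda>j. \<Sum>l<m. r l * wave (bfreq m \<theta> l) j)"
        using bloch_inversion[of m v \<theta>, OF m vper] by (simp add: r_def fun_eq_iff)
      define \<nu> where "\<nu> = \<i> * of_real \<theta>"
      define d where "d = L 0 - \<nu>"
      \<comment> \<open>The defect of the plane wave at the nodes; \<open>\<rho>\<close> is its increment in Bloch coefficients, divided by \<open>q\<close>.\<close>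
      define R where "R j = (\<Sum>i\<in>stencil s. coef s x j i *\<^sub>R (E (j + i) - E j)) - \<nu> * E j" for j
      have flux_v: "flux s x v j = (R j + \<nu> * E j) / q" for j
      proof -
        have "psum v j i = (E (j + i) - E j) / q" for i
        proof -
          have "psum v j i = psum (\<lambda>l. E (l + 1) / q - E l / q) j i"
            by (simp add: v_def[abs_def] diff_divide_distrib)
          also have "\<dots> = E (j + i) / q - E j / q"
            by (rule psum_telescope[of "\<lambda>l. E l / q"])
          finally show ?thesis by (simp add: diff_divide_distrib)
        qed
        then show ?thesis
          by (simp add: flux_def R_def sum_divide_distrib scaleR_conv_of_real)
      qed
      define \<rho> where "\<rho> k = (\<Sum>l<m. bloch_matrix s x m \<theta> k l * r l) - \<nu> * r k" for k
      have fper: "flux s x v (j + int m) = cis (\<theta> * real m) * flux s x v j" for j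
        by (rule flux_quasi_periodic[of x "int m" "real m" v, OF per vper])
      have Rper: "R (j + int m) = cis (\<theta> * real m) * R j" for j
      proof -
        have Rj: "R j = q * flux s x v j - \<nu> * E j" for j using q0 by (simp add: flux_v)
        show ?thesis unfolding Rj[of "j + int m"] Rj[of j] fper Eper by (simp add: algebra_simps)
      qed
      have \<rho>e: "\<rho> k = (cis (bfreq m \<theta> k) - 1) / q * bloch_coeff m (bfreq m \<theta> k) R" for k
      proof -
        let ?b = "bloch_coeff m (bfreq m \<theta> k)"
        have "(\<Sum>l<m. bloch_matrix s x m \<theta> k l * r l) = ?b (\<lambda>j. \<Sum>l<m. r l * fv_op s x (wave (bfreq m \<theta> l)) j)"
          by (simp add: bloch_matrix_def bloch_coeff_sum mult.commute)
        also have "(\<lambda>j. \<Sum>l<m. r l * fv_op s x (wave (bfreq m \<theta> l)) j) = fv_op s x v"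
          by (subst vr) (simp add: fv_op_sum fun_eq_iff)
        also have "?b (fv_op s x v) = ?b (\<lambda>j. flux s x v (j + 1) - flux s x v j)"
          by (simp add: fv_op_def[abs_def])
        also have "\<dots> = (cis (bfreq m \<theta> k) - 1) * ?b (flux s x v)"
          by (rule bloch_coeff_difference[of m "flux s x v", OF m fper])
        also have "flux s x v = (\<lambda>j. 1 / q * R j + \<nu> / q * E j)"
          by (simp add: fun_eq_iff flux_v add_divide_distrib)
        also have "?b \<dots> = 1 / q * ?b R + \<nu> / q * ?b E"
          by (simp only: bloch_coeff_add bloch_coeff_mult)
        finally have 1: "(\<Sum>l<m. bloch_matrix s x m \<theta> k l * r l) = (cis (bfreq m \<theta> k) - 1) * (1 / q * ?b R + \<nu> / q * ?b E)" .
        have "r k = ?b (\<lambda>j. 1 / q * (E (j + 1) - E j))"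
          by (simp add: r_def v_def[abs_def])
        also have "\<dots> = 1 / q * ((cis (bfreq m \<theta> k) - 1) * ?b E)"
          by (simp only: bloch_coeff_mult bloch_coeff_difference[of m E, OF m Eper])
        finally have 2: "r k = 1 / q * ((cis (bfreq m \<theta> k) - 1) * ?b E)" .
        show ?thesis
          unfolding \<rho>_def 1 2 by (simp add: algebra_simps diff_divide_distrib)
      qed
      have Rd: "norm (R j - d * wave \<theta> j) \<le> \<epsilon> / 2 * \<tau> ^ (2 * s + 2)" for j
      proof -
        have "norm (R j - d * wave \<theta> j) \<le> (real (2 * s + 1) * \<eta> + 5 * uniform_coef_norm s * \<mu>) * c * \<bar>\<theta>\<bar> ^ (2 * s + 2)"
          unfolding R_def d_def \<nu>_def E_def L_def bfreq_0 c_def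
          by (rule defect_close[where m = m and x = x, OF m n \<mu>(2) x0 per \<theta> co])
        also have "\<dots> = (real (2 * s + 1) * \<eta> + 5 * uniform_coef_norm s * \<mu>) * (c * \<bar>\<theta>\<bar> ^ (2 * s + 2))"
          by (simp only: mult.assoc)
        also have "\<dots> \<le> (real (2 * s + 1) * \<eta> + 5 * uniform_coef_norm s * \<mu>) * (D * \<tau> ^ (2 * s + 2))"
          using \<theta>\<beta> \<eta>(1) \<mu>(1) uniform_coef_norm_nonneg[of s] by (intro mult_left_mono) auto
        also have "\<dots> = (real (2 * s + 1) * \<eta> * D + 5 * uniform_coef_norm s * \<mu> * D) * \<tau> ^ (2 * s + 2)"
          by (simp only: distrib_right mult.assoc)
        also have "\<dots> \<le> (\<epsilon> / 4 + \<epsilon> / 4) * \<tau> ^ (2 * s + 2)"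
          using \<eta>(3) \<mu>(4) \<tau> by (intro mult_right_mono add_mono) auto
        finally show ?thesis by simp
      qed
      have \<rho>d: "\<rho> k = (cis (bfreq m \<theta> k) - 1) / q * bloch_coeff m (bfreq m \<theta> k) (\<lambda>j. R j - d * wave \<theta> j) + (if k = 0 then d else 0)"
        if k: "k < m" for k
      proof -
        let ?b = "bloch_coeff m (bfreq m \<theta> k)"
        have "?b (wave \<theta>) = (if k = 0 then 1 else 0)"
          using bloch_orthonormal[OF m k m, of \<theta>] by simp
        then have "?b (\<lambda>j. R j - d * wave \<theta> j) = ?b R - (if k = 0 then d else 0)"
          by (simp add: bloch_coeff_diff bloch_coeff_mult)
        then show ?thesis
          unfolding \<rho>e using q0 by (cases "k = 0") (auto simp: q_def)
      qed
      have bR: "norm (bloch_coeff m (bfreq m \<theta> k) (\<lambda>j. R j - d * wave \<theta> j)) \<le> \<epsilon> / 2 * \<tau> ^ (2 * s + 2)" for k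
        by (rule norm_bloch_coeff_le[OF m Rd])
      have rv: "norm (v j - wave \<theta> j) \<le> \<epsilon>" for j
      proof -
        have "v j - wave \<theta> j = ((E (j + 1) - E j) - (cis \<theta> - 1) * wave \<theta> j) / q"
          using q0 by (simp add: v_def q_def field_simps)
        then have "norm (v j - wave \<theta> j) = norm ((E (j + 1) - E j) - (cis \<theta> - 1) * wave \<theta> j) / \<tau>"
          by (simp add: norm_divide q_def \<tau>_def)
        also have "\<dots> \<le> (10 * real m * \<mu> * \<bar>\<theta>\<bar>) / \<tau>"
          unfolding E_def using \<tau>
          by (intro divide_right_mono sampled_wave_close[where m = m and x = x, OF m n x0 per \<theta>])
        also have "\<dots> \<le> (10 * real m * \<mu> * (C * \<tau>)) / \<tau>"
          using \<theta>\<tau> \<tau> \<mu>(1) by (intro divide_right_mono mult_left_mono) auto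
        also have "\<dots> = 10 * real m * \<mu> * C" using \<tau>0 by simp
        also have "\<dots> \<le> \<epsilon>" by (rule \<mu>(5))
        finally show ?thesis .
      qed
      have rk: "norm (r k - (if k = 0 then 1 else 0)) \<le> \<epsilon>" if k: "k < m" for k
      proof -
        have "r k - (if k = 0 then 1 else 0) = bloch_coeff m (bfreq m \<theta> k) (\<lambda>j. v j - wave \<theta> j)"
          using bloch_orthonormal[OF m k m, of \<theta>] by (simp add: bloch_coeff_diff r_def)
        then show ?thesis
          using norm_bloch_coeff_le[OF m rv] by simp
      qed
      have "\<exists>T. \<forall>z. mode_form m \<delta> (\<lambda>k l. (if k = l then L k else 0) + P k l) T z"
      proof (rule near_mode[where \<tau> = \<tau> and r = r and \<rho> = \<rho> and \<nu> = \<nu>])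
        show "norm (P i k) \<le> \<epsilon>" if "i < m" "k < m" for i k
          using P2[OF that] e(2) by linarith
        show "norm (P 0 k) \<le> \<epsilon> * \<tau>" if "0 < k" "k < m" for k
        proof -
          have "norm (P 0 k) \<le> \<tau> * e" using Pb[OF m that(2)] by (simp add: \<tau>_def)
          also have "\<dots> \<le> \<tau> * \<epsilon>" using e(1,2) \<tau> by (intro mult_left_mono) auto
          finally show ?thesis by (simp add: mult.commute)
        qed
        show "norm (r 0 - 1) \<le> \<epsilon>" using rk[OF m] by simp
        show "norm (r k) \<le> \<epsilon>" if "0 < k" "k < m" for k using rk[OF that(2)] that(1) by simp
        show "L k * r k + (\<Sum>i<m. P k i * r i) = \<nu> * r k + \<rho> k" if k: "k < m" for k
        proof -
          have "(\<Sum>l<m. bloch_matrix s x m \<theta> k l * r l) = (\<Sum>l<m. (if k = l then L k else 0) * r l) + (\<Sum>i<m. P k i * r i)"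
            unfolding BP distrib_right sum.distrib by simp
          then show ?thesis unfolding \<rho>_def sum_delta_mult[OF k] by simp
        qed
        show "norm (\<rho> 0 - (L 0 - \<nu>)) \<le> \<epsilon> * \<tau> ^ (2 * s + 2)"
        proof -
          have "\<rho> 0 - (L 0 - \<nu>) = bloch_coeff m (bfreq m \<theta> 0) (\<lambda>j. R j - d * wave \<theta> j)"
            unfolding \<rho>d[OF m] using q0 by (simp add: d_def q_def)
          then have "norm (\<rho> 0 - (L 0 - \<nu>)) \<le> \<epsilon> / 2 * \<tau> ^ (2 * s + 2)" using bR[of 0] by simp
          also have "\<dots> \<le> \<epsilon> * \<tau> ^ (2 * s + 2)" using \<epsilon> \<tau> by (intro mult_right_mono) auto
          finally show ?thesis .
        qed
        show "norm (\<rho> k) \<le> \<epsilon> * \<tau> ^ (2 * s + 1)" if "0 < k" "k < m" for k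
        proof -
          have "norm (\<rho> k) = norm (cis (bfreq m \<theta> k) - 1) / \<tau> * norm (bloch_coeff m (bfreq m \<theta> k) (\<lambda>j. R j - d * wave \<theta> j))"
            unfolding \<rho>d[OF that(2)] using that(1) by (simp add: norm_mult norm_divide q_def \<tau>_def)
          also have "\<dots> \<le> 2 / \<tau> * (\<epsilon> / 2 * \<tau> ^ (2 * s + 2))"
            using bR \<tau> norm_cis_minus_one_le by (intro mult_mono divide_right_mono) auto
          also have "\<dots> = \<epsilon> * \<tau> ^ (2 * s + 1)" using \<tau>0 by simp
          finally show ?thesis .
        qed
        show "Re (L 0) = \<kappa> * \<tau> ^ (2 * s + 2)" by (rule ReL0)
        show "g + Re (L 0) \<le> Re (L k)" if "0 < k" "k < m" for k
          using ReL[OF that] near0 by linarith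
        show "norm (L 0 - \<nu>) \<le> K * \<tau> ^ (2 * s + 2)"
        proof -
          have "norm (L 0 - \<nu>) \<le> uniform_coef_norm s * c * \<bar>\<theta>\<bar> ^ (2 * s + 2)"
            unfolding L_def \<nu>_def bfreq_0 c_def by (rule symbol_defect_bound)
          also have "\<dots> = uniform_coef_norm s * (c * \<bar>\<theta>\<bar> ^ (2 * s + 2))" by (simp only: mult.assoc)
          also have "\<dots> \<le> uniform_coef_norm s * (D * \<tau> ^ (2 * s + 2))"
            using \<theta>\<beta> uniform_coef_norm_nonneg by (rule mult_left_mono)
          also have "\<dots> = K * \<tau> ^ (2 * s + 2)" by (simp only: K_def D_def mult.assoc)
          finally show ?thesis .
        qed
      qed (use \<tau> in auto)
      then show ?thesis unfolding BP by blast
    qed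
  qed
qed

text \<open>At \<open>z\<close>, the sum of the squares of the linear functionals with coefficients \<open>w q\<close> is close to the
Euclidean norm and does not increase along \<open>z' = - B z\<close>.\<close>

definition lyapunov_form ::
  "nat \<Rightarrow> real \<Rightarrow> ((int \<Rightarrow> real) \<Rightarrow> int \<Rightarrow> real) \<Rightarrow> 'q set \<Rightarrow> ('q \<Rightarrow> int \<Rightarrow> complex) \<Rightarrow> (int \<Rightarrow> real) \<Rightarrow> bool" where
  "lyapunov_form N \<delta> B Q w z \<longleftrightarrow>
    \<bar>(\<Sum>j\<in>{0..<int N}. (z j)\<^sup>2) - (\<Sum>q\<in>Q. (norm (\<Sum>j\<in>{0..<int N}. w q j * of_real (z j)))\<^sup>2)\<bar>
      \<le> \<delta> * (\<Sum>q\<in>Q. (norm (\<Sum>j\<in>{0..<int N}. w q j * of_real (z j)))\<^sup>2) \<and>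
    0 \<le> (\<Sum>q\<in>Q. Re (cnj (\<Sum>j\<in>{0..<int N}. w q j * of_real (z j)) *
           (\<Sum>j\<in>{0..<int N}. w q j * of_real (B z j))))"

text \<open>The forms of the single blocks are added up by Parseval's identity. The deviation \<open>\<mu>\<close> depends on the
period \<open>m\<close> but not on the number \<open>n\<close> of periods. The mean has to vanish because the steady state of the scheme is
proportional to the cell lengths and not constant.\<close>

lemma near_uniform_stability:
  assumes m: "m > 0" and \<delta>: "\<delta> > 0"
  obtains \<mu> where "\<mu> > 0" "\<mu> < 1"
    "\<And>x n. near_uniform \<mu> x \<Longrightarrow> x 0 = 0 \<Longrightarrow> (\<And>j. x (j + int m) = x j + real m) \<Longrightarrow> n > 0 \<Longrightarrow>
      \<exists>(Q :: (int \<times> nat) set) (w :: int \<times> nat \<Rightarrow> int \<Rightarrow> complex). finite Q \<and>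
        (\<forall>z :: int \<Rightarrow> real. (\<forall>j. z (j + int (m * n)) = z j) \<longrightarrow> (\<Sum>j\<in>{0..<int (m * n)}. z j) = 0 \<longrightarrow>
          lyapunov_form (m * n) \<delta> (fv_op s x) Q w z)"
proof -
  obtain \<mu> where \<mu>: "\<mu> > 0" "\<mu> < 1" and form:
    "\<And>x \<theta>. near_uniform \<mu> x \<Longrightarrow> x 0 = 0 \<Longrightarrow> (\<And>j. x (j + int m) = x j + real m) \<Longrightarrow> \<bar>\<theta>\<bar> \<le> pi / real m
      \<Longrightarrow> \<exists>T. \<forall>z. (\<theta> = 0 \<longrightarrow> z 0 = 0) \<longrightarrow> mode_form m \<delta> (bloch_matrix s x m \<theta>) T z"
    by (rule mode_form_exists[OF m \<delta>, of s]) blast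
  show ?thesis
  proof (rule that[OF \<mu>])
    fix x :: "int \<Rightarrow> real" and n :: nat
    assume x: "near_uniform \<mu> x" "x 0 = 0" and per: "\<And>j. x (j + int m) = x j + real m" and n: "n > 0"
    define N where "N = m * n"
    have N: "N > 0" using m n by (simp add: N_def)
    have "\<exists>T. \<forall>z. (dft_freq m n a = 0 \<longrightarrow> z 0 = 0) \<longrightarrow> mode_form m \<delta> (bloch_matrix s x m (dft_freq m n a)) T z" if "a \<in> dft_base n" for a
      by (rule form[OF x per dft_freq_le[OF m n that]])
    then obtain T where T: "\<And>a z. a \<in> dft_base n \<Longrightarrow> (dft_freq m n a = 0 \<longrightarrow> z 0 = 0) \<Longrightarrow> mode_form m \<delta> (bloch_matrix s x m (dft_freq m n a)) (T a) z"
      by metis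
    define Q where "Q = dft_base n \<times> {..m}"
    define w where "w q j = (\<Sum>l<m. T (fst q) (snd q) l * cnj (wave (bfreq m (dft_freq m n (fst q)) l) j)) / of_real (sqrt (real N))" for q j
    have wz: "(\<Sum>j\<in>{0..<int N}. w (a, k) j * z j) = of_real (sqrt (real N)) * (\<Sum>l<m. T a k l * dft m n z a l)" for a k z
    proof -
      have sq: "complex_of_real (sqrt (real N)) * complex_of_real (sqrt (real N)) = of_nat N"
        by (simp flip: of_real_mult)
      have s0: "complex_of_real (sqrt (real N)) \<noteq> 0" using N by simp
      have "(\<Sum>j\<in>{0..<int N}. w (a, k) j * z j)
          = (\<Sum>j\<in>{0..<int N}. \<Sum>l<m. T a k l * (cnj (wave (bfreq m (dft_freq m n a) l) j) * z j)) / of_real (sqrt (real N))"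
        by (simp only: w_def fst_conv snd_conv times_divide_eq_left sum_distrib_right mult.assoc sum_divide_distrib)
      also have "\<dots> = (\<Sum>l<m. T a k l * (\<Sum>j\<in>{0..<int N}. cnj (wave (bfreq m (dft_freq m n a) l) j) * z j)) / of_real (sqrt (real N))"
        by (subst sum.swap) (simp only: sum_distrib_left)
      also have "\<dots> = (\<Sum>l<m. T a k l * (of_nat N * dft m n z a l)) / of_real (sqrt (real N))"
        using N by (simp add: dft_def bloch_coeff_def N_def)
      also have "\<dots> = (\<Sum>l<m. of_nat N * (T a k l * dft m n z a l)) / of_real (sqrt (real N))"
        by (simp only: mult.left_commute)
      also have "\<dots> = of_nat N / of_real (sqrt (real N)) * (\<Sum>l<m. T a k l * dft m n z a l)"
        by (simp only: sum_distrib_left[symmetric] times_divide_eq_left)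
      also have "of_nat N / of_real (sqrt (real N)) = complex_of_real (sqrt (real N))"
        using s0 by (simp flip: sq)
      finally show ?thesis .
    qed
    have main: "lyapunov_form N \<delta> (fv_op s x) Q w z"
      if zp: "\<forall>j. z (j + int N) = z j" and z0: "(\<Sum>j\<in>{0..<int N}. z j) = 0" for z :: "int \<Rightarrow> real"
    proof -
      define Z where "Z j = complex_of_real (z j)" for j
      have Zp: "Z (j + int (m * n)) = Z j" for j using zp by (simp add: Z_def N_def[symmetric])
      have BZ: "of_real (fv_op s x z j) = fv_op s x Z j" for j
        by (simp add: Z_def[abs_def] fv_op_of_real)
      define y where "y a k = (\<Sum>l<m. T a k l * dft m n Z a l)" for a k
      define y' where "y' a k = (\<Sum>l<m. T a k l * (\<Sum>i<m. bloch_matrix s x m (dft_freq m n a) l i * dft m n Z a i))" for a k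
      have zero: "dft m n Z a 0 = 0" if "dft_freq m n a = 0" for a
      proof -
        have "(\<Sum>j\<in>{0..<int N}. Z j) = 0" using z0 by (simp add: Z_def flip: of_real_sum)
        then show ?thesis by (simp add: dft_def bloch_coeff_def that wave_def N_def)
      qed
      have mf: "mode_form m \<delta> (bloch_matrix s x m (dft_freq m n a)) (T a) (dft m n Z a)" if "a \<in> dft_base n" for a
        by (rule T[OF that]) (use zero in auto)
      have 1: "\<bar>(\<Sum>k<m. (norm (dft m n Z a k))\<^sup>2) - (\<Sum>k\<le>m. (norm (y a k))\<^sup>2)\<bar> \<le> \<delta> * (\<Sum>k\<le>m. (norm (y a k))\<^sup>2)"
        and 2: "0 \<le> (\<Sum>k\<le>m. Re (cnj (y a k) * y' a k))" if "a \<in> dft_base n" for a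
        using mf[OF that] by (simp_all only: mode_form_def y_def y'_def)
      have Lz: "(\<Sum>j\<in>{0..<int N}. w (a, k) j * of_real (z j)) = of_real (sqrt (real N)) * y a k" for a k
        using wz[of a k Z] by (simp add: Z_def y_def)
      have Lz': "(\<Sum>j\<in>{0..<int N}. w (a, k) j * of_real (fv_op s x z j)) = of_real (sqrt (real N)) * y' a k" if "a \<in> dft_base n" for a k
        unfolding BZ wz y'_def by (simp only: dft_fv_op[where m = m and x = x and z = Z, OF m n Zp per that])
      have E: "(\<Sum>q\<in>Q. (norm (\<Sum>j\<in>{0..<int N}. w q j * of_real (z j)))\<^sup>2) = real N * (\<Sum>a\<in>dft_base n. \<Sum>k\<le>m. (norm (y a k))\<^sup>2)"
        unfolding Q_def sum.cartesian_product' Lz by (simp add: norm_mult power_mult_distrib sum_distrib_left)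
      have S: "(\<Sum>j\<in>{0..<int N}. (z j)\<^sup>2) = real N * (\<Sum>a\<in>dft_base n. \<Sum>k<m. (norm (dft m n Z a k))\<^sup>2)"
        using dft_parseval[of m n Z, OF m n Zp] by (simp add: Z_def N_def)
      have "(\<Sum>j\<in>{0..<int N}. (z j)\<^sup>2) - (\<Sum>q\<in>Q. (norm (\<Sum>j\<in>{0..<int N}. w q j * of_real (z j)))\<^sup>2)
          = real N * (\<Sum>a\<in>dft_base n. (\<Sum>k<m. (norm (dft m n Z a k))\<^sup>2) - (\<Sum>k\<le>m. (norm (y a k))\<^sup>2))"
        unfolding E S by (simp add: sum_subtractf right_diff_distrib)
      also have "\<bar>\<dots>\<bar> \<le> real N * (\<Sum>a\<in>dft_base n. \<delta> * (\<Sum>k\<le>m. (norm (y a k))\<^sup>2))"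
        unfolding abs_mult using 1 by (intro mult_mono order_trans[OF sum_abs sum_mono]) (auto intro!: sum_nonneg)
      also have "\<dots> = \<delta> * (\<Sum>q\<in>Q. (norm (\<Sum>j\<in>{0..<int N}. w q j * of_real (z j)))\<^sup>2)"
        unfolding E by (simp add: sum_distrib_left mult.left_commute)
      finally have first: "\<bar>(\<Sum>j\<in>{0..<int N}. (z j)\<^sup>2) - (\<Sum>q\<in>Q. (norm (\<Sum>j\<in>{0..<int N}. w q j * of_real (z j)))\<^sup>2)\<bar>
          \<le> \<delta> * (\<Sum>q\<in>Q. (norm (\<Sum>j\<in>{0..<int N}. w q j * of_real (z j)))\<^sup>2)" .
      have "(\<Sum>q\<in>Q. Re (cnj (\<Sum>j\<in>{0..<int N}. w q j * of_real (z j)) * (\<Sum>j\<in>{0..<int N}. w q j * of_real (fv_op s x z j))))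
          = (\<Sum>a\<in>dft_base n. \<Sum>k\<le>m. real N * Re (cnj (y a k) * y' a k))"
        unfolding Q_def sum.cartesian_product'
      proof (intro sum.cong refl)
        fix a k assume a: "a \<in> dft_base n"
        have "cnj (of_real (sqrt (real N)) * y a k) * (of_real (sqrt (real N)) * y' a k) = of_real (real N) * (cnj (y a k) * y' a k)"
        proof -
          have "complex_of_real (sqrt (real N)) * complex_of_real (sqrt (real N)) = of_real (real N)"
            by (simp flip: of_real_mult)
          then show ?thesis by (simp add: mult.left_commute mult.assoc)
        qed
        then show "Re (cnj (\<Sum>j\<in>{0..<int N}. w (a, k) j * of_real (z j)) * (\<Sum>j\<in>{0..<int N}. w (a, k) j * of_real (fv_op s x z j)))
            = real N * Re (cnj (y a k) * y' a k)"
          unfolding Lz Lz'[OF a] by (simp only: Re_complex_of_real times_complex.sel Im_complex_of_real mult_zero_left diff_zero)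
      qed
      also have "\<dots> = real N * (\<Sum>a\<in>dft_base n. \<Sum>k\<le>m. Re (cnj (y a k) * y' a k))"
        by (simp only: sum_distrib_left)
      also have "\<dots> \<ge> 0" by (rule mult_nonneg_nonneg[OF of_nat_0_le_iff sum_nonneg[OF 2]])
      finally show ?thesis unfolding lyapunov_form_def using first by blast
    qed
    show "\<exists>(Q :: (int \<times> nat) set) (w :: int \<times> nat \<Rightarrow> int \<Rightarrow> complex). finite Q \<and>
        (\<forall>z :: int \<Rightarrow> real. (\<forall>j. z (j + int (m * n)) = z j) \<longrightarrow> (\<Sum>j\<in>{0..<int (m * n)}. z j) = 0 \<longrightarrow>
          lyapunov_form (m * n) \<delta> (fv_op s x) Q w z)"
      unfolding N_def[symmetric]
      by (rule exI[of _ Q], rule exI[of _ w]) (use main in \<open>auto simp: Q_def\<close>)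
  qed
qed

section \<open>The corrector\<close>

text \<open>A periodic sequence is determined by one period.\<close>

lemma int_shift_mod:
  fixes f :: "int \<Rightarrow> 'a"
  assumes "\<And>j. f (j + int m) = f j"
  shows "f j = f (j mod int m)"
proof -
  have "f (i + int m * b) = f i" for i b
  proof (induction b rule: int_induct[where k = 0])
    case (step1 b)
    then show ?case using assms[of "i + int m * b"] by (simp add: algebra_simps)
  next
    case (step2 b)
    then show ?case using assms[of "i + int m * (b - 1)"] by (simp add: algebra_simps)
  qed simp
  from this[of "j mod int m" "j div int m"] show ?thesis by simp
qed

lemma int_const:
  fixes f :: "int \<Rightarrow> 'a"
  assumes "\<And>j. f (j + 1) = f j"
  shows "f j = f 0"
  using int_shift_mod[of f 1 j] assms by simp

lemma psum_0_step: "psum z 0 (j + 1) - psum z 0 j = z j" for z :: "int \<Rightarrow> real"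
proof (cases "j \<ge> 0")
  case True
  then have "{0..<j + 1} = insert j {0..<j}" by auto
  then show ?thesis using True by (simp add: psum_def)
next
  case False
  then have "{j..<0} = insert j {j + 1..<0}" by auto
  then show ?thesis using False by (simp add: psum_def)
qed

lemma Re_psum: "Re (psum z j i) = psum (\<lambda>l. Re (z l)) j i"
  by (simp add: psum_def)

lemma Re_fv_op: "Re (fv_op s x z j) = fv_op s x (\<lambda>l. Re (z l)) j"
  by (simp add: fv_op_def flux_def Re_psum)

text \<open>In Bloch coefficients at frequency zero the operator is a small perturbation of a diagonal matrix
whose entries, apart from the one for the mean, are bounded away from zero; the system is
solved by iteration. The real part of the complex solution is again a solution.\<close>

lemma fv_op_solve:
  assumes m: "m > 0"
  obtains \<mu> C :: real where "\<mu> > 0" "\<mu> < 1" "C \<ge> 0"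
    "\<And>x q B. near_uniform \<mu> x \<Longrightarrow> (\<And>j. x (j + int m) = x j + real m) \<Longrightarrow> (\<And>j. q (j + int m) = q j) \<Longrightarrow>
      (\<Sum>j\<in>{0..<int m}. q j) = 0 \<Longrightarrow> (\<And>j. \<bar>q j\<bar> \<le> B) \<Longrightarrow>
      \<exists>z. (\<forall>j. z (j + int m) = z j) \<and> (\<Sum>j\<in>{0..<int m}. z j) = 0 \<and> (\<forall>j. \<bar>z j\<bar> \<le> C * B) \<and> (\<forall>j. fv_op s x z j = q j)"
proof -
  define G where "G = dissipation s * (2 - 2 * cos (pi / real m)) ^ (s + 1)"
  have "cos (pi / real m) < cos 0"
    by (rule cos_monotone_0_pi) (use m in \<open>auto simp: divide_le_eq\<close>)
  then have G: "G > 0" using dissipation_pos[of s] by (simp add: G_def del: power_Suc)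
  define Ks where "Ks = real (2 * s + 1) * real (s + 1)"
  have Ks: "Ks > 0" by (simp add: Ks_def add_pos_nonneg)
  define \<eta> where "\<eta> = G / (4 * real m * Ks)"
  have d: "4 * real m * Ks > 0" using m Ks by simp
  have \<eta>: "\<eta> > 0" "real m * (2 * (\<eta> * Ks)) = G / 2"
    using G d m Ks by (simp_all add: \<eta>_def)
  obtain \<mu>1 where \<mu>1: "\<mu>1 > 0" "\<And>X j i. near_uniform \<mu>1 X \<Longrightarrow> i \<in> stencil s \<Longrightarrow> \<bar>coef s X j i - uniform_coef s i\<bar> \<le> \<eta>"
    by (rule coef_close[OF \<eta>(1), of s]) blast
  define \<mu> where "\<mu> = min \<mu>1 (1 / 2)"
  have \<mu>: "\<mu> > 0" "\<mu> < 1" "\<mu> \<le> \<mu>1" using \<mu>1 by (auto simp: \<mu>_def)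
  define C where "C = real m * (2 / G)"
  have C: "C \<ge> 0" using G by (simp add: C_def)
  show ?thesis
  proof (rule that[OF \<mu>(1,2) C])
    fix x q :: "int \<Rightarrow> real" and B :: real
    assume n: "near_uniform \<mu> x" and per: "\<And>j. x (j + int m) = x j + real m" and qper: "\<And>j. q (j + int m) = q j"
      and q0: "(\<Sum>j\<in>{0..<int m}. q j) = 0" and qB: "\<And>j. \<bar>q j\<bar> \<le> B"
    have B0: "0 \<le> B" using qB[of 0] by linarith
    have co: "\<bar>coef s x j i - uniform_coef s i\<bar> \<le> \<eta>" if "i \<in> stencil s" for i j
      using \<mu>1(2)[OF near_uniform_mono[OF n \<mu>(3)] that] .
    define I where "I = {1..<m}"
    define qc where "qc j = complex_of_real (q j)" for j
    define b where "b k = bloch_coeff m (bfreq m 0 k)" for k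
    define L where "L k = symbol s (bfreq m 0 k)" for k
    define P where "P k l = bloch_matrix s x m 0 k l - (if k = l then L k else 0)" for k l
    have Pb: "norm (P k l) \<le> 2 * (\<eta> * Ks)" if "k < m" "l < m" for k l
    proof -
      have "norm (P k l) \<le> norm (cis (bfreq m 0 k) - 1) * (\<eta> * Ks)"
        unfolding P_def L_def Ks_def
        by (rule bloch_matrix_perturbation_bound[where m = m and x = x, OF m per that co])
      also have "\<dots> \<le> 2 * (\<eta> * Ks)"
        using norm_cis_minus_one_le \<eta>(1) Ks by (intro mult_right_mono) auto
      finally show ?thesis .
    qed
    have LG: "G \<le> norm (L k)" if "k \<in> I" for k
      using Re_symbol_gap[OF m, of 0 k s] that m complex_Re_le_cmod[of "L k"] by (simp add: G_def L_def I_def del: power_Suc)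
    define F where "F y k = (b k qc - (\<Sum>l\<in>I. P k l * y l)) / L k" for y k
    define R where "R = 2 * B / G"
    have R0: "0 \<le> R" using B0 G by (simp add: R_def)
    have bq: "norm (b k qc) \<le> B" for k
      unfolding b_def by (rule norm_bloch_coeff_le[OF m]) (simp add: qc_def qB)
    have sumP: "norm (\<Sum>l\<in>I. P k l * y l) \<le> G / 2 * M" if "\<forall>l\<in>I. norm (y l) \<le> M" "k \<in> I" "0 \<le> M" for y k M
    proof -
      have "norm (\<Sum>l\<in>I. P k l * y l) \<le> real m * (2 * (\<eta> * Ks) * M)"
        by (rule norm_sum_mult_le) (use that Pb \<eta> Ks m in \<open>auto simp: I_def\<close>)
      also have "\<dots> = G / 2 * M" using \<eta>(2) by (metis mult.assoc)
      finally show ?thesis .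
    qed
    have div: "norm (a / L k) \<le> A / G" if "norm a \<le> A" "k \<in> I" for a A k
      unfolding norm_divide using that LG[OF that(2)] G
      by (intro frac_le) (auto intro: order_trans[OF norm_ge_zero])
    obtain y where y: "\<And>k. k \<in> I \<Longrightarrow> norm (y k) \<le> R" "\<And>k. k \<in> I \<Longrightarrow> F y k = y k"
    proof (rule picard_fixpoint[of I "1/2" R F])
      show "norm (F y k) \<le> R" if "\<forall>k\<in>I. norm (y k) \<le> R" "k \<in> I" for y k
      proof -
        have "norm (b k qc - (\<Sum>l\<in>I. P k l * y l)) \<le> B + G / 2 * R"
          using norm_triangle_ineq4[of "b k qc" "\<Sum>l\<in>I. P k l * y l"] bq[of k] sumP[OF that R0] by linarith
        from div[OF this that(2)] show ?thesis using G by (simp add: F_def R_def field_simps)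
      qed
      show "norm (F y k - F y' k) \<le> 1 / 2 * M"
        if M: "\<forall>k\<in>I. norm (y k - y' k) \<le> M" and k: "k \<in> I" for y y' M k
      proof -
        have M0: "0 \<le> M" using M k norm_ge_zero order_trans by blast
        have "F y k - F y' k = (- (\<Sum>l\<in>I. P k l * (y l - y' l))) / L k"
          unfolding F_def diff_divide_distrib[symmetric] by (simp add: right_diff_distrib sum_subtractf)
        moreover have "norm (- (\<Sum>l\<in>I. P k l * (y l - y' l))) \<le> G / 2 * M"
          using sumP[OF M k M0] by simp
        ultimately have "norm (F y k - F y' k) \<le> G / 2 * M / G" using div[OF _ k] by metis
        then show ?thesis using G by simp
      qed
    qed (use R0 I_def in auto)
    define Z where "Z j = (\<Sum>l\<in>I. y l * wave (bfreq m 0 l) j)" for j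
    have Zper: "Z (j + int m) = Z j" for j
      unfolding Z_def wave_bfreq_period[OF m] by simp
    have bZ: "b k (fv_op s x Z) = (\<Sum>l\<in>I. bloch_matrix s x m 0 k l * y l)" for k
    proof -
      have "fv_op s x Z = (\<lambda>j. \<Sum>l\<in>I. y l * fv_op s x (wave (bfreq m 0 l)) j)"
        by (simp add: Z_def[abs_def] fv_op_sum fun_eq_iff)
      then show ?thesis
        by (simp add: b_def bloch_coeff_sum bloch_matrix_def mult.commute)
    qed
    have fper: "fv_op s x Z (j + int m) = cis (0 * real m) * fv_op s x Z j" for j
      by (rule fv_op_quasi_periodic[of x "int m" "real m" Z, OF per]) (simp add: Zper)
    have qcper: "qc (j + int m) = cis (0 * real m) * qc j" for j by (simp add: qc_def qper)
    have eq: "b k (fv_op s x Z) = b k qc" if k: "k < m" for k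
    proof (cases "k = 0")
      case True
      have "b 0 qc = 0"
        using q0 by (simp add: b_def bloch_coeff_def qc_def wave_def flip: of_real_sum)
      moreover have "bloch_matrix s x m 0 0 l = 0" if "l \<in> I" for l
        using bloch_matrix_split[where m = m and x = x, OF m per m, of l s 0] that by (simp add: I_def)
      ultimately show ?thesis using True by (simp add: bZ)
    next
      case False
      then have kI: "k \<in> I" using k by (simp add: I_def)
      have L0: "L k \<noteq> 0" using LG[OF kI] G by auto
      have "(\<Sum>l\<in>I. bloch_matrix s x m 0 k l * y l) = (\<Sum>l\<in>I. (if k = l then L k * y l else 0) + P k l * y l)"
        by (intro sum.cong refl) (simp add: P_def algebra_simps)
      also have "\<dots> = L k * y k + (\<Sum>l\<in>I. P k l * y l)"
        using kI by (simp add: sum.distrib I_def)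
      also have "\<dots> = b k qc"
        using y(2)[OF kI] L0 by (simp add: F_def field_simps)
      finally show ?thesis by (simp add: bZ)
    qed
    have sol: "fv_op s x Z j = qc j" for j
    proof -
      have "fv_op s x Z j = (\<Sum>k<m. b k (fv_op s x Z) * wave (bfreq m 0 k) j)"
        unfolding b_def by (rule bloch_inversion[of m "fv_op s x Z" 0, OF m fper])
      also have "\<dots> = (\<Sum>k<m. b k qc * wave (bfreq m 0 k) j)"
        by (intro sum.cong refl) (simp add: eq)
      also have "\<dots> = qc j"
        unfolding b_def by (rule bloch_inversion[of m qc 0, OF m qcper, symmetric])
      finally show ?thesis .
    qed
    define z where "z j = Re (Z j)" for j
    have "z (j + int m) = z j" for j by (simp add: z_def Zper)
    moreover have "(\<Sum>j\<in>{0..<int m}. z j) = 0"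
    proof -
      have "b 0 Z = (\<Sum>l\<in>I. y l * b 0 (wave (bfreq m 0 l)))"
        by (simp add: b_def Z_def[abs_def] bloch_coeff_sum)
      also have "\<dots> = 0"
        using bloch_orthonormal[OF m m, of _ 0] by (intro sum.neutral) (auto simp: b_def I_def)
      finally have "(\<Sum>j\<in>{0..<int m}. Z j) = 0"
        using m by (simp add: b_def bloch_coeff_def wave_def)
      then show ?thesis by (simp add: z_def flip: Re_sum)
    qed
    moreover have "\<bar>z j\<bar> \<le> C * B" for j
    proof -
      have "norm (Z j) \<le> real m * (R * 1)"
        unfolding Z_def by (rule norm_sum_mult_le) (use y R0 in \<open>auto simp: I_def\<close>)
      then show ?thesis
        using abs_Re_le_cmod[of "Z j"] by (simp add: z_def C_def R_def mult_ac)
    qed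
    moreover have "fv_op s x z j = q j" for j
      using sol[of j] by (simp add: z_def[abs_def] qc_def flip: Re_fv_op)
    ultimately show "\<exists>z. (\<forall>j. z (j + int m) = z j) \<and> (\<Sum>j\<in>{0..<int m}. z j) = 0 \<and> (\<forall>j. \<bar>z j\<bar> \<le> C * B) \<and> (\<forall>j. fv_op s x z j = q j)"
      by blast
  qed
qed

text \<open>The constant \<open>C\<close> bounds the corrector by the oscillation of \<open>\<omega>\<close>; it is kept as a parameter
because it enters the final constant, which must be fixed before the tolerance \<open>\<delta>\<close>.\<close>

definition corrector_ok :: "nat \<Rightarrow> nat \<Rightarrow> real \<Rightarrow> real \<Rightarrow> bool" where
  "corrector_ok s m \<mu> C \<longleftrightarrow> \<mu> > 0 \<and> \<mu> < 1 \<and> C \<ge> 0 \<and>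
    (\<forall>x \<omega> B. near_uniform \<mu> x \<longrightarrow> (\<forall>j. x (j + int m) = x j + real m) \<longrightarrow> (\<forall>j. \<omega> (j + int m) = \<omega> j) \<longrightarrow>
      (\<forall>j. \<bar>\<omega> (j + 1) - \<omega> j\<bar> \<le> B) \<longrightarrow>
      (\<exists>g \<kappa>. (\<forall>j. g (j + int m) = g j) \<and> (\<forall>j. \<bar>g j\<bar> \<le> C * B) \<and>
        (\<forall>j. (\<Sum>i\<in>stencil s. coef s x j i * (g (j + i) - g j)) = \<omega> j + \<kappa>)))"

text \<open>The increments \<open>z\<close> of \<open>g\<close> solve \<open>fv_op z = \<omega> (j + 1) - \<omega> j\<close>; then the flux of \<open>z\<close> differs from \<open>\<omega>\<close> by a
constant, and \<open>g\<close> is periodic since \<open>z\<close> has mean zero.\<close>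

lemma corrector:
  assumes m: "m > 0"
  shows "\<exists>C \<mu>. corrector_ok s m \<mu> C"
proof (rule fv_op_solve[OF m, of s])
  fix \<mu> C :: real
  assume \<mu>: "\<mu> > 0" "\<mu> < 1" and C: "C \<ge> 0" and solve:
    "\<And>x q B. near_uniform \<mu> x \<Longrightarrow> (\<And>j. x (j + int m) = x j + real m) \<Longrightarrow> (\<And>j. q (j + int m) = q j) \<Longrightarrow>
      (\<Sum>j\<in>{0..<int m}. q j) = 0 \<Longrightarrow> (\<And>j. \<bar>q j\<bar> \<le> B) \<Longrightarrow>
      \<exists>z. (\<forall>j. z (j + int m) = z j) \<and> (\<Sum>j\<in>{0..<int m}. z j) = 0 \<and> (\<forall>j. \<bar>z j\<bar> \<le> C * B) \<and> (\<forall>j. fv_op s x z j = q j)"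
  have "corrector_ok s m \<mu> (real m * C)"
    unfolding corrector_ok_def
  proof (intro conjI allI impI)
    show "0 < \<mu>" "\<mu> < 1" "0 \<le> real m * C" using \<mu> C by simp_all
    fix x \<omega> :: "int \<Rightarrow> real" and B :: real
    assume n: "near_uniform \<mu> x" and "\<forall>j. x (j + int m) = x j + real m" and "\<forall>j. \<omega> (j + int m) = \<omega> j"
      and "\<forall>j. \<bar>\<omega> (j + 1) - \<omega> j\<bar> \<le> B"
    then have per: "\<And>j. x (j + int m) = x j + real m" and \<omega>: "\<And>j. \<omega> (j + int m) = \<omega> j"
      and B: "\<And>j. \<bar>\<omega> (j + 1) - \<omega> j\<bar> \<le> B" by simp_all
    have B0: "0 \<le> B" using B[of 0] by linarith
    have "\<exists>z. (\<forall>j. z (j + int m) = z j) \<and> (\<Sum>j\<in>{0..<int m}. z j) = 0 \<and> (\<forall>j. \<bar>z j\<bar> \<le> C * B) \<and> (\<forall>j. fv_op s x z j = \<omega> (j + 1) - \<omega> j)"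
    proof (rule solve[OF n per])
      show "\<omega> (j + int m + 1) - \<omega> (j + int m) = \<omega> (j + 1) - \<omega> j" for j
        using \<omega>[of j] \<omega>[of "j + 1"] by (simp add: ac_simps)
      show "(\<Sum>j\<in>{0..<int m}. \<omega> (j + 1) - \<omega> j) = 0"
        using \<omega>[of 0] by (simp add: sum_int_telescope)
    qed (rule B)
    then obtain z where zper: "\<And>j. z (j + int m) = z j" and z0: "(\<Sum>j\<in>{0..<int m}. z j) = 0"
      and zB: "\<And>j. \<bar>z j\<bar> \<le> C * B" and zs: "\<And>j. fv_op s x z j = \<omega> (j + 1) - \<omega> j"
      by blast
    define g where "g j = psum z 0 j" for j
    have gs: "g (j + 1) - g j = z j" for j by (simp add: g_def psum_0_step)
    have "g (j + int m) - g j = g (0 + int m) - g 0" for j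
    proof (rule int_const[of "\<lambda>j. g (j + int m) - g j"])
      show "g (j + 1 + int m) - g (j + 1) = g (j + int m) - g j" for j
        using gs[of j] gs[of "j + int m"] zper[of j] by (simp add: algebra_simps)
    qed
    moreover have "g (0 + int m) - g 0 = 0" using z0 by (simp add: g_def psum_def)
    ultimately have gper: "g (j + int m) = g j" for j by (metis eq_iff_diff_eq_0)
    moreover have "\<bar>g j\<bar> \<le> real m * C * B" for j
    proof -
      define r where "r = j mod int m"
      have r: "0 \<le> r" "r < int m" using m by (auto simp: r_def)
      have "\<bar>real_of_int r\<bar> \<le> real m" using r by linarith
      have "\<bar>g r\<bar> \<le> \<bar>real_of_int r\<bar> * (C * B)"
        using norm_psum_le[of z "C * B" 0 r] zB by (simp add: g_def)
      also have "\<dots> \<le> real m * (C * B)"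
        using \<open>\<bar>real_of_int r\<bar> \<le> real m\<close> C B0 by (intro mult_right_mono) auto
      finally show ?thesis
        using int_shift_mod[of g m j, OF gper] by (simp add: r_def)
    qed
    moreover have "(\<Sum>i\<in>stencil s. coef s x j i * (g (j + i) - g j)) = \<omega> j + (flux s x z 0 - \<omega> 0)" for j
    proof -
      have "g (j + i) - g j = psum z j i" for i
        using psum_telescope[of g j i] by (simp add: gs)
      then have "(\<Sum>i\<in>stencil s. coef s x j i * (g (j + i) - g j)) = flux s x z j"
        by (simp add: flux_def)
      moreover have "flux s x z j - \<omega> j = flux s x z 0 - \<omega> 0"
      proof (rule int_const[of "\<lambda>j. flux s x z j - \<omega> j"])
        show "flux s x z (j + 1) - \<omega> (j + 1) = flux s x z j - \<omega> j" for j
          using zs[of j] by (simp add: fv_op_def)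
      qed
      ultimately show ?thesis by simp
    qed
    ultimately show "\<exists>g \<kappa>. (\<forall>j. g (j + int m) = g j) \<and> (\<forall>j. \<bar>g j\<bar> \<le> real m * C * B) \<and>
        (\<forall>j. (\<Sum>i\<in>stencil s. coef s x j i * (g (j + i) - g j)) = \<omega> j + \<kappa>)"
      by blast
  qed
  then show ?thesis by blast
qed

section \<open>Interpolation errors\<close>

text \<open>Here \<open>D q\<close> stands for the derivative of order \<open>q\<close> of the function \<open>D 0\<close>.\<close>

definition taylor_rem :: "nat \<Rightarrow> (nat \<Rightarrow> real \<Rightarrow> real) \<Rightarrow> real \<Rightarrow> real \<Rightarrow> real" where
  "taylor_rem n D a y = D 0 (a + y) - (\<Sum>q\<le>n. D q a * y ^ q / fact q)"

lemma taylor_rem_0 [simp]: "taylor_rem n D a 0 = 0"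
proof -
  have "(\<Sum>q\<le>n. D q a * 0 ^ q / fact q) = (\<Sum>q\<in>{0}. D q a * 0 ^ q / fact q)"
    by (rule sum.mono_neutral_right) auto
  then show ?thesis by (simp add: taylor_rem_def)
qed

lemma taylor_rem_deriv:
  assumes "\<And>y. (D 0 has_field_derivative D (Suc 0) y) (at y)"
  shows "(taylor_rem (Suc n) D a has_field_derivative taylor_rem n (\<lambda>q. D (Suc q)) a y) (at y within S)"
proof -
  have 1: "((\<lambda>y. D 0 (a + y)) has_field_derivative D (Suc 0) (a + y)) (at y within S)"
  proof -
    have "((\<lambda>y. a + y) has_field_derivative 1) (at y within S)"
      by (auto intro!: derivative_eq_intros)
    from DERIV_chain2[OF assms this] show ?thesis by simp
  qed
  have 2: "((\<lambda>y. \<Sum>q\<le>Suc n. D q a * y ^ q / fact q) has_field_derivative (\<Sum>q\<le>n. D (Suc q) a * y ^ q / fact q)) (at y within S)"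
  proof -
    have d: "((\<lambda>y. D q a * y ^ q / fact q) has_field_derivative D q a * (of_nat q * y ^ (q - 1)) / fact q) (at y within S)" for q
      by (auto intro!: derivative_eq_intros)
    have "((\<lambda>y. \<Sum>q\<le>Suc n. D q a * y ^ q / fact q) has_field_derivative (\<Sum>q\<le>Suc n. D q a * (of_nat q * y ^ (q - 1)) / fact q)) (at y within S)"
      by (rule DERIV_sum) (rule d)
    also have "(\<Sum>q\<le>Suc n. D q a * (of_nat q * y ^ (q - 1)) / fact q) = (\<Sum>q\<le>n. D (Suc q) a * y ^ q / fact q)"
      unfolding sum.atMost_Suc_shift by (simp add: field_simps del: of_nat_Suc sum.atMost_Suc)
    finally show ?thesis .
  qed
  show ?thesis
    unfolding taylor_rem_def[abs_def] by (rule DERIV_diff[OF 1 2])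
qed

text \<open>The derivative of a remainder is the remainder of the derivative, one order lower.\<close>

lemma taylor_rem_lipschitz:
  assumes "\<And>q y. q \<le> n \<Longrightarrow> (D q has_field_derivative D (Suc q) y) (at y)"
    and "\<And>y. \<bar>D (Suc n) y\<bar> \<le> M" and "\<bar>y\<bar> \<le> Y" "\<bar>y'\<bar> \<le> Y"
  shows "\<bar>taylor_rem n D a y - taylor_rem n D a y'\<bar> \<le> M * Y ^ n * \<bar>y - y'\<bar>"
  using assms
proof (induction n arbitrary: D y y')
  case 0
  have "norm (D 0 (a + y) - D 0 (a + y')) \<le> M * norm ((a + y) - (a + y'))"
    by (rule field_differentiable_bound[where S = UNIV and f' = "D (Suc 0)"])
      (use 0 in \<open>auto intro: has_field_derivative_at_within\<close>)
  then show ?case by (simp add: taylor_rem_def)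
next
  case (Suc n)
  have Y0: "0 \<le> Y" using Suc.prems(3) by linarith
  have M0: "0 \<le> M" using Suc.prems(2)[of 0] by linarith
  have "norm (taylor_rem (Suc n) D a y - taylor_rem (Suc n) D a y') \<le> (M * Y ^ Suc n) * norm (y - y')"
  proof (rule field_differentiable_bound[where S = "{-Y..Y}" and f' = "taylor_rem n (\<lambda>q. D (Suc q)) a"])
    show "(taylor_rem (Suc n) D a has_field_derivative taylor_rem n (\<lambda>q. D (Suc q)) a z) (at z within {-Y..Y})" for z
      by (rule taylor_rem_deriv) (rule Suc.prems(1), simp)
    fix z assume "z \<in> {-Y..Y}"
    then have z: "\<bar>z\<bar> \<le> Y" by auto
    have "\<bar>taylor_rem n (\<lambda>q. D (Suc q)) a z - taylor_rem n (\<lambda>q. D (Suc q)) a 0\<bar> \<le> M * Y ^ n * \<bar>z - 0\<bar>"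
      by (rule Suc.IH) (use Suc.prems z Y0 in auto)
    also have "\<dots> \<le> M * Y ^ n * Y" using z M0 Y0 by (intro mult_left_mono) auto
    finally show "norm (taylor_rem n (\<lambda>q. D (Suc q)) a z) \<le> M * Y ^ Suc n" by (simp add: mult_ac)
  qed (use Suc.prems in auto)
  then show ?case by simp
qed

lemma taylor_rem_bound:
  assumes "\<And>q y. q \<le> n \<Longrightarrow> (D q has_field_derivative D (Suc q) y) (at y)"
    and "\<And>y. \<bar>D (Suc n) y\<bar> \<le> M" and "\<bar>y\<bar> \<le> Y"
  shows "\<bar>taylor_rem n D a y\<bar> \<le> M * Y ^ Suc n"
proof -
  have Y0: "0 \<le> Y" using assms(3) by linarith
  have M0: "0 \<le> M" using assms(2)[of 0] by linarith
  have "\<bar>taylor_rem n D a y - taylor_rem n D a 0\<bar> \<le> M * Y ^ n * \<bar>y - 0\<bar>"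
    by (rule taylor_rem_lipschitz) (use assms Y0 in auto)
  also have "\<dots> \<le> M * Y ^ n * Y" using assms(3) M0 Y0 by (intro mult_left_mono) auto
  finally show ?thesis by (simp add: mult_ac)
qed

lemma iterated_Rolle:
  fixes G :: "nat \<Rightarrow> real \<Rightarrow> real" and z :: "nat \<Rightarrow> real"
  assumes "\<And>q y. q < n \<Longrightarrow> (G q has_field_derivative G (Suc q) y) (at y)"
    and "\<And>i. i < n \<Longrightarrow> z i < z (Suc i)" and "\<And>i. i \<le> n \<Longrightarrow> G 0 (z i) = 0"
  shows "\<exists>\<xi>. G n \<xi> = 0"
  using assms
proof (induction n arbitrary: G z)
  case 0
  then show ?case by auto
next
  case (Suc n)
  have "\<exists>w. z i < w \<and> w < z (Suc i) \<and> G (Suc 0) w = 0" if i: "i < Suc n" for i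
  proof -
    have "\<exists>w>z i. w < z (Suc i) \<and> (*) (G (Suc 0) w) = (\<lambda>v. 0)"
    proof (rule Rolle_deriv[where f = "G 0" and f' = "\<lambda>w. (*) (G (Suc 0) w)"])
      show "z i < z (Suc i)" using Suc.prems(2) i by simp
      show "G 0 (z i) = G 0 (z (Suc i))" using Suc.prems(3) i by simp
      have d: "(G 0 has_field_derivative G (Suc 0) y) (at y)" for y using Suc.prems(1) by simp
      show "continuous_on {z i..z (Suc i)} (G 0)"
        by (rule DERIV_continuous_on) (rule has_field_derivative_at_within[OF d])
      show "(G 0 has_derivative (*) (G (Suc 0) w)) (at w)" for w
        using d by (simp add: has_field_derivative_def)
    qed
    then obtain w where w: "z i < w" "w < z (Suc i)" and e: "(*) (G (Suc 0) w) = (\<lambda>v. 0)" by blast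
    from fun_cong[OF e, of 1] w show ?thesis by auto
  qed
  then obtain w where w: "\<And>i. i < Suc n \<Longrightarrow> z i < w i \<and> w i < z (Suc i) \<and> G (Suc 0) (w i) = 0"
    by metis
  have "\<exists>\<xi>. (\<lambda>q. G (Suc q)) n \<xi> = 0"
  proof (rule Suc.IH[where z = w])
    show "w i < w (Suc i)" if "i < n" for i
      using w[of i] w[of "Suc i"] that by auto
  qed (use Suc.prems(1) w in auto)
  then show ?case by simp
qed

lemma has_field_derivative_shift:
  assumes "\<And>y. (f has_field_derivative f' y) (at y)"
  shows "((\<lambda>y. f (a + y)) has_field_derivative f' (a + y)) (at (y::real))"
proof -
  have "((\<lambda>y. a + y) has_field_derivative 1) (at y)"
    by (auto intro!: derivative_eq_intros)
  from DERIV_chain2[OF assms this] show ?thesis by simp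
qed

lemma prod_stencil_abs: "\<bar>\<Prod>i\<in>stencil s. real_of_int i\<bar> = fact s * fact (s + 1)"
proof -
  have st: "stencil s = int ` {1..s} \<union> (\<lambda>k. - int k) ` {1..s + 1}"
  proof (intro equalityI subsetI)
    fix i assume i: "i \<in> stencil s"
    show "i \<in> int ` {1..s} \<union> (\<lambda>k. - int k) ` {1..s + 1}"
    proof (cases "i > 0")
      case True
      then have "i = int (nat i)" "nat i \<in> {1..s}" using i by (auto simp: stencil_def)
      then show ?thesis by blast
    next
      case False
      then have "i = - int (nat (- i))" "nat (- i) \<in> {1..s + 1}" using i by (auto simp: stencil_def)
      then show ?thesis by blast
    qed
  qed (auto simp: stencil_def)
  have "(\<Prod>i\<in>stencil s. real_of_int i) = (\<Prod>i\<in>int ` {1..s}. real_of_int i) * (\<Prod>i\<in>(\<lambda>k. - int k) ` {1..s + 1}. real_of_int i)"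
    unfolding st by (rule prod.union_disjoint) auto
  also have "(\<Prod>i\<in>int ` {1..s}. real_of_int i) = fact s"
    by (subst prod.reindex) (auto simp: fact_prod)
  also have "(\<Prod>i\<in>(\<lambda>k. - int k) ` {1..s + 1}. real_of_int i) = (\<Prod>k\<in>{1..s + 1}. - real k)"
    by (subst prod.reindex) (auto simp: inj_on_def)
  also have "\<bar>fact s * (\<Prod>k\<in>{1..s + 1}. - real k)\<bar> = fact s * (\<Prod>k\<in>{1..s + 1}. real k)"
    by (simp add: abs_mult abs_prod)
  also have "(\<Prod>k\<in>{1..s + 1}. real k) = fact (s + 1)"
    by (simp only: fact_prod of_nat_prod)
  finally show ?thesis .
qed

text \<open>The interpolation error formula at a node, with its sharp constant. Let \<open>K\<close> be such that
\<open>E = D 0 (a + y) - P y - K * W y\<close>, with the interpolating polynomial \<open>P\<close> and the node polynomial \<open>W\<close>, has a critical point at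
the base node. Then \<open>E'\<close> vanishes there and between any two neighbouring nodes,
and repeated use of Rolle's theorem gives \<open>K * (2 s + 2)!\<close> as a value of \<open>D (2 s + 2)\<close>.\<close>

lemma uniform_truncation_bound:
  assumes D: "\<And>q y. q \<le> 2 * s + 1 \<Longrightarrow> (D q has_field_derivative D (Suc q) y) (at y)"
    and M: "\<And>y. \<bar>D (2 * s + 2) y\<bar> \<le> M"
  shows "\<bar>D 1 a - (\<Sum>i\<in>stencil s. uniform_coef s i * (D 0 (a + real_of_int i) - D 0 a))\<bar>
    \<le> fact s * fact (s + 1) / fact (2 * s + 2) * M"
proof -
  define node where "node k = real k - real s - 1" for k
  have sm: "strict_mono node" by (auto simp: strict_mono_def node_def)
  obtain P where P: "degree P \<le> 2 * s + 1" "\<And>k. k \<le> 2 * s + 1 \<Longrightarrow> poly P (node k) = D 0 (a + node k)"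
    using interpolating_poly_exists[OF sm, of "2 * s + 1" "\<lambda>k. D 0 (a + node k)"] by blast
  have Pi: "poly P (real_of_int i) = D 0 (a + real_of_int i)" if "i \<in> insert 0 (stencil s)" for i
  proof -
    have "node (nat (i + int s + 1)) = real_of_int i" "nat (i + int s + 1) \<le> 2 * s + 1"
      using that by (auto simp: node_def stencil_def)
    then show ?thesis using P(2) by metis
  qed
  have dP: "(\<Sum>i\<in>stencil s. uniform_coef s i * (D 0 (a + real_of_int i) - D 0 a)) = poly (pderiv P) 0"
  proof -
    have "(\<Sum>i\<in>stencil s. uniform_coef s i * (D 0 (a + real_of_int i) - D 0 a))
        = (\<Sum>i\<in>stencil s. uniform_coef s i * (poly P (real_of_int i) - poly P 0))"
      using Pi[of 0] by (intro sum.cong refl) (simp add: Pi)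
    also have "\<dots> = poly (pderiv P) 0"
      using coef_exact[OF _ P(1), of real_of_int 0] by (simp add: strict_mono_def)
    finally show ?thesis .
  qed
  define W where "W = (\<Prod>i\<in>insert 0 (stencil s). [:- real_of_int i, 1:])"
  have degW: "degree W = 2 * s + 2" and lcW: "lead_coeff W = 1"
  proof -
    have "card (insert 0 (stencil s)) = 2 * s + 2"
      using stencil_nonzero[of 0 s] by (subst card_insert_disjoint) (auto simp: card_stencil)
    then show "degree W = 2 * s + 2"
      unfolding W_def by (subst degree_prod_eq_sum_degree) auto
    show "lead_coeff W = 1" unfolding W_def by (subst lead_coeff_prod) auto
  qed
  have W0: "poly W (real_of_int i) = 0" if "i \<in> insert 0 (stencil s)" for i
    using that by (auto simp: W_def poly_prod intro!: prod_zero)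
  have dW: "\<bar>poly (pderiv W) 0\<bar> = fact s * fact (s + 1)"
  proof -
    have "W = [:0, 1:] * (\<Prod>i\<in>stencil s. [:- real_of_int i, 1:])"
      unfolding W_def using stencil_nonzero[of 0 s] by (subst prod.insert) auto
    then have "poly (pderiv W) 0 = (\<Prod>i\<in>stencil s. - real_of_int i)"
      by (simp add: pderiv_pCons poly_prod)
    then show ?thesis
      using prod_stencil_abs[of s] by (simp add: abs_prod)
  qed
  then have dW0: "poly (pderiv W) 0 \<noteq> 0" by auto
  define K where "K = (D 1 a - poly (pderiv P) 0) / poly (pderiv W) 0"
  define E where "E y = D 0 (a + y) - poly P y - K * poly W y" for y
  define G where "G q y = D (Suc q) (a + y) - poly ((pderiv ^^ q) (pderiv P)) y - K * poly ((pderiv ^^ q) (pderiv W)) y" for q y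
  have dE: "(E has_field_derivative G 0 y) (at y)" for y
  proof -
    have d: "((\<lambda>y. D 0 (a + y)) has_field_derivative D (Suc 0) (a + y)) (at y)"
      by (rule has_field_derivative_shift) (rule D, simp)
    from DERIV_diff[OF DERIV_diff[OF d poly_DERIV[of P y]] DERIV_cmult[OF poly_DERIV[of W y], of K]]
    show ?thesis by (simp add: E_def[abs_def] G_def)
  qed
  have dG: "(G q has_field_derivative G (Suc q) y) (at y)" if "q < 2 * s + 1" for q y
  proof -
    have d: "((\<lambda>y. D (Suc q) (a + y)) has_field_derivative D (Suc (Suc q)) (a + y)) (at y)"
      by (rule has_field_derivative_shift) (rule D, use that in simp)
    from DERIV_diff[OF DERIV_diff[OF d poly_DERIV[of "(pderiv ^^ q) (pderiv P)" y]]
        DERIV_cmult[OF poly_DERIV[of "(pderiv ^^ q) (pderiv W)" y], of K]]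
    show ?thesis by (simp add: G_def[abs_def])
  qed
  have E0: "E (real_of_int i) = 0" if "i \<in> insert 0 (stencil s)" for i
    unfolding E_def W0[OF that] Pi[OF that] by simp
  have G0: "G 0 0 = 0" using dW0 by (simp add: G_def K_def)
  have "\<exists>w. real_of_int i < w \<and> w < real_of_int (i + 1) \<and> G 0 w = 0" if i: "- int s - 1 \<le> i" "i < int s" for i
  proof -
    have "\<exists>w>real_of_int i. w < real_of_int (i + 1) \<and> (*) (G 0 w) = (\<lambda>v. 0)"
    proof (rule Rolle_deriv[where f = E and f' = "\<lambda>w. (*) (G 0 w)"])
      have "i \<in> insert 0 (stencil s)" "i + 1 \<in> insert 0 (stencil s)" using i by (auto simp: stencil_def)
      then show "E (real_of_int i) = E (real_of_int (i + 1))" by (simp only: E0)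
      show "continuous_on {real_of_int i..real_of_int (i + 1)} E"
        by (rule DERIV_continuous_on) (rule has_field_derivative_at_within[OF dE])
      show "(E has_derivative (*) (G 0 w)) (at w)" for w
        using dE by (simp add: has_field_derivative_def)
    qed simp
    then obtain w where w: "real_of_int i < w" "w < real_of_int (i + 1)" and e: "(*) (G 0 w) = (\<lambda>v. 0)" by blast
    from fun_cong[OF e, of 1] w show ?thesis by auto
  qed
  then obtain w where w: "\<And>i. - int s - 1 \<le> i \<Longrightarrow> i < int s \<Longrightarrow> real_of_int i < w i \<and> w i < real_of_int (i + 1) \<and> G 0 (w i) = 0"
    by metis
  define z where "z k = (if k < s + 1 then w (int k - int s - 1) else if k = s + 1 then 0 else w (int k - int s - 2))" for k
  have "\<exists>\<xi>. G (2 * s + 1) \<xi> = 0"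
  proof (rule iterated_Rolle[of "2 * s + 1" G z])
    show "z i < z (Suc i)" if i: "i < 2 * s + 1" for i
    proof -
      consider "Suc i < s + 1" | "Suc i = s + 1" | "i = s + 1" | "i > s + 1" by linarith
      then show ?thesis
      proof cases
        case 1
        then show ?thesis
          using w[of "int i - int s - 1"] w[of "int i - int s"] by (simp add: z_def)
      next
        case 2
        then show ?thesis using w[of "- 1"] by (simp add: z_def)
      next
        case 3
        then show ?thesis using w[of 0] i by (simp add: z_def)
      next
        case 4
        then show ?thesis
          using w[of "int i - int s - 2"] w[of "int i - int s - 1"] i by (simp add: z_def)
      qed
    qed
    show "G 0 (z i) = 0" if i: "i \<le> 2 * s + 1" for i
      using w[of "int i - int s - 1"] w[of "int i - int s - 2"] i G0 by (auto simp: z_def)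
  qed (use dG in auto)
  then obtain \<xi> where \<xi>: "G (2 * s + 1) \<xi> = 0" by blast
  have hP: "(pderiv ^^ (2 * s + 1)) (pderiv P) = 0"
  proof (rule poly_eqI)
    fix n
    have "(pderiv ^^ (2 * s + 1)) (pderiv P) = (pderiv ^^ (2 * s + 2)) P"
      by (simp add: funpow_swap1)
    then show "coeff ((pderiv ^^ (2 * s + 1)) (pderiv P)) n = coeff 0 n"
      using P(1) by (simp add: coeff_higher_pderiv coeff_eq_0 del: funpow.simps)
  qed
  have hW: "poly ((pderiv ^^ (2 * s + 1)) (pderiv W)) \<xi> = fact (2 * s + 2)"
  proof -
    have "(pderiv ^^ (2 * s + 1)) (pderiv W) = (pderiv ^^ (2 * s + 2)) W"
      by (simp add: funpow_swap1)
    moreover have "(pderiv ^^ (2 * s + 2)) W = [:fact (2 * s + 2):]"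
    proof (rule poly_eqI)
      fix n
      show "coeff ((pderiv ^^ (2 * s + 2)) W) n = coeff [:fact (2 * s + 2):] n"
      proof (cases n)
        case 0
        then show ?thesis
          using lcW degW by (simp add: coeff_higher_pderiv pochhammer_fact del: funpow.simps)
      next
        case (Suc n')
        then show ?thesis
          using degW by (simp add: coeff_higher_pderiv coeff_eq_0 del: funpow.simps)
      qed
    qed
    ultimately show ?thesis by simp
  qed
  have "D (2 * s + 2) (a + \<xi>) = K * fact (2 * s + 2)"
    using \<xi> unfolding G_def hP hW by simp
  then have "K = D (2 * s + 2) (a + \<xi>) / fact (2 * s + 2)" by simp
  moreover have "D 1 a - poly (pderiv P) 0 = K * poly (pderiv W) 0"
    using dW0 by (simp add: K_def)
  ultimately have "\<bar>D 1 a - poly (pderiv P) 0\<bar> = fact s * fact (s + 1) / fact (2 * s + 2) * \<bar>D (2 * s + 2) (a + \<xi>)\<bar>"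
    using dW by (simp add: abs_mult)
  also have "\<dots> \<le> fact s * fact (s + 1) / fact (2 * s + 2) * M"
    using M by (intro mult_left_mono) auto
  finally show ?thesis by (simp add: dP)
qed

section \<open>The residual of the corrected error\<close>

text \<open>The leading coefficient \<open>\<omega>\<close> of the truncation error.\<close>

definition trunc_coef :: "nat \<Rightarrow> (int \<Rightarrow> real) \<Rightarrow> int \<Rightarrow> real" where
  "trunc_coef s x j = (\<Prod>i\<in>stencil s. x j - x (j + i)) / fact (2 * s + 2)"

text \<open>The truncation error at node \<open>j\<close>; \<open>D 0\<close> is a primitive of the solution \<open>D 1\<close>.\<close>

definition trunc :: "nat \<Rightarrow> (nat \<Rightarrow> real \<Rightarrow> real) \<Rightarrow> (int \<Rightarrow> real) \<Rightarrow> int \<Rightarrow> real" where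
  "trunc s D x j = D 1 (x j) - (\<Sum>i\<in>stencil s. coef s x j i * (D 0 (x (j + i)) - D 0 (x j)))"

definition uniform_trunc :: "nat \<Rightarrow> (nat \<Rightarrow> real \<Rightarrow> real) \<Rightarrow> real \<Rightarrow> real" where
  "uniform_trunc s D a = D 1 a - (\<Sum>i\<in>stencil s. uniform_coef s i * (D 0 (a + real_of_int i) - D 0 a))"

lemma trunc_expansion:
  assumes x: "strict_mono x"
  shows "trunc s D x j = trunc_coef s x j * D (2 * s + 2) (x j)
    - (\<Sum>i\<in>stencil s. coef s x j i * taylor_rem (2 * s + 2) D (x j) (x (j + i) - x j))"
proof -
  define Y where "Y i = x (j + i) - x j" for i
  have idx: "{..2 * s + 2} = insert 0 (insert (2 * s + 2) {1..2 * s + 1})" by auto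
  have e: "D 0 (x (j + i)) - D 0 (x j) = taylor_rem (2 * s + 2) D (x j) (Y i)
      + (D (2 * s + 2) (x j) / fact (2 * s + 2) * Y i ^ (2 * s + 2) + (\<Sum>q\<in>{1..2 * s + 1}. D q (x j) / fact q * Y i ^ q))" for i
    unfolding taylor_rem_def idx by (simp add: Y_def del: fact_Suc power_Suc)
  have "(\<Sum>i\<in>stencil s. coef s x j i * (\<Sum>q\<in>{1..2 * s + 1}. D q (x j) / fact q * Y i ^ q))
      = (\<Sum>q\<in>{1..2 * s + 1}. D q (x j) / fact q * (\<Sum>i\<in>stencil s. coef s x j i * Y i ^ q))"
    unfolding sum_distrib_left by (subst sum.swap) (simp only: mult.left_commute)
  also have "\<dots> = (\<Sum>q\<in>{1..2 * s + 1}. if q = 1 then D 1 (x j) else 0)"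
    by (intro sum.cong refl) (auto simp: coef_moment[OF x] Y_def)
  also have "\<dots> = D 1 (x j)" by simp
  finally have low: "(\<Sum>i\<in>stencil s. coef s x j i * (\<Sum>q\<in>{1..2 * s + 1}. D q (x j) / fact q * Y i ^ q)) = D 1 (x j)" .
  have "(\<Sum>i\<in>stencil s. coef s x j i * (D (2 * s + 2) (x j) / fact (2 * s + 2) * Y i ^ (2 * s + 2)))
      = D (2 * s + 2) (x j) / fact (2 * s + 2) * (\<Sum>i\<in>stencil s. coef s x j i * Y i ^ (2 * s + 2))"
    unfolding sum_distrib_left by (simp only: mult.left_commute)
  also have "\<dots> = - (trunc_coef s x j * D (2 * s + 2) (x j))"
    unfolding Y_def coef_moment_top[OF x] trunc_coef_def by simp
  finally have top: "(\<Sum>i\<in>stencil s. coef s x j i * (D (2 * s + 2) (x j) / fact (2 * s + 2) * Y i ^ (2 * s + 2)))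
      = - (trunc_coef s x j * D (2 * s + 2) (x j))" .
  show ?thesis
    unfolding trunc_def e distrib_left sum.distrib low top by (simp add: Y_def)
qed

lemma uniform_trunc_expansion:
  "uniform_trunc s D a = trunc_coef s real_of_int 0 * D (2 * s + 2) a
    - (\<Sum>i\<in>stencil s. uniform_coef s i * taylor_rem (2 * s + 2) D a (real_of_int i))"
proof -
  define x where "x i = a + real_of_int i" for i
  have "coef s x 0 i = uniform_coef s i" for i by (simp add: uniform_coef_def coef_def lagrange_weight_def x_def)
  moreover have "trunc_coef s x 0 = trunc_coef s real_of_int 0" by (simp add: trunc_coef_def x_def)
  moreover have "strict_mono x" by (simp add: x_def strict_mono_def)
  ultimately show ?thesis
    using trunc_expansion[of x s D 0] by (simp add: trunc_def uniform_trunc_def x_def del: fact_Suc)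
qed

text \<open>The truncation error on the uniform mesh commutes with translations, so its increment is the
truncation error of the increment of the function.\<close>

lemma uniform_trunc_lipschitz:
  assumes D: "\<And>q y. q \<le> 2 * s + 2 \<Longrightarrow> (D q has_field_derivative D (Suc q) y) (at y)"
    and M: "\<And>y. \<bar>D (2 * s + 3) y\<bar> \<le> M"
  shows "\<bar>uniform_trunc s D b - uniform_trunc s D a\<bar> \<le> fact s * fact (s + 1) / fact (2 * s + 2) * (M * \<bar>b - a\<bar>)"
proof -
  define E where "E q y = D q ((b - a) + y) - D q y" for q y
  have "(E q has_field_derivative E (Suc q) y) (at y)" if "q \<le> 2 * s + 1" for q y
  proof -
    have d: "(D q has_field_derivative D (Suc q) y) (at y)" for y using D that by simp
    show ?thesis
      unfolding E_def[abs_def] by (rule DERIV_diff[OF has_field_derivative_shift[OF d] d])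
  qed
  moreover have "\<bar>E (2 * s + 2) y\<bar> \<le> M * \<bar>b - a\<bar>" for y
  proof -
    have "norm (D (2 * s + 2) ((b - a) + y) - D (2 * s + 2) y) \<le> M * norm ((b - a) + y - y)"
      by (rule field_differentiable_bound[where S = UNIV and f' = "D (2 * s + 3)"])
        (use D[of "2 * s + 2"] M in \<open>auto simp: eval_nat_numeral\<close>)
    then show ?thesis by (simp add: E_def)
  qed
  ultimately have "\<bar>E 1 a - (\<Sum>i\<in>stencil s. uniform_coef s i * (E 0 (a + real_of_int i) - E 0 a))\<bar>
      \<le> fact s * fact (s + 1) / fact (2 * s + 2) * (M * \<bar>b - a\<bar>)"
    by (rule uniform_truncation_bound)
  moreover have "E 1 a - (\<Sum>i\<in>stencil s. uniform_coef s i * (E 0 (a + real_of_int i) - E 0 a)) = uniform_trunc s D b - uniform_trunc s D a"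
    unfolding uniform_trunc_def E_def
    by (simp add: algebra_simps sum_subtractf sum.distrib)
  ultimately show ?thesis by (simp only:)
qed

lemma prod_diff_le:
  fixes a b :: "'i \<Rightarrow> real"
  assumes Y: "1 \<le> Y" and a: "\<And>i. i \<in> I \<Longrightarrow> \<bar>a i\<bar> \<le> Y" and b: "\<And>i. i \<in> I \<Longrightarrow> \<bar>b i\<bar> \<le> Y"
    and d: "\<And>i. i \<in> I \<Longrightarrow> \<bar>a i - b i\<bar> \<le> d" "0 \<le> d"
  shows "\<bar>prod a I - prod b I\<bar> \<le> Y ^ card I * (real (card I) * d)"
proof -
  have sc: "prod f I = Y ^ card I * (\<Prod>i\<in>I. f i / Y)" for f :: "'i \<Rightarrow> real"
    using Y by (simp add: prod_dividef)
  have "norm ((\<Prod>i\<in>I. a i / Y) - (\<Prod>i\<in>I. b i / Y)) \<le> (\<Sum>i\<in>I. norm (a i / Y - b i / Y))"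
    by (rule norm_prod_diff) (use Y a b in \<open>auto simp: abs_divide divide_le_eq\<close>)
  also have "\<dots> \<le> (\<Sum>i\<in>I. d)"
  proof (rule sum_mono)
    fix i assume i: "i \<in> I"
    have "norm (a i / Y - b i / Y) = \<bar>a i - b i\<bar> / Y"
      using Y by (simp add: diff_divide_distrib[symmetric] abs_divide)
    also have "\<dots> \<le> d / 1" using d(1)[OF i] d(2) Y by (intro frac_le) auto
    finally show "norm (a i / Y - b i / Y) \<le> d" by simp
  qed
  finally have "\<bar>(\<Prod>i\<in>I. a i / Y) - (\<Prod>i\<in>I. b i / Y)\<bar> \<le> real (card I) * d" by simp
  then have "Y ^ card I * \<bar>(\<Prod>i\<in>I. a i / Y) - (\<Prod>i\<in>I. b i / Y)\<bar> \<le> Y ^ card I * (real (card I) * d)"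
    using Y by (intro mult_left_mono) auto
  then show ?thesis
    unfolding sc[of a] sc[of b] using Y by (simp add: abs_mult flip: right_diff_distrib)
qed

lemma near_uniform_stencil_bounds:
  assumes n: "near_uniform \<mu> x" and \<mu>: "\<mu> < 1" and i: "i \<in> stencil s"
  shows "\<bar>x (j + i) - x j\<bar> \<le> 2 * real (s + 1)"
    and "\<bar>(x (j + i) - x j) - real_of_int i\<bar> \<le> real (s + 1) * \<mu>"
proof -
  have "\<bar>x 1 - x 0 - 1\<bar> \<le> \<mu>" using n unfolding near_uniform_def by (metis add_0)
  then have \<mu>0: "0 \<le> \<mu>" by linarith
  have i1: "\<bar>real_of_int i\<bar> \<le> real (s + 1)" by (rule stencil_abs_le_real[OF i])
  show d: "\<bar>(x (j + i) - x j) - real_of_int i\<bar> \<le> real (s + 1) * \<mu>"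
    using near_uniform_dist[OF n, of j i] mult_right_mono[OF i1 \<mu>0] by simp
  also have "\<dots> \<le> real (s + 1) * 1" using \<mu> by (intro mult_left_mono) auto
  finally have d1: "\<bar>(x (j + i) - x j) - real_of_int i\<bar> \<le> real (s + 1)" by simp
  have "\<bar>x (j + i) - x j\<bar> \<le> \<bar>(x (j + i) - x j) - real_of_int i\<bar> + \<bar>real_of_int i\<bar>" by linarith
  then show "\<bar>x (j + i) - x j\<bar> \<le> 2 * real (s + 1)" using add_mono[OF d1 i1] by simp
qed

lemma trunc_coef_diff_le:
  assumes "\<And>i. i \<in> stencil s \<Longrightarrow> \<bar>x j - x (j + i)\<bar> \<le> 2 * real (s + 1)"
    and "\<And>i. i \<in> stencil s \<Longrightarrow> \<bar>y k - y (k + i)\<bar> \<le> 2 * real (s + 1)"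
    and "\<And>i. i \<in> stencil s \<Longrightarrow> \<bar>(x j - x (j + i)) - (y k - y (k + i))\<bar> \<le> d" "0 \<le> d"
  shows "\<bar>trunc_coef s x j - trunc_coef s y k\<bar> \<le> (2 * real (s + 1)) ^ (2 * s + 1) * real (2 * s + 1) * d"
proof -
  have "\<bar>trunc_coef s x j - trunc_coef s y k\<bar> = \<bar>(\<Prod>i\<in>stencil s. x j - x (j + i)) - (\<Prod>i\<in>stencil s. y k - y (k + i))\<bar> / fact (2 * s + 2)"
    by (simp add: trunc_coef_def abs_divide del: fact_Suc flip: diff_divide_distrib)
  also have "\<dots> \<le> \<bar>(\<Prod>i\<in>stencil s. x j - x (j + i)) - (\<Prod>i\<in>stencil s. y k - y (k + i))\<bar> / 1"
    by (rule frac_le) (simp_all add: fact_ge_1 del: fact_Suc)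
  also have "\<dots> \<le> (2 * real (s + 1)) ^ card (stencil s) * (real (card (stencil s)) * d)"
    unfolding div_by_1 by (rule prod_diff_le) (use assms in auto)
  finally show ?thesis by (simp only: card_stencil mult.assoc)
qed

lemma abs_sum_mult_le:
  fixes c :: "'i \<Rightarrow> real"
  assumes "\<And>i. i \<in> I \<Longrightarrow> \<bar>v i\<bar> \<le> B" "(\<Sum>i\<in>I. \<bar>c i\<bar>) \<le> A" "0 \<le> B"
  shows "\<bar>\<Sum>i\<in>I. c i * v i\<bar> \<le> A * B"
proof -
  have "\<bar>\<Sum>i\<in>I. c i * v i\<bar> \<le> (\<Sum>i\<in>I. \<bar>c i\<bar> * B)"
    by (rule order_trans[OF sum_abs sum_mono]) (auto simp: abs_mult intro!: mult_left_mono assms(1))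
  also have "\<dots> = (\<Sum>i\<in>I. \<bar>c i\<bar>) * B" by (simp only: sum_distrib_right)
  also have "\<dots> \<le> A * B" using assms(2,3) by (rule mult_right_mono)
  finally show ?thesis .
qed

text \<open>The forcing of the corrected error at node \<open>j\<close>: the truncation error, minus the scheme applied to
\<open>g * D (2 s + 2)\<close>, minus the time derivative of that product, which is \<open>- g * D (2 s + 3)\<close> as the
solution is transported with unit speed.\<close>

definition residual :: "nat \<Rightarrow> (nat \<Rightarrow> real \<Rightarrow> real) \<Rightarrow> (int \<Rightarrow> real) \<Rightarrow> (int \<Rightarrow> real) \<Rightarrow> int \<Rightarrow> real" where
  "residual s D x g j = trunc s D x j
    - (\<Sum>i\<in>stencil s. coef s x j i * (g (j + i) * D (2 * s + 2) (x (j + i)) - g j * D (2 * s + 2) (x j)))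
    + g j * D (2 * s + 3) (x j)"

text \<open>Write \<open>\<omega>0\<close> for the coefficient of the uniform mesh and \<open>f\<close> for \<open>D (2 s + 2)\<close>. Using the equation for \<open>g\<close>, the
residual is the uniform truncation error at \<open>x j\<close>, minus \<open>(\<omega>0 + \<kappa>) * f (x j)\<close>, plus
terms that are themselves small multiples of \<open>M\<close>. The increment of the first is bounded by the sharp
constant times the cell length, that of the second is small since \<open>\<omega>0 + \<kappa>\<close> is,
and the remaining terms may be differenced without any gain.\<close>

lemma residual_bound:
  assumes \<delta>: "\<delta> > 0" and Cg: "Cg \<ge> (0::real)"
  obtains \<mu> where "\<mu> > 0" "\<mu> < 1"
    "\<And>x g \<kappa> \<omega>' D M j. near_uniform \<mu> x \<Longrightarrow> 0 \<le> \<omega>' \<Longrightarrow> \<omega>' \<le> 2 * \<mu> \<Longrightarrow> (\<And>j. \<bar>g j\<bar> \<le> Cg * \<omega>') \<Longrightarrow>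
      (\<And>j. (\<Sum>i\<in>stencil s. coef s x j i * (g (j + i) - g j)) = trunc_coef s x j + \<kappa>) \<Longrightarrow>
      (\<And>q y. q \<le> 2 * s + 2 \<Longrightarrow> (D q has_field_derivative D (Suc q) y) (at y)) \<Longrightarrow>
      (\<And>y. \<bar>D (2 * s + 3) y\<bar> \<le> M) \<Longrightarrow>
      \<bar>residual s D x g (j + 1) - residual s D x g j\<bar>
      \<le> (fact s * fact (s + 1) / fact (2 * s + 2) + \<delta>) * M"
proof -
  define cs :: real where "cs = fact s * fact (s + 1) / fact (2 * s + 2)"
  have cs: "cs \<ge> 0" by (simp add: cs_def)
  define Y where "Y = 2 * real (s + 1)"
  have Y: "Y \<ge> 1" by (simp add: Y_def)
  define c' where "c' = Y ^ (2 * s + 3)"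
  have c': "c' > 0" using Y by (simp add: c'_def)
  define U where "U = uniform_coef_norm s"
  have U: "U \<ge> 0" by (simp add: U_def uniform_coef_norm_nonneg)
  define A where "A = U + real (2 * s + 1)"
  have A: "A \<ge> 0" using U by (simp add: A_def)
  define cw where "cw = Y ^ (2 * s + 1) * real (2 * s + 1) * real (s + 1)"
  have cw: "cw \<ge> 0" using Y by (simp add: cw_def)
  define Z where "Z = 1 + cs + 2 * (cw + 4 * A * Cg) + 2 * c' * U + 4 * (A * Y + 1) * Cg"
  have Z: "Z > 0" unfolding Z_def using cs cw A Cg c' U Y
    by (intro add_pos_nonneg mult_nonneg_nonneg add_nonneg_nonneg) auto
  define \<eta> where "\<eta> = min 1 (\<delta> / (4 * c' * real (2 * s + 1)))"
  have d: "4 * c' * real (2 * s + 1) > 0" using c' by simp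
  have \<eta>: "\<eta> > 0" "\<eta> \<le> 1" "2 * (c' * (real (2 * s + 1) * \<eta>)) \<le> \<delta> / 2"
  proof -
    show "\<eta> > 0" using \<delta> d unfolding \<eta>_def by simp
    show "\<eta> \<le> 1" by (simp add: \<eta>_def)
    have "\<eta> \<le> \<delta> / (4 * c' * real (2 * s + 1))" by (simp add: \<eta>_def)
    then have "\<eta> * (4 * c' * real (2 * s + 1)) \<le> \<delta>" using pos_le_divide_eq[OF d] by blast
    then show "2 * (c' * (real (2 * s + 1) * \<eta>)) \<le> \<delta> / 2" by (simp add: algebra_simps)
  qed
  obtain \<mu>1 where \<mu>1: "\<mu>1 > 0" "\<And>X j i. near_uniform \<mu>1 X \<Longrightarrow> i \<in> stencil s \<Longrightarrow> \<bar>coef s X j i - uniform_coef s i\<bar> \<le> \<eta>"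
    by (rule coef_close[OF \<eta>(1), of s]) blast
  define \<mu> where "\<mu> = min (min \<mu>1 (1/2)) (\<delta> / (2 * Z))"
  have \<mu>: "\<mu> > 0" "\<mu> < 1" "\<mu> \<le> \<mu>1" "Z * \<mu> \<le> \<delta> / 2"
  proof -
    show "\<mu> > 0" using \<mu>1 \<delta> Z by (simp add: \<mu>_def)
    have "\<mu> \<le> 1 / 2" unfolding \<mu>_def by (rule order_trans[OF min.cobounded1 min.cobounded2])
    then show "\<mu> < 1" by simp
    show "\<mu> \<le> \<mu>1" by (simp add: \<mu>_def)
    have "\<mu> \<le> \<delta> / (2 * Z)" by (simp add: \<mu>_def)
    then show "Z * \<mu> \<le> \<delta> / 2" using Z by (simp add: field_simps)
  qed
  show ?thesis
  proof (rule that[OF \<mu>(1,2)])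
    fix x g :: "int \<Rightarrow> real" and \<kappa> \<omega>' M :: real and D :: "nat \<Rightarrow> real \<Rightarrow> real" and j :: int
    assume n: "near_uniform \<mu> x" and \<omega>'0: "0 \<le> \<omega>'" and \<omega>'\<mu>: "\<omega>' \<le> 2 * \<mu>" and g: "\<And>j. \<bar>g j\<bar> \<le> Cg * \<omega>'"
      and gs: "\<And>j. (\<Sum>i\<in>stencil s. coef s x j i * (g (j + i) - g j)) = trunc_coef s x j + \<kappa>"
      and D: "\<And>q y. q \<le> 2 * s + 2 \<Longrightarrow> (D q has_field_derivative D (Suc q) y) (at y)"
      and M: "\<And>y. \<bar>D (2 * s + 3) y\<bar> \<le> M"
    have M0: "0 \<le> M" using M[of 0] by linarith
    have sm: "strict_mono x" by (rule near_uniform_strict_mono[OF n \<mu>(2)])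
    have co: "\<bar>coef s x j i - uniform_coef s i\<bar> \<le> \<eta>" if "i \<in> stencil s" for i j
      using \<mu>1(2)[OF near_uniform_mono[OF n \<mu>(3)] that] .
    have sumc: "(\<Sum>i\<in>stencil s. \<bar>coef s x j i\<bar>) \<le> A" for j
    proof -
      have "(\<Sum>i\<in>stencil s. \<bar>coef s x j i\<bar>) \<le> (\<Sum>i\<in>stencil s. \<bar>uniform_coef s i\<bar> + 1)"
      proof (rule sum_mono)
        fix i assume "i \<in> stencil s"
        from co[OF this, of j] \<eta>(2) show "\<bar>coef s x j i\<bar> \<le> \<bar>uniform_coef s i\<bar> + 1" by linarith
      qed
      also have "\<dots> = A" by (simp add: sum.distrib card_stencil A_def U_def uniform_coef_norm_def)
      finally show ?thesis .
    qed
    have g2: "\<bar>g j\<bar> \<le> 2 * (Cg * \<mu>)" for j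
      using g[of j] mult_left_mono[OF \<omega>'\<mu> Cg] by simp
    have Cm: "0 \<le> 2 * (Cg * \<mu>)" using Cg \<mu>(1) by simp
    define f where "f = D (2 * s + 2)"
    have fd: "\<bar>f b - f a\<bar> \<le> M * \<bar>b - a\<bar>" for a b
    proof -
      have "norm (f b - f a) \<le> M * norm (b - a)"
        unfolding f_def
        by (rule field_differentiable_bound[where S = UNIV and f' = "D (2 * s + 3)"])
          (use D[of "2 * s + 2"] M in \<open>auto simp: eval_nat_numeral\<close>)
      then show ?thesis by simp
    qed
    define \<omega>0 where "\<omega>0 = trunc_coef s real_of_int 0"
    note nb = near_uniform_stencil_bounds[OF n \<mu>(2)]
    define e where "e j = (\<Sum>i\<in>stencil s. uniform_coef s i * taylor_rem (2 * s + 2) D (x j) (real_of_int i))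
      - (\<Sum>i\<in>stencil s. coef s x j i * taylor_rem (2 * s + 2) D (x j) (x (j + i) - x j))
      - (\<Sum>i\<in>stencil s. coef s x j i * (g (j + i) * (f (x (j + i)) - f (x j)))) + g j * D (2 * s + 3) (x j)" for j
    define \<rho> where "\<rho> = residual s D x g"
    have \<rho>e: "\<rho> j = uniform_trunc s D (x j) - (\<omega>0 + \<kappa>) * f (x j) + e j" for j
    proof -
      have "(\<Sum>i\<in>stencil s. coef s x j i * (g (j + i) * f (x (j + i)) - g j * f (x j)))
          = (\<Sum>i\<in>stencil s. coef s x j i * (g (j + i) - g j)) * f (x j) + (\<Sum>i\<in>stencil s. coef s x j i * (g (j + i) * (f (x (j + i)) - f (x j))))"
        unfolding sum_distrib_right sum.distrib[symmetric] by (intro sum.cong refl) (simp add: algebra_simps)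
      then show ?thesis
        unfolding \<rho>_def residual_def e_def uniform_trunc_expansion trunc_expansion[OF sm] gs \<omega>0_def f_def[symmetric]
        by (simp add: algebra_simps)
    qed
    have rem: "\<bar>uniform_coef s i * taylor_rem (2 * s + 2) D (x j) (real_of_int i) - coef s x j i * taylor_rem (2 * s + 2) D (x j) (x (j + i) - x j)\<bar>
        \<le> \<eta> * (M * c') + \<bar>uniform_coef s i\<bar> * (M * c' * \<mu>)" if i: "i \<in> stencil s" for i j
    proof -
      let ?r = "taylor_rem (2 * s + 2) D (x j)" and ?y = "x (j + i) - x j"
      have y: "\<bar>?y\<bar> \<le> Y" and iY: "\<bar>real_of_int i\<bar> \<le> Y"
        using nb(1)[OF i] stencil_abs_le_real[OF i] by (simp_all add: Y_def)
      have ry: "\<bar>?r ?y\<bar> \<le> M * c'"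
        using taylor_rem_bound[of "2 * s + 2" D M ?y Y "x j"] D M y by (simp add: c'_def eval_nat_numeral)
      have rd: "\<bar>?r (real_of_int i) - ?r ?y\<bar> \<le> M * c' * \<mu>"
      proof -
        have "\<bar>?r (real_of_int i) - ?r ?y\<bar> \<le> M * Y ^ (2 * s + 2) * \<bar>real_of_int i - ?y\<bar>"
          by (rule taylor_rem_lipschitz) (use D M y iY in \<open>auto simp: eval_nat_numeral\<close>)
        also have "\<dots> \<le> M * Y ^ (2 * s + 2) * (real (s + 1) * \<mu>)"
          using nb(2)[OF i, of j] M0 Y by (intro mult_left_mono) (auto simp: abs_minus_commute)
        also have "\<dots> \<le> M * Y ^ (2 * s + 2) * (Y * \<mu>)"
          using M0 Y \<mu>(1) by (intro mult_left_mono mult_right_mono) (auto simp: Y_def)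
        also have "\<dots> = M * c' * \<mu>" by (simp add: c'_def eval_nat_numeral)
        finally show ?thesis .
      qed
      have "uniform_coef s i * ?r (real_of_int i) - coef s x j i * ?r ?y
          = (uniform_coef s i - coef s x j i) * ?r ?y + uniform_coef s i * (?r (real_of_int i) - ?r ?y)"
        by (simp add: algebra_simps)
      then have "\<bar>uniform_coef s i * ?r (real_of_int i) - coef s x j i * ?r ?y\<bar>
          \<le> \<bar>uniform_coef s i - coef s x j i\<bar> * \<bar>?r ?y\<bar> + \<bar>uniform_coef s i\<bar> * \<bar>?r (real_of_int i) - ?r ?y\<bar>"
        unfolding abs_mult[symmetric] by (simp only: abs_triangle_ineq)
      also have "\<dots> \<le> \<eta> * (M * c') + \<bar>uniform_coef s i\<bar> * (M * c' * \<mu>)"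
        using co[OF i, of j] ry rd \<eta>(1) by (intro add_mono mult_mono mult_left_mono) (auto simp: abs_minus_commute)
      finally show ?thesis .
    qed
    have e1: "\<bar>(\<Sum>i\<in>stencil s. uniform_coef s i * taylor_rem (2 * s + 2) D (x j) (real_of_int i))
      - (\<Sum>i\<in>stencil s. coef s x j i * taylor_rem (2 * s + 2) D (x j) (x (j + i) - x j))\<bar>
      \<le> M * (c' * (real (2 * s + 1) * \<eta>) + c' * U * \<mu>)" for j
    proof -
      have "\<bar>(\<Sum>i\<in>stencil s. uniform_coef s i * taylor_rem (2 * s + 2) D (x j) (real_of_int i))
        - (\<Sum>i\<in>stencil s. coef s x j i * taylor_rem (2 * s + 2) D (x j) (x (j + i) - x j))\<bar>
        \<le> (\<Sum>i\<in>stencil s. \<eta> * (M * c') + \<bar>uniform_coef s i\<bar> * (M * c' * \<mu>))"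
        unfolding sum_subtractf[symmetric] by (rule order_trans[OF sum_abs sum_mono]) (rule rem)
      also have "\<dots> = real (2 * s + 1) * (\<eta> * (M * c')) + U * (M * c' * \<mu>)"
        by (simp only: sum.distrib sum_constant card_stencil U_def uniform_coef_norm_def sum_distrib_right[symmetric])
      finally show ?thesis by (simp add: algebra_simps)
    qed
    have e2: "\<bar>\<Sum>i\<in>stencil s. coef s x j i * (g (j + i) * (f (x (j + i)) - f (x j)))\<bar> \<le> A * (2 * (Cg * \<mu>) * (M * Y))" for j
    proof (rule abs_sum_mult_le[OF _ sumc])
      fix i assume i: "i \<in> stencil s"
      have "\<bar>f (x (j + i)) - f (x j)\<bar> \<le> M * Y"
        using fd[of "x (j + i)" "x j"] mult_left_mono[OF nb(1)[OF i, of j] M0] by (simp add: Y_def)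
      then show "\<bar>g (j + i) * (f (x (j + i)) - f (x j))\<bar> \<le> 2 * (Cg * \<mu>) * (M * Y)"
        unfolding abs_mult using g2 Cm by (intro mult_mono) auto
    qed (use Cg \<mu>(1) M0 Y in auto)
    have e3: "\<bar>g j * D (2 * s + 3) (x j)\<bar> \<le> 2 * (Cg * \<mu>) * M" for j
      unfolding abs_mult using g2 M Cm by (intro mult_mono) auto
    have eb: "\<bar>e j\<bar> \<le> M * (c' * (real (2 * s + 1) * \<eta>) + c' * U * \<mu> + 2 * (A * Y + 1) * Cg * \<mu>)" for j
    proof -
      have "\<bar>a - b - c + d\<bar> \<le> \<bar>a - b\<bar> + \<bar>c\<bar> + \<bar>d\<bar>" for a b c d :: real by linarith
      then have "\<bar>e j\<bar> \<le> M * (c' * (real (2 * s + 1) * \<eta>) + c' * U * \<mu>) + A * (2 * (Cg * \<mu>) * (M * Y)) + 2 * (Cg * \<mu>) * M"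
        unfolding e_def using e1[of j] e2[of j] e3[of j] by (meson add_mono order_trans)
      also have "\<dots> = M * (c' * (real (2 * s + 1) * \<eta>) + c' * U * \<mu> + 2 * (A * Y + 1) * Cg * \<mu>)"
        by (simp add: algebra_simps)
      finally show ?thesis .
    qed
    have \<kappa>b: "\<bar>\<omega>0 + \<kappa>\<bar> \<le> (cw + 4 * A * Cg) * \<mu>"
    proof -
      have "\<bar>trunc_coef s x 0 - trunc_coef s real_of_int 0\<bar> \<le> (2 * real (s + 1)) ^ (2 * s + 1) * real (2 * s + 1) * (real (s + 1) * \<mu>)"
      proof (rule trunc_coef_diff_le)
        fix i assume i: "i \<in> stencil s"
        show "\<bar>x 0 - x (0 + i)\<bar> \<le> 2 * real (s + 1)" using nb(1)[OF i, of 0] by (simp add: abs_minus_commute)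
        show "\<bar>real_of_int 0 - real_of_int (0 + i)\<bar> \<le> 2 * real (s + 1)"
          using stencil_abs_le_real[OF i] by simp
        show "\<bar>(x 0 - x (0 + i)) - (real_of_int 0 - real_of_int (0 + i))\<bar> \<le> real (s + 1) * \<mu>"
          using nb(2)[OF i, of 0] by (simp add: abs_minus_commute algebra_simps)
      qed (use \<mu>(1) in auto)
      then have 1: "\<bar>trunc_coef s x 0 - \<omega>0\<bar> \<le> cw * \<mu>" by (simp only: \<omega>0_def cw_def Y_def mult.assoc)
      have "\<bar>\<Sum>i\<in>stencil s. coef s x 0 i * (g (0 + i) - g 0)\<bar> \<le> A * (4 * (Cg * \<mu>))"
      proof (rule abs_sum_mult_le[OF _ sumc])
        show "\<bar>g (0 + i) - g 0\<bar> \<le> 4 * (Cg * \<mu>)" for i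
          using g2[of "0 + i"] g2[of 0] by linarith
      qed (use Cg \<mu>(1) in auto)
      then have "\<bar>trunc_coef s x 0 + \<kappa>\<bar> \<le> A * (4 * (Cg * \<mu>))" unfolding gs .
      then show ?thesis using 1 by (simp add: algebra_simps)
    qed
    have hj: "\<bar>x (j + 1) - x j\<bar> \<le> 1 + \<mu>" using n by (simp add: near_uniform_def abs_le_iff) (smt (verit))
    have "\<bar>\<rho> (j + 1) - \<rho> j\<bar> \<le> \<bar>uniform_trunc s D (x (j + 1)) - uniform_trunc s D (x j)\<bar>
        + \<bar>\<omega>0 + \<kappa>\<bar> * \<bar>f (x (j + 1)) - f (x j)\<bar> + \<bar>e (j + 1)\<bar> + \<bar>e j\<bar>"
    proof -
      have "\<rho> (j + 1) - \<rho> j = (uniform_trunc s D (x (j + 1)) - uniform_trunc s D (x j))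
        - (\<omega>0 + \<kappa>) * (f (x (j + 1)) - f (x j)) + e (j + 1) - e j"
        unfolding \<rho>e by (simp add: algebra_simps)
      then show ?thesis unfolding abs_mult[symmetric] by linarith
    qed
    also have "\<bar>uniform_trunc s D (x (j + 1)) - uniform_trunc s D (x j)\<bar> \<le> cs * (M * (1 + \<mu>))"
    proof -
      have "\<bar>uniform_trunc s D (x (j + 1)) - uniform_trunc s D (x j)\<bar> \<le> cs * (M * \<bar>x (j + 1) - x j\<bar>)"
        unfolding cs_def by (rule uniform_trunc_lipschitz[OF D M])
      also have "\<dots> \<le> cs * (M * (1 + \<mu>))" using hj M0 cs by (intro mult_left_mono)
      finally show ?thesis .
    qed
    also have "\<bar>\<omega>0 + \<kappa>\<bar> * \<bar>f (x (j + 1)) - f (x j)\<bar> \<le> ((cw + 4 * A * Cg) * \<mu>) * (M * 2)"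
    proof (rule mult_mono[OF \<kappa>b])
      have "\<bar>f (x (j + 1)) - f (x j)\<bar> \<le> M * \<bar>x (j + 1) - x j\<bar>" by (rule fd)
      also have "\<dots> \<le> M * 2" using hj \<mu>(2) M0 by (intro mult_left_mono) auto
      finally show "\<bar>f (x (j + 1)) - f (x j)\<bar> \<le> M * 2" .
    qed (use cw A Cg \<mu>(1) in auto)
    also note eb[of "j + 1"]
    also note eb[of j]
    finally have "\<bar>\<rho> (j + 1) - \<rho> j\<bar> \<le> M * (cs + cs * \<mu> + 2 * (cw + 4 * A * Cg) * \<mu>
        + 2 * (c' * (real (2 * s + 1) * \<eta>)) + 2 * c' * U * \<mu> + 4 * (A * Y + 1) * Cg * \<mu>)"
      by (simp add: algebra_simps)
    also have "\<dots> \<le> M * (cs + \<delta>)"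
    proof (rule mult_left_mono[OF _ M0])
      have "cs * \<mu> + 2 * (cw + 4 * A * Cg) * \<mu> + 2 * c' * U * \<mu> + 4 * (A * Y + 1) * Cg * \<mu> \<le> Z * \<mu>"
        using \<mu>(1) by (simp add: Z_def algebra_simps)
      then show "cs + cs * \<mu> + 2 * (cw + 4 * A * Cg) * \<mu>
        + 2 * (c' * (real (2 * s + 1) * \<eta>)) + 2 * c' * U * \<mu> + 4 * (A * Y + 1) * Cg * \<mu> \<le> cs + \<delta>"
        using \<mu>(4) \<eta>(3) by linarith
    qed
    finally show "\<bar>residual s D x g (j + 1) - residual s D x g j\<bar>
      \<le> (fact s * fact (s + 1) / fact (2 * s + 2) + \<delta>) * M"
      unfolding \<rho>_def cs_def by (simp only: mult.commute)
  qed
qed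

section \<open>The energy estimate\<close>

text \<open>The square root is regularised as the energy may vanish.\<close>

lemma sqrt_growth_bound:
  fixes E :: "real \<Rightarrow> real"
  assumes E0: "\<And>t. 0 \<le> t \<Longrightarrow> 0 \<le> E t"
    and dE: "\<And>t. 0 \<le> t \<Longrightarrow> (E has_real_derivative E' t) (at t within {0..})"
    and le: "\<And>t. 0 \<le> t \<Longrightarrow> E' t \<le> 2 * R * sqrt (E t)" and R: "0 \<le> R" and t: "0 \<le> t"
  shows "sqrt (E t) \<le> sqrt (E 0) + R * t"
proof (rule field_le_epsilon)
  fix d :: real assume d: "d > 0"
  define \<phi> where "\<phi> \<tau> = sqrt (E \<tau> + d\<^sup>2) - R * \<tau>" for \<tau>
  have pos: "0 < E \<tau> + d\<^sup>2" if "0 \<le> \<tau>" for \<tau>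
    using E0[OF that] d by (simp add: add_nonneg_pos)
  have d\<phi>: "(\<phi> has_real_derivative E' \<tau> / (2 * sqrt (E \<tau> + d\<^sup>2)) - R) (at \<tau> within {0..})" if "0 \<le> \<tau>" for \<tau>
    unfolding \<phi>_def[abs_def] using pos[OF that]
    by (auto intro!: derivative_eq_intros dE[OF that] simp: field_simps)
  have "\<phi> t \<le> \<phi> 0"
  proof (rule DERIV_nonpos_imp_decreasing_open[OF t])
      fix \<tau> assume \<tau>: "0 < \<tau>" "\<tau> < t"
      have "(\<phi> has_real_derivative E' \<tau> / (2 * sqrt (E \<tau> + d\<^sup>2)) - R) (at \<tau>)"
        using d\<phi>[of \<tau>] \<tau> at_within_interior[of \<tau> "{0..}"] by (simp add: interior_real_atLeast)
      moreover have "E' \<tau> / (2 * sqrt (E \<tau> + d\<^sup>2)) - R \<le> 0"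
      proof -
        have "E' \<tau> \<le> 2 * R * sqrt (E \<tau>)" using le \<tau> by simp
        also have "\<dots> \<le> 2 * R * sqrt (E \<tau> + d\<^sup>2)" using R by (intro mult_left_mono) auto
        finally show ?thesis using pos[of \<tau>] \<tau> by (simp add: divide_le_eq mult_ac)
      qed
      ultimately show "\<exists>y. DERIV \<phi> \<tau> :> y \<and> y \<le> 0" by blast
    next
      show "continuous_on {0..t} \<phi>"
        by (rule DERIV_continuous_on[OF DERIV_subset[OF d\<phi>]]) auto
  qed
  then have "sqrt (E t + d\<^sup>2) \<le> sqrt (E 0 + d\<^sup>2) + R * t" by (simp add: \<phi>_def)
  moreover have "sqrt (E t) \<le> sqrt (E t + d\<^sup>2)" by simp
  moreover have "sqrt (E 0 + d\<^sup>2) \<le> sqrt (E 0) + d"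
    using sqrt_add_le_add_sqrt[OF E0[of 0], of "d\<^sup>2"] d by simp
  ultimately show "sqrt (E t) \<le> sqrt (E 0) + R * t + d" by linarith
qed

text \<open>The quadratic form decreases along the homogeneous equation, so its square root grows at most at the
rate of the forcing; passing between the form and the Euclidean norm costs the factor in front.\<close>

lemma energy_estimate:
  fixes z r :: "real \<Rightarrow> int \<Rightarrow> real" and w :: "'q \<Rightarrow> int \<Rightarrow> complex"
  assumes Q: "finite Q" and \<delta>: "0 < \<delta>" "\<delta> < 1" and H: "0 < H"
    and form: "\<And>z :: int \<Rightarrow> real. (\<And>j. z (j + int N) = z j) \<Longrightarrow> (\<Sum>j\<in>{0..<int N}. z j) = 0 \<Longrightarrow>
      lyapunov_form N \<delta> B Q w z"
    and z: "\<And>t j. 0 \<le> t \<Longrightarrow> z t (j + int N) = z t j" "\<And>t. 0 \<le> t \<Longrightarrow> (\<Sum>j\<in>{0..<int N}. z t j) = 0"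
    and r: "\<And>t j. 0 \<le> t \<Longrightarrow> r t (j + int N) = r t j" "\<And>t. 0 \<le> t \<Longrightarrow> (\<Sum>j\<in>{0..<int N}. r t j) = 0"
      "\<And>t j. 0 \<le> t \<Longrightarrow> \<bar>r t j\<bar> \<le> Rb"
    and dz: "\<And>t j. 0 \<le> t \<Longrightarrow> ((\<lambda>\<tau>. z \<tau> j) has_real_derivative - ((B (z t) j - r t j) / H)) (at t within {0..})"
    and t: "0 \<le> t"
  shows "sqrt (\<Sum>j\<in>{0..<int N}. (z t j)\<^sup>2)
    \<le> sqrt ((1 + \<delta>) / (1 - \<delta>)) * (sqrt (\<Sum>j\<in>{0..<int N}. (z 0 j)\<^sup>2) + sqrt (real N) * Rb * t / H)"
proof -
  define L where "L y q = (\<Sum>j\<in>{0..<int N}. w q j * complex_of_real (y j))" for y q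
  define En where "En y = (\<Sum>q\<in>Q. (norm (L y q))\<^sup>2)" for y
  have En0: "0 \<le> En y" for y by (simp add: En_def sum_nonneg)
  have eq: "(\<Sum>j\<in>{0..<int N}. (y j)\<^sup>2) \<le> (1 + \<delta>) * En y" "(1 - \<delta>) * En y \<le> (\<Sum>j\<in>{0..<int N}. (y j)\<^sup>2)"
    and dissipation: "0 \<le> (\<Sum>q\<in>Q. Re (cnj (L y q) * L (B y) q))"
    if "\<And>j. y (j + int N) = y j" "(\<Sum>j\<in>{0..<int N}. y j) = 0" for y
  proof -
    have F: "\<bar>(\<Sum>j\<in>{0..<int N}. (y j)\<^sup>2) - En y\<bar> \<le> \<delta> * En y \<and> 0 \<le> (\<Sum>q\<in>Q. Re (cnj (L y q) * L (B y) q))"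
      using form[of y, OF that] by (simp only: L_def En_def lyapunov_form_def)
    then show "0 \<le> (\<Sum>q\<in>Q. Re (cnj (L y q) * L (B y) q))" by (rule conjunct2)
    from F have "\<bar>(\<Sum>j\<in>{0..<int N}. (y j)\<^sup>2) - En y\<bar> \<le> \<delta> * En y" by (rule conjunct1)
    then show "(\<Sum>j\<in>{0..<int N}. (y j)\<^sup>2) \<le> (1 + \<delta>) * En y" "(1 - \<delta>) * En y \<le> (\<Sum>j\<in>{0..<int N}. (y j)\<^sup>2)"
      unfolding distrib_right left_diff_distrib mult_1_left by linarith+
  qed
  have Rb0: "0 \<le> Rb" using r(3)[of 0 0] by linarith
  define Rr where "Rr = sqrt (real N) * Rb / (sqrt (1 - \<delta>) * H)"
  have Rr0: "0 \<le> Rr" using Rb0 H \<delta> by (simp add: Rr_def)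
  define E' where "E' \<tau> = 2 * (\<Sum>q\<in>Q. Re (cnj (L (z \<tau>) q) * L (\<lambda>j. - ((B (z \<tau>) j - r \<tau> j) / H)) q))" for \<tau>
  have "sqrt (En (z t)) \<le> sqrt (En (z 0)) + Rr * t"
  proof (rule sqrt_growth_bound[where E = "\<lambda>\<tau>. En (z \<tau>)" and E' = E'])
    fix \<tau> :: real assume \<tau>: "0 \<le> \<tau>"
    show "((\<lambda>\<tau>. En (z \<tau>)) has_real_derivative E' \<tau>) (at \<tau> within {0..})"
    proof -
      define y where "y j = - ((B (z \<tau>) j - r \<tau> j) / H)" for j
      have dy: "((\<lambda>\<tau>. z \<tau> j) has_real_derivative y j) (at \<tau> within {0..})" for j
        unfolding y_def by (rule dz[OF \<tau>])
      have Re: "((\<lambda>\<tau>. Re (L (z \<tau>) q)) has_real_derivative Re (L y q)) (at \<tau> within {0..})" for q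
      proof -
        have "((\<lambda>\<tau>. \<Sum>j\<in>{0..<int N}. Re (w q j) * z \<tau> j) has_real_derivative (\<Sum>j\<in>{0..<int N}. Re (w q j) * y j)) (at \<tau> within {0..})"
          by (intro DERIV_sum DERIV_cmult dy)
        then show ?thesis by (simp add: L_def)
      qed
      have Im: "((\<lambda>\<tau>. Im (L (z \<tau>) q)) has_real_derivative Im (L y q)) (at \<tau> within {0..})" for q
      proof -
        have "((\<lambda>\<tau>. \<Sum>j\<in>{0..<int N}. Im (w q j) * z \<tau> j) has_real_derivative (\<Sum>j\<in>{0..<int N}. Im (w q j) * y j)) (at \<tau> within {0..})"
          by (intro DERIV_sum DERIV_cmult dy)
        then show ?thesis by (simp add: L_def)
      qed
      have "((\<lambda>\<tau>. (norm (L (z \<tau>) q))\<^sup>2) has_real_derivative 2 * Re (cnj (L (z \<tau>) q) * L y q)) (at \<tau> within {0..})" for q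
        using DERIV_add[OF DERIV_power[OF Re[of q], of 2] DERIV_power[OF Im[of q], of 2]]
        by (simp add: cmod_power2 algebra_simps)
      then have "((\<lambda>\<tau>. \<Sum>q\<in>Q. (norm (L (z \<tau>) q))\<^sup>2) has_real_derivative (\<Sum>q\<in>Q. 2 * Re (cnj (L (z \<tau>) q) * L y q))) (at \<tau> within {0..})"
        by (intro DERIV_sum)
      then show ?thesis by (simp only: En_def E'_def y_def[abs_def] sum_distrib_left)
    qed
    show "E' \<tau> \<le> 2 * Rr * sqrt (En (z \<tau>))"
    proof -
      have Ly: "L (\<lambda>j. - ((B (z \<tau>) j - r \<tau> j) / H)) q = (L (r \<tau>) q - L (B (z \<tau>)) q) / of_real H" for q
        unfolding L_def by (simp add: sum_subtractf[symmetric] sum_divide_distrib algebra_simps diff_divide_distrib)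
      have split: "Re (cnj (L (z \<tau>) q) * L (\<lambda>j. - ((B (z \<tau>) j - r \<tau> j) / H)) q)
          = (Re (cnj (L (z \<tau>) q) * L (r \<tau>) q) - Re (cnj (L (z \<tau>) q) * L (B (z \<tau>)) q)) / H" for q
        unfolding Ly by (simp add: algebra_simps diff_divide_distrib add_divide_distrib)
      have E'e: "E' \<tau> = 2 / H * ((\<Sum>q\<in>Q. Re (cnj (L (z \<tau>) q) * L (r \<tau>) q)) - (\<Sum>q\<in>Q. Re (cnj (L (z \<tau>) q) * L (B (z \<tau>)) q)))"
        unfolding E'_def split sum_subtractf[symmetric] sum_divide_distrib[symmetric] by simp
      have "(\<Sum>q\<in>Q. Re (cnj (L (z \<tau>) q) * L (r \<tau>) q)) \<le> (\<Sum>q\<in>Q. \<bar>norm (L (z \<tau>) q)\<bar> * \<bar>norm (L (r \<tau>) q)\<bar>)"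
      proof (rule sum_mono)
        fix q
        show "Re (cnj (L (z \<tau>) q) * L (r \<tau>) q) \<le> \<bar>norm (L (z \<tau>) q)\<bar> * \<bar>norm (L (r \<tau>) q)\<bar>"
          using complex_Re_le_cmod[of "cnj (L (z \<tau>) q) * L (r \<tau>) q"] by (simp add: norm_mult)
      qed
      also have "\<dots> \<le> sqrt (En (z \<tau>)) * sqrt (En (r \<tau>))"
        using L2_set_mult_ineq[of "\<lambda>q. norm (L (z \<tau>) q)" "\<lambda>q. norm (L (r \<tau>) q)" Q] by (simp add: L2_set_def En_def)
      also have "\<dots> \<le> sqrt (En (z \<tau>)) * (sqrt (real N) * Rb / sqrt (1 - \<delta>))"
      proof (rule mult_left_mono)
        have "(1 - \<delta>) * En (r \<tau>) \<le> (\<Sum>j\<in>{0..<int N}. (r \<tau> j)\<^sup>2)" using eq(2)[OF r(1,2)[OF \<tau>]] .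
        also have "\<dots> \<le> (\<Sum>j\<in>{0..<int N}. Rb\<^sup>2)"
          by (intro sum_mono) (use r(3)[OF \<tau>] in \<open>simp add: abs_le_square_iff[symmetric] order_trans[OF _ abs_ge_self]\<close>)
        also have "\<dots> = real N * Rb\<^sup>2" by simp
        finally have "En (r \<tau>) \<le> real N * Rb\<^sup>2 / (1 - \<delta>)" using \<delta> by (simp add: pos_le_divide_eq mult.commute)
        then have "sqrt (En (r \<tau>)) \<le> sqrt (real N * Rb\<^sup>2 / (1 - \<delta>))" by simp
        also have "\<dots> = sqrt (real N) * Rb / sqrt (1 - \<delta>)" using Rb0 by (simp add: real_sqrt_divide real_sqrt_mult)
        finally show "sqrt (En (r \<tau>)) \<le> sqrt (real N) * Rb / sqrt (1 - \<delta>)" .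
      qed (simp add: En0)
      finally have 1: "(\<Sum>q\<in>Q. Re (cnj (L (z \<tau>) q) * L (r \<tau>) q)) \<le> sqrt (En (z \<tau>)) * (sqrt (real N) * Rb / sqrt (1 - \<delta>))" .
      have "E' \<tau> \<le> 2 / H * (sqrt (En (z \<tau>)) * (sqrt (real N) * Rb / sqrt (1 - \<delta>)))"
        unfolding E'e using 1 dissipation[OF z[OF \<tau>]] H by (intro mult_left_mono) auto
      also have "\<dots> = 2 * Rr * sqrt (En (z \<tau>))" by (simp add: Rr_def mult_ac)
      finally show ?thesis .
    qed
  qed (use En0 Rr0 t in auto)
  have s\<delta>: "0 < sqrt (1 - \<delta>)" using \<delta> by simp
  have "sqrt (En (z 0)) \<le> sqrt (\<Sum>j\<in>{0..<int N}. (z 0 j)\<^sup>2) / sqrt (1 - \<delta>)"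
  proof -
    have "(1 - \<delta>) * En (z 0) \<le> (\<Sum>j\<in>{0..<int N}. (z 0 j)\<^sup>2)" using eq(2)[OF z[OF order_refl]] .
    then have "sqrt ((1 - \<delta>) * En (z 0)) \<le> sqrt (\<Sum>j\<in>{0..<int N}. (z 0 j)\<^sup>2)" by (rule real_sqrt_le_mono)
    then show ?thesis using s\<delta> by (simp add: real_sqrt_mult pos_le_divide_eq mult.commute)
  qed
  then have 2: "sqrt (En (z t)) \<le> (sqrt (\<Sum>j\<in>{0..<int N}. (z 0 j)\<^sup>2) + sqrt (real N) * Rb * t / H) / sqrt (1 - \<delta>)"
    using \<open>sqrt (En (z t)) \<le> sqrt (En (z 0)) + Rr * t\<close> H by (simp add: Rr_def add_divide_distrib mult_ac)
  have "sqrt (\<Sum>j\<in>{0..<int N}. (z t j)\<^sup>2) \<le> sqrt ((1 + \<delta>) * En (z t))"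
    using eq(1)[OF z[OF t]] by (rule real_sqrt_le_mono)
  also have "\<dots> = sqrt (1 + \<delta>) * sqrt (En (z t))" by (rule real_sqrt_mult)
  also have "\<dots> \<le> sqrt (1 + \<delta>) * ((sqrt (\<Sum>j\<in>{0..<int N}. (z 0 j)\<^sup>2) + sqrt (real N) * Rb * t / H) / sqrt (1 - \<delta>))"
    using 2 \<delta> by (intro mult_left_mono) auto
  finally show ?thesis by (simp add: real_sqrt_divide)
qed

lemma mesh_h_period_multiple:
  assumes "\<And>j. h x (j + int m) = h x j"
  shows "h x (j + int m * b) = h x j"
proof (induction b rule: int_induct[where k = 0])
  case (step1 b)
  then show ?case using assms[of "j + int m * b"] by (simp add: algebra_simps)
next
  case (step2 b)
  then show ?case using assms[of "j + int m * (b - 1)"] by (simp add: algebra_simps)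
qed simp

text \<open>The minimal period of the cell lengths divides the number of cells, and the nodes advance over one
period by \<open>m\<close> average cell lengths.\<close>

lemma mesh_facts:
  assumes mesh: "mesh x"
  shows "mesh_N x > 0" "\<And>j. x (j + int (mesh_N x)) = x j + 2 * pi"
    "mesh_m x > 0" "\<And>j. h x (j + int (mesh_m x)) = h x j" "mesh_m x dvd mesh_N x"
    "\<And>j. h_min x \<le> h x j" "\<And>j. h x j \<le> h_max x"
    "h_av x > 0" "h_min x \<le> h_av x" "h_av x \<le> h_max x" "real (mesh_N x) * h_av x = 2 * pi"
    "\<And>j. x (j + int (mesh_m x)) = x j + real (mesh_m x) * h_av x"
proof -
  define N where "N = mesh_N x"
  define m where "m = mesh_m x"
  show N: "mesh_N x > 0" and xN: "\<And>j. x (j + int (mesh_N x)) = x j + 2 * pi"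
    using mesh_N[OF mesh] by (auto simp: is_mesh_period_def)
  have hN: "h x (j + int N) = h x j" for j
    using xN[of j] xN[of "j + 1"] by (simp add: h_def N_def algebra_simps)
  have ex: "\<exists>m. m > 0 \<and> (\<forall>j. h x (j + int m) = h x j)" using N hN by (auto simp: N_def)
  show m: "mesh_m x > 0" and hm: "\<And>j. h x (j + int (mesh_m x)) = h x j"
    using LeastI_ex[OF ex] by (auto simp: mesh_m_def)
  show dvd: "mesh_m x dvd mesh_N x"
  proof -
    define r where "r = N mod m"
    have "h x (j + int r) = h x j" for j
    proof -
      have "int N = int r + int m * int (N div m)" by (simp add: r_def flip: of_nat_mult of_nat_add)
      then have "h x (j + int r) = h x (j + int N + int m * (- int (N div m)))" by simp
      also have "\<dots> = h x (j + int N)" by (rule mesh_h_period_multiple) (simp add: hm m_def)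
      finally show ?thesis by (simp add: hN)
    qed
    moreover have "r < m" using m by (simp add: r_def m_def)
    ultimately have "\<not> r > 0" using not_less_Least[of r "\<lambda>m. m > 0 \<and> (\<forall>j. h x (j + int m) = h x j)"]
      by (auto simp: mesh_m_def m_def)
    then show ?thesis by (simp add: r_def m_def N_def dvd_eq_mod_eq_0)
  qed
  show hmin: "h_min x \<le> h x j" and hmax: "h x j \<le> h_max x" for j
    using mesh_finite_range_h[OF mesh] by (auto simp: h_min_def h_max_def)
  show H: "h_av x > 0" using N by (simp add: h_av_def)
  show NH: "real (mesh_N x) * h_av x = 2 * pi" using N by (simp add: h_av_def)
  have tele: "(\<Sum>j\<in>{a..<a + int k}. h x j) = x (a + int k) - x a" for a k
    unfolding h_def by (rule sum_int_telescope) simp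
  have tot: "(\<Sum>j\<in>{0..<int N}. h x j) = real N * h_av x"
    using tele[of 0 N] xN[of 0] NH by (simp add: N_def)
  have "real N * h_min x \<le> (\<Sum>j\<in>{0..<int N}. h x j)"
    using sum_bounded_below[of "{0..<int N}" "h_min x" "h x"] hmin by simp
  then have "real N * h_min x \<le> real N * h_av x" by (simp only: tot)
  then show "h_min x \<le> h_av x" using N by (simp add: N_def)
  have "(\<Sum>j\<in>{0..<int N}. h x j) \<le> real N * h_max x"
    using sum_bounded_above[of "{0..<int N}" "h x" "h_max x"] hmax by simp
  then have "real N * h_av x \<le> real N * h_max x" by (simp only: tot)
  then show "h_av x \<le> h_max x" using N by (simp add: N_def)
  show "x (j + int (mesh_m x)) = x j + real (mesh_m x) * h_av x" for j
  proof -
    have const: "x (j + int m) - x j = x (0 + int m) - x 0" for j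
    proof (rule int_const[of "\<lambda>j. x (j + int m) - x j"])
      show "x (j + 1 + int m) - x (j + 1) = x (j + int m) - x j" for j
        using hm[of j] by (simp add: h_def m_def algebra_simps)
    qed
    define c where "c = x (0 + int m) - x 0"
    have step: "x (j + int m) = x j + c" for j using const[of j] by (simp add: c_def)
    have "x (int m * int k) = x 0 + real k * c" for k
    proof (induction k)
      case (Suc k)
      then show ?case using step[of "int m * int k"] by (simp add: algebra_simps)
    qed simp
    moreover obtain n where n: "N = m * n" using dvd by (auto simp: N_def m_def)
    ultimately have "2 * pi = real n * c" using xN[of 0] by (simp add: N_def[symmetric])
    moreover have "real m * real n * h_av x = 2 * pi" using NH n by (simp add: N_def[symmetric])
    moreover have "n > 0" using N n by (cases n) (auto simp: N_def)
    ultimately have "c = real m * h_av x" by simp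
    then show ?thesis using step by (simp add: m_def)
  qed
qed

section \<open>The error bound\<close>

lemma C_k_DERIV:
  assumes "C_k k f" "i < k"
  shows "((deriv ^^ i) f has_real_derivative (deriv ^^ Suc i) f y) (at y)"
proof -
  have "(deriv ^^ i) f differentiable (at y)" using assms by (simp add: C_k_def)
  then show ?thesis by (simp add: DERIV_deriv_iff_real_differentiable)
qed

lemma C_k_continuous:
  assumes "C_k k f" "i \<le> k"
  shows "continuous_on UNIV ((deriv ^^ i) f)"
proof (cases "i = k")
  case True
  then show ?thesis using assms by (simp add: C_k_def)
next
  case False
  then have "i < k" using assms by simp
  from C_k_DERIV[OF assms(1) this] show ?thesis
    by (intro DERIV_continuous_on) (rule has_field_derivative_at_within)
qed

lemma deriv_periodic:
  fixes f :: "real \<Rightarrow> real"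
  assumes "\<And>y. f (y + c) = f y"
  shows "(deriv ^^ i) f (y + c) = (deriv ^^ i) f y"
proof (induction i arbitrary: y)
  case (Suc i)
  have "deriv ((deriv ^^ i) f) (y + c) = deriv (\<lambda>y. (deriv ^^ i) f (y + c)) y"
    by (simp add: deriv_def DERIV_shift)
  also have "(\<lambda>y. (deriv ^^ i) f (y + c)) = (deriv ^^ i) f" using Suc by (simp add: fun_eq_iff)
  finally show ?case by simp
qed (simp add: assms)

lemma deriv_seminorm_upper:
  assumes per: "\<And>y. f (y + 2 * pi) = f y" and C: "C_k k f" "i \<le> k"
  shows "\<bar>(deriv ^^ i) f y\<bar> \<le> deriv_seminorm i f"
proof -
  define F where "F = (deriv ^^ i) f"
  have Fp: "F (y + 2 * pi) = F y" for y unfolding F_def by (rule deriv_periodic) (rule per)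
  have Fk: "F (y + 2 * pi * real_of_int b) = F y" for y b
  proof (induction b rule: int_induct[where k = 0])
    case (step1 b)
    then show ?case using Fp[of "y + 2 * pi * real_of_int b"] by (simp add: algebra_simps)
  next
    case (step2 b)
    then show ?case using Fp[of "y + 2 * pi * real_of_int (b - 1)"] by (simp add: algebra_simps)
  qed simp
  have "continuous_on {0..2 * pi} F"
    using C_k_continuous[OF C] continuous_on_subset unfolding F_def by blast
  then have "compact (F ` {0..2 * pi})" by (intro compact_continuous_image) auto
  then obtain B where B: "\<And>y. y \<in> {0..2 * pi} \<Longrightarrow> \<bar>F y\<bar> \<le> B"
    using compact_imp_bounded bounded_real by (metis image_eqI)
  have "\<bar>F y\<bar> \<le> B" for y
  proof -
    define b where "b = \<lfloor>y / (2 * pi)\<rfloor>"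
    have "real_of_int b \<le> y / (2 * pi)" "y / (2 * pi) \<le> real_of_int b + 1" by (simp_all add: b_def)
    then have "y - 2 * pi * real_of_int b \<in> {0..2 * pi}" by (auto simp: field_simps)
    from B[OF this] Fk[of "y - 2 * pi * real_of_int b" b] show ?thesis by simp
  qed
  then have "bdd_above (range (\<lambda>y. \<bar>F y\<bar>))" by (intro bdd_aboveI[of _ B]) auto
  then show ?thesis unfolding deriv_seminorm_def F_def by (intro cSUP_upper) auto
qed

text \<open>An antiderivative on the whole line, as the characteristics leave every bounded interval.\<close>

lemma continuous_antiderivative:
  fixes f :: "real \<Rightarrow> real"
  assumes "continuous_on UNIV f"
  obtains V where "\<And>y. (V has_real_derivative f y) (at y)"
proof -
  have "isCont f y" for y using assms by (simp add: continuous_on_eq_continuous_at)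
  then have "\<exists>F. \<forall>x::real. - \<infinity> < ereal x \<longrightarrow> ereal x < \<infinity> \<longrightarrow> (F has_vector_derivative f x) (at x)"
    by (intro einterval_antiderivative) auto
  then show ?thesis using that by (auto simp: has_real_derivative_iff_has_vector_derivative)
qed

lemma flux_periodic:
  assumes "\<And>j. x (j + d) = x j + c" "\<And>j. z (j + d) = z j"
  shows "flux s x z (j + d) = flux s x z j"
  by (simp add: flux_def coef_period[of x d c, OF assms(1)] psum_shift assms(2))

lemma flux_telescope:
  fixes w :: "int \<Rightarrow> real"
  shows "flux s x (\<lambda>l. w (l + 1) - w l) j = (\<Sum>i\<in>stencil s. coef s x j i * (w (j + i) - w j))"
  by (simp add: flux_def psum_telescope[of w])

lemma flux_diff:
  fixes a b :: "int \<Rightarrow> real"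
  shows "flux s x (\<lambda>l. a l - b l) j = flux s x a j - flux s x b j"
proof -
  have "psum (\<lambda>l. a l - b l) j i = psum a j i - psum b j i" for i
    by (simp add: psum_def sum_subtractf)
  then show ?thesis by (simp add: flux_def right_diff_distrib sum_subtractf)
qed

lemma flux_scale:
  fixes w :: "int \<Rightarrow> real"
  assumes H: "H > 0"
  shows "flux s x w j = flux s (\<lambda>j. (x j - a) / H) (\<lambda>l. w l / H) j"
proof -
  have d: "(x k - a) / H - (x l - a) / H = (x k - x l) / H" for k l
    by (simp add: diff_divide_distrib)
  have "coef s (\<lambda>j. (x j - a) / H) j i = coef s x j i * H" for i
    using H unfolding coef_def lagrange_weight_def d by simp
  moreover have "psum (\<lambda>l. w l / H) j i = psum w j i / H" for i
    by (simp add: psum_def sum_divide_distrib diff_divide_distrib)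
  ultimately show ?thesis using H by (simp add: flux_def)
qed

text \<open>The factor that bounds the increments of \<open>\<omega>\<close> by the oscillation of the cell lengths; see
\<open>trunc_coef_diff_le\<close>.\<close>

definition trunc_coef_lipschitz :: "nat \<Rightarrow> real" where
  "trunc_coef_lipschitz s = (2 * real (s + 1)) ^ (2 * s + 1) * real (2 * s + 1)"

text \<open>A choice that depends on \<open>s\<close> and \<open>m\<close> only, so that the constant of the theorem does not depend on the
tolerance.\<close>

definition corrector_const :: "nat \<Rightarrow> nat \<Rightarrow> real" where
  "corrector_const s m = (SOME C. \<exists>\<mu>. corrector_ok s m \<mu> C)"

text \<open>The estimate of the theorem on a single mesh, with the two constants as parameters.\<close>

definition error_estimate :: "nat \<Rightarrow> real \<Rightarrow> real \<Rightarrow> (int \<Rightarrow> real) \<Rightarrow> bool" where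
  "error_estimate s A B x \<longleftrightarrow>
    (\<forall>v0 u. (\<forall>y. v0 (y + 2 * pi) = v0 y) \<longrightarrow> C_k (2 * s + 2) v0 \<longrightarrow> fv_solution (2 * s) x v0 u \<longrightarrow>
      (\<forall>t\<ge>0. 1 / sqrt (2 * pi) *
            sqrt (\<Sum>j = 1..int (mesh_N x). h x j * \<bar>u t j - cell_avg x (\<lambda>y. v0 (y - t)) j\<bar>\<^sup>2)
          \<le> A * deriv_seminorm (2 * s + 1) v0 * h_max x ^ (2 * s) * (h_max x - h_min x)
            + B * deriv_seminorm (2 * s + 2) v0 * h_max x ^ (2 * s + 1) * t))"

text \<open>The smallness of the mesh deviation is used for the corrector, for the stability, for the residual
and for the comparison of the cell lengths with their average. After rescaling to average cell
length one, the data at time \<open>\<tau>\<close> enter only through the functions \<open>D \<tau> q\<close>, the derivatives of a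
rescaled primitive of the exact solution.\<close>

lemma error_bound_for_period:
  fixes \<delta> :: real
  assumes m: "m > 0" and \<delta>: "\<delta> > 0"
  shows "\<exists>\<mu>>0. \<forall>x. mesh x \<longrightarrow> mesh_m x = m \<longrightarrow> h_max x - h_min x \<le> \<mu> * h_av x \<longrightarrow>
    error_estimate s (8 * (corrector_const s m * trunc_coef_lipschitz s)) (fact s * fact (s + 1) / fact (2 * s + 2) + \<delta>) x"
proof -
  define cs :: real where "cs = fact s * fact (s + 1) / fact (2 * s + 2)"
  have cs: "cs \<ge> 0" by (simp add: cs_def)
  define Cc where "Cc = corrector_const s m"
  have "\<exists>\<mu>. corrector_ok s m \<mu> Cc"
    unfolding Cc_def corrector_const_def by (rule someI_ex) (rule corrector[OF m])
  then obtain \<mu>c where ok: "corrector_ok s m \<mu>c Cc" by blast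
  have \<mu>c: "\<mu>c > 0" "\<mu>c < 1" and Cc: "Cc \<ge> 0" using ok by (auto simp: corrector_ok_def)
  define Cg where "Cg = Cc * trunc_coef_lipschitz s"
  have Cg: "Cg \<ge> 0" using Cc by (simp add: Cg_def trunc_coef_lipschitz_def)
  define \<theta> where "\<theta> = min 1 (\<delta> / (2 * (cs + \<delta> / 2)))"
  have cd: "cs + \<delta> / 2 > 0" using cs \<delta> by simp
  have \<theta>: "\<theta> > 0" "\<theta> \<le> 1" "\<theta> * (cs + \<delta> / 2) \<le> \<delta> / 2"
  proof -
    show "\<theta> > 0" "\<theta> \<le> 1" using \<delta> cd by (auto simp: \<theta>_def)
    have "\<theta> \<le> \<delta> / (2 * (cs + \<delta> / 2))" by (simp add: \<theta>_def)
    moreover have "2 * (cs + \<delta> / 2) > 0" using cd by simp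
    ultimately have "\<theta> * (2 * (cs + \<delta> / 2)) \<le> \<delta>" by (rule pos_le_divide_eq[THEN iffD1, rotated])
    then show "\<theta> * (cs + \<delta> / 2) \<le> \<delta> / 2" by (simp add: algebra_simps)
  qed
  \<comment> \<open>The factor \<open>1 + \<theta>\<close> is the total loss in the stability constant; half of \<open>\<delta>\<close> is left for the residual.\<close>
  define \<delta>1 where "\<delta>1 = \<theta> / 4"
  have \<delta>1: "\<delta>1 > 0" "\<delta>1 \<le> 1 / 4" "\<delta>1 < 1" using \<theta> by (auto simp: \<delta>1_def)
  have \<delta>2: "\<delta> / 2 > 0" using \<delta> by simp
  show ?thesis
  proof (rule near_uniform_stability[OF m \<delta>1(1), of s])
    fix \<mu>s :: real
    assume \<mu>s: "\<mu>s > 0" "\<mu>s < 1" and stab: "\<And>x n. near_uniform \<mu>s x \<Longrightarrow> x 0 = 0 \<Longrightarrow> (\<And>j. x (j + int m) = x j + real m) \<Longrightarrow> n > 0 \<Longrightarrow>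
      \<exists>(Q :: (int \<times> nat) set) (w :: int \<times> nat \<Rightarrow> int \<Rightarrow> complex). finite Q \<and>
        (\<forall>z :: int \<Rightarrow> real. (\<forall>j. z (j + int (m * n)) = z j) \<longrightarrow> (\<Sum>j\<in>{0..<int (m * n)}. z j) = 0 \<longrightarrow>
          lyapunov_form (m * n) \<delta>1 (fv_op s x) Q w z)"
    show ?thesis
    proof (rule residual_bound[OF \<delta>2 Cg, of s])
      fix \<mu>r :: real
      assume \<mu>r: "\<mu>r > 0" "\<mu>r < 1" and resid: "\<And>x g \<kappa> \<omega>' D M j. near_uniform \<mu>r x \<Longrightarrow> 0 \<le> \<omega>' \<Longrightarrow> \<omega>' \<le> 2 * \<mu>r \<Longrightarrow> (\<And>j. \<bar>g j\<bar> \<le> Cg * \<omega>') \<Longrightarrow>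
        (\<And>j. (\<Sum>i\<in>stencil s. coef s x j i * (g (j + i) - g j)) = trunc_coef s x j + \<kappa>) \<Longrightarrow>
        (\<And>q y. q \<le> 2 * s + 2 \<Longrightarrow> (D q has_field_derivative D (Suc q) y) (at y)) \<Longrightarrow>
        (\<And>y. \<bar>D (2 * s + 3) y\<bar> \<le> M) \<Longrightarrow>
        \<bar>residual s D x g (j + 1) - residual s D x g j\<bar>
        \<le> (fact s * fact (s + 1) / fact (2 * s + 2) + \<delta> / 2) * M"
      define \<mu> where "\<mu> = min (min \<mu>c \<mu>s) (min \<mu>r \<delta>1)"
      have \<mu>: "\<mu> > 0" "\<mu> \<le> \<mu>c" "\<mu> \<le> \<mu>s" "\<mu> \<le> \<mu>r" "\<mu> \<le> \<delta>1" "\<mu> < 1"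
        using \<mu>c \<mu>s \<mu>r \<delta>1 by (auto simp: \<mu>_def)
      show ?thesis
        unfolding error_estimate_def
      proof (intro exI[of _ \<mu>] conjI \<mu>(1) allI impI)
        fix x :: "int \<Rightarrow> real" and v0 :: "real \<Rightarrow> real" and u :: "real \<Rightarrow> int \<Rightarrow> real" and t :: real
        assume mesh: "mesh x" and xm: "mesh_m x = m" and dh: "h_max x - h_min x \<le> \<mu> * h_av x"
          and v0p: "\<forall>y. v0 (y + 2 * pi) = v0 y" and v0C: "C_k (2 * s + 2) v0" and sol: "fv_solution (2 * s) x v0 u" and t: "0 \<le> t"
        note mf = mesh_facts[OF mesh]
        define N where "N = mesh_N x"
        define H where "H = h_av x"
        obtain n where n: "N = m * n" using mf(5) by (auto simp: N_def xm)
        have N0: "N > 0" using mf(1) by (simp add: N_def)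
        have n0: "n > 0" using N0 n by (cases n) auto
        have H: "H > 0" using mf(8) by (simp add: H_def)
        have NH: "real N * H = 2 * pi" using mf(11) by (simp add: N_def H_def)
        define X where "X j = (x j - x 0) / H" for j
        have sm: "strict_mono x" using mesh by (simp add: mesh_def)
        have hX: "X (j + 1) - X j = h x j / H" for j by (simp add: X_def h_def diff_divide_distrib)
        define \<Delta> where "\<Delta> = h_max x - h_min x"
        define \<omega>' where "\<omega>' = \<Delta> / H"
        have \<Delta>0: "0 \<le> \<Delta>" using mf(6,7)[of 0] by (simp add: \<Delta>_def)
        have \<omega>'0: "0 \<le> \<omega>'" using \<Delta>0 H by (simp add: \<omega>'_def)
        have \<omega>'\<mu>: "\<omega>' \<le> \<mu>" using dh H by (simp add: \<omega>'_def \<Delta>_def H_def divide_le_eq)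
        have near_uniform: "near_uniform \<mu> X"
        proof -
          have "\<bar>X (j + 1) - X j - 1\<bar> \<le> \<mu>" for j
          proof -
            have "\<bar>h x j - H\<bar> \<le> \<Delta>" using mf(6,7)[of j] mf(9,10) by (auto simp: \<Delta>_def H_def abs_le_iff)
            then have "\<bar>h x j - H\<bar> / H \<le> \<omega>'" unfolding \<omega>'_def using H by (intro divide_right_mono) auto
            moreover have "\<bar>X (j + 1) - X j - 1\<bar> = \<bar>h x j - H\<bar> / H" unfolding hX
            proof -
              have "h x j / H - 1 = (h x j - H) / H" using H by (simp add: diff_divide_distrib)
              then show "\<bar>h x j / H - 1\<bar> = \<bar>h x j - H\<bar> / H" using H by (simp add: abs_divide)
            qed
            ultimately show ?thesis using \<omega>'\<mu> by linarith
          qed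
          then show ?thesis by (simp add: near_uniform_def)
        qed
        have X0: "X 0 = 0" by (simp add: X_def)
        have Xm: "X (j + int m) = X j + real m" for j
          using mf(12)[of j] H by (simp add: X_def xm H_def field_simps)
        have XN: "X (j + int N) = X j + real N" for j
        proof -
          have "x (j + int N) = x j + real N * H" using mf(2)[of j] NH by (simp add: N_def)
          then show ?thesis using H by (simp add: X_def field_simps)
        qed
        have \<omega>per: "trunc_coef s X (j + int m) = trunc_coef s X j" for j
        proof -
          have "X (j + int m) - X (j + int m + i) = X j - X (j + i)" for i
            using Xm[of j] Xm[of "j + i"] by (simp add: ac_simps)
          then show ?thesis by (simp add: trunc_coef_def)
        qed
        have \<omega>diff: "\<bar>trunc_coef s X (j + 1) - trunc_coef s X j\<bar> \<le> trunc_coef_lipschitz s * \<omega>'" for j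
          unfolding trunc_coef_lipschitz_def
        proof (rule trunc_coef_diff_le)
          fix i assume i: "i \<in> stencil s"
          show "\<bar>X (j + 1) - X (j + 1 + i)\<bar> \<le> 2 * real (s + 1)" "\<bar>X j - X (j + i)\<bar> \<le> 2 * real (s + 1)"
            using near_uniform_stencil_bounds(1)[OF near_uniform \<mu>(6) i] by (simp_all only: abs_minus_commute)
          have "(X (j + 1) - X (j + 1 + i)) - (X j - X (j + i)) = (h x j - h x (j + i)) / H"
            using hX[of j] hX[of "j + i"] by (simp add: diff_divide_distrib ac_simps)
          moreover have "\<bar>h x j - h x (j + i)\<bar> \<le> \<Delta>"
            using mf(6,7)[of j] mf(6,7)[of "j + i"] by (auto simp: \<Delta>_def abs_le_iff)
          ultimately show "\<bar>(X (j + 1) - X (j + 1 + i)) - (X j - X (j + i))\<bar> \<le> \<omega>'"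
            using H by (simp add: \<omega>'_def abs_divide divide_right_mono)
        qed (rule \<omega>'0)
        obtain g \<kappa> where gper: "\<And>j. g (j + int m) = g j" and gb: "\<And>j. \<bar>g j\<bar> \<le> Cg * \<omega>'"
          and gs: "\<And>j. (\<Sum>i\<in>stencil s. coef s X j i * (g (j + i) - g j)) = trunc_coef s X j + \<kappa>"
        proof -
          have "\<exists>g \<kappa>. (\<forall>j. g (j + int m) = g j) \<and> (\<forall>j. \<bar>g j\<bar> \<le> Cc * (trunc_coef_lipschitz s * \<omega>')) \<and>
            (\<forall>j. (\<Sum>i\<in>stencil s. coef s X j i * (g (j + i) - g j)) = trunc_coef s X j + \<kappa>)"
            using ok near_uniform_mono[OF near_uniform \<mu>(2)] Xm \<omega>per \<omega>diff unfolding corrector_ok_def by blast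
          then show ?thesis using that by (auto simp: Cg_def mult.assoc)
        qed
        have gN: "g (j + int N) = g j" for j
          using int_shift_mod[of g m j, OF gper] int_shift_mod[of g m "j + int N", OF gper] by (simp add: n)
        obtain V where V: "\<And>y. (V has_real_derivative v0 y) (at y)"
          using continuous_antiderivative C_k_continuous[OF v0C, of 0] by auto
        define \<Phi> where "\<Phi> q = (case q of 0 \<Rightarrow> V | Suc i \<Rightarrow> (deriv ^^ i) v0)" for q
        have d\<Phi>: "(\<Phi> q has_real_derivative \<Phi> (Suc q) y) (at y)" if "q \<le> 2 * s + 2" for q y
        proof (cases q)
          case 0
          then show ?thesis using V by (simp add: \<Phi>_def)
        next
          case (Suc i)
          then show ?thesis using C_k_DERIV[OF v0C, of i y] that by (simp add: \<Phi>_def)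
        qed
        define D where "D \<tau> q y = H ^ q / H * \<Phi> q (x 0 + H * y - \<tau>)" for \<tau> :: real and q and y :: real
        have dD: "(D \<tau> q has_real_derivative D \<tau> (Suc q) y) (at y)" if "q \<le> 2 * s + 2" for \<tau> q y
        proof -
          have "((\<lambda>y. x 0 + H * y - \<tau>) has_real_derivative H) (at y)" by (auto intro!: derivative_eq_intros)
          from DERIV_cmult[OF DERIV_chain2[OF d\<Phi>[OF that] this], of "H ^ q / H"]
          have "(D \<tau> q has_real_derivative H ^ q / H * (\<Phi> (Suc q) (x 0 + H * y - \<tau>) * H)) (at y)"
            unfolding D_def[abs_def] .
          moreover have "D \<tau> (Suc q) y = H ^ q / H * (\<Phi> (Suc q) (x 0 + H * y - \<tau>) * H)"
            by (simp add: D_def)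
          ultimately show ?thesis by (simp only:)
        qed
        have dt: "((\<lambda>\<tau>. D \<tau> q y) has_real_derivative - (D \<tau> (Suc q) y / H)) (at \<tau> within {0..})" if "q \<le> 2 * s + 2" for \<tau> q y
        proof -
          have "((\<lambda>\<tau>. x 0 + H * y - \<tau>) has_real_derivative - 1) (at \<tau> within {0..})" by (auto intro!: derivative_eq_intros)
          from DERIV_cmult[OF DERIV_chain2[OF d\<Phi>[OF that] this], of "H ^ q / H"]
          show ?thesis unfolding D_def using H by simp
        qed
        have H\<Phi>: "x 0 + H * X j = x j" for j using H by (simp add: X_def)
        have D0: "D \<tau> 0 (X j) = V (x j - \<tau>) / H" for \<tau> j
          using H\<Phi>[of j] by (simp add: D_def \<Phi>_def)
        have avg: "h x j * cell_avg x (\<lambda>y. v0 (y - \<tau>)) j / H = D \<tau> 0 (X (j + 1)) - D \<tau> 0 (X j)" for \<tau> j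
        proof -
          have le: "x j \<le> x (j + 1)" and pos: "h x j > 0"
            using sm by (simp_all add: strict_mono_less_eq h_def strict_mono_less)
          have dv: "((\<lambda>y. V (y - \<tau>)) has_real_derivative v0 (y - \<tau>)) (at y)" for y
          proof -
            have "((\<lambda>y. y - \<tau>) has_real_derivative 1) (at y)" by (auto intro!: derivative_eq_intros)
            from DERIV_chain2[OF V this] show ?thesis by simp
          qed
          have "((\<lambda>y. v0 (y - \<tau>)) has_integral (V (x (j + 1) - \<tau>) - V (x j - \<tau>))) {x j..x (j + 1)}"
            using le by (rule fundamental_theorem_of_calculus)
              (use dv in \<open>auto simp: has_real_derivative_iff_has_vector_derivative[symmetric] intro: has_field_derivative_at_within\<close>)
          then have "h x j * cell_avg x (\<lambda>y. v0 (y - \<tau>)) j = V (x (j + 1) - \<tau>) - V (x j - \<tau>)"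
            using pos by (simp add: cell_avg_def integral_unique)
          then show ?thesis by (simp add: D0 diff_divide_distrib)
        qed
        have \<Phi>per: "\<Phi> (Suc q) (y + 2 * pi) = \<Phi> (Suc q) y" for q y
          using deriv_periodic[of v0 "2 * pi"] v0p by (simp add: \<Phi>_def)
        have DN: "D \<tau> (Suc q) (X (j + int N)) = D \<tau> (Suc q) (X j)" for \<tau> q j
        proof -
          have "x 0 + H * X (j + int N) - \<tau> = (x 0 + H * X j - \<tau>) + 2 * pi"
            using NH by (simp add: XN algebra_simps)
          then show ?thesis unfolding D_def by (simp only: \<Phi>per)
        qed
        \<comment> \<open>The primitive is periodic only up to the mean of the data, which cancels in increments.\<close>
        define c0 where "c0 = V (2 * pi) - V 0"
        have VN: "V (y + 2 * pi) = V y + c0" for y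
        proof -
          have "DERIV (\<lambda>y. V (y + 2 * pi) - V y) y :> 0" for y
          proof -
            have "DERIV (\<lambda>y. V (y + 2 * pi)) y :> v0 (y + 2 * pi)" using V[of "y + 2 * pi"] unfolding DERIV_shift .
            from DERIV_diff[OF this V] show ?thesis using v0p by simp
          qed
          then have "V (y + 2 * pi) - V y = V (0 + 2 * pi) - V 0" using DERIV_isconst_all by blast
          then show ?thesis by (simp add: c0_def)
        qed
        have D0N: "D \<tau> 0 (X (j + int N)) = D \<tau> 0 (X j) + c0 / H" for \<tau> j
        proof -
          have "x (j + int N) - \<tau> = (x j - \<tau>) + 2 * pi" using mf(2)[of j] by (simp add: N_def)
          then show ?thesis unfolding D0 by (simp only: VN add_divide_distrib)
        qed
        define G where "G \<tau> j = g j * D \<tau> (2 * s + 2) (X j)" for \<tau> j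
        have GN: "G \<tau> (j + int N) = G \<tau> j" for \<tau> j
          using DN[of \<tau> "2 * s + 1" j] by (simp add: G_def gN)
        define S0 where "S0 \<tau> j = (\<Sum>i\<in>stencil s. coef s X j i * (D \<tau> 0 (X (j + i)) - D \<tau> 0 (X j)))" for \<tau> j
        define SG where "SG \<tau> j = (\<Sum>i\<in>stencil s. coef s X j i * (G \<tau> (j + i) - G \<tau> j))" for \<tau> j
        define \<rho> where "\<rho> \<tau> = residual s (D \<tau>) X g" for \<tau>
        have \<rho>G: "\<rho> \<tau> j = trunc s (D \<tau>) X j - SG \<tau> j + g j * D \<tau> (2 * s + 3) (X j)" for \<tau> j
          by (simp only: \<rho>_def residual_def SG_def G_def)
        define r where "r \<tau> j = \<rho> \<tau> (j + 1) - \<rho> \<tau> j" for \<tau> j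
        define a where "a \<tau> j = h x j * u \<tau> j / H" for \<tau> j
        \<comment> \<open>The scaled cell integrals of the error, minus the increments of the corrector term.\<close>
        define z where "z \<tau> j = a \<tau> j - (D \<tau> 0 (X (j + 1)) - D \<tau> 0 (X j)) - (G \<tau> (j + 1) - G \<tau> j)" for \<tau> j
        have coN: "coef s X (j + int N) i = coef s X j i" for i j
          by (rule coef_period[of X "int N" "real N", OF XN])
        have \<rho>N: "\<rho> \<tau> (j + int N) = \<rho> \<tau> j" for \<tau> j
        proof -
          have "D \<tau> 0 (X (j + int N + i)) = D \<tau> 0 (X (j + i)) + c0 / H" for i
            using D0N[of \<tau> "j + i"] by (simp add: ac_simps)
          moreover have "G \<tau> (j + int N + i) = G \<tau> (j + i)" for i
            using GN[of \<tau> "j + i"] by (simp add: ac_simps)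
          moreover have "D \<tau> (2 * s + 3) (X (j + int N)) = D \<tau> (2 * s + 3) (X j)"
            using DN[of \<tau> "2 * s + 2" j] by (simp add: eval_nat_numeral)
          ultimately show ?thesis
            using DN[of \<tau> 0 j] by (simp add: \<rho>G trunc_def SG_def coN D0N GN gN)
        qed
        have uN: "u \<tau> (j + int N) = u \<tau> j" if "0 \<le> \<tau>" for \<tau> j
          using sol that by (simp add: fv_solution_def N_def)
        have hN: "h x (j + int N) = h x j" for j
          using mf(2)[of j] mf(2)[of "j + 1"] by (simp add: h_def N_def algebra_simps)
        have zN: "z \<tau> (j + int N) = z \<tau> j" if "0 \<le> \<tau>" for \<tau> j
        proof -
          have "j + int N + 1 = (j + 1) + int N" by simp
          then show ?thesis unfolding z_def a_def by (simp only: uN[OF that] hN D0N GN)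
        qed
        have rN: "r \<tau> (j + int N) = r \<tau> j" for \<tau> j
        proof -
          have "j + int N + 1 = (j + 1) + int N" by simp
          then show ?thesis unfolding r_def by (simp only: \<rho>N)
        qed
        have rsum: "(\<Sum>j\<in>{0..<int N}. r \<tau> j) = 0" for \<tau>
          using \<rho>N[of \<tau> 0] by (simp add: r_def sum_int_telescope)
        have dz: "((\<lambda>\<tau>. z \<tau> j) has_real_derivative - ((fv_op s X (z \<tau>) j - r \<tau> j) / H)) (at \<tau> within {0..})" if \<tau>: "0 \<le> \<tau>" for \<tau> j
        proof -
          define F where "F = flux s x (\<lambda>l. h x l * u \<tau> l)"
          have pos: "h x j > 0" using sm by (simp add: h_def strict_mono_less)
          have "((\<lambda>\<tau>. u \<tau> j) has_real_derivative - ((F (j + 1) - F j) / h x j)) (at \<tau> within {0..})"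
          proof -
            have "((\<lambda>\<tau>. u \<tau> j) has_real_derivative
              - ((poly (recon (2 * s) x (u \<tau>) j) (x (j + 1)) - poly (recon (2 * s) x (u \<tau>) (j - 1)) (x j)) / h x j)) (at \<tau> within {0..})"
              using sol \<tau> by (simp add: fv_solution_def)
            moreover have "poly (recon (2 * s) x (u \<tau>) j) (x (j + 1)) = F (j + 1)"
              using recon_eq_flux[OF sm, of s "u \<tau>" "j + 1"] by (simp add: F_def)
            moreover have "poly (recon (2 * s) x (u \<tau>) (j - 1)) (x j) = F j"
              using recon_eq_flux[OF sm, of s "u \<tau>" j] by (simp add: F_def)
            ultimately show ?thesis by simp
          qed
          from DERIV_cdivide[OF DERIV_cmult[OF this, of "h x j"], of H]
          have da: "((\<lambda>\<tau>. a \<tau> j) has_real_derivative - ((F (j + 1) - F j) / H)) (at \<tau> within {0..})"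
            using pos by (simp add: a_def minus_divide_left)
          have dd: "((\<lambda>\<tau>. D \<tau> 0 (X k)) has_real_derivative - (D \<tau> 1 (X k) / H)) (at \<tau> within {0..})" for k
            using dt[of 0 "X k" \<tau>] by simp
          have dg: "((\<lambda>\<tau>. G \<tau> k) has_real_derivative g k * - (D \<tau> (2 * s + 3) (X k) / H)) (at \<tau> within {0..})" for k
            unfolding G_def using DERIV_cmult[OF dt[of "2 * s + 2" "X k" \<tau>], of "g k"] by (simp add: eval_nat_numeral)
          have Fa: "F k = flux s X (a \<tau>) k" for k
            unfolding F_def X_def[abs_def] a_def[abs_def] by (rule flux_scale[OF H])
          have fz: "flux s X (z \<tau>) k = F k - S0 \<tau> k - SG \<tau> k" for k
          proof -
            have "flux s X (z \<tau>) k = flux s X (a \<tau>) k - flux s X (\<lambda>l. D \<tau> 0 (X (l + 1)) - D \<tau> 0 (X l)) k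
              - flux s X (\<lambda>l. G \<tau> (l + 1) - G \<tau> l) k"
              unfolding z_def[abs_def] flux_diff[symmetric] ..
            then show ?thesis
              unfolding Fa S0_def SG_def flux_telescope[of s X "\<lambda>l. D \<tau> 0 (X l)"] flux_telescope[of s X "G \<tau>"] .
          qed
          have \<rho>S: "\<rho> \<tau> k = D \<tau> 1 (X k) - S0 \<tau> k - SG \<tau> k + g k * D \<tau> (2 * s + 3) (X k)" for k
            by (simp add: \<rho>G trunc_def S0_def)
          have "- ((F (j + 1) - F j) / H) - (- (D \<tau> 1 (X (j + 1)) / H) - - (D \<tau> 1 (X j) / H))
            - (g (j + 1) * - (D \<tau> (2 * s + 3) (X (j + 1)) / H) - g j * - (D \<tau> (2 * s + 3) (X j) / H))
            = - ((fv_op s X (z \<tau>) j - r \<tau> j) / H)"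
            unfolding fv_op_def fz r_def \<rho>S by (simp add: add_divide_distrib diff_divide_distrib)
          then show ?thesis
            unfolding z_def using DERIV_diff[OF DERIV_diff[OF da DERIV_diff[OF dd[of "j + 1"] dd[of j]]] DERIV_diff[OF dg[of "j + 1"] dg[of j]]]
            by (simp only:)
        qed
        have z0: "z 0 j = - (G 0 (j + 1) - G 0 j)" for j
        proof -
          have "u 0 j = cell_avg x v0 j" using sol by (simp add: fv_solution_def)
          then show ?thesis using avg[of j 0] by (simp add: z_def a_def)
        qed
        have zsum: "(\<Sum>j\<in>{0..<int N}. z \<tau> j) = 0" if \<tau>: "0 \<le> \<tau>" for \<tau>
        proof -
          have "((\<lambda>\<tau>. \<Sum>j\<in>{0..<int N}. z \<tau> j) has_real_derivative 0) (at \<tau> within {0..})" if "0 \<le> \<tau>" for \<tau>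
          proof -
            have "(\<Sum>j\<in>{0..<int N}. - ((fv_op s X (z \<tau>) j - r \<tau> j) / H)) = 0"
            proof -
              have "flux s X (z \<tau>) (0 + int N) = flux s X (z \<tau>) 0"
                by (rule flux_periodic[of X "int N" "real N", OF XN]) (rule zN[OF that])
              then have "(\<Sum>j\<in>{0..<int N}. fv_op s X (z \<tau>) j) = 0"
                by (simp add: fv_op_def sum_int_telescope)
              then show ?thesis
                by (simp add: sum_negf sum_subtractf rsum flip: sum_divide_distrib)
            qed
            then show ?thesis using DERIV_sum[of "{0..<int N}" "\<lambda>\<tau> j. z \<tau> j", OF dz[OF that]] by simp
          qed
          then obtain c where c: "\<And>\<tau>. 0 \<le> \<tau> \<Longrightarrow> (\<Sum>j\<in>{0..<int N}. z \<tau> j) = c"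
            using has_field_derivative_zero_constant[of "{0..}" "\<lambda>\<tau>. \<Sum>j\<in>{0..<int N}. z \<tau> j"] by auto
          moreover have "(\<Sum>j\<in>{0..<int N}. z 0 j) = 0"
            using GN[of 0 0] by (simp add: z0 sum_negf sum_int_telescope del: minus_diff_eq)
          ultimately show ?thesis using \<tau> by (metis order_refl)
        qed
        define Mf where "Mf = H ^ (2 * s + 1) * deriv_seminorm (2 * s + 1) v0"
        define M2 where "M2 = H ^ (2 * s + 2) * deriv_seminorm (2 * s + 2) v0"
        have sem: "\<bar>(deriv ^^ i) v0 y\<bar> \<le> deriv_seminorm i v0" if "i \<le> 2 * s + 2" for i y
          by (rule deriv_seminorm_upper[OF _ v0C that]) (use v0p in simp)
        have DMf: "\<bar>D \<tau> (2 * s + 2) y\<bar> \<le> Mf" for \<tau> y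
        proof -
          have "D \<tau> (2 * s + 2) y = H ^ (2 * s + 1) * (deriv ^^ (2 * s + 1)) v0 (x 0 + H * y - \<tau>)"
            using H by (simp add: D_def \<Phi>_def)
          then have "\<bar>D \<tau> (2 * s + 2) y\<bar> = H ^ (2 * s + 1) * \<bar>(deriv ^^ (2 * s + 1)) v0 (x 0 + H * y - \<tau>)\<bar>"
            using H by (simp only: abs_mult power_abs abs_of_pos)
          also have "\<dots> \<le> Mf" unfolding Mf_def using H by (intro mult_left_mono sem) auto
          finally show ?thesis .
        qed
        have DM2: "\<bar>D \<tau> (2 * s + 3) y\<bar> \<le> M2" for \<tau> y
        proof -
          have "D \<tau> (2 * s + 3) y = H ^ (2 * s + 2) * (deriv ^^ (2 * s + 2)) v0 (x 0 + H * y - \<tau>)"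
            using H by (simp add: D_def \<Phi>_def eval_nat_numeral)
          then have "\<bar>D \<tau> (2 * s + 3) y\<bar> = H ^ (2 * s + 2) * \<bar>(deriv ^^ (2 * s + 2)) v0 (x 0 + H * y - \<tau>)\<bar>"
            using H by (simp only: abs_mult power_abs abs_of_pos)
          also have "\<dots> \<le> M2" unfolding M2_def using H by (intro mult_left_mono sem) auto
          finally show ?thesis .
        qed
        have Mf0: "0 \<le> Mf" using DMf[of 0 0] by linarith
        have M20: "0 \<le> M2" using DM2[of 0 0] by linarith
        have rb: "\<bar>r \<tau> j\<bar> \<le> (cs + \<delta> / 2) * M2" for \<tau> j
        proof -
          have "\<omega>' \<le> 2 * \<mu>r" using \<omega>'\<mu> \<mu>(4) \<mu>r(1) by linarith
          from resid[OF near_uniform_mono[OF near_uniform \<mu>(4)] \<omega>'0 this gb gs dD[of _ \<tau>] DM2[of \<tau>], of j]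
          show ?thesis
            unfolding r_def \<rho>_def cs_def .
        qed
        define G0 where "G0 = 2 * (Cg * \<omega>' * Mf)"
        have G00: "0 \<le> G0" using Cg \<omega>'0 Mf0 by (simp add: G0_def)
        have Gb: "\<bar>G \<tau> (j + 1) - G \<tau> j\<bar> \<le> G0" for \<tau> j
        proof -
          have "\<bar>G \<tau> k\<bar> \<le> Cg * \<omega>' * Mf" for k
            unfolding G_def abs_mult using gb DMf Cg \<omega>'0 by (intro mult_mono) auto
          from this[of j] this[of "j + 1"] show ?thesis unfolding G0_def by linarith
        qed
        have L2G: "sqrt (\<Sum>j\<in>{0..<int N}. (G \<tau> (j + 1) - G \<tau> j)\<^sup>2) \<le> sqrt (real N) * G0" for \<tau>
        proof -
          have "(\<Sum>j\<in>{0..<int N}. (G \<tau> (j + 1) - G \<tau> j)\<^sup>2) \<le> (\<Sum>j\<in>{0..<int N}. G0\<^sup>2)"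
          proof (rule sum_mono)
            fix j
            show "(G \<tau> (j + 1) - G \<tau> j)\<^sup>2 \<le> G0\<^sup>2" using power_mono[OF Gb[of \<tau> j], of 2] by simp
          qed
          then have "sqrt (\<Sum>j\<in>{0..<int N}. (G \<tau> (j + 1) - G \<tau> j)\<^sup>2) \<le> sqrt (real N * G0\<^sup>2)" by simp
          then show ?thesis using G00 by (simp add: real_sqrt_mult)
        qed
        obtain Q :: "(int \<times> nat) set" and w where Q: "finite Q" and form: "\<And>z :: int \<Rightarrow> real. (\<And>j. z (j + int N) = z j) \<Longrightarrow> (\<Sum>j\<in>{0..<int N}. z j) = 0 \<Longrightarrow>
          lyapunov_form N \<delta>1 (fv_op s X) Q w z"
          using stab[OF near_uniform_mono[OF near_uniform \<mu>(3)] X0 Xm n0, folded n] by blast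
        define \<kappa>1 where "\<kappa>1 = sqrt ((1 + \<delta>1) / (1 - \<delta>1))"
        define \<kappa>2 where "\<kappa>2 = sqrt (1 / (1 - \<delta>1))"
        define Rb where "Rb = (cs + \<delta> / 2) * M2"
        have "sqrt (\<Sum>j\<in>{0..<int N}. (z t j)\<^sup>2) \<le> \<kappa>1 * (sqrt (\<Sum>j\<in>{0..<int N}. (z 0 j)\<^sup>2) + sqrt (real N) * Rb * t / H)"
          unfolding \<kappa>1_def
          by (rule energy_estimate[where Q = Q and w = w and B = "fv_op s X" and r = r])
            (use Q \<delta>1 H form zN zsum rN rsum rb dz t Rb_def in auto)
        also have "sqrt (\<Sum>j\<in>{0..<int N}. (z 0 j)\<^sup>2) \<le> sqrt (real N) * G0"
          using L2G[of 0] by (simp only: z0 power2_minus)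
        finally have zt: "sqrt (\<Sum>j\<in>{0..<int N}. (z t j)\<^sup>2) \<le> \<kappa>1 * (sqrt (real N) * G0 + sqrt (real N) * Rb * t / H)"
          using \<delta>1 by (simp add: \<kappa>1_def)
        define e where "e j = u t j - cell_avg x (\<lambda>y. v0 (y - t)) j" for j
        \<comment> \<open>Back to the uncorrected error, in the cell integrals; the corrector costs \<open>G0\<close> at both ends of the time interval.\<close>
        define y where "y j = h x j * e j / H" for j
        have yz: "y j = z t j + (G t (j + 1) - G t j)" for j
          using avg[of j t] by (simp add: y_def e_def z_def a_def right_diff_distrib diff_divide_distrib)
        have "sqrt (\<Sum>j\<in>{0..<int N}. (y j)\<^sup>2) \<le> sqrt (\<Sum>j\<in>{0..<int N}. (z t j)\<^sup>2) + sqrt (\<Sum>j\<in>{0..<int N}. (G t (j + 1) - G t j)\<^sup>2)"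
          using L2_set_triangle_ineq[of "z t" "\<lambda>j. G t (j + 1) - G t j" "{0..<int N}"] by (simp add: L2_set_def yz)
        also have "\<dots> \<le> \<kappa>1 * (sqrt (real N) * G0 + sqrt (real N) * Rb * t / H) + sqrt (real N) * G0"
          using zt L2G[of t] by (rule add_mono)
        also have "\<dots> = sqrt (real N) * (\<kappa>1 * (G0 + Rb * t / H) + G0)"
          by (simp add: algebra_simps)
        finally have yb: "sqrt (\<Sum>j\<in>{0..<int N}. (y j)\<^sup>2) \<le> sqrt (real N) * (\<kappa>1 * (G0 + Rb * t / H) + G0)" .
        have hlow: "(1 - \<delta>1) * H \<le> h x j" for j
        proof -
          have "\<Delta> \<le> \<delta>1 * H"
          proof -
            have "\<Delta> \<le> \<mu> * H" using dh by (simp add: \<Delta>_def H_def)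
            also have "\<dots> \<le> \<delta>1 * H" using \<mu>(5) H by (intro mult_right_mono) auto
            finally show ?thesis .
          qed
          moreover have "H - h x j \<le> \<Delta>" using mf(6)[of j] mf(10) by (simp add: \<Delta>_def H_def)
          ultimately show ?thesis by (simp add: algebra_simps)
        qed
        have "(\<Sum>j = 1..int N. h x j * \<bar>e j\<bar>\<^sup>2) = (\<Sum>j\<in>{0..<int N}. h x (j + 1) * \<bar>e (j + 1)\<bar>\<^sup>2)"
          by (rule sum.reindex_bij_witness[of _ "\<lambda>j. j + 1" "\<lambda>j. j - 1"]) auto
        also have "\<dots> = (\<Sum>j\<in>{0..<int N}. h x j * \<bar>e j\<bar>\<^sup>2)"
        proof (rule sum_period_shift[of "\<lambda>j. h x j * \<bar>e j\<bar>\<^sup>2"])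
          have "cell_avg x (\<lambda>y. v0 (y - t)) (j + int N) = cell_avg x (\<lambda>y. v0 (y - t)) j" for j
          proof -
            have "j + int N + 1 = (j + 1) + int N" by simp
            then have "D t 0 (X (j + int N + 1)) - D t 0 (X (j + int N)) = D t 0 (X (j + 1)) - D t 0 (X j)"
              by (simp only: D0N)
            then have "h x j * cell_avg x (\<lambda>y. v0 (y - t)) (j + int N) / H = h x j * cell_avg x (\<lambda>y. v0 (y - t)) j / H"
              unfolding avg[symmetric] hN .
            moreover have "h x j > 0" using sm by (simp add: h_def strict_mono_less)
            ultimately show ?thesis using H by simp
          qed
          then show "h x (j + int N) * \<bar>e (j + int N)\<bar>\<^sup>2 = h x j * \<bar>e j\<bar>\<^sup>2" for j
            by (simp add: e_def hN uN[OF t])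
        qed
        also have "\<dots> \<le> (\<Sum>j\<in>{0..<int N}. H / (1 - \<delta>1) * (y j)\<^sup>2)"
        proof (rule sum_mono)
          fix j
          have pos: "h x j > 0" using sm by (simp add: h_def strict_mono_less)
          have "h x j * \<bar>e j\<bar>\<^sup>2 = (H * H / h x j) * (y j)\<^sup>2"
            using pos H by (simp add: y_def power2_eq_square)
          also have "\<dots> \<le> (H / (1 - \<delta>1)) * (y j)\<^sup>2"
          proof (rule mult_right_mono)
            have "H * ((1 - \<delta>1) * H) \<le> H * h x j" using hlow H by (intro mult_left_mono) auto
            then show "H * H / h x j \<le> H / (1 - \<delta>1)" using pos \<delta>1 by (simp add: field_simps)
          qed simp
          finally show "h x j * \<bar>e j\<bar>\<^sup>2 \<le> H / (1 - \<delta>1) * (y j)\<^sup>2" .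
        qed
        also have "\<dots> = H / (1 - \<delta>1) * (\<Sum>j\<in>{0..<int N}. (y j)\<^sup>2)" by (simp only: sum_distrib_left)
        finally have se: "(\<Sum>j = 1..int N. h x j * \<bar>e j\<bar>\<^sup>2) \<le> H / (1 - \<delta>1) * (\<Sum>j\<in>{0..<int N}. (y j)\<^sup>2)" .
        have "1 / sqrt (2 * pi) * sqrt (\<Sum>j = 1..int N. h x j * \<bar>e j\<bar>\<^sup>2)
          \<le> 1 / sqrt (2 * pi) * sqrt (H / (1 - \<delta>1) * (\<Sum>j\<in>{0..<int N}. (y j)\<^sup>2))"
          using se by (intro mult_left_mono real_sqrt_le_mono) auto
        also have "\<dots> = \<kappa>2 * sqrt (\<Sum>j\<in>{0..<int N}. (y j)\<^sup>2) / sqrt (real N)"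
        proof -
          have "H / (2 * pi) = 1 / real N" using NH N0 by (simp add: field_simps)
          then have sH: "sqrt H / sqrt (2 * pi) = 1 / sqrt (real N)"
            by (metis real_sqrt_divide real_sqrt_one)
          have "1 / sqrt (2 * pi) * sqrt (H / (1 - \<delta>1) * (\<Sum>j\<in>{0..<int N}. (y j)\<^sup>2))
            = (sqrt H / sqrt (2 * pi)) * (\<kappa>2 * sqrt (\<Sum>j\<in>{0..<int N}. (y j)\<^sup>2))"
            unfolding \<kappa>2_def by (simp add: real_sqrt_mult real_sqrt_divide)
          then show ?thesis unfolding sH by simp
        qed
        also have "\<dots> \<le> \<kappa>2 * (sqrt (real N) * (\<kappa>1 * (G0 + Rb * t / H) + G0)) / sqrt (real N)"
          using yb \<delta>1 by (intro divide_right_mono mult_left_mono) (auto simp: \<kappa>2_def)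
        also have "\<dots> = \<kappa>2 * (\<kappa>1 * (G0 + Rb * t / H) + G0)"
          using N0 by simp
        also have "\<dots> = (\<kappa>1 * \<kappa>2) * (G0 + Rb * t / H) + \<kappa>2 * G0"
          by (simp add: algebra_simps)
        also have "\<dots> \<le> (1 + \<theta>) * (G0 + Rb * t / H) + 2 * G0"
        proof -
          have \<kappa>12: "\<kappa>1 * \<kappa>2 \<le> 1 + \<theta>"
          proof -
            have "\<kappa>1 * \<kappa>2 = sqrt ((1 + \<delta>1) / ((1 - \<delta>1) * (1 - \<delta>1)))"
              unfolding \<kappa>1_def \<kappa>2_def by (simp flip: real_sqrt_mult)
            also have "\<dots> \<le> sqrt ((1 + \<theta>)\<^sup>2)"
            proof (rule real_sqrt_le_mono)
              have a: "1 + \<delta>1 \<le> (1 + \<theta>) * (1 - \<delta>1)" using \<theta> by (simp add: \<delta>1_def field_simps)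
              have "1 + \<delta>1 \<le> (1 + \<delta>1) * (1 + \<delta>1)" using \<delta>1 by simp
              also have "\<dots> \<le> ((1 + \<theta>) * (1 - \<delta>1)) * ((1 + \<theta>) * (1 - \<delta>1))"
                using a \<delta>1 by (intro mult_mono) auto
              finally show "(1 + \<delta>1) / ((1 - \<delta>1) * (1 - \<delta>1)) \<le> (1 + \<theta>)\<^sup>2"
                using \<delta>1 by (simp add: divide_le_eq power2_eq_square mult_ac)
            qed
            also have "\<dots> = 1 + \<theta>" using \<theta> by simp
            finally show ?thesis .
          qed
          have \<kappa>22: "\<kappa>2 \<le> 2"
          proof -
            have "1 / (1 - \<delta>1) \<le> 4" using \<delta>1 by (simp add: field_simps)
            then have "\<kappa>2 \<le> sqrt 4" unfolding \<kappa>2_def by (rule real_sqrt_le_mono)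
            then show ?thesis by simp
          qed
          have "0 \<le> G0 + Rb * t / H" using G00 M20 cd t H by (simp add: Rb_def)
          then show ?thesis using \<kappa>12 \<kappa>22 G00 by (intro add_mono mult_right_mono)
        qed
        also have "\<dots> = (1 + \<theta>) * G0 + 2 * G0 + (1 + \<theta>) * (cs + \<delta> / 2) * (M2 * t / H)"
        proof -
          have "Rb * t / H = (cs + \<delta> / 2) * (M2 * t / H)" by (simp add: Rb_def)
          then show ?thesis by (simp only: distrib_left[of "1 + \<theta>" G0] mult.assoc add_ac)
        qed
        also have "\<dots> \<le> 4 * G0 + (cs + \<delta>) * (M2 * t / H)"
        proof (rule add_mono)
          have "(1 + \<theta>) * G0 \<le> 2 * G0" using \<theta>(2) G00 by (intro mult_right_mono) auto
          then show "(1 + \<theta>) * G0 + 2 * G0 \<le> 4 * G0" by linarith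
          have "(1 + \<theta>) * (cs + \<delta> / 2) \<le> cs + \<delta>"
            using \<theta>(3) unfolding distrib_right[of 1] mult_1_left by linarith
          then show "(1 + \<theta>) * (cs + \<delta> / 2) * (M2 * t / H) \<le> (cs + \<delta>) * (M2 * t / H)"
            using M20 t H by (intro mult_right_mono) auto
        qed
        also have "4 * G0 \<le> 8 * (Cc * trunc_coef_lipschitz s) * deriv_seminorm (2 * s + 1) v0 * h_max x ^ (2 * s) * \<Delta>"
        proof -
          have sn: "0 \<le> deriv_seminorm (2 * s + 1) v0" using sem[of "2 * s + 1" 0] by linarith
          have "4 * G0 = 8 * Cg * deriv_seminorm (2 * s + 1) v0 * H ^ (2 * s) * \<Delta>"
            using H by (simp add: G0_def \<omega>'_def Mf_def)
          also have "\<dots> \<le> 8 * Cg * deriv_seminorm (2 * s + 1) v0 * h_max x ^ (2 * s) * \<Delta>"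
            using mf(10) H Cg sn \<Delta>0 by (intro mult_right_mono mult_left_mono power_mono) (auto simp: H_def)
          finally show ?thesis by (simp only: Cg_def)
        qed
        also have "(cs + \<delta>) * (M2 * t / H) \<le> (cs + \<delta>) * deriv_seminorm (2 * s + 2) v0 * h_max x ^ (2 * s + 1) * t"
        proof -
          have sn: "0 \<le> deriv_seminorm (2 * s + 2) v0" using sem[of "2 * s + 2" 0] by linarith
          have "M2 * t / H = deriv_seminorm (2 * s + 2) v0 * H ^ (2 * s + 1) * t"
            using H by (simp add: M2_def)
          also have "\<dots> \<le> deriv_seminorm (2 * s + 2) v0 * h_max x ^ (2 * s + 1) * t"
            using mf(10) H sn t by (intro mult_right_mono mult_left_mono power_mono) (auto simp: H_def)
          finally have "(cs + \<delta>) * (M2 * t / H) \<le> (cs + \<delta>) * (deriv_seminorm (2 * s + 2) v0 * h_max x ^ (2 * s + 1) * t)"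
            using cs \<delta> by (intro mult_left_mono) auto
          then show ?thesis by (simp only: mult.assoc)
        qed
        finally show "1 / sqrt (2 * pi) *
            sqrt (\<Sum>j = 1..int (mesh_N x). h x j * \<bar>u t j - cell_avg x (\<lambda>y. v0 (y - t)) j\<bar>\<^sup>2)
          \<le> 8 * (corrector_const s m * trunc_coef_lipschitz s) * deriv_seminorm (2 * s + 1) v0 * h_max x ^ (2 * s) * (h_max x - h_min x)
            + (fact s * fact (s + 1) / fact (2 * s + 2) + \<delta>) * deriv_seminorm (2 * s + 2) v0 * h_max x ^ (2 * s + 1) * t"
          by (simp add: e_def N_def Cc_def \<Delta>_def cs_def)
      qed
    qed
  qed
qed

theorem theorem4p4:
  fixes p s :: nat and c_s :: real
  assumes "p = 2 * s"
    and "c_s = fact s * fact (s + 1) / fact (2 * s + 2)"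
  shows "\<exists>c :: nat \<Rightarrow> real. \<forall>\<delta>>0. \<exists>\<mu> :: nat \<Rightarrow> real. (\<forall>m. \<mu> m > 0) \<and>
    (\<forall>x\<in>mesh_class \<mu>. \<forall>v0 :: real \<Rightarrow> real. \<forall>u :: real \<Rightarrow> int \<Rightarrow> real.
       (\<forall>y. v0 (y + 2 * pi) = v0 y) \<and> C_k (p + 2) v0 \<and> fv_solution p x v0 u \<longrightarrow>
       (\<forall>t\<ge>0.
          1 / sqrt (2 * pi) *
            sqrt (\<Sum>j = 1..int (mesh_N x). h x j * \<bar>u t j - cell_avg x (\<lambda>y. v0 (y - t)) j\<bar>\<^sup>2)
          \<le> c (mesh_m x) * deriv_seminorm (p + 1) v0 * h_max x ^ p * (h_max x - h_min x)
            + (c_s + \<delta>) * deriv_seminorm (p + 2) v0 * h_max x ^ (p + 1) * t))"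
proof -
  define c where "c m = 8 * (corrector_const s m * trunc_coef_lipschitz s)" for m
  define bound where "bound \<delta> x \<longleftrightarrow> error_estimate s (c (mesh_m x)) (c_s + \<delta>) x" for \<delta> x
  have ex: "\<exists>\<mu>>0. \<forall>x. mesh x \<longrightarrow> mesh_m x = m \<longrightarrow> h_max x - h_min x \<le> \<mu> * h_av x \<longrightarrow> bound \<delta> x" if "\<delta> > 0" for \<delta> m
  proof (cases "m > 0")
    case True
    from error_bound_for_period[OF True that, of s]
    obtain \<mu> where \<mu>: "\<mu> > 0" "\<And>x. mesh x \<Longrightarrow> mesh_m x = m \<Longrightarrow> h_max x - h_min x \<le> \<mu> * h_av x \<Longrightarrow> error_estimate s (c m) (c_s + \<delta>) x"
      unfolding c_def assms(2) by blast
    show ?thesis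
      by (rule exI[of _ \<mu>]) (use \<mu> in \<open>auto simp: bound_def\<close>)
  next
    case False
    then have "mesh_m x \<noteq> m" if "mesh x" for x using mesh_facts(3)[OF that] by simp
    then show ?thesis by (intro exI[of _ 1]) auto
  qed
  have main: "\<exists>\<mu>. (\<forall>m. \<mu> m > 0) \<and> (\<forall>x\<in>mesh_class \<mu>. bound \<delta> x)" if "\<delta> > 0" for \<delta>
  proof -
    have "\<exists>\<mu>. \<forall>m. \<mu> m > 0 \<and> (\<forall>x. mesh x \<longrightarrow> mesh_m x = m \<longrightarrow> h_max x - h_min x \<le> \<mu> m * h_av x \<longrightarrow> bound \<delta> x)"
      by (rule choice) (rule allI, rule ex[OF that])
    then obtain \<mu> where \<mu>: "\<forall>m. \<mu> m > 0 \<and> (\<forall>x. mesh x \<longrightarrow> mesh_m x = m \<longrightarrow> h_max x - h_min x \<le> \<mu> m * h_av x \<longrightarrow> bound \<delta> x)"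
      by (rule exE)
    show ?thesis
    proof (intro exI[of _ \<mu>] conjI allI ballI)
      show "\<mu> m > 0" for m using \<mu> by blast
      show "bound \<delta> x" if "x \<in> mesh_class \<mu>" for x
        using spec[OF \<mu>, of "mesh_m x"] that by (simp add: mesh_class_def)
    qed
  qed
  show ?thesis
    unfolding assms(1) imp_conjL
    by (rule exI[of _ c], intro allI impI, rule main[unfolded bound_def error_estimate_def])
qed

end
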